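(* Let $w_0>0$, $\ell>1$, and let $(\phi_0^\varepsilon,a_0^\varepsilon)_{\varepsilon\in[0,1]}$ be a bounded family in $\mathcal{H}_{w_0}^{\ell+1}\times\mathcal{H}_{w_0}^{\ell}$, with $\phi_0^\varepsilon$ real-valued and $a_0^\varepsilon$ complex-valued. Then, provided $M=M(\ell)>0$ is chosen sufficiently large (i.e. for all $M\ge M_0$, for some $M_0>0$ independent of $\varepsilon$), the following holds with $w(t)=w_0-Mt$ and $0<T<w_0/M$: for all $\varepsilon\in[0,1]$ there is a unique solution $(\phi^\varepsilon,a^\varepsilon)\in X_{w,T}^\ell$ to $$ \begin{cases} \partial_t \phi^\varepsilon + \frac12(\partial_x\phi^\varepsilon)^2+\frac12 g(|a^\varepsilon|^2)\partial_x\phi^\varepsilon+f(|a^\varepsilon|^2)=0, & \phi^\varepsilon_{|t=0}=\phi_0^\varepsilon,\\ \partial_t a^\varepsilon+\partial_x\phi^\varepsilon\,\partial_x a^\varepsilon+\frac12 a^\varepsilon\partial_x^2\phi^\varepsilon+\frac12\partial_x\big(g(|a^\varepsilon|^2)a^\varepsilon\big)=\frac{i\varepsilon}{2}\partial_x^2a^\varepsilon, & a^\varepsilon_{|t=0}=a_0^\varepsilon, \end{cases} $$ for $(t,x)\in[0,T]\times\mathbb{R}$. Moreover, up to choosing a possibly larger value of $M$ (and consequently a smaller $T$), still independent of $\varepsilon$, one has for all $\varepsilon\in[0,1]$ $$ |||\phi^\varepsilon|||_{\ell+1,T}^2\le 4\|\phi_0^\varepsilon\|_{\mathcal{H}_{w_0}^{\ell+1}}^2+\|a_0^\varepsilon\|_{\mathcal{H}_{w_0}^{\ell}}^{4\sigma},\qquad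 |||a^\varepsilon|||_{\ell,T}^2\le 2\|a_0^\varepsilon\|_{\mathcal{H}_{w_0}^{\ell}}^2 . $$
   Context: Nonlinearities: $g(s)=\alpha s^\gamma$ and $f(s)=\lambda s^\sigma$, where $\alpha,\lambda\in\mathbb{R}$ and $\gamma,\sigma$ are positive integers, fixed throughout. Fourier transform: $\hat\psi(\xi)=\mathcal{F}\psi(\xi)=\frac{1}{\sqrt{2\pi}}\int_{\mathbb{R}}e^{-ix\xi}\psi(x)\,dx$, and $\langle\xi\rangle=\sqrt{1+\xi^2}$. For $w\ge0$ and $\ell\ge0$, $\mathcal{H}_w^\ell=\{\psi\in L^2(\mathbb{R}):\|\psi\|_{\mathcal{H}_w^\ell}<\infty\}$ with $\|\psi\|_{\mathcal{H}_w^\ell}^2=\int_{\mathbb{R}}\langle\xi\rangle^{2\ell}e^{2w\langle\xi\rangle}|\hat\psi(\xi)|^2\,d\xi$. For a time-dependent weight $w(t)=w_0-Mt$ with $w_0,M>0$ and $0<T<w_0/M$: $C([0,T],\mathcal{H}_w^\ell)$ is the set of $\psi$ such that $\mathcal{F}^{-1}\big(e^{w(t)\langle\xi\rangle}\hat\psi\big)\in C([0,T],H^\ell(\mathbb{R}))$ (Fourier transform in $x$); $L^2_T\mathcal{H}_w^\ell$ is the set of $\psi$ such that $\int_0^T\|\psi(t)\|_{\mathcal{H}_{w(t)}^\ell}^2dt<\infty$. Set $Y_{w,T}^\ell=C([0,T],\mathcal{H}_w^\ell)\cap L^2_T\mathcal{H}_w^{\ell+1/2}$ and $X_{w,T}^\ell=Y_{w,T}^{\ell+1}\times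 Y_{w,T}^\ell$. For $0\le t\le T$, $$|||\psi|||_{\ell,t}^2=\max\Big(\sup_{0\le s\le t}\|\psi(s)\|_{\mathcal{H}_{w(s)}^\ell}^2,\ 2M\int_0^t\|\psi(s)\|_{\mathcal{H}_{w(s)}^{\ell+1/2}}^2ds\Big),$$ and $X_{w,T}^\ell$ is normed by $\|(\phi,a)\|_{X_{w,T}^\ell}=|||\phi|||_{\ell+1,T}+|||a|||_{\ell,T}$. *)

theory Defs
  imports "HOL-Analysis.Analysis"
begin

text \<open>
  Elements of $L^2$ are represented by Borel functions; everything below depends only on the
  a.e.-class of such a function, except \<open>classical_solution\<close>, which selects the smooth
  representative.
\<close>

definition L2 :: "(real \<Rightarrow> complex) set" where
  "L2 = {\<psi> \<in> borel_measurable lborel. integrable lborel (\<lambda>x. (cmod (\<psi> x))\<^sup>2)}"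

definition japanese :: "real \<Rightarrow> real" where
  "japanese \<xi> = sqrt (1 + \<xi>\<^sup>2)"

text \<open>
  Fourier transform on $L^2$ in the sense of Plancherel: the $L^2$ limit, as $R\to\infty$, of the
  Fourier integrals over $[-R,R]$. It agrees a.e. with the Fourier integral over the whole line if
  the function is also integrable. The choice operator picks a representative of the limit.
\<close>

definition is_fourier :: "(real \<Rightarrow> complex) \<Rightarrow> (real \<Rightarrow> complex) \<Rightarrow> bool" where
  "is_fourier \<psi> h \<longleftrightarrow> h \<in> L2 \<and>
     ((\<lambda>R. \<integral>\<^sup>+ \<xi>. ennreal ((cmod (h \<xi> -
            complex_of_real (1 / sqrt (2 * pi)) *
            (LBINT x:{- R..R}. exp (- \<i> * complex_of_real (x * \<xi>)) * \<psi> x)))\<^sup>2) \<partial>lborel)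
       \<longlongrightarrow> 0) at_top"

definition fourier :: "(real \<Rightarrow> complex) \<Rightarrow> real \<Rightarrow> complex" where
  "fourier \<psi> = (SOME h. is_fourier \<psi> h)"

definition inv_fourier :: "(real \<Rightarrow> complex) \<Rightarrow> real \<Rightarrow> complex" where
  "inv_fourier h = (SOME \<psi>. \<psi> \<in> L2 \<and> (AE \<xi> in lborel. fourier \<psi> \<xi> = h \<xi>))"

text \<open>The squared norm of $\mathcal{H}^\ell_w$, possibly infinite; meaningful for \<open>\<psi> \<in> L2\<close>.\<close>

definition H_norm_sq :: "real \<Rightarrow> real \<Rightarrow> (real \<Rightarrow> complex) \<Rightarrow> ennreal" where
  "H_norm_sq w l \<psi> =
     (\<integral>\<^sup>+ \<xi>. ennreal (japanese \<xi> powr (2 * l) * exp (2 * w * japanese \<xi>) *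
                     (cmod (fourier \<psi> \<xi>))\<^sup>2) \<partial>lborel)"

definition H_space :: "real \<Rightarrow> real \<Rightarrow> (real \<Rightarrow> complex) set" where
  "H_space w l = {\<psi> \<in> L2. H_norm_sq w l \<psi> < \<infinity>}"

definition H_norm :: "real \<Rightarrow> real \<Rightarrow> (real \<Rightarrow> complex) \<Rightarrow> real" where
  "H_norm w l \<psi> = sqrt (enn2real (H_norm_sq w l \<psi>))"

text \<open>Time-dependent functions are written \<open>\<psi> t x\<close>; only \<open>t \<in> {0..T}\<close> matters.
  The Sobolev space $H^\ell$ is \<open>H_space 0 l\<close>.\<close>

definition C_sobolev :: "real \<Rightarrow> real \<Rightarrow> (real \<Rightarrow> real \<Rightarrow> complex) set" where
  "C_sobolev T l = {u. \<forall>t\<in>{0..T}. u t \<in> H_space 0 l \<and>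
     ((\<lambda>s. H_norm_sq 0 l (\<lambda>x. u s x - u t x)) \<longlongrightarrow> 0) (at t within {0..T})}"

definition weight :: "real \<Rightarrow> real \<Rightarrow> real \<Rightarrow> real" where
  "weight w0 M t = w0 - M * t"

definition C_H :: "(real \<Rightarrow> real) \<Rightarrow> real \<Rightarrow> real \<Rightarrow> (real \<Rightarrow> real \<Rightarrow> complex) set" where
  "C_H w T l = {\<psi>.
     (\<forall>t\<in>{0..T}. \<psi> t \<in> L2 \<and>
        (\<lambda>\<xi>. complex_of_real (exp (w t * japanese \<xi>)) * fourier (\<psi> t) \<xi>) \<in> L2) \<and>
     (\<lambda>t. inv_fourier (\<lambda>\<xi>. complex_of_real (exp (w t * japanese \<xi>)) * fourier (\<psi> t) \<xi>))
       \<in> C_sobolev T l}"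

definition L2_H :: "(real \<Rightarrow> real) \<Rightarrow> real \<Rightarrow> real \<Rightarrow> (real \<Rightarrow> real \<Rightarrow> complex) set" where
  "L2_H w T l = {\<psi>. (\<forall>t\<in>{0..T}. \<psi> t \<in> L2) \<and>
     (\<lambda>t. H_norm_sq (w t) l (\<psi> t) * indicator {0..T} t) \<in> borel_measurable lborel \<and>
     (\<integral>\<^sup>+ t\<in>{0..T}. H_norm_sq (w t) l (\<psi> t) \<partial>lborel) < \<infinity>}"

definition Y_space :: "(real \<Rightarrow> real) \<Rightarrow> real \<Rightarrow> real \<Rightarrow> (real \<Rightarrow> real \<Rightarrow> complex) set" where
  "Y_space w T l = C_H w T l \<inter> L2_H w T (l + 1 / 2)"

definition X_space :: "(real \<Rightarrow> real) \<Rightarrow> real \<Rightarrow> real \<Rightarrow>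
    ((real \<Rightarrow> real \<Rightarrow> complex) \<times> (real \<Rightarrow> real \<Rightarrow> complex)) set" where
  "X_space w T l = Y_space w T (l + 1) \<times> Y_space w T l"

text \<open>The square of $|||\psi|||_{\ell,t}$ for the weight $w(s)=w_0-Ms$.\<close>

definition triple_norm_sq ::
    "real \<Rightarrow> real \<Rightarrow> real \<Rightarrow> real \<Rightarrow> (real \<Rightarrow> real \<Rightarrow> complex) \<Rightarrow> ennreal" where
  "triple_norm_sq w0 M l t \<psi> =
     max (SUP s\<in>{0..t}. H_norm_sq (weight w0 M s) l (\<psi> s))
         (ennreal (2 * M) *
           (\<integral>\<^sup>+ s\<in>{0..t}. H_norm_sq (weight w0 M s) (l + 1 / 2) (\<psi> s) \<partial>lborel))"

definition dx :: "(real \<Rightarrow> real \<Rightarrow> complex) \<Rightarrow> real \<Rightarrow> real \<Rightarrow> complex" where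
  "dx u t x = vector_derivative (u t) (at x)"

text \<open>One-sided at the end points of $[0,T]$.\<close>

definition dt :: "real \<Rightarrow> (real \<Rightarrow> real \<Rightarrow> complex) \<Rightarrow> real \<Rightarrow> real \<Rightarrow> complex" where
  "dt T u t x = vector_derivative (\<lambda>s. u s x) (at t within {0..T})"

text \<open>
  For a positive weight, functions in $\mathcal{H}^\ell_w$ are real-analytic (after modification on
  a null set), and the equations then make solutions in $X^\ell_{w,T}$ continuously differentiable
  in time. So the equations are required pointwise. The initial data are only given
  up to null sets.
\<close>

definition classical_solution ::
    "(real \<Rightarrow> real) \<Rightarrow> (real \<Rightarrow> real) \<Rightarrow> real \<Rightarrow> real \<Rightarrow>
     (real \<Rightarrow> complex) \<Rightarrow> (real \<Rightarrow> complex) \<Rightarrow>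
     (real \<Rightarrow> real \<Rightarrow> complex) \<Rightarrow> (real \<Rightarrow> real \<Rightarrow> complex) \<Rightarrow> bool" where
  "classical_solution g f \<epsilon> T \<phi>0 a0 \<phi> a \<longleftrightarrow>
     (AE x in lborel. \<phi> 0 x = \<phi>0 x) \<and> (AE x in lborel. a 0 x = a0 x) \<and>
     (\<forall>t\<in>{0..T}. \<forall>x.
        \<phi> t differentiable at x \<and> dx \<phi> t differentiable at x \<and>
        a t differentiable at x \<and> dx a t differentiable at x \<and>
        (\<lambda>s. \<phi> s x) differentiable (at t within {0..T}) \<and>
        (\<lambda>s. a s x) differentiable (at t within {0..T}) \<and>
        dt T \<phi> t x + 1 / 2 * (dx \<phi> t x)\<^sup>2
          + 1 / 2 * complex_of_real (g ((cmod (a t x))\<^sup>2)) * dx \<phi> t x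
          + complex_of_real (f ((cmod (a t x))\<^sup>2)) = 0 \<and>
        dt T a t x + dx \<phi> t x * dx a t x + 1 / 2 * a t x * dx (dx \<phi>) t x
          + 1 / 2 * dx (\<lambda>s y. complex_of_real (g ((cmod (a s y))\<^sup>2)) * a s y) t x
          = \<i> * complex_of_real \<epsilon> / 2 * dx (dx a) t x)"

end

theory Submission
  imports Defs "HOL-Probability.Probability"
begin

text \<open>
  On the Fourier side put $p=\langle\xi\rangle\hat\phi$ and $b=\hat a$. The system becomes a Duhamel
  equation $u(t)=e^{-it\theta}u(0)+\langle\xi\rangle\int_0^te^{-i(t-s)\theta}N(u(s))\,ds$ with
  $\theta=0$ for $p$ and $\theta=\varepsilon\xi^2/2$ for $b$, where $N$ consists of convolutions
  without loss of derivatives. It is solved by contraction in the norm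
  $\|\sup_te^{w(t)\langle\xi\rangle}|u(t,\xi)|\|$ of the weighted $L^2$ space of functions of $\xi$, the supremum
  being taken at fixed frequency: the weight decays at rate $M\langle\xi\rangle$, so integration in time
  regains the factor $\langle\xi\rangle$ and gains $1/M$, uniformly in $\varepsilon$ because $\theta$ is real.
  The iteration is run with $w_0-Mt/3$, a weight larger than the one of the theorem; the surplus
  yields continuity in time and the half derivative in $L^2_T$.

  For uniqueness, a solution in the class extends holomorphically in $x$ at all times, so that it satisfies
  the equations also on the Fourier side; integrating in time gives a representative that
  is continuous in $t$ for every frequency and solves the Duhamel equation. The contraction estimate then applies
  on short time intervals.
\<close>

section \<open>The Fourier transform on square-integrable functions\<close>

text \<open>The weighted L2 norm drives the contraction. In addition, differences of the nonlinear
  terms are bounded uniformly in frequency (\<open>sbound\<close>), so the iterates converge at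
  every frequency and the limit solves the Duhamel equation everywhere; time derivatives can then be
  taken under the inverse Fourier integral.

  Constants: with rate M/3 in the iteration, the squared weight of the theorem is smaller by
  exp(-(4M/3)t<xi>), and the time integral of this against 2M<xi> is at most 3/2. If the Lipschitz
  part of the nonlinearity costs at most 1/8 of the radius, the radius is 8/7 of the data, and 3/2
  (8/7)^2 = 96/49 lies just below 2. Any share of M below 1/2 would leave such room.

  The obstacle for uniqueness: the solution space bounds the supremum in time of norms, the
  contraction needs the norm of a supremum in time, and transforms at different times are unrelated
  representatives. Integrating the equation in time repairs both defects, at the price of half of
  the remaining weight.\<close>

definition ft :: "(real \<Rightarrow> complex) \<Rightarrow> real \<Rightarrow> complex" where
  "ft h \<xi> = complex_of_real (1 / sqrt (2 * pi)) *
     (LBINT x. exp (- \<i> * complex_of_real (x * \<xi>)) * h x)"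

definition l2n :: "(real \<Rightarrow> complex) \<Rightarrow> ennreal" where
  "l2n f = (\<integral>\<^sup>+ x. ennreal ((cmod (f x))\<^sup>2) \<partial>lborel)"

lemma norm_exp_imaginary [simp]: "cmod (exp (- (\<i> * complex_of_real r))) = 1"
  "cmod (exp (\<i> * complex_of_real r)) = 1"
  by (simp_all add: norm_exp_eq_Re)

lemma integrable_character_mult:
  assumes "integrable lborel (h :: real \<Rightarrow> complex)"
  shows "integrable lborel (\<lambda>x. exp (- \<i> * complex_of_real (x * \<xi>)) * h x)"
  using borel_measurable_integrable[OF assms]
  by (intro Bochner_Integration.integrable_bound[OF assms]) (auto simp: norm_mult)

lemma ft_bound:
  assumes "integrable lborel h"
  shows "cmod (ft h \<xi>) \<le> (LBINT x. cmod (h x))"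
proof -
  have "cmod (LBINT x. exp (- \<i> * complex_of_real (x * \<xi>)) * h x) \<le> (LBINT x. cmod (h x))"
    using integral_norm_bound[of lborel "\<lambda>x. exp (- \<i> * complex_of_real (x * \<xi>)) * h x"]
    by (simp add: norm_mult)
  moreover have "\<bar>1 / sqrt (2 * pi)\<bar> \<le> 1"
    using pi_gt3 by (simp add: real_le_rsqrt)
  ultimately show ?thesis
    unfolding ft_def norm_mult norm_of_real
    using mult_mono[of "\<bar>1 / sqrt (2 * pi)\<bar>" 1] by fastforce
qed

lemma measurable_cnj [measurable (raw)]:
  "f \<in> borel_measurable M \<Longrightarrow> (\<lambda>x. cnj (f x)) \<in> borel_measurable M"
  by (rule measurable_compose[OF _ borel_measurable_continuous_onI]) (auto intro: continuous_intros)

lemma measurable_ft [measurable]: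
  assumes [measurable]: "h \<in> borel_measurable borel"
  shows "ft h \<in> borel_measurable borel"
  unfolding ft_def[abs_def] by measurable

lemma integrable_tensor:
  fixes f k :: "real \<Rightarrow> complex" and e :: "real \<times> real \<Rightarrow> complex"
  assumes f: "integrable lborel f" and k: "integrable lborel k"
    and [measurable]: "e \<in> borel_measurable borel" and e: "\<And>z. cmod (e z) \<le> 1"
  shows "integrable (lborel \<Otimes>\<^sub>M lborel) (\<lambda>(x, y). k x * (e (x, y) * f y))"
proof -
  note [measurable] = borel_measurable_integrable[OF f, simplified]
    borel_measurable_integrable[OF k, simplified]
  have m: "(\<lambda>(x, y). k x * (e (x, y) * f y)) \<in> borel_measurable (lborel \<Otimes>\<^sub>M lborel)"
    by measurable
  have b: "integrable lborel (\<lambda>y. e (x, y) * f y)" for x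
    by (rule Bochner_Integration.integrable_bound[OF f])
      (auto simp: norm_mult intro!: AE_I2 mult_left_le_one_le e)
  have c: "(LBINT y. cmod (e (x, y) * f y)) \<le> (LBINT y. cmod (f y))" for x
    by (rule integral_mono[OF integrable_norm[OF b] integrable_norm[OF f]])
      (simp add: norm_mult mult_left_le_one_le e)
  show ?thesis
  proof (rule lborel_pair.Fubini_integrable[OF m])
    show "integrable lborel (\<lambda>x. LBINT y. cmod (case (x, y) of (x, y) \<Rightarrow> k x * (e (x, y) * f y)))"
    proof (rule Bochner_Integration.integrable_bound)
      show "integrable lborel (\<lambda>x. k x * of_real (LBINT y. cmod (f y)))" using k by simp
      show "(\<lambda>x. LBINT y. cmod (case (x, y) of (x, y) \<Rightarrow> k x * (e (x, y) * f y))) \<in> borel_measurable lborel"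
        by measurable
      have "\<bar>LBINT y. cmod (e (x, y) * f y)\<bar> \<le> \<bar>LBINT y. cmod (f y)\<bar>" for x
        using c[of x] Bochner_Integration.integral_nonneg[of lborel "\<lambda>y. cmod (e (x, y) * f y)"] by simp
      then show "AE x in lborel. norm (LBINT y. cmod (case (x, y) of (x, y) \<Rightarrow> k x * (e (x, y) * f y)))
          \<le> norm (k x * of_real (LBINT y. cmod (f y)))"
        unfolding prod.case norm_mult[of "k _"] by (auto simp: abs_mult intro!: mult_left_mono)
    qed
    show "AE x in lborel. integrable lborel (\<lambda>y. case (x, y) of (x, y) \<Rightarrow> k x * (e (x, y) * f y))"
      using b by simp
  qed
qed

text \<open>Fubini, since the exponential kernel is bounded and symmetric in position and frequency.
  It serves to move the transform onto a Gaussian, where it is explicit, or onto an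
  indicator.\<close>

lemma ft_exchange:
  assumes f: "integrable lborel f" and k: "integrable lborel k"
  shows "(LBINT \<xi>. k \<xi> * ft f \<xi>) = (LBINT x. f x * ft k x)"
proof -
  let ?e = "\<lambda>z::real\<times>real. exp (- \<i> * complex_of_real (snd z * fst z))"
  have int: "integrable (lborel \<Otimes>\<^sub>M lborel) (\<lambda>(\<xi>, x). k \<xi> * (?e (\<xi>, x) * f x))"
    by (rule integrable_tensor[OF f k]) (auto intro!: borel_measurable_continuous_onI continuous_intros)
  have "(LBINT \<xi>. (LBINT x. k \<xi> * (?e (\<xi>, x) * f x))) = (LBINT x. (LBINT \<xi>. k \<xi> * (?e (\<xi>, x) * f x)))"
    by (rule lborel_pair.Fubini_integral[symmetric]) (use int in simp)
  moreover have "(LBINT x. k \<xi> * (?e (\<xi>, x) * f x)) = k \<xi> * (LBINT x. ?e (\<xi>, x) * f x)" for \<xi>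
    by (simp del: snd_conv fst_conv)
  moreover have "(LBINT \<xi>. k \<xi> * (?e (\<xi>, x) * f x)) = f x * (LBINT \<xi>. ?e (x, \<xi>) * k \<xi>)" for x
    by (subst Bochner_Integration.integral_mult_right_zero[symmetric])
      (auto intro!: Bochner_Integration.integral_cong simp: mult_ac)
  ultimately show ?thesis
    unfolding ft_def by (simp add: mult.left_commute mult.assoc)
qed

section \<open>Gaussian regularisation and the Plancherel inequality\<close>

definition gauss :: "real \<Rightarrow> real \<Rightarrow> real" where
  "gauss d z = exp (- (z\<^sup>2 / (2 * d\<^sup>2))) / (d * sqrt (2 * pi))"

lemma gauss_normal: "d > 0 \<Longrightarrow> gauss d (y - x) = normal_density x d y"
  by (simp add: gauss_def normal_density_def real_sqrt_mult)

lemma gauss_commute: "gauss d (y - x) = gauss d (x - y)"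
  by (simp add: gauss_def power2_commute)

lemma gauss_nonneg: "d > 0 \<Longrightarrow> gauss d z \<ge> 0" by (simp add: gauss_def)

lemma nn_integral_gauss: "d > 0 \<Longrightarrow> (\<integral>\<^sup>+ y. ennreal (gauss d (y - x)) \<partial>lborel) = 1"
  using prob_space.emeasure_space_1[OF prob_space_normal_density[of d x]]
  by (simp add: emeasure_density gauss_normal)

lemma measurable_gauss [measurable]: "gauss d \<in> borel_measurable borel"
  unfolding gauss_def[abs_def] by measurable

text \<open>This is the characteristic function of the standard normal law at \<open>- x\<close>;
  the normalising factor of its density is the factor in \<open>ft\<close>.\<close>

lemma ft_gauss1: "ft (\<lambda>\<xi>. complex_of_real (exp (- (\<xi>\<^sup>2 / 2)))) x = complex_of_real (exp (- (x\<^sup>2 / 2)))"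
proof -
  have "char std_normal_distribution (- x) = complex_of_real (exp (- (x\<^sup>2 / 2)))"
    by (simp add: char_std_normal_distribution)
  moreover have "char std_normal_distribution (- x) =
      (LBINT y. std_normal_density y *\<^sub>R iexp (- x * y))"
    unfolding char_def by (subst integral_density) auto
  moreover have "\<dots> = ft (\<lambda>\<xi>. complex_of_real (exp (- (\<xi>\<^sup>2 / 2)))) x"
    unfolding ft_def
    apply (subst Bochner_Integration.integral_mult_right_zero[symmetric])
    apply (rule Bochner_Integration.integral_cong[OF refl])
    apply (simp add: std_normal_density_def scaleR_conv_of_real mult_ac)
    done
  ultimately show ?thesis by simp
qed

lemma ft_gauss:
  assumes d: "d > 0"
  shows "ft (\<lambda>\<xi>. complex_of_real (exp (- ((d * \<xi>)\<^sup>2 / 2)))) x =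
    complex_of_real (sqrt (2 * pi) * gauss d x)"
proof -
  have "(LBINT y. exp (- \<i> * complex_of_real (y * (x / d))) * complex_of_real (exp (- (y\<^sup>2 / 2)))) =
    \<bar>d\<bar> *\<^sub>R (LBINT y. exp (- \<i> * complex_of_real ((0 + d * y) * (x / d))) * complex_of_real (exp (- ((0 + d * y)\<^sup>2 / 2))))"
    using d by (intro lborel_integral_real_affine) auto
  also have "\<dots> = \<bar>d\<bar> *\<^sub>R (LBINT y. exp (- \<i> * complex_of_real (y * x)) * complex_of_real (exp (- ((d * y)\<^sup>2 / 2))))"
    using d by (simp add: mult.commute)
  finally have "ft (\<lambda>\<xi>. complex_of_real (exp (- (\<xi>\<^sup>2 / 2)))) (x / d) =
    d *\<^sub>R ft (\<lambda>\<xi>. complex_of_real (exp (- ((d * \<xi>)\<^sup>2 / 2)))) x"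
    using d unfolding ft_def by simp
  then have "ft (\<lambda>\<xi>. complex_of_real (exp (- ((d * \<xi>)\<^sup>2 / 2)))) x = complex_of_real (exp (- ((x / d)\<^sup>2 / 2))) / d"
    using d unfolding ft_gauss1 by (simp add: scaleR_conv_of_real field_simps)
  also have "\<dots> = complex_of_real (exp (- ((x / d)\<^sup>2 / 2)) / d)" by simp
  also have "exp (- ((x / d)\<^sup>2 / 2)) / d = sqrt (2 * pi) * gauss d x"
    using d by (simp add: gauss_def power_divide)
  finally show ?thesis .
qed

lemma integrable_gauss_factor:
  assumes d: "d > 0"
  shows "integrable lborel (\<lambda>\<xi>. complex_of_real (exp (- ((d * \<xi>)\<^sup>2 / 2))))"
proof -
  have "integrable lborel (\<lambda>\<xi>. sqrt (2 * pi) * std_normal_density \<xi>)"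
    by (intro integrable_mult_right integrable_normal_density | simp)+
  then have "integrable lborel (\<lambda>\<xi>::real. exp (- (\<xi>\<^sup>2 / 2)))"
    by (simp add: std_normal_density_def)
  from lborel_integrable_real_affine[OF this, of d 0] d show ?thesis
    by (simp add: integrable_of_real)
qed

lemma cnj_ft: "cnj (ft h \<xi>) = ft (\<lambda>x. cnj (h x)) (- \<xi>)"
proof -
  have "cnj (LBINT x. exp (- \<i> * complex_of_real (x * \<xi>)) * h x) =
      (LBINT x. cnj (exp (- \<i> * complex_of_real (x * \<xi>)) * h x))"
    by (rule Bochner_Integration.integral_cnj[symmetric])
  also have "\<dots> = (LBINT x. exp (- \<i> * complex_of_real (x * - \<xi>)) * cnj (h x))"
    by (rule Bochner_Integration.integral_cong) (auto simp: exp_cnj)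
  finally show ?thesis unfolding ft_def by simp
qed

lemma ft_reflect: "ft (\<lambda>x. h (- x)) \<xi> = ft h (- \<xi>)"
  unfolding ft_def
  by (subst lborel_integral_real_affine[where c="-1" and t=0]) auto

lemma lborel_integral_reflect:
  "(LBINT x. f (- x)) = (LBINT x. (f x :: complex))" for f :: "real \<Rightarrow> complex"
  by (subst lborel_integral_real_affine[where c="-1" and t=0]) auto

lemma integrable_reflect:
  "integrable lborel (f :: real \<Rightarrow> complex) \<Longrightarrow> integrable lborel (\<lambda>x. f (- x))"
  using lborel_integrable_real_affine[of f "-1" 0] by simp

text \<open>A Parseval identity for merely integrable functions: the Gaussian damping makes the
  frequency integral converge, and its price is a convolution with a normal density of deviation
  \<open>d\<close>, an approximate identity as \<open>d\<close> tends to 0.\<close>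

lemma gauss_pairing:
  assumes f: "integrable lborel f" and h: "integrable lborel h" and d: "d > 0"
  shows "(LBINT \<xi>. complex_of_real (exp (- ((d * \<xi>)\<^sup>2 / 2))) * (ft f \<xi> * cnj (ft h \<xi>))) =
    (LBINT x. f x * (LBINT y. cnj (h y) * complex_of_real (gauss d (y - x))))"
proof -
  note [measurable] = borel_measurable_integrable[OF f, simplified]
    borel_measurable_integrable[OF h, simplified]
  define G where "G \<xi> = complex_of_real (exp (- ((d * \<xi>)\<^sup>2 / 2)))" for \<xi>
  have [measurable]: "G \<in> borel_measurable borel" unfolding G_def[abs_def] by measurable
  have Gi: "integrable lborel G"
    using integrable_gauss_factor[OF d] by (simp add: G_def[abs_def])
  define k where "k \<xi> = G \<xi> * cnj (ft h \<xi>)" for \<xi>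
  have [measurable]: "k \<in> borel_measurable borel" unfolding k_def[abs_def] by measurable
  have ki: "integrable lborel k"
  proof (rule Bochner_Integration.integrable_bound)
    show "integrable lborel (\<lambda>\<xi>. of_real (LBINT x. cmod (h x)) * G \<xi>)" using Gi by simp
    show "AE \<xi> in lborel. cmod (k \<xi>) \<le> cmod (of_real (LBINT x. cmod (h x)) * G \<xi>)"
      using ft_bound[OF h] by (auto simp: k_def norm_mult mult.commute intro!: mult_left_mono)
  qed simp
  have ftk: "ft k x = (LBINT y. cnj (h y) * complex_of_real (gauss d (y - x)))" for x
  proof -
    define q where "q \<xi> = exp (\<i> * complex_of_real (\<xi> * x)) * G \<xi>" for \<xi>
    have qi: "integrable lborel q"
      using integrable_character_mult[OF Gi, of "-x"] by (simp add: q_def[abs_def])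
    have hi: "integrable lborel (\<lambda>y. cnj (h y))" using h by simp
    have G_even: "G (- \<xi>) = G \<xi>" for \<xi> by (simp add: G_def)
    \<comment> \<open>Conjugation reflects the frequency (\<open>cnj_ft\<close>). Substituting the
      negative frequency restores \<open>ft\<close> and leaves a plain phase times the even
      Gaussian, so that \<open>ft_exchange\<close> applies.\<close>
    have "(LBINT \<xi>. exp (- \<i> * complex_of_real (\<xi> * x)) * k \<xi>) =
        (LBINT \<xi>. q (- \<xi>) * ft (\<lambda>y. cnj (h y)) (- \<xi>))"
      by (simp add: q_def k_def cnj_ft G_even mult.assoc)
    also have "\<dots> = (LBINT \<xi>. q \<xi> * ft (\<lambda>y. cnj (h y)) \<xi>)"
      by (rule lborel_integral_reflect)
    also have "\<dots> = (LBINT y. cnj (h y) * ft q y)"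
      by (rule ft_exchange[OF hi qi])
    also have "ft q = (\<lambda>y. ft G (y - x))"
    proof
      fix y
      have "exp (- \<i> * complex_of_real (\<xi> * y)) * (exp (\<i> * complex_of_real (\<xi> * x)) * c) =
          exp (- \<i> * complex_of_real (\<xi> * (y - x))) * c" for \<xi> c
        unfolding mult.assoc[symmetric] mult_exp_exp by (simp add: algebra_simps)
      then show "ft q y = ft G (y - x)" unfolding ft_def q_def by (simp only:)
    qed
    also have "ft G = (\<lambda>z. complex_of_real (sqrt (2 * pi)) * complex_of_real (gauss d z))"
      using ft_gauss[OF d] by (simp add: G_def[abs_def] fun_eq_iff)
    finally show ?thesis unfolding ft_def
      by (simp add: mult.left_commute[of "cnj _"] del: of_real_mult)
  qed
  have "(LBINT \<xi>. G \<xi> * (ft f \<xi> * cnj (ft h \<xi>))) = (LBINT \<xi>. k \<xi> * ft f \<xi>)"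
    by (simp add: k_def mult_ac)
  also have "\<dots> = (LBINT x. f x * ft k x)" by (rule ft_exchange[OF f ki])
  finally show ?thesis unfolding G_def ftk .
qed

lemma norm_integral_le_nn_integral:
  fixes f :: "'a \<Rightarrow> 'b::{banach, second_countable_topology}"
  shows "ennreal (norm (integral\<^sup>L M f)) \<le> (\<integral>\<^sup>+ x. ennreal (norm (f x)) \<partial>M)"
proof (cases "integrable M f")
  case True
  then show ?thesis by (rule integral_norm_bound_ennreal)
qed (simp add: not_integrable_integral_eq)

lemma L2_iff: "f \<in> L2 \<longleftrightarrow> f \<in> borel_measurable borel \<and> l2n f < \<infinity>"
  by (auto simp: L2_def l2n_def integrable_iff_bounded)

text \<open>\<open>gauss_pairing\<close> with both functions equal to \<open>f\<close> gives a bound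
  uniform in \<open>d\<close>, because the kernel is symmetric with mass 1; Fatou then removes the
  Gaussian.\<close>

lemma l2n_ft_le:
  assumes f: "integrable lborel f"
  shows "l2n (ft f) \<le> l2n f"
proof -
  note [measurable] = borel_measurable_integrable[OF f, simplified]
  have gauss_le: "(\<integral>\<^sup>+ \<xi>. ennreal (exp (- ((d * \<xi>)\<^sup>2 / 2)) * (cmod (ft f \<xi>))\<^sup>2) \<partial>lborel) \<le> l2n f"
    if d: "d > 0" for d
  proof -
    have "integrable lborel (\<lambda>\<xi>. complex_of_real (exp (- ((d * \<xi>)\<^sup>2 / 2))) * (ft f \<xi> * cnj (ft f \<xi>)))"
    proof (rule Bochner_Integration.integrable_bound)
      show "integrable lborel (\<lambda>\<xi>. of_real ((LBINT x. cmod (f x))\<^sup>2) * complex_of_real (exp (- ((d * \<xi>)\<^sup>2 / 2))))"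
        using integrable_gauss_factor[OF d] by (intro integrable_mult_right) auto
      have "cmod (ft f \<xi> * cnj (ft f \<xi>)) \<le> (LBINT x. cmod (f x))\<^sup>2" for \<xi>
        unfolding norm_mult complex_mod_cnj power2_eq_square
        by (intro mult_mono ft_bound f) auto
      then show "AE \<xi> in lborel. cmod (complex_of_real (exp (- ((d * \<xi>)\<^sup>2 / 2))) * (ft f \<xi> * cnj (ft f \<xi>)))
          \<le> cmod (of_real ((LBINT x. cmod (f x))\<^sup>2) * complex_of_real (exp (- ((d * \<xi>)\<^sup>2 / 2))))"
        by (subst (1 2) norm_mult, subst (2) norm_of_real)
          (auto simp: mult.commute intro!: mult_left_mono AE_I2)
    qed simp
    then have int: "integrable lborel (\<lambda>\<xi>. exp (- ((d * \<xi>)\<^sup>2 / 2)) * (cmod (ft f \<xi>))\<^sup>2)"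
      unfolding complex_norm_square[symmetric] of_real_mult[symmetric]
      by (simp only: complex_of_real_integrable_eq)
    have "(\<integral>\<^sup>+ \<xi>. ennreal (exp (- ((d * \<xi>)\<^sup>2 / 2)) * (cmod (ft f \<xi>))\<^sup>2) \<partial>lborel) =
        ennreal (LBINT \<xi>. exp (- ((d * \<xi>)\<^sup>2 / 2)) * (cmod (ft f \<xi>))\<^sup>2)"
      by (rule nn_integral_eq_integral[OF int]) auto
    also have "\<dots> = ennreal (cmod (complex_of_real (LBINT \<xi>. exp (- ((d * \<xi>)\<^sup>2 / 2)) * (cmod (ft f \<xi>))\<^sup>2)))"
      unfolding norm_of_real
      by (subst abs_of_nonneg) (auto intro!: Bochner_Integration.integral_nonneg)
    also have "complex_of_real (LBINT \<xi>. exp (- ((d * \<xi>)\<^sup>2 / 2)) * (cmod (ft f \<xi>))\<^sup>2) =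
        (LBINT \<xi>. complex_of_real (exp (- ((d * \<xi>)\<^sup>2 / 2))) * (ft f \<xi> * cnj (ft f \<xi>)))"
      unfolding complex_norm_square[symmetric] of_real_mult[symmetric] integral_complex_of_real ..
    also have "\<dots> = (LBINT x. f x * (LBINT y. cnj (f y) * complex_of_real (gauss d (y - x))))"
      by (rule gauss_pairing[OF f f d])
    also have "ennreal (cmod \<dots>) \<le>
        (\<integral>\<^sup>+ x. ennreal (cmod (f x)) * (\<integral>\<^sup>+ y. ennreal (cmod (f y) * gauss d (y - x)) \<partial>lborel) \<partial>lborel)"
    proof (rule order_trans[OF norm_integral_le_nn_integral], rule nn_integral_mono)
      fix x :: real
      have "ennreal (cmod (LBINT y. cnj (f y) * complex_of_real (gauss d (y - x))))
          \<le> (\<integral>\<^sup>+ y. ennreal (cmod (f y) * gauss d (y - x)) \<partial>lborel)"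
        using norm_integral_le_nn_integral[of lborel "\<lambda>y. cnj (f y) * complex_of_real (gauss d (y - x))"]
          gauss_nonneg[OF d] by (simp add: norm_mult)
      then show "ennreal (cmod (f x * (LBINT y. cnj (f y) * complex_of_real (gauss d (y - x)))))
          \<le> ennreal (cmod (f x)) * (\<integral>\<^sup>+ y. ennreal (cmod (f y) * gauss d (y - x)) \<partial>lborel)"
        by (simp add: norm_mult ennreal_mult mult_left_mono)
    qed
    also have "\<dots> = (\<integral>\<^sup>+ x. \<integral>\<^sup>+ y. ennreal (cmod (f x) * (cmod (f y) * gauss d (y - x))) \<partial>lborel \<partial>lborel)"
      by (simp add: ennreal_mult' nn_integral_cmult)
    \<comment> \<open>The product is at most half the sum of the squares. In each summand the kernel
      is written so that the variable missing from the square can be integrated out to 1.\<close>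
    also have "\<dots> \<le> (\<integral>\<^sup>+ x. \<integral>\<^sup>+ y. ennreal ((cmod (f x))\<^sup>2 / 2) * ennreal (gauss d (y - x)) +
        ennreal ((cmod (f y))\<^sup>2 / 2) * ennreal (gauss d (x - y)) \<partial>lborel \<partial>lborel)"
    proof (intro nn_integral_mono)
      fix x y :: real
      have "cmod (f x) * cmod (f y) \<le> (cmod (f x))\<^sup>2 / 2 + (cmod (f y))\<^sup>2 / 2"
        using sum_squares_bound[of "cmod (f x)" "cmod (f y)"] by simp
      then have "cmod (f x) * (cmod (f y) * gauss d (y - x)) \<le>
          ((cmod (f x))\<^sup>2 / 2 + (cmod (f y))\<^sup>2 / 2) * gauss d (y - x)"
        unfolding mult.assoc[symmetric] by (rule mult_right_mono) (simp add: gauss_nonneg d)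
      then show "ennreal (cmod (f x) * (cmod (f y) * gauss d (y - x))) \<le>
          ennreal ((cmod (f x))\<^sup>2 / 2) * ennreal (gauss d (y - x)) +
          ennreal ((cmod (f y))\<^sup>2 / 2) * ennreal (gauss d (x - y))"
        using gauss_nonneg[OF d] unfolding gauss_commute[of d x y]
        by (simp add: ennreal_mult[symmetric] ennreal_plus[symmetric] distrib_right del: ennreal_plus)
    qed
    also have "\<dots> = (\<integral>\<^sup>+ x. \<integral>\<^sup>+ y. ennreal ((cmod (f x))\<^sup>2 / 2) * ennreal (gauss d (y - x)) \<partial>lborel \<partial>lborel) +
        (\<integral>\<^sup>+ x. \<integral>\<^sup>+ y. ennreal ((cmod (f y))\<^sup>2 / 2) * ennreal (gauss d (x - y)) \<partial>lborel \<partial>lborel)"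
      by (simp add: nn_integral_add)
    also have "(\<integral>\<^sup>+ x. \<integral>\<^sup>+ y. ennreal ((cmod (f y))\<^sup>2 / 2) * ennreal (gauss d (x - y)) \<partial>lborel \<partial>lborel) =
        (\<integral>\<^sup>+ y. \<integral>\<^sup>+ x. ennreal ((cmod (f y))\<^sup>2 / 2) * ennreal (gauss d (x - y)) \<partial>lborel \<partial>lborel)"
      by (rule lborel_pair.Fubini') simp
    also have "(\<integral>\<^sup>+ x. \<integral>\<^sup>+ y. ennreal ((cmod (f x))\<^sup>2 / 2) * ennreal (gauss d (y - x)) \<partial>lborel \<partial>lborel) + \<dots> =
        (\<integral>\<^sup>+ x. ennreal ((cmod (f x))\<^sup>2 / 2) \<partial>lborel) + (\<integral>\<^sup>+ x. ennreal ((cmod (f x))\<^sup>2 / 2) \<partial>lborel)"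
      by (simp add: nn_integral_cmult nn_integral_gauss[OF d])
    also have "\<dots> = l2n f"
      unfolding l2n_def
      by (subst nn_integral_add[symmetric]) (simp_all add: ennreal_plus[symmetric] del: ennreal_plus)
    finally show ?thesis .
  qed
  let ?u = "\<lambda>n \<xi>. ennreal (exp (- ((inverse (real (Suc n)) * \<xi>)\<^sup>2 / 2)) * (cmod (ft f \<xi>))\<^sup>2)"
  have "(\<lambda>n. ?u n \<xi>) \<longlonglongrightarrow> ennreal (exp (- ((0 * \<xi>)\<^sup>2 / 2)) * (cmod (ft f \<xi>))\<^sup>2)" for \<xi>
    by (intro tendsto_intros LIMSEQ_inverse_real_of_nat) auto
  then have lim: "liminf (\<lambda>n. ?u n \<xi>) = ennreal ((cmod (ft f \<xi>))\<^sup>2)" for \<xi>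
    using lim_imp_Liminf[OF sequentially_bot, of "\<lambda>n. ?u n \<xi>"] by simp
  have "l2n (ft f) = (\<integral>\<^sup>+ \<xi>. liminf (\<lambda>n. ?u n \<xi>) \<partial>lborel)"
    unfolding l2n_def lim ..
  also have "\<dots> \<le> liminf (\<lambda>n. \<integral>\<^sup>+ \<xi>. ?u n \<xi> \<partial>lborel)"
    by (rule nn_integral_liminf) simp
  also have "\<dots> \<le> l2n f"
    by (rule Liminf_le) (auto intro!: always_eventually gauss_le)
  finally show ?thesis .
qed

lemma integrable_mult_L2:
  assumes "f \<in> L2" "g \<in> L2"
  shows "integrable lborel (\<lambda>x. f x * g x)"
proof -
  have [measurable]: "f \<in> borel_measurable borel" "g \<in> borel_measurable borel"
    using assms by (auto simp: L2_iff)
  show ?thesis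
  proof (rule Bochner_Integration.integrable_bound)
    show "integrable lborel (\<lambda>x. (cmod (f x))\<^sup>2 + (cmod (g x))\<^sup>2)"
      using assms by (auto simp: L2_def)
    have "cmod (f x) * cmod (g x) \<le> (cmod (f x))\<^sup>2 + (cmod (g x))\<^sup>2" for x
      using sum_squares_bound[of "cmod (f x)" "cmod (g x)"]
        mult_nonneg_nonneg[OF norm_ge_zero norm_ge_zero, of "f x" "g x"] by linarith
    then show "AE x in lborel. cmod (f x * g x) \<le> norm ((cmod (f x))\<^sup>2 + (cmod (g x))\<^sup>2)"
      by (auto simp: norm_mult)
  qed simp
qed

lemma ft_L2:
  assumes "integrable lborel f" "f \<in> L2"
  shows "ft f \<in> L2"
  using assms l2n_ft_le[OF assms(1)] measurable_ft[of f] by (auto simp: L2_iff)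

text \<open>The substitution y = x + d z fixes the kernel and moves the width into the indicator,
  which is continuous at \<open>x\<close> away from the end points; then dominated
  convergence.\<close>

lemma gauss_average_tendsto:
  fixes x a b :: real
  assumes "x \<noteq> a" "x \<noteq> b"
  shows "(\<lambda>n. LBINT y. indicator {a..b} y * gauss (inverse (real (Suc n))) (y - x)) \<longlonglongrightarrow> indicator {a..b} x"
proof -
  have scale: "(LBINT y. indicator {a..b} y * gauss d (y - x)) =
      (LBINT z. indicator {a..b} (x + d * z) * gauss 1 z)" if d: "d > 0" for d
  proof -
    have g: "gauss 1 z = d * gauss d (d * z)" for z
      using d by (simp add: gauss_def power_mult_distrib)
    have "(LBINT y. indicator {a..b} y * gauss d (y - x)) =
        \<bar>d\<bar> *\<^sub>R (LBINT z. indicator {a..b} (x + d * z) * gauss d (x + d * z - x))"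
      using d by (intro lborel_integral_real_affine) auto
    also have "\<dots> = (LBINT z. d * (indicator {a..b} (x + d * z) * gauss d (d * z)))"
      using d by simp
    finally show ?thesis by (simp only: g mult.left_commute)
  qed
  have int: "integrable lborel (gauss 1)" "(LBINT z. gauss 1 z) = 1"
  proof -
    have "gauss 1 = normal_density 0 1"
      using gauss_normal[of 1 _ 0] by (simp add: fun_eq_iff)
    then show "integrable lborel (gauss 1)" "(LBINT z. gauss 1 z) = 1" by simp_all
  qed
  have "(\<lambda>n. LBINT z. indicator {a..b} (x + inverse (real (Suc n)) * z) * gauss 1 z)
      \<longlonglongrightarrow> (LBINT z. indicator {a..b} x * gauss 1 z)"
  proof (rule integral_dominated_convergence[where w="gauss 1"])
    show "AE z in lborel. (\<lambda>n. indicator {a..b} (x + inverse (real (Suc n)) * z) * gauss 1 z)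
        \<longlonglongrightarrow> indicator {a..b} x * gauss 1 z"
    proof (intro AE_I2 tendsto_mult tendsto_const)
      fix z
      have lim: "(\<lambda>n. x + inverse (real (Suc n)) * z) \<longlonglongrightarrow> x + 0 * z"
        by (intro tendsto_intros LIMSEQ_inverse_real_of_nat)
      have "isCont (indicator {a..b} :: real \<Rightarrow> real) x"
        using assms by (subst isCont_indicator) (auto simp: frontier_def)
      from isCont_tendsto_compose[OF this] lim
      show "(\<lambda>n. indicator {a..b} (x + inverse (real (Suc n)) * z) :: real) \<longlonglongrightarrow> indicator {a..b} x"
        by simp
    qed
  qed (use int gauss_nonneg[of 1] in \<open>auto simp: indicator_def\<close>)
  then show ?thesis
    using int by (simp add: scale)
qed

section \<open>Limits and completeness in L2\<close>

lemma L2_measurable: "f \<in> L2 \<Longrightarrow> f \<in> borel_measurable borel"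
  by (simp add: L2_iff)

text \<open>The constant 2 replaces Minkowski's inequality: it avoids square roots in
  \<open>ennreal\<close> and is harmless where terms tend to 0 or only finiteness matters.\<close>

lemma l2n_add_le:
  assumes [measurable]: "f \<in> borel_measurable borel" "g \<in> borel_measurable borel"
  shows "l2n (\<lambda>x. f x + g x) \<le> 2 * l2n f + 2 * l2n g"
proof -
  have "(cmod (f x + g x))\<^sup>2 \<le> 2 * (cmod (f x))\<^sup>2 + 2 * (cmod (g x))\<^sup>2" for x
  proof -
    have "(cmod (f x + g x))\<^sup>2 \<le> (cmod (f x) + cmod (g x))\<^sup>2"
      by (rule power_mono[OF norm_triangle_ineq norm_ge_zero])
    also have "\<dots> \<le> 2 * (cmod (f x))\<^sup>2 + 2 * (cmod (g x))\<^sup>2"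
      using sum_squares_bound[of "cmod (f x)" "cmod (g x)"] by (simp add: power2_sum)
    finally show ?thesis .
  qed
  then have "l2n (\<lambda>x. f x + g x) \<le> (\<integral>\<^sup>+ x. ennreal (2 * (cmod (f x))\<^sup>2 + 2 * (cmod (g x))\<^sup>2) \<partial>lborel)"
    unfolding l2n_def by (intro nn_integral_mono ennreal_leI)
  also have "\<dots> = 2 * l2n f + 2 * l2n g"
    unfolding l2n_def by (simp add: ennreal_mult nn_integral_add nn_integral_cmult)
  finally show ?thesis .
qed

lemma l2n_uminus: "l2n (\<lambda>x. - f x) = l2n f" by (simp add: l2n_def)

lemma l2n_diff_commute: "l2n (\<lambda>x. f x - g x) = l2n (\<lambda>x. g x - f x)"
  by (simp add: l2n_def norm_minus_commute)

lemma l2n_diff_triangle: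
  assumes [measurable]: "f \<in> borel_measurable borel" "g \<in> borel_measurable borel" "h \<in> borel_measurable borel"
  shows "l2n (\<lambda>x. f x - h x) \<le> 2 * l2n (\<lambda>x. f x - g x) + 2 * l2n (\<lambda>x. g x - h x)"
  using l2n_add_le[of "\<lambda>x. f x - g x" "\<lambda>x. g x - h x"] by simp

lemma l2n_diff_le:
  assumes [measurable]: "f \<in> borel_measurable borel" "g \<in> borel_measurable borel"
  shows "l2n (\<lambda>x. f x - g x) \<le> 2 * l2n f + 2 * l2n g"
  using l2n_add_le[of f "\<lambda>x. - g x"] by (simp add: l2n_uminus)

lemma L2_diff: "f \<in> L2 \<Longrightarrow> g \<in> L2 \<Longrightarrow> (\<lambda>x. f x - g x) \<in> L2"
  using l2n_diff_le[of f g] by (auto simp: L2_iff ennreal_mult_less_top intro: le_less_trans)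

lemma l2n_eq_0_iff:
  assumes [measurable]: "f \<in> borel_measurable borel"
  shows "l2n f = 0 \<longleftrightarrow> (AE x in lborel. f x = 0)"
  unfolding l2n_def by (subst nn_integral_0_iff_AE) auto

lemma l2n_cong_AE: "AE x in lborel. f x = g x \<Longrightarrow> l2n f = l2n g"
  unfolding l2n_def by (rule nn_integral_cong_AE) auto

lemma L2_cong_AE:
  assumes "AE x in lborel. f x = g x" "f \<in> L2" "g \<in> borel_measurable borel"
  shows "g \<in> L2"
  using assms l2n_cong_AE[OF assms(1)] by (simp add: L2_iff)

lemma l2n_reflect:
  assumes [measurable]: "f \<in> borel_measurable borel"
  shows "l2n (\<lambda>x. f (- x)) = l2n f"
  unfolding l2n_def
  by (subst (2) nn_integral_real_affine[where c="-1" and t=0]) auto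

lemma L2_reflect: "f \<in> L2 \<Longrightarrow> (\<lambda>x. f (- x)) \<in> L2"
  by (auto simp: L2_iff l2n_reflect)

text \<open>Null sets are pulled back by the change of variables in the integral of their
  indicator.\<close>

lemma AE_lborel_affine:
  fixes c t :: real
  assumes "AE x in lborel. P x" and c: "c \<noteq> 0"
  shows "AE x in lborel. P (t + c * x)"
proof -
  obtain N where N: "{x \<in> space lborel. \<not> P x} \<subseteq> N" "emeasure lborel N = 0" "N \<in> sets lborel"
    using assms(1) by (rule AE_E)
  have [measurable]: "N \<in> sets borel" using N by simp
  have "0 = (\<integral>\<^sup>+ x. indicator N x \<partial>lborel)" using N by simp
  also have "\<dots> = ennreal \<bar>c\<bar> * (\<integral>\<^sup>+ x. indicator N (t + c * x) \<partial>lborel)"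
    using c by (intro nn_integral_real_affine) auto
  finally have "(\<integral>\<^sup>+ x. indicator N (t + c * x) \<partial>lborel) = (0::ennreal)"
    using c by simp
  then have "AE x in lborel. indicator N (t + c * x) = (0::ennreal)"
    by (subst (asm) nn_integral_0_iff_AE) auto
  then show ?thesis
    by eventually_elim (use N(1) in \<open>auto simp: indicator_def split: if_splits\<close>)
qed

lemma AE_reflect: "AE x in lborel. P x \<Longrightarrow> AE x in lborel. P (- x :: real)"
  using AE_lborel_affine[of P "-1" 0] by simp

lemma norm_integral_mult_le:
  assumes [measurable]: "f \<in> borel_measurable borel" "g \<in> borel_measurable borel"
  shows "(ennreal (cmod (LBINT x. f x * g x)))\<^sup>2 \<le> l2n f * l2n g"
proof -
  have "ennreal (cmod (LBINT x. f x * g x)) \<le> (\<integral>\<^sup>+ x. ennreal (cmod (f x)) * ennreal (cmod (g x)) \<partial>lborel)"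
    using norm_integral_le_nn_integral[of lborel "\<lambda>x. f x * g x"] by (simp add: norm_mult ennreal_mult)
  then have "(ennreal (cmod (LBINT x. f x * g x)))\<^sup>2 \<le>
      (\<integral>\<^sup>+ x. ennreal (cmod (f x)) * ennreal (cmod (g x)) \<partial>lborel)\<^sup>2"
    by (rule power_mono) simp
  also have "\<dots> \<le> l2n f * l2n g"
    using Cauchy_Schwarz_nn_integral[of "\<lambda>x. ennreal (cmod (f x))" lborel "\<lambda>x. ennreal (cmod (g x))"]
    by (simp add: l2n_def ennreal_power)
  finally show ?thesis .
qed

text \<open>Cauchy-Schwarz. It passes to the limit in pairings when functions are approximated by
  truncations.\<close>

lemma tendsto_integral_mult_L2:
  assumes "\<And>n. f n \<in> L2" "F \<in> L2" "g \<in> L2" and lim: "((\<lambda>n. l2n (\<lambda>x. f n x - F x)) \<longlongrightarrow> 0) net"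
  shows "((\<lambda>n. LBINT x. f n x * g x) \<longlongrightarrow> (LBINT x. F x * g x)) net"
proof -
  have eq: "(LBINT x. (f n x - F x) * g x) = (LBINT x. f n x * g x) - (LBINT x. F x * g x)" for n
    by (subst Bochner_Integration.integral_diff[symmetric]) (simp_all add: integrable_mult_L2 assms left_diff_distrib)
  have bound: "((\<lambda>n. l2n g * l2n (\<lambda>x. f n x - F x)) \<longlongrightarrow> 0) net"
    using ennreal_tendsto_cmult[of "l2n g", OF _ lim] assms(3) by (auto simp: L2_iff)
  have "((\<lambda>n. (ennreal (cmod (LBINT x. (f n x - F x) * g x)))\<^sup>2) \<longlongrightarrow> 0) net"
  proof (rule tendsto_sandwich[OF _ _ tendsto_const bound])
    show "\<forall>\<^sub>F n in net. (ennreal (cmod (LBINT x. (f n x - F x) * g x)))\<^sup>2 \<le> l2n g * l2n (\<lambda>x. f n x - F x)"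
      using assms(1-3) by (intro always_eventually allI, subst mult.commute[of "l2n g"])
        (intro norm_integral_mult_le borel_measurable_diff L2_measurable)
  qed auto
  then have "((\<lambda>n. ennreal ((cmod (LBINT x. (f n x - F x) * g x))\<^sup>2)) \<longlongrightarrow> ennreal 0) net"
    by (simp add: ennreal_power)
  then have "((\<lambda>n. (cmod (LBINT x. (f n x - F x) * g x))\<^sup>2) \<longlongrightarrow> 0) net"
    by (subst (asm) tendsto_ennreal_iff) auto
  then have "((\<lambda>n. sqrt ((cmod (LBINT x. (f n x - F x) * g x))\<^sup>2)) \<longlongrightarrow> sqrt 0) net"
    by (rule tendsto_real_sqrt)
  then have "((\<lambda>n. cmod ((LBINT x. f n x * g x) - (LBINT x. F x * g x))) \<longlongrightarrow> 0) net"
    by (simp add: eq)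
  then show ?thesis
    by (simp add: tendsto_norm_zero_iff LIM_zero_iff)
qed

lemma summable_diff_imp_convergent:
  fixes a :: "nat \<Rightarrow> 'a::real_normed_vector"
  assumes "summable (\<lambda>n. a (Suc n) - a n)"
  shows "convergent a"
proof -
  have "(\<lambda>n. \<Sum>k<n. a (Suc k) - a k) \<longlonglongrightarrow> (\<Sum>n. a (Suc n) - a n)"
    using summable_LIMSEQ[OF assms] .
  then have "(\<lambda>n. (a n - a 0) + a 0) \<longlonglongrightarrow> (\<Sum>n. a (Suc n) - a n) + a 0"
    unfolding sum_lessThan_telescope by (rule tendsto_add) (rule tendsto_const)
  then show ?thesis by (auto simp: convergent_def)
qed

text \<open>Riesz-Fischer: a fast subsequence converges almost everywhere, and Fatou turns the
  Cauchy bound of the whole sequence into convergence to this limit.\<close>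

lemma L2_complete:
  fixes f :: "nat \<Rightarrow> real \<Rightarrow> complex"
  assumes f: "\<And>n. f n \<in> L2"
    and cauchy: "\<And>e. e > 0 \<Longrightarrow> \<exists>N. \<forall>m\<ge>N. \<forall>n\<ge>N. l2n (\<lambda>x. f m x - f n x) \<le> ennreal e"
  obtains g where "g \<in> L2" "(\<lambda>n. l2n (\<lambda>x. f n x - g x)) \<longlonglongrightarrow> 0"
proof -
  have [measurable]: "f n \<in> borel_measurable borel" for n using f by (simp add: L2_iff)
  \<comment> \<open>The rate 1/8 leaves room: after multiplication by 2^k the squared increments
    still have a geometric sum, and this is what yields summability of the increments
    themselves.\<close>
  have "\<forall>k. \<exists>N. \<forall>m\<ge>N. \<forall>n\<ge>N. l2n (\<lambda>x. f m x - f n x) \<le> ennreal ((1/8)^k)"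
    using cauchy by simp
  then obtain r where r: "\<And>k m n. m \<ge> r k \<Longrightarrow> n \<ge> r k \<Longrightarrow> l2n (\<lambda>x. f m x - f n x) \<le> ennreal ((1/8)^k)"
    by metis
  \<comment> \<open>The partial sums put both \<open>s k\<close> and \<open>s (Suc k)\<close> beyond
    \<open>r k\<close>; the summand \<open>k\<close> makes \<open>s\<close> unbounded.\<close>
  define s where "s k = k + (\<Sum>i\<le>k. r i)" for k
  have s: "s k \<ge> r k" "s (Suc k) \<ge> r k" "s k \<ge> k" for k
    using member_le_sum[of k "{..k}" r] by (auto simp: s_def)
  define D where "D k x = cmod (f (s (Suc k)) x - f (s k) x)" for k x
  have [measurable]: "D k \<in> borel_measurable borel" for k unfolding D_def[abs_def] by measurable
  have "(\<integral>\<^sup>+ x. (\<Sum>k. ennreal (2^k * (D k x)\<^sup>2)) \<partial>lborel) = (\<Sum>k. \<integral>\<^sup>+ x. ennreal (2^k * (D k x)\<^sup>2) \<partial>lborel)"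
    by (rule nn_integral_suminf) simp
  also have "\<dots> \<le> (\<Sum>k. ennreal ((1/4)^k))"
  proof (intro suminf_le summableI)
    fix k
    have "(\<integral>\<^sup>+ x. ennreal (2^k * (D k x)\<^sup>2) \<partial>lborel) = ennreal (2^k) * l2n (\<lambda>x. f (s (Suc k)) x - f (s k) x)"
      by (simp add: l2n_def D_def ennreal_mult nn_integral_cmult)
    also have "\<dots> \<le> ennreal (2^k) * ennreal ((1/8)^k)"
      by (intro mult_left_mono r s) simp
    also have "\<dots> = ennreal ((1/4)^k)"
      by (simp add: ennreal_mult[symmetric] power_mult_distrib[symmetric])
    finally show "(\<integral>\<^sup>+ x. ennreal (2^k * (D k x)\<^sup>2) \<partial>lborel) \<le> ennreal ((1/4)^k)" .
  qed
  also have "\<dots> < \<infinity>"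
  proof -
    have "(\<Sum>k. ennreal ((1/4)^k)) = ennreal (\<Sum>k. (1/4)^k)"
      by (intro suminf_ennreal2 summable_geometric) auto
    then show ?thesis by (simp only: ennreal_less_top infinity_ennreal_def)
  qed
  finally have "(\<integral>\<^sup>+ x. (\<Sum>k. ennreal (2^k * (D k x)\<^sup>2)) \<partial>lborel) < \<infinity>" .
  then have "AE x in lborel. (\<Sum>k. ennreal (2^k * (D k x)\<^sup>2)) \<noteq> \<infinity>"
    by (intro nn_integral_PInf_AE) auto
  then have conv: "AE x in lborel. convergent (\<lambda>k. f (s k) x)"
  proof eventually_elim
    case (elim x)
    have sum2: "summable (\<lambda>k. 2^k * (D k x)\<^sup>2)"
      using elim by (intro summable_suminf_not_top) auto
    \<comment> \<open>An increment above 2^-k satisfies 1 <= 2^k D, hence D <= 2^k D^2.\<close>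
    have "D k x \<le> (1/2)^k + 2^k * (D k x)\<^sup>2" for k
    proof (cases "D k x \<le> (1/2)^k")
      case False
      then have "1 \<le> 2^k * D k x" by (simp add: field_simps power_divide)
      then have "D k x * 1 \<le> D k x * (2^k * D k x)" by (intro mult_left_mono) (auto simp: D_def)
      then show ?thesis by (simp add: power2_eq_square mult_ac add_increasing)
    qed (simp add: add_increasing2)
    then have "summable (\<lambda>k. D k x)"
      by (intro summable_comparison_test'[OF summable_add[OF summable_geometric[of "1/2"] sum2]])
        (auto simp: D_def)
    then have "summable (\<lambda>k. f (s (Suc k)) x - f (s k) x)"
      unfolding D_def by (rule summable_norm_cancel)
    then show ?case by (rule summable_diff_imp_convergent)
  qed
  define g where "g x = lim (\<lambda>k. f (s k) x)" for x
  have [measurable]: "g \<in> borel_measurable borel" unfolding g_def[abs_def] by measurable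
  have lim: "AE x in lborel. (\<lambda>k. f (s k) x) \<longlonglongrightarrow> g x"
    using conv by eventually_elim (simp add: g_def convergent_LIMSEQ_iff)
  have fatou: "l2n (\<lambda>x. f n x - g x) \<le> ennreal e" if N: "\<forall>m\<ge>N. \<forall>n\<ge>N. l2n (\<lambda>x. f m x - f n x) \<le> ennreal e" "n \<ge> N" for e n N
  proof -
    have "l2n (\<lambda>x. f n x - g x) = (\<integral>\<^sup>+ x. liminf (\<lambda>k. ennreal ((cmod (f n x - f (s k) x))\<^sup>2)) \<partial>lborel)"
      unfolding l2n_def
    proof (rule nn_integral_cong_AE)
      show "AE x in lborel. ennreal ((cmod (f n x - g x))\<^sup>2) = liminf (\<lambda>k. ennreal ((cmod (f n x - f (s k) x))\<^sup>2))"
        using lim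
      proof eventually_elim
        case (elim x)
        have "(\<lambda>k. ennreal ((cmod (f n x - f (s k) x))\<^sup>2)) \<longlonglongrightarrow> ennreal ((cmod (f n x - g x))\<^sup>2)"
          by (intro tendsto_intros elim) 
        from lim_imp_Liminf[OF sequentially_bot this] show ?case by simp
      qed
    qed
    also have "\<dots> \<le> liminf (\<lambda>k. l2n (\<lambda>x. f n x - f (s k) x))"
      unfolding l2n_def by (rule nn_integral_liminf) simp
    also have "\<dots> \<le> ennreal e"
    proof (rule Liminf_le)
      have "l2n (\<lambda>x. f n x - f (s k) x) \<le> ennreal e" if "k \<ge> N" for k
        using N that s(3)[of k] by auto
      then show "\<forall>\<^sub>F k in sequentially. l2n (\<lambda>x. f n x - f (s k) x) \<le> ennreal e"
        by (auto simp: eventually_sequentially)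
    qed simp
    finally show ?thesis .
  qed
  show ?thesis
  proof (rule that)
    obtain N where "\<forall>m\<ge>N. \<forall>n\<ge>N. l2n (\<lambda>x. f m x - f n x) \<le> ennreal 1" using cauchy[OF zero_less_one] by blast
    then have 1: "l2n (\<lambda>x. f N x - g x) \<le> ennreal 1" by (rule fatou) simp
    have "l2n g \<le> 2 * l2n (\<lambda>x. f N x) + 2 * l2n (\<lambda>x. f N x - g x)"
      using l2n_diff_le[of "f N" "\<lambda>x. f N x - g x"] by simp
    also have "\<dots> < \<infinity>" using f[of N] le_less_trans[OF 1] by (auto simp: L2_iff ennreal_mult_less_top)
    finally show "g \<in> L2" by (simp add: L2_iff)
    show "(\<lambda>n. l2n (\<lambda>x. f n x - g x)) \<longlonglongrightarrow> 0"
    proof (rule tendsto_0_if_Limsup_eq_0_ennreal, rule antisym)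
      show "limsup (\<lambda>n. l2n (\<lambda>x. f n x - g x)) \<le> 0"
      proof (rule ennreal_le_epsilon)
        fix e :: real assume "e > 0"
        then obtain N where "\<forall>m\<ge>N. \<forall>n\<ge>N. l2n (\<lambda>x. f m x - f n x) \<le> ennreal e" using cauchy[OF \<open>e > 0\<close>] by blast
        then show "limsup (\<lambda>n. l2n (\<lambda>x. f n x - g x)) \<le> 0 + ennreal e"
          by (intro Limsup_bounded) (auto simp: eventually_sequentially intro!: exI[of _ N] fatou)
      qed
    qed simp
  qed
qed

section \<open>The Fourier transform on L2: truncated integrals, Parseval identity,
  inversion\<close>

definition trunc :: "real \<Rightarrow> (real \<Rightarrow> complex) \<Rightarrow> real \<Rightarrow> complex" where
  "trunc R f x = indicator {- R..R} x *\<^sub>R f x"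

lemma is_fourier_iff:
  "is_fourier \<psi> h \<longleftrightarrow> h \<in> L2 \<and> ((\<lambda>R. l2n (\<lambda>\<xi>. h \<xi> - ft (trunc R \<psi>) \<xi>)) \<longlongrightarrow> 0) at_top"
  unfolding is_fourier_def l2n_def ft_def trunc_def set_lebesgue_integral_def
  by (simp only: mult_scaleR_right)

lemma measurable_trunc [measurable]:
  "f \<in> borel_measurable borel \<Longrightarrow> trunc R f \<in> borel_measurable borel"
  unfolding trunc_def[abs_def] by measurable

lemma indicator_interval_L2: "(\<lambda>x. complex_of_real (indicator {a..b::real} x)) \<in> L2"
proof -
  have "l2n (\<lambda>x. complex_of_real (indicator {a..b} x)) = (\<integral>\<^sup>+ x. indicator {a..b} x \<partial>lborel)"
    unfolding l2n_def by (intro nn_integral_cong) (simp add: indicator_def)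
  also have "\<dots> < \<infinity>" using emeasure_lborel_cbox_finite[of a b] by simp
  finally show ?thesis by (simp add: L2_iff)
qed

lemma integrable_indicator_mult_L2:
  assumes "f \<in> L2"
  shows "integrable lborel (\<lambda>x. complex_of_real (indicator {a..b} x) * f x)"
  by (rule integrable_mult_L2[OF indicator_interval_L2 assms])

lemma integrable_indicator_interval: "integrable lborel (\<lambda>x. complex_of_real (indicator {a..b::real} x))"
proof -
  have "(\<lambda>x. complex_of_real (indicator {a..b} x)) =
      (\<lambda>x. complex_of_real (indicator {a..b} x) * complex_of_real (indicator {a..b} x))"
    by (auto simp: fun_eq_iff indicator_def)
  then show ?thesis
    using integrable_mult_L2[OF indicator_interval_L2 indicator_interval_L2, of a b a b] by simp
qed

lemma trunc_eq: "trunc R f = (\<lambda>x. complex_of_real (indicator {- R..R} x) * f x)"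
  by (simp add: trunc_def fun_eq_iff scaleR_conv_of_real)

lemma trunc_integrable: "f \<in> L2 \<Longrightarrow> integrable lborel (trunc R f)"
  unfolding trunc_eq by (rule integrable_indicator_mult_L2)

lemma l2n_mono:
  "(\<And>x. cmod (f x) \<le> cmod (g x)) \<Longrightarrow> l2n f \<le> l2n g"
  unfolding l2n_def by (intro nn_integral_mono ennreal_leI power_mono) auto

lemma trunc_L2: "f \<in> L2 \<Longrightarrow> trunc R f \<in> L2"
proof -
  have "l2n (trunc R f) \<le> l2n f" by (rule l2n_mono) (simp add: trunc_def indicator_def)
  then show "f \<in> L2 \<Longrightarrow> trunc R f \<in> L2" by (auto simp: L2_iff intro: le_less_trans)
qed

lemma tail_tendsto:
  assumes "f \<in> L2"
  shows "((\<lambda>R. l2n (\<lambda>x. f x - trunc R f x)) \<longlongrightarrow> 0) at_top"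
proof -
  have [measurable]: "f \<in> borel_measurable borel" using assms by (rule L2_measurable)
  have int: "integrable lborel (\<lambda>x. (cmod (f x))\<^sup>2)" using assms by (simp add: L2_def)
  have bd: "(cmod (f x - trunc R f x))\<^sup>2 \<le> (cmod (f x))\<^sup>2" for R x
    by (simp add: trunc_def indicator_def)
  have inti: "integrable lborel (\<lambda>x. (cmod (f x - trunc R f x))\<^sup>2)" for R
    by (rule Bochner_Integration.integrable_bound[OF int]) (use bd in auto)
  have "((\<lambda>R. LBINT x. (cmod (f x - trunc R f x))\<^sup>2) \<longlongrightarrow> (LBINT x::real. 0)) at_top"
  proof (rule Bochner_Integration.integral_dominated_convergence_at_top[where w="\<lambda>x. (cmod (f x))\<^sup>2" and M=lborel
        and f="\<lambda>x. 0" and s="\<lambda>R x. (cmod (f x - trunc R f x))\<^sup>2"])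
    show "AE x in lborel. ((\<lambda>R. (cmod (f x - trunc R f x))\<^sup>2) \<longlongrightarrow> 0) at_top"
    proof (intro AE_I2 tendsto_eventually)
      fix x show "\<forall>\<^sub>F R in at_top. (cmod (f x - trunc R f x))\<^sup>2 = 0"
        using eventually_ge_at_top[of "\<bar>x\<bar>"] by eventually_elim (auto simp: trunc_def indicator_def)
    qed
  qed (use int bd in \<open>auto intro!: always_eventually\<close>)
  then have "((\<lambda>R. ennreal (LBINT x. (cmod (f x - trunc R f x))\<^sup>2)) \<longlongrightarrow> ennreal 0) at_top"
    by (intro tendsto_ennrealI) simp
  also have "(\<lambda>R. ennreal (LBINT x. (cmod (f x - trunc R f x))\<^sup>2)) = (\<lambda>R. l2n (\<lambda>x. f x - trunc R f x))"
    unfolding l2n_def by (intro ext nn_integral_eq_integral[symmetric] inti) auto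
  finally show ?thesis by simp
qed

lemma ft_diff:
  assumes "integrable lborel f" "integrable lborel g"
  shows "ft (\<lambda>x. f x - g x) \<xi> = ft f \<xi> - ft g \<xi>"
  using integrable_character_mult[OF assms(1), of \<xi>] integrable_character_mult[OF assms(2), of \<xi>]
  unfolding ft_def right_diff_distrib by (subst Bochner_Integration.integral_diff) (simp_all only: right_diff_distrib)

lemma l2n_ft_diff_le:
  assumes "integrable lborel f" "integrable lborel g"
  shows "l2n (\<lambda>\<xi>. ft f \<xi> - ft g \<xi>) \<le> l2n (\<lambda>x. f x - g x)"
proof -
  have "ft (\<lambda>x. f x - g x) = (\<lambda>\<xi>. ft f \<xi> - ft g \<xi>)"
    using assms by (simp add: fun_eq_iff ft_diff)
  then show ?thesis using l2n_ft_le[of "\<lambda>x. f x - g x"] assms by simp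
qed

text \<open>\<open>l2n_ft_le\<close> carries the convergence of the truncations over to their
  transforms, and completeness provides the limit.\<close>

lemma is_fourier_exists:
  assumes f: "f \<in> L2"
  shows "\<exists>h. is_fourier f h"
proof -
  have [measurable]: "f \<in> borel_measurable borel" using assms by (rule L2_measurable)
  define tail where "tail R = l2n (\<lambda>x. f x - trunc R f x)" for R
  have tail: "(tail \<longlongrightarrow> 0) at_top" unfolding tail_def[abs_def] by (rule tail_tendsto[OF f])
  have near: "l2n (\<lambda>\<xi>. ft (trunc R f) \<xi> - ft (trunc S f) \<xi>) \<le> 2 * tail R + 2 * tail S" for R S
    using order_trans[OF l2n_ft_diff_le[OF trunc_integrable trunc_integrable] l2n_diff_triangle[of "trunc R f" f "trunc S f"]] f
    by (simp add: tail_def l2n_diff_commute[of "trunc R f" f])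
  have seq: "(\<lambda>n. tail (real n)) \<longlonglongrightarrow> 0"
    by (rule filterlim_compose[OF tail filterlim_real_sequentially])
  obtain g where g: "g \<in> L2" and lim: "(\<lambda>n. l2n (\<lambda>\<xi>. ft (trunc (real n) f) \<xi> - g \<xi>)) \<longlonglongrightarrow> 0"
  proof (rule L2_complete[of "\<lambda>n. ft (trunc (real n) f)"])
    show "ft (trunc (real n) f) \<in> L2" for n by (intro ft_L2 trunc_integrable trunc_L2 f)
    fix e :: real assume "e > 0"
    then have "\<forall>\<^sub>F n in sequentially. tail (real n) < ennreal (e / 4)"
      using seq by (intro order_tendstoD) auto
    then obtain N where N: "\<And>n. n \<ge> N \<Longrightarrow> tail (real n) < ennreal (e / 4)"
      by (auto simp: eventually_sequentially)
    have "l2n (\<lambda>\<xi>. ft (trunc (real m) f) \<xi> - ft (trunc (real n) f) \<xi>) \<le> ennreal e" if "m \<ge> N" "n \<ge> N" for m n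
    proof -
      have "2 * tail (real m) + 2 * tail (real n) \<le> 2 * ennreal (e / 4) + 2 * ennreal (e / 4)"
        by (intro add_mono mult_left_mono less_imp_le N that) auto
      also have "\<dots> = ennreal e"
        using \<open>e > 0\<close> by (simp add: ennreal_plus[symmetric] ennreal_mult[symmetric]
          ennreal_numeral[symmetric] del: ennreal_plus ennreal_numeral)
      finally show ?thesis using near order_trans by blast
    qed
    then show "\<exists>N. \<forall>m\<ge>N. \<forall>n\<ge>N. l2n (\<lambda>\<xi>. ft (trunc (real m) f) \<xi> - ft (trunc (real n) f) \<xi>) \<le> ennreal e"
      by blast
  qed
  have [measurable]: "g \<in> borel_measurable borel" using g by (rule L2_measurable)
  \<comment> \<open>Completeness yields a limit along integer radii; comparison with the ceiling of
    \<open>R\<close> extends it to the limit over real radii demanded by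
    \<open>is_fourier\<close>.\<close>
  have nat_top: "filterlim (\<lambda>R::real. nat \<lceil>R\<rceil>) sequentially at_top"
    unfolding filterlim_at_top
  proof
    fix Z :: nat
    show "\<forall>\<^sub>F R::real in at_top. Z \<le> nat \<lceil>R\<rceil>"
      using eventually_ge_at_top[of "real Z"] by eventually_elim linarith
  qed
  have "((\<lambda>R. l2n (\<lambda>\<xi>. g \<xi> - ft (trunc R f) \<xi>)) \<longlongrightarrow> 0) at_top"
  proof (rule tendsto_sandwich[OF _ _ tendsto_const])
    let ?B = "\<lambda>R. 2 * l2n (\<lambda>\<xi>. ft (trunc (real (nat \<lceil>R\<rceil>)) f) \<xi> - g \<xi>) + 2 * (2 * tail (real (nat \<lceil>R\<rceil>)) + 2 * tail R)"
    show "\<forall>\<^sub>F R in at_top. l2n (\<lambda>\<xi>. g \<xi> - ft (trunc R f) \<xi>) \<le> ?B R"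
    proof (intro always_eventually allI)
      fix R
      have "l2n (\<lambda>\<xi>. g \<xi> - ft (trunc R f) \<xi>) \<le> 2 * l2n (\<lambda>\<xi>. g \<xi> - ft (trunc (real (nat \<lceil>R\<rceil>)) f) \<xi>) +
          2 * l2n (\<lambda>\<xi>. ft (trunc (real (nat \<lceil>R\<rceil>)) f) \<xi> - ft (trunc R f) \<xi>)"
        by (rule l2n_diff_triangle) auto
      also have "\<dots> \<le> ?B R"
        by (intro add_mono mult_left_mono near) (auto simp: l2n_diff_commute[of g])
      finally show "l2n (\<lambda>\<xi>. g \<xi> - ft (trunc R f) \<xi>) \<le> ?B R" .
    qed
    have t1: "((\<lambda>R::real. tail (real (nat \<lceil>R\<rceil>))) \<longlongrightarrow> 0) at_top" by (rule filterlim_compose[OF seq nat_top])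
    have t2: "((\<lambda>R::real. l2n (\<lambda>\<xi>. ft (trunc (real (nat \<lceil>R\<rceil>)) f) \<xi> - g \<xi>)) \<longlongrightarrow> 0) at_top"
      by (rule filterlim_compose[OF lim nat_top])
    have "(?B \<longlongrightarrow> 2 * 0 + 2 * (2 * 0 + 2 * 0)) at_top"
      by (intro tendsto_add ennreal_tendsto_cmult t1 t2 tail) auto
    then show "(?B \<longlongrightarrow> 0) at_top" by simp
  qed auto
  with g show ?thesis by (auto simp: is_fourier_iff)
qed

lemma is_fourier_fourier: "f \<in> L2 \<Longrightarrow> is_fourier f (fourier f)"
  unfolding fourier_def using is_fourier_exists by (rule someI_ex)

lemma fourier_L2: "f \<in> L2 \<Longrightarrow> fourier f \<in> L2"
  using is_fourier_fourier by (auto simp: is_fourier_iff)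

lemma is_fourier_unique:
  assumes f: "f \<in> L2" and h: "is_fourier f h" "is_fourier f k"
  shows "AE \<xi> in lborel. h \<xi> = k \<xi>"
proof -
  have [measurable]: "f \<in> borel_measurable borel" "h \<in> borel_measurable borel" "k \<in> borel_measurable borel"
    using assms by (auto simp: is_fourier_iff L2_iff)
  let ?b = "\<lambda>R. 2 * l2n (\<lambda>\<xi>. h \<xi> - ft (trunc R f) \<xi>) + 2 * l2n (\<lambda>\<xi>. k \<xi> - ft (trunc R f) \<xi>)"
  have "(?b \<longlongrightarrow> 2 * 0 + 2 * 0) at_top"
    using h by (intro tendsto_add ennreal_tendsto_cmult) (auto simp: is_fourier_iff)
  moreover have "l2n (\<lambda>\<xi>. h \<xi> - k \<xi>) \<le> ?b R" for R
    using l2n_diff_triangle[of h "ft (trunc R f)" k] by (simp add: l2n_diff_commute[of "ft _"])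
  ultimately have "l2n (\<lambda>\<xi>. h \<xi> - k \<xi>) \<le> 0"
    by (intro tendsto_lowerbound[of ?b _ at_top]) (auto intro!: always_eventually)
  then show ?thesis using l2n_eq_0_iff[of "\<lambda>\<xi>. h \<xi> - k \<xi>"] by simp
qed

lemma fourier_eqI: "f \<in> L2 \<Longrightarrow> is_fourier f h \<Longrightarrow> AE \<xi> in lborel. fourier f \<xi> = h \<xi>"
  by (rule is_fourier_unique[OF _ is_fourier_fourier])

lemma is_fourier_cong_AE:
  assumes "AE x in lborel. f x = g x" "f \<in> borel_measurable borel" "g \<in> borel_measurable borel"
  shows "is_fourier f = is_fourier g"
proof -
  have "ft (trunc R f) = ft (trunc R g)" for R
    unfolding ft_def
    by (intro ext arg_cong2[where f="(*)"] refl integral_cong_AE)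
      (use assms in \<open>auto simp: trunc_def\<close>)
  then show ?thesis by (simp add: is_fourier_iff fun_eq_iff)
qed

lemma fourier_cong_AE:
  assumes "AE x in lborel. f x = g x" "f \<in> borel_measurable borel" "g \<in> borel_measurable borel"
  shows "fourier f = fourier g"
  by (simp add: fourier_def is_fourier_cong_AE[OF assms])

lemma is_fourier_ft:
  assumes f: "integrable lborel f" "f \<in> L2"
  shows "is_fourier f (ft f)"
proof -
  have "((\<lambda>R. l2n (\<lambda>\<xi>. ft f \<xi> - ft (trunc R f) \<xi>)) \<longlongrightarrow> 0) at_top"
    by (rule tendsto_sandwich[OF _ _ tendsto_const tail_tendsto[OF f(2)]])
      (auto intro!: always_eventually l2n_ft_diff_le trunc_integrable f)
  then show ?thesis using ft_L2[OF f] by (simp add: is_fourier_iff)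
qed

lemma is_fourier_diff:
  assumes f: "f \<in> L2" and g: "g \<in> L2" and h: "is_fourier f h" "is_fourier g k"
  shows "is_fourier (\<lambda>x. f x - g x) (\<lambda>\<xi>. h \<xi> - k \<xi>)"
proof -
  have [measurable]: "f \<in> borel_measurable borel" "h \<in> borel_measurable borel" "k \<in> borel_measurable borel"
     "g \<in> borel_measurable borel"
    using assms by (auto simp: is_fourier_iff L2_iff)
  have ftd: "ft (trunc R (\<lambda>x. f x - g x)) \<xi> = ft (trunc R f) \<xi> - ft (trunc R g) \<xi>" for R \<xi>
  proof -
    have "trunc R (\<lambda>x. f x - g x) = (\<lambda>x. trunc R f x - trunc R g x)"
      by (auto simp: trunc_def scaleR_diff_right)
    then show ?thesis by (simp add: ft_diff trunc_integrable f g)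
  qed
  let ?b = "\<lambda>R. 2 * l2n (\<lambda>\<xi>. h \<xi> - ft (trunc R f) \<xi>) + 2 * l2n (\<lambda>\<xi>. k \<xi> - ft (trunc R g) \<xi>)"
  have "(?b \<longlongrightarrow> 2 * 0 + 2 * 0) at_top"
    using h by (intro tendsto_add ennreal_tendsto_cmult) (auto simp: is_fourier_iff)
  then have b: "(?b \<longlongrightarrow> 0) at_top" by simp
  have le: "l2n (\<lambda>\<xi>. h \<xi> - k \<xi> - ft (trunc R (\<lambda>x. f x - g x)) \<xi>) \<le> ?b R" for R
    using l2n_diff_le[of "\<lambda>\<xi>. h \<xi> - ft (trunc R f) \<xi>" "\<lambda>\<xi>. k \<xi> - ft (trunc R g) \<xi>"]
    by (simp add: ftd algebra_simps)
  have "((\<lambda>R. l2n (\<lambda>\<xi>. h \<xi> - k \<xi> - ft (trunc R (\<lambda>x. f x - g x)) \<xi>)) \<longlongrightarrow> 0) at_top"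
    by (rule tendsto_sandwich[OF _ _ tendsto_const b]) (auto intro!: always_eventually le)
  then show ?thesis using h by (auto simp: is_fourier_iff L2_diff)
qed

lemma is_fourier_reflect:
  assumes f: "f \<in> L2" and "is_fourier f h"
  shows "is_fourier (\<lambda>x. f (- x)) (\<lambda>\<xi>. h (- \<xi>))"
proof -
  have [measurable]: "f \<in> borel_measurable borel" "h \<in> borel_measurable borel"
    using assms by (auto simp: is_fourier_iff L2_iff)
  have c: "trunc R (\<lambda>x. f (- x)) = (\<lambda>x. trunc R f (- x))" for R
    by (auto simp: trunc_def indicator_def fun_eq_iff)
  have "l2n (\<lambda>\<xi>. h (- \<xi>) - ft (trunc R f) (- \<xi>)) = l2n (\<lambda>\<xi>. h \<xi> - ft (trunc R f) \<xi>)" for R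
    by (rule l2n_reflect) simp
  then show ?thesis using assms by (simp add: is_fourier_iff c ft_reflect L2_reflect)
qed

lemma is_fourier_cnj:
  assumes f: "f \<in> L2" and "is_fourier f h"
  shows "is_fourier (\<lambda>x. cnj (f x)) (\<lambda>\<xi>. cnj (h (- \<xi>)))"
proof -
  have [measurable]: "f \<in> borel_measurable borel" "h \<in> borel_measurable borel"
    using assms by (auto simp: is_fourier_iff L2_iff)
  have h: "(\<lambda>\<xi>. h (- \<xi>)) \<in> L2" using assms by (simp add: is_fourier_iff L2_reflect)
  have c: "ft (trunc R (\<lambda>x. cnj (f x))) \<xi> = cnj (ft (trunc R f) (- \<xi>))" for R \<xi>
  proof -
    have "trunc R (\<lambda>x. cnj (f x)) = (\<lambda>x. cnj (trunc R f x))" by (auto simp: trunc_def)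
    then show ?thesis by (simp add: cnj_ft)
  qed
  have "l2n (\<lambda>\<xi>. cnj (h (- \<xi>)) - cnj (ft (trunc R f) (- \<xi>))) = l2n (\<lambda>\<xi>. h \<xi> - ft (trunc R f) \<xi>)" for R
    by (subst l2n_reflect[symmetric]) (simp_all add: l2n_def complex_cnj_diff[symmetric] del: complex_cnj_diff)
  then show ?thesis using h assms
    by (simp add: is_fourier_iff c) (simp add: l2n_def L2_iff)
qed

text \<open>The Gaussian in \<open>gauss_pairing\<close> is removed on both sides by dominated
  convergence. Indicators are convenient partners: their Gaussian averages are bounded by 1 and
  converge off two points, and they suffice to identify a function.\<close>

lemma parseval_indicator:
  assumes f: "integrable lborel f" "f \<in> L2"
  shows "(LBINT \<xi>. ft f \<xi> * cnj (ft (\<lambda>x. complex_of_real (indicator {a..b} x)) \<xi>)) =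
    (LBINT x. f x * complex_of_real (indicator {a..b} x))"
proof -
  let ?I = "\<lambda>x. complex_of_real (indicator {a..b} x)"
  let ?g = "\<lambda>n \<xi>. complex_of_real (exp (- ((inverse (real (Suc n)) * \<xi>)\<^sup>2 / 2)))"
  let ?K = "\<lambda>n x. LBINT y. cnj (?I y) * complex_of_real (gauss (inverse (real (Suc n))) (y - x))"
  have [measurable]: "f \<in> borel_measurable borel" using f(2) by (rule L2_measurable)
  have L2: "ft f \<in> L2" "(\<lambda>\<xi>. cnj (ft ?I \<xi>)) \<in> L2"
    using ft_L2[OF f] ft_L2[OF integrable_indicator_interval indicator_interval_L2, of a b]
    by (auto simp: L2_iff l2n_def)
  have left: "(\<lambda>n. LBINT \<xi>. ?g n \<xi> * (ft f \<xi> * cnj (ft ?I \<xi>))) \<longlonglongrightarrow> (LBINT \<xi>. ft f \<xi> * cnj (ft ?I \<xi>))"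
  proof (rule integral_dominated_convergence[where w="\<lambda>\<xi>. cmod (ft f \<xi> * cnj (ft ?I \<xi>))"])
    show "integrable lborel (\<lambda>\<xi>. cmod (ft f \<xi> * cnj (ft ?I \<xi>)))"
      by (intro integrable_norm integrable_mult_L2 L2)
    have "(\<lambda>n. ?g n \<xi>) \<longlonglongrightarrow> complex_of_real (exp (- ((0 * \<xi>)\<^sup>2 / 2)))" for \<xi>
      by (intro tendsto_intros LIMSEQ_inverse_real_of_nat) auto
    then have "(\<lambda>n. ?g n \<xi>) \<longlonglongrightarrow> 1" for \<xi> by simp
    from tendsto_mult[OF this tendsto_const]
    show "AE \<xi> in lborel. (\<lambda>n. ?g n \<xi> * (ft f \<xi> * cnj (ft ?I \<xi>))) \<longlonglongrightarrow> ft f \<xi> * cnj (ft ?I \<xi>)"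
      by (intro AE_I2) (simp only: mult_1_left)
    show "AE \<xi> in lborel. cmod (?g n \<xi> * (ft f \<xi> * cnj (ft ?I \<xi>))) \<le> cmod (ft f \<xi> * cnj (ft ?I \<xi>))" for n
      by (intro AE_I2) (simp only: norm_mult[of "?g n _"] norm_of_real, simp add: mult_left_le_one_le)
  qed auto
  have int1: "integrable lborel (\<lambda>y. indicator {a..b} y * gauss d (y - x))" if "d > 0" for d x
  proof (rule Bochner_Integration.integrable_bound)
    show "integrable lborel (\<lambda>y. gauss d (y - x))"
      using that by (simp add: gauss_normal)
  qed (auto simp: indicator_def)
  have Kr: "?K n x = complex_of_real (LBINT y. indicator {a..b} y * gauss (inverse (real (Suc n))) (y - x))" for n x
    unfolding integral_complex_of_real[symmetric] by simp
  have "(LBINT y. indicator {a..b} y * gauss d (y - x)) \<le> (LBINT y. gauss d (y - x))" if "d > 0" for d x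
    using that int1[OF that] gauss_nonneg[OF that]
    by (intro integral_mono) (auto simp: gauss_normal indicator_def)
  then have "(LBINT y. indicator {a..b} y * gauss d (y - x)) \<le> 1" if "d > 0" for d x
    using that by (simp add: gauss_normal)
  moreover have "0 \<le> (LBINT y. indicator {a..b} y * gauss d (y - x))" if "d > 0" for d x
    using that by (intro Bochner_Integration.integral_nonneg) (simp add: gauss_nonneg)
  ultimately have Kb: "cmod (?K n x) \<le> 1" for n x
    unfolding Kr norm_of_real by (simp del: of_nat_Suc)
  have right: "(\<lambda>n. LBINT x. f x * ?K n x) \<longlonglongrightarrow> (LBINT x. f x * ?I x)"
  proof (rule integral_dominated_convergence[where w="\<lambda>x. cmod (f x)"])
    show "integrable lborel (\<lambda>x. cmod (f x))" using f(1) by simp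
    show "AE x in lborel. (\<lambda>n. f x * ?K n x) \<longlonglongrightarrow> f x * ?I x"
      using AE_lborel_singleton[of a] AE_lborel_singleton[of b]
      by eventually_elim (unfold Kr, intro tendsto_mult tendsto_const tendsto_of_real gauss_average_tendsto)
    show "AE x in lborel. cmod (f x * ?K n x) \<le> cmod (f x)" for n
      unfolding norm_mult using Kb[of n] by (intro AE_I2) (simp add: mult_right_le_one_le del: norm_of_real)
    show "(\<lambda>x. f x * ?K n x) \<in> borel_measurable lborel" for n unfolding Kr by measurable
  qed auto
  have eq: "(LBINT \<xi>. ?g n \<xi> * (ft f \<xi> * cnj (ft ?I \<xi>))) = (LBINT x. f x * ?K n x)" for n
    by (rule gauss_pairing[OF f(1) integrable_indicator_interval]) simp
  show ?thesis
    using LIMSEQ_unique[OF left[unfolded eq] right] .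
qed

text \<open>Closed intervals are an intersection-stable generator of the Borel sets, and the sets
  with vanishing integral form a Dynkin system; a density whose integral vanishes over all Borel
  sets is zero.\<close>

lemma AE_eq_0_if_interval_integrals:
  fixes g :: "real \<Rightarrow> complex"
  assumes g: "integrable lborel g" and 0: "\<And>a b. (LBINT x:{a..b}. g x) = 0"
  shows "AE x in lborel. g x = 0"
proof (rule sigma_finite_measure.density_zero[OF sigma_finite_lborel g])
  \<comment> \<open>The complement step needs the integral over the whole line, obtained here as a
    limit of intervals.\<close>
  have all: "(LBINT x. g x) = 0"
  proof -
    have "(\<lambda>n. LBINT x:{- real n..real n}. g x) \<longlonglongrightarrow> (LBINT x. g x)"
      unfolding set_lebesgue_integral_def
    proof (rule integral_dominated_convergence[where w="\<lambda>x. cmod (g x)"])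
      show "AE x in lborel. (\<lambda>n. indicat_real {- real n..real n} x *\<^sub>R g x) \<longlonglongrightarrow> g x"
      proof (intro AE_I2 tendsto_eventually)
        fix x
        have "\<forall>\<^sub>F n in sequentially. \<bar>x\<bar> \<le> real n"
          by (rule filterlim_at_top[THEN iffD1, OF filterlim_real_sequentially, rule_format])
        then show "\<forall>\<^sub>F n in sequentially. indicat_real {- real n..real n} x *\<^sub>R g x = g x"
          by eventually_elim (auto simp: indicator_def)
      qed
    qed (use g in \<open>auto simp: indicator_def\<close>)
    then show ?thesis by (simp add: 0 LIMSEQ_const_iff)
  qed
  let ?G = "range (\<lambda>(a::real, b). {a..b})"
  have Int: "Int_stable ?G"
  proof (rule Int_stableI)
    fix X Y assume "X \<in> ?G" "Y \<in> ?G"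
    then obtain a b c d where "X = {a..b}" "Y = {c..d}" by auto
    then show "X \<inter> Y \<in> ?G" by (intro image_eqI[of _ _ "(max a c, min b d)"]) auto
  qed
  have sets: "sigma_sets UNIV ?G = sets borel"
    by (subst borel_eq_atLeastAtMost) (simp add: sets_measure_of)
  fix A :: "real set" assume "A \<in> sets lborel"
  then have "A \<in> sigma_sets UNIV ?G" by (simp add: sets)
  from Int subset_UNIV[of ?G, folded Pow_UNIV] this show "(LBINT x:A. g x) = 0"
  proof (induction rule: sigma_sets_induct_disjoint)
    case (basic A)
    then show ?case using 0 by auto
  next
    case empty
    show ?case by (simp add: set_lebesgue_integral_def)
  next
    case (compl A)
    have [measurable]: "A \<in> sets borel" using compl(1) by (simp add: sets)
    have "integrable lborel (\<lambda>x. indicat_real A x *\<^sub>R g x)"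
      by (rule integrable_mult_indicator[OF _ g]) simp
    from Bochner_Integration.integral_diff[OF g this]
    have "(LBINT x. g x - indicat_real A x *\<^sub>R g x) = (LBINT x. g x) - (LBINT x:A. g x)"
      by (simp only: set_lebesgue_integral_def)
    moreover have "g x - indicat_real A x *\<^sub>R g x = indicat_real (UNIV - A) x *\<^sub>R g x" for x
      by (simp add: indicator_def)
    ultimately have "(LBINT x:UNIV - A. g x) = (LBINT x. g x) - (LBINT x:A. g x)"
      by (simp only: set_lebesgue_integral_def)
    then show ?case using all compl by simp
  next
    case (union A)
    have [measurable]: "A i \<in> sets borel" for i using union(2) by (auto simp: sets)
    have "(LBINT x:(\<Union>i. A i). g x) = (\<Sum>i. LBINT x:A i. g x)"
      by (rule lebesgue_integral_countable_add)
        (use union(1) g in \<open>auto simp: disjoint_family_on_def set_integrable_def intro!: integrable_mult_indicator\<close>)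
    then show ?case using union by simp
  qed
qed

lemma ft_indicator_cnj:
  "cnj (ft (\<lambda>x. complex_of_real (indicator {a..b} x)) \<xi>) =
    ft (\<lambda>x. complex_of_real (indicator {a..b} (- x))) \<xi>"
  by (simp add: cnj_ft ft_reflect[of "\<lambda>x. complex_of_real (indicator {a..b} x)"])

text \<open>Both sides are tested against indicators. The pairing of \<open>fourier h\<close> with
  the conjugate transform of an indicator is computed twice: by Parseval for truncations of
  \<open>h\<close>, and by \<open>ft_exchange\<close> for truncations of
  \<open>fourier h\<close>.\<close>

lemma fourier_fourier:
  assumes h: "h \<in> L2"
  shows "AE x in lborel. fourier (fourier h) (- x) = h x"
proof -
  define k where "k = fourier h"
  define m where "m x = fourier k (- x)" for x
  have k: "k \<in> L2" and isk: "is_fourier h k" using h by (auto simp: k_def fourier_L2 is_fourier_fourier)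
  have m: "m \<in> L2" unfolding m_def[abs_def] by (intro L2_reflect fourier_L2 k)
  have ism: "is_fourier k (fourier k)" by (rule is_fourier_fourier[OF k])
  have key: "(LBINT x. m x * complex_of_real (indicator {a..b} x)) =
      (LBINT x. h x * complex_of_real (indicator {a..b} x))" for a b
  proof -
    let ?I = "\<lambda>x. complex_of_real (indicator {a..b} x)"
    let ?J = "\<lambda>\<xi>. cnj (ft ?I \<xi>)"
    have J: "?J \<in> L2"
      using ft_L2[OF integrable_indicator_interval indicator_interval_L2, of a b] by (auto simp: L2_iff l2n_def)
    have ind: "?I \<in> L2" by (rule indicator_interval_L2)
    have lim_h: "((\<lambda>R. l2n (\<lambda>\<xi>. ft (trunc R h) \<xi> - k \<xi>)) \<longlongrightarrow> 0) at_top"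
      using isk by (simp add: is_fourier_iff l2n_diff_commute[of _ k])
    have "((\<lambda>R. LBINT \<xi>. ft (trunc R h) \<xi> * ?J \<xi>) \<longlongrightarrow> (LBINT \<xi>. k \<xi> * ?J \<xi>)) at_top"
      by (rule tendsto_integral_mult_L2[OF _ k J lim_h]) (intro ft_L2 trunc_integrable trunc_L2 h)
    moreover have "(LBINT \<xi>. ft (trunc R h) \<xi> * ?J \<xi>) = (LBINT x. trunc R h x * ?I x)" for R
      by (intro parseval_indicator trunc_integrable trunc_L2 h)
    moreover have "((\<lambda>R. LBINT x. trunc R h x * ?I x) \<longlongrightarrow> (LBINT x. h x * ?I x)) at_top"
      by (rule tendsto_integral_mult_L2[OF _ h ind])
        (use tail_tendsto[OF h] in \<open>auto simp: trunc_L2 h l2n_diff_commute[of "trunc _ h" h]\<close>)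
    ultimately have A: "(LBINT \<xi>. k \<xi> * ?J \<xi>) = (LBINT x. h x * ?I x)"
      using tendsto_unique[OF trivial_limit_at_top_linorder] by fastforce
    have "((\<lambda>R. LBINT \<xi>. trunc R k \<xi> * ?J \<xi>) \<longlongrightarrow> (LBINT \<xi>. k \<xi> * ?J \<xi>)) at_top"
      by (rule tendsto_integral_mult_L2[OF _ k J])
        (use tail_tendsto[OF k] in \<open>auto simp: trunc_L2 k l2n_diff_commute[of "trunc _ k" k]\<close>)
    moreover have "(LBINT \<xi>. trunc R k \<xi> * ?J \<xi>) = (LBINT x. ft (trunc R k) (- x) * ?I x)" for R
    proof -
      have "(LBINT \<xi>. trunc R k \<xi> * ?J \<xi>) = (LBINT x. ?I (- x) * ft (trunc R k) x)"
        unfolding ft_indicator_cnj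
        by (intro ft_exchange integrable_reflect integrable_indicator_interval trunc_integrable k)
      also have "\<dots> = (LBINT x. ft (trunc R k) (- x) * ?I x)"
        by (subst lborel_integral_reflect[symmetric]) (simp add: mult.commute)
      finally show ?thesis .
    qed
    moreover have "((\<lambda>R. LBINT x. ft (trunc R k) (- x) * ?I x) \<longlongrightarrow> (LBINT x. m x * ?I x)) at_top"
    proof (rule tendsto_integral_mult_L2[OF _ m ind])
      show "(\<lambda>x. ft (trunc R k) (- x)) \<in> L2" for R by (intro L2_reflect ft_L2 trunc_integrable trunc_L2 k)
      have [measurable]: "ft (trunc R k) \<in> borel_measurable borel" "fourier k \<in> borel_measurable borel" for R
        using ft_L2[OF trunc_integrable[OF k] trunc_L2[OF k]] fourier_L2[OF k] by (auto simp: L2_iff)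
      have "l2n (\<lambda>x. ft (trunc R k) (- x) - m x) = l2n (\<lambda>x. fourier k x - ft (trunc R k) x)" for R
        unfolding m_def l2n_diff_commute[of "\<lambda>x. ft (trunc R k) (- x)"]
        by (rule l2n_reflect[of "\<lambda>x. fourier k x - ft (trunc R k) x"]) simp
      then show "((\<lambda>R. l2n (\<lambda>x. ft (trunc R k) (- x) - m x)) \<longlongrightarrow> 0) at_top"
        using ism by (simp add: is_fourier_iff)
    qed
    ultimately have "(LBINT \<xi>. k \<xi> * ?J \<xi>) = (LBINT x. m x * ?I x)"
      using tendsto_unique[OF trivial_limit_at_top_linorder] by fastforce
    with A show ?thesis by simp
  qed
  \<comment> \<open>A difference of L2 functions need not be integrable on the line, so the
    vanishing criterion is applied on each [-n, n].\<close>
  have AE_n: "AE x in lborel. trunc (real n) (\<lambda>x. m x - h x) x = 0" for n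
  proof (rule AE_eq_0_if_interval_integrals)
    show "integrable lborel (trunc (real n) (\<lambda>x. m x - h x))" by (intro trunc_integrable L2_diff m h)
    fix a b
    have "(LBINT x:{a..b}. trunc (real n) (\<lambda>x. m x - h x) x) =
      (LBINT x. m x * complex_of_real (indicator {max a (- real n)..min b (real n)} x) -
        h x * complex_of_real (indicator {max a (- real n)..min b (real n)} x))"
      unfolding set_lebesgue_integral_def
      by (intro Bochner_Integration.integral_cong) (auto simp: trunc_def indicator_def)
    also have "\<dots> = 0"
      by (subst Bochner_Integration.integral_diff) (auto simp: key integrable_mult_L2 indicator_interval_L2 m h)
    finally show "(LBINT x:{a..b}. trunc (real n) (\<lambda>x. m x - h x) x) = 0" .
  qed
  then have "AE x in lborel. \<forall>n. trunc (real n) (\<lambda>x. m x - h x) x = 0"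
    by (simp add: AE_all_countable)
  then show ?thesis
  proof eventually_elim
    case (elim x)
    obtain n where "\<bar>x\<bar> \<le> real n" using real_arch_simple by blast
    with elim[rule_format, of n] show ?case
      by (auto simp: trunc_def indicator_def m_def k_def abs_le_iff split: if_splits)
  qed
qed

section \<open>Pointwise inversion formulas\<close>

definition ift :: "(real \<Rightarrow> complex) \<Rightarrow> real \<Rightarrow> complex" where
  "ift h x = ft h (- x)"

lemma fourier_ft_AE: "integrable lborel f \<Longrightarrow> f \<in> L2 \<Longrightarrow> AE \<xi> in lborel. fourier f \<xi> = ft f \<xi>"
  by (rule fourier_eqI[OF _ is_fourier_ft])

text \<open>\<open>fourier f\<close> is a representative fixed by choice. It is exchanged for the
  integrable \<open>h\<close>, whose transform is a genuine integral at every point.\<close>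

lemma fourier_inversion:
  assumes f: "f \<in> L2" and h: "integrable lborel h" and eq: "AE \<xi> in lborel. fourier f \<xi> = h \<xi>"
  shows "AE x in lborel. f x = ift h x"
proof -
  have F: "fourier f \<in> L2" by (rule fourier_L2[OF f])
  have hm: "h \<in> borel_measurable borel" using borel_measurable_integrable[OF h] by simp
  have h2: "h \<in> L2" by (rule L2_cong_AE[OF eq F hm])
  have "fourier (fourier f) = fourier h"
    using F by (intro fourier_cong_AE eq hm) (simp add: L2_iff)
  then have "AE x in lborel. fourier (fourier f) (- x) = ft h (- x)"
    using AE_reflect[OF fourier_ft_AE[OF h h2]] by simp
  with fourier_fourier[OF f] show ?thesis
    by eventually_elim (simp add: ift_def)
qed

lemma ift_L2: "integrable lborel h \<Longrightarrow> h \<in> L2 \<Longrightarrow> ift h \<in> L2"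
  unfolding ift_def[abs_def] by (intro L2_reflect ft_L2)

lemma fourier_surj:
  assumes h: "h \<in> L2"
  shows "(\<lambda>x. fourier h (- x)) \<in> L2" "AE \<xi> in lborel. fourier (\<lambda>x. fourier h (- x)) \<xi> = h \<xi>"
proof -
  have F: "fourier h \<in> L2" by (rule fourier_L2[OF h])
  then show G: "(\<lambda>x. fourier h (- x)) \<in> L2" by (rule L2_reflect)
  have "AE \<xi> in lborel. fourier (\<lambda>x. fourier h (- x)) \<xi> = fourier (fourier h) (- \<xi>)"
    by (rule fourier_eqI[OF G is_fourier_reflect[OF F is_fourier_fourier[OF F]]])
  with fourier_fourier[OF h] show "AE \<xi> in lborel. fourier (\<lambda>x. fourier h (- x)) \<xi> = h \<xi>"
    by eventually_elim simp
qed

lemma fourier_ift: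
  assumes h: "integrable lborel h" "h \<in> L2"
  shows "AE \<xi> in lborel. fourier (ift h) \<xi> = h \<xi>"
proof -
  have "AE x in lborel. fourier h (- x) = ift h x"
    using AE_reflect[OF fourier_ft_AE[OF h]] by (simp add: ift_def)
  then have "fourier (\<lambda>x. fourier h (- x)) = fourier (ift h)"
    using fourier_surj(1)[OF h(2)] ift_L2[OF h] by (intro fourier_cong_AE) (auto simp: L2_iff)
  with fourier_surj(2)[OF h(2)] show ?thesis by simp
qed

lemma inv_fourier:
  assumes h: "h \<in> L2"
  shows "inv_fourier h \<in> L2" "AE \<xi> in lborel. fourier (inv_fourier h) \<xi> = h \<xi>"
proof -
  have "\<exists>\<psi>. \<psi> \<in> L2 \<and> (AE \<xi> in lborel. fourier \<psi> \<xi> = h \<xi>)"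
    using fourier_surj[OF h] by blast
  from someI_ex[OF this] show "inv_fourier h \<in> L2" "AE \<xi> in lborel. fourier (inv_fourier h) \<xi> = h \<xi>"
    by (simp_all add: inv_fourier_def)
qed

lemma fourier_diff:
  "f \<in> L2 \<Longrightarrow> g \<in> L2 \<Longrightarrow> AE \<xi> in lborel. fourier (\<lambda>x. f x - g x) \<xi> = fourier f \<xi> - fourier g \<xi>"
  by (intro fourier_eqI L2_diff is_fourier_diff is_fourier_fourier)

lemma fourier_real:
  assumes f: "f \<in> L2" and real: "\<And>x. f x \<in> \<real>"
  shows "AE \<xi> in lborel. fourier f \<xi> = cnj (fourier f (- \<xi>))"
proof (rule fourier_eqI[OF f])
  have "(\<lambda>x. cnj (f x)) = f" using real by (simp add: fun_eq_iff complex_is_Real_iff complex_eq_iff)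
  then show "is_fourier f (\<lambda>\<xi>. cnj (fourier f (- \<xi>)))"
    using is_fourier_cnj[OF f is_fourier_fourier[OF f]] by simp
qed

section \<open>Weighted bounds on the Fourier side\<close>

lemma japanese_ge_1: "1 \<le> japanese \<xi>"
  by (simp add: japanese_def)

lemma japanese_pos [simp]: "0 < japanese \<xi>" "0 \<le> japanese \<xi>" "japanese \<xi> \<noteq> 0"
  using japanese_ge_1[of \<xi>] by linarith+

lemma japanese_uminus [simp]: "japanese (- \<xi>) = japanese \<xi>"
  by (simp add: japanese_def)

lemma abs_le_japanese: "\<bar>\<xi>\<bar> \<le> japanese \<xi>"
  by (simp add: japanese_def real_le_rsqrt)

text \<open>The bracket of z is the Euclidean norm of (1, z). The triangle inequality for these
  vectors produces first coordinate 2, which only enlarges the norm.\<close>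

lemma japanese_triangle: "japanese (x + y) \<le> japanese x + japanese y"
proof -
  have "japanese z = norm (1::real, z)" for z by (simp add: japanese_def norm_Pair)
  moreover have "norm (1::real, x + y) \<le> norm (2::real, x + y)"
    by (simp add: norm_Pair)
  moreover have "norm (2::real, x + y) \<le> norm (1::real, x) + norm (1::real, y)"
    using norm_triangle_ineq[of "(1::real, x)" "(1::real, y)"] by simp
  ultimately show ?thesis by simp
qed

lemma measurable_japanese [measurable]: "japanese \<in> borel_measurable borel"
  unfolding japanese_def[abs_def] by measurable

lemma ennreal_le_of_power2_le:
  fixes c :: ennreal assumes "c\<^sup>2 \<le> ennreal (d\<^sup>2)" "0 \<le> d" shows "c \<le> ennreal d"
proof (cases c)
  case (real x)
  then have "ennreal (x\<^sup>2) \<le> ennreal (d\<^sup>2)" using assms(1) by (simp only: ennreal_power)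
  then have "x\<^sup>2 \<le> d\<^sup>2" by (subst (asm) ennreal_le_iff) auto
  then have "x \<le> d" using assms(2) by (rule power2_le_imp_le)
  then show ?thesis using real by (simp add: ennreal_leI)
next
  case top
  then show ?thesis using assms by (auto simp: power2_eq_square ennreal_top_mult top_unique)
qed

text \<open>Here the sharp triangle inequality matters, since radii of balls are added in the
  fixed-point argument. Explicit radii \<open>r\<close> and \<open>s\<close> replace square roots in
  \<open>ennreal\<close>; Cauchy-Schwarz handles the cross term.\<close>

lemma nn_integral_minkowski:
  assumes [measurable]: "F \<in> borel_measurable M" "G \<in> borel_measurable M"
    and r: "(\<integral>\<^sup>+ x. (F x)\<^sup>2 \<partial>M) \<le> ennreal (r\<^sup>2)" "0 \<le> r"
    and s: "(\<integral>\<^sup>+ x. (G x)\<^sup>2 \<partial>M) \<le> ennreal (s\<^sup>2)" "0 \<le> s"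
  shows "(\<integral>\<^sup>+ x. (F x + G x)\<^sup>2 \<partial>M) \<le> ennreal ((r + s)\<^sup>2)"
proof -
  have "(\<integral>\<^sup>+ x. F x * G x \<partial>M)\<^sup>2 \<le> ennreal (r\<^sup>2) * ennreal (s\<^sup>2)"
    by (rule order_trans[OF Cauchy_Schwarz_nn_integral mult_mono]) (use r s in auto)
  also have "\<dots> = ennreal ((r * s)\<^sup>2)"
    by (simp only: ennreal_mult[OF zero_le_power2 zero_le_power2] power_mult_distrib)
  finally have c: "(\<integral>\<^sup>+ x. F x * G x \<partial>M) \<le> ennreal (r * s)"
    by (rule ennreal_le_of_power2_le) (use r s in simp)
  have "(\<integral>\<^sup>+ x. (F x + G x)\<^sup>2 \<partial>M) = (\<integral>\<^sup>+ x. (F x)\<^sup>2 + 2 * (F x * G x) + (G x)\<^sup>2 \<partial>M)"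
    by (intro nn_integral_cong) (simp only: power2_sum mult.assoc add_ac)
  also have "\<dots> = (\<integral>\<^sup>+ x. (F x)\<^sup>2 \<partial>M) + 2 * (\<integral>\<^sup>+ x. F x * G x \<partial>M) + (\<integral>\<^sup>+ x. (G x)\<^sup>2 \<partial>M)"
    by (simp add: nn_integral_add nn_integral_cmult)
  also have "\<dots> \<le> ennreal (r\<^sup>2) + 2 * ennreal (r * s) + ennreal (s\<^sup>2)"
    by (intro add_mono mult_left_mono c r s) auto
  also have "\<dots> = ennreal (r\<^sup>2 + 2 * (r * s) + s\<^sup>2)"
    using r s by (simp add: ennreal_plus[symmetric] ennreal_mult[symmetric] ennreal_numeral[symmetric]
      del: ennreal_plus ennreal_numeral)
  finally show ?thesis by (simp add: power2_sum algebra_simps)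
qed

text \<open>The argument has values in \<open>ennreal\<close> so that a majorant may be infinite on
  a null set.\<close>

definition wsq :: "real \<Rightarrow> (real \<Rightarrow> ennreal) \<Rightarrow> ennreal" where
  "wsq l m = (\<integral>\<^sup>+ \<xi>. (ennreal (japanese \<xi> powr l) * m \<xi>)\<^sup>2 \<partial>lborel)"

lemma wsq_add:
  assumes [measurable]: "m \<in> borel_measurable borel" "n \<in> borel_measurable borel"
    and "wsq l m \<le> ennreal (r\<^sup>2)" "0 \<le> r" "wsq l n \<le> ennreal (s\<^sup>2)" "0 \<le> s"
  shows "wsq l (\<lambda>\<xi>. m \<xi> + n \<xi>) \<le> ennreal ((r + s)\<^sup>2)"
  using nn_integral_minkowski[of "\<lambda>\<xi>. ennreal (japanese \<xi> powr l) * m \<xi>" lborel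
      "\<lambda>\<xi>. ennreal (japanese \<xi> powr l) * n \<xi>" r s] assms
  by (simp add: wsq_def distrib_left)

lemma wsq_cmult:
  assumes [measurable]: "m \<in> borel_measurable borel" and "wsq l m \<le> ennreal (r\<^sup>2)" "0 \<le> c" "0 \<le> r"
  shows "wsq l (\<lambda>\<xi>. ennreal c * m \<xi>) \<le> ennreal ((c * r)\<^sup>2)"
proof -
  have "wsq l (\<lambda>\<xi>. ennreal c * m \<xi>) = ennreal (c\<^sup>2) * wsq l m"
    using assms unfolding wsq_def
    by (subst nn_integral_cmult[symmetric])
      (auto simp: power_mult_distrib mult_ac ennreal_power intro!: nn_integral_cong)
  also have "\<dots> \<le> ennreal (c\<^sup>2) * ennreal (r\<^sup>2)" by (intro mult_left_mono assms) simp
  finally show ?thesis by (simp add: ennreal_mult[symmetric] power_mult_distrib)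
qed

lemma wsq_mono: "(\<And>\<xi>. m \<xi> \<le> n \<xi>) \<Longrightarrow> wsq l m \<le> wsq l n"
  unfolding wsq_def by (intro nn_integral_mono power_mono mult_left_mono) auto

lemma wsq_cong_AE: "AE \<xi> in lborel. m \<xi> = n \<xi> \<Longrightarrow> wsq l m = wsq l n"
  unfolding wsq_def by (rule nn_integral_cong_AE) auto

text \<open>The weight \<open>W - M * t\<close> stays nonnegative up to time \<open>T\<close>, which
  makes its exponential submultiplicative. \<open>M = 0\<close> gives a constant weight, and
  \<open>T = 0\<close> reduces a trajectory to a single function.\<close>

definition admissible :: "real \<Rightarrow> real \<Rightarrow> real \<Rightarrow> bool" where
  "admissible W M T \<longleftrightarrow> 0 \<le> M \<and> 0 \<le> T \<and> M * T \<le> W"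

text \<open>Caratheodory functions. Continuity in time is demanded at every frequency, so that
  Duhamel integrals exist without an exceptional set.\<close>

definition zcarrier :: "real \<Rightarrow> (real \<Rightarrow> real \<Rightarrow> complex) \<Rightarrow> bool" where
  "zcarrier T u \<longleftrightarrow> (\<forall>t\<in>{0..T}. u t \<in> borel_measurable borel) \<and>
     (\<forall>\<xi>. continuous_on {0..T} (\<lambda>t. u t \<xi>))"

text \<open>A measurable majorant stands in for the supremum over uncountably many times, whose
  measurability would have to be proved separately.\<close>

definition zmajor :: "real \<Rightarrow> real \<Rightarrow> real \<Rightarrow> (real \<Rightarrow> real \<Rightarrow> complex) \<Rightarrow> (real \<Rightarrow> ennreal) \<Rightarrow> bool" where
  "zmajor W M T u m \<longleftrightarrow> m \<in> borel_measurable borel \<and>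
     (\<forall>t\<in>{0..T}. \<forall>\<xi>. ennreal (exp ((W - M * t) * japanese \<xi>) * cmod (u t \<xi>)) \<le> m \<xi>)"

text \<open>The ball of radius \<open>r\<close> in the norm that takes the supremum in time at fixed
  frequency. Radii are propagated instead of norms.\<close>

definition zbound :: "real \<Rightarrow> real \<Rightarrow> real \<Rightarrow> real \<Rightarrow> real \<Rightarrow> (real \<Rightarrow> real \<Rightarrow> complex) \<Rightarrow> bool" where
  "zbound l W M T r u \<longleftrightarrow> 0 \<le> r \<and> zcarrier T u \<and> (\<exists>m. zmajor W M T u m \<and> wsq l m \<le> ennreal (r\<^sup>2))"

text \<open>Control at every frequency, whereas \<open>zbound\<close> by itself is an L2 statement;
  it yields the pointwise convergence of the iterates.\<close>

definition sbound :: "real \<Rightarrow> real \<Rightarrow> real \<Rightarrow> real \<Rightarrow> (real \<Rightarrow> real \<Rightarrow> complex) \<Rightarrow> bool" where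
  "sbound W M T r u \<longleftrightarrow> (\<forall>t\<in>{0..T}. \<forall>\<xi>. exp ((W - M * t) * japanese \<xi>) * cmod (u t \<xi>) \<le> r)"

lemma zboundI:
  "0 \<le> r \<Longrightarrow> zcarrier T u \<Longrightarrow> zmajor W M T u m \<Longrightarrow> wsq l m \<le> ennreal (r\<^sup>2) \<Longrightarrow> zbound l W M T r u"
  by (auto simp: zbound_def)

lemma zbound_mono: "zbound l W M T r u \<Longrightarrow> r \<le> s \<Longrightarrow> zbound l W M T s u"
proof -
  assume z: "zbound l W M T r u" and rs: "r \<le> s"
  then obtain m where m: "zmajor W M T u m" "wsq l m \<le> ennreal (r\<^sup>2)" "0 \<le> r" "zcarrier T u"
    by (auto simp: zbound_def)
  have "wsq l m \<le> ennreal (s\<^sup>2)"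
    using m rs by (intro order_trans[OF m(2)] ennreal_leI power_mono) auto
  with m rs show ?thesis by (intro zboundI) auto
qed

lemma sbound_mono: "sbound W M T r u \<Longrightarrow> r \<le> s \<Longrightarrow> sbound W M T s u"
  unfolding sbound_def using order_trans by blast

lemma zcarrier_add: "zcarrier T u \<Longrightarrow> zcarrier T v \<Longrightarrow> zcarrier T (\<lambda>t \<xi>. u t \<xi> + v t \<xi>)"
  by (auto simp: zcarrier_def intro!: continuous_intros borel_measurable_add)

lemma zcarrier_diff: "zcarrier T u \<Longrightarrow> zcarrier T v \<Longrightarrow> zcarrier T (\<lambda>t \<xi>. u t \<xi> - v t \<xi>)"
  by (auto simp: zcarrier_def intro!: continuous_intros borel_measurable_diff)

lemma zcarrier_mult:
  "c \<in> borel_measurable borel \<Longrightarrow> zcarrier T u \<Longrightarrow> zcarrier T (\<lambda>t \<xi>. c \<xi> * u t \<xi>)"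
  by (auto simp: zcarrier_def intro!: continuous_intros borel_measurable_times)

lemma zbound_add:
  assumes "zbound l W M T r u" "zbound l W M T s v"
  shows "zbound l W M T (r + s) (\<lambda>t \<xi>. u t \<xi> + v t \<xi>)"
proof -
  from assms obtain m n where m: "zmajor W M T u m" "wsq l m \<le> ennreal (r\<^sup>2)"
    and n: "zmajor W M T v n" "wsq l n \<le> ennreal (s\<^sup>2)" and rs: "0 \<le> r" "0 \<le> s"
    and c: "zcarrier T u" "zcarrier T v"
    by (auto simp: zbound_def)
  have "zmajor W M T (\<lambda>t \<xi>. u t \<xi> + v t \<xi>) (\<lambda>\<xi>. m \<xi> + n \<xi>)"
    unfolding zmajor_def
  proof (intro conjI ballI allI)
    fix t \<xi> assume t: "t \<in> {0..T}"
    have "ennreal (exp ((W - M * t) * japanese \<xi>) * cmod (u t \<xi> + v t \<xi>)) \<le>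
      ennreal (exp ((W - M * t) * japanese \<xi>) * cmod (u t \<xi>)) + ennreal (exp ((W - M * t) * japanese \<xi>) * cmod (v t \<xi>))"
      by (simp add: ennreal_plus[symmetric] distrib_left[symmetric] norm_triangle_ineq del: ennreal_plus)
    also have "\<dots> \<le> m \<xi> + n \<xi>" using m(1) n(1) t by (intro add_mono) (auto simp: zmajor_def)
    finally show "ennreal (exp ((W - M * t) * japanese \<xi>) * cmod (u t \<xi> + v t \<xi>)) \<le> m \<xi> + n \<xi>" .
  qed (use m n in \<open>auto simp: zmajor_def\<close>)
  moreover have "wsq l (\<lambda>\<xi>. m \<xi> + n \<xi>) \<le> ennreal ((r + s)\<^sup>2)"
    using m n rs by (intro wsq_add) (auto simp: zmajor_def)
  ultimately show ?thesis using c rs by (intro zboundI zcarrier_add) auto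
qed

lemma zbound_mult:
  assumes "zbound l W M T r u" and [measurable]: "c \<in> borel_measurable borel"
    and c: "\<And>\<xi>. cmod (c \<xi>) \<le> C"
  shows "zbound l W M T (C * r) (\<lambda>t \<xi>. c \<xi> * u t \<xi>)"
proof -
  from assms obtain m where m: "zmajor W M T u m" "wsq l m \<le> ennreal (r\<^sup>2)" "0 \<le> r" "zcarrier T u"
    by (auto simp: zbound_def)
  have C: "0 \<le> C" using order_trans[OF norm_ge_zero c] .
  have "zmajor W M T (\<lambda>t \<xi>. c \<xi> * u t \<xi>) (\<lambda>\<xi>. ennreal C * m \<xi>)"
    unfolding zmajor_def
  proof (intro conjI ballI allI)
    fix t \<xi> assume t: "t \<in> {0..T}"
    have "exp ((W - M * t) * japanese \<xi>) * cmod (c \<xi> * u t \<xi>) \<le> C * (exp ((W - M * t) * japanese \<xi>) * cmod (u t \<xi>))"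
      using mult_right_mono[OF c[of \<xi>], of "exp ((W - M * t) * japanese \<xi>) * cmod (u t \<xi>)"]
      by (simp add: norm_mult mult_ac)
    then have "ennreal (exp ((W - M * t) * japanese \<xi>) * cmod (c \<xi> * u t \<xi>)) \<le>
        ennreal C * ennreal (exp ((W - M * t) * japanese \<xi>) * cmod (u t \<xi>))"
      using C by (simp add: ennreal_mult[symmetric] ennreal_leI)
    also have "\<dots> \<le> ennreal C * m \<xi>" using m t by (intro mult_left_mono) (auto simp: zmajor_def)
    finally show "ennreal (exp ((W - M * t) * japanese \<xi>) * cmod (c \<xi> * u t \<xi>)) \<le> ennreal C * m \<xi>" .
  qed (use m in \<open>auto simp: zmajor_def\<close>)
  moreover have "wsq l (\<lambda>\<xi>. ennreal C * m \<xi>) \<le> ennreal ((C * r)\<^sup>2)"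
    using m C by (intro wsq_cmult) (auto simp: zmajor_def)
  ultimately show ?thesis using m C by (intro zboundI zcarrier_mult) auto
qed

lemma sbound_mult:
  assumes "sbound W M T r u" and c: "\<And>\<xi>. cmod (c \<xi>) \<le> C"
  shows "sbound W M T (C * r) (\<lambda>t \<xi>. c \<xi> * u t \<xi>)"
  unfolding sbound_def
proof (intro ballI allI)
  fix t \<xi> assume t: "t \<in> {0..T}"
  have "cmod (c \<xi>) * (exp ((W - M * t) * japanese \<xi>) * cmod (u t \<xi>)) \<le> C * r"
    using assms t by (intro mult_mono c) (auto simp: sbound_def intro: order_trans[OF norm_ge_zero c])
  then show "exp ((W - M * t) * japanese \<xi>) * cmod (c \<xi> * u t \<xi>) \<le> C * r"
    by (simp add: norm_mult mult_ac)
qed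

lemma sbound_add:
  assumes "sbound W M T r u" "sbound W M T s v"
  shows "sbound W M T (r + s) (\<lambda>t \<xi>. u t \<xi> + v t \<xi>)"
  unfolding sbound_def
proof (intro ballI allI)
  fix t \<xi> assume t: "t \<in> {0..T}"
  have "exp ((W - M * t) * japanese \<xi>) * cmod (u t \<xi> + v t \<xi>) \<le>
    exp ((W - M * t) * japanese \<xi>) * cmod (u t \<xi>) + exp ((W - M * t) * japanese \<xi>) * cmod (v t \<xi>)"
    unfolding distrib_left[symmetric] by (intro mult_left_mono norm_triangle_ineq) simp
  also have "\<dots> \<le> r + s" using assms t by (intro add_mono) (auto simp: sbound_def)
  finally show "exp ((W - M * t) * japanese \<xi>) * cmod (u t \<xi> + v t \<xi>) \<le> r + s" .
qed

lemma zbound_uminus: "zbound l W M T r u \<Longrightarrow> zbound l W M T r (\<lambda>t \<xi>. - u t \<xi>)"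
  using zbound_mult[of l W M T r u "\<lambda>_. -1" 1] by simp

lemma zbound_diff:
  "zbound l W M T r u \<Longrightarrow> zbound l W M T s v \<Longrightarrow> zbound l W M T (r + s) (\<lambda>t \<xi>. u t \<xi> - v t \<xi>)"
  using zbound_add[OF _ zbound_uminus, of l W M T r u s v] by simp

lemma zbound_zero: "0 \<le> r \<Longrightarrow> zbound l W M T r (\<lambda>t \<xi>. 0)"
  by (rule zboundI[where m="\<lambda>_. 0"]) (auto simp: zcarrier_def zmajor_def wsq_def)

text \<open>Complex conjugation as seen on the Fourier side; its fixed points correspond to real
  functions.\<close>

definition til :: "(real \<Rightarrow> complex) \<Rightarrow> real \<Rightarrow> complex" where
  "til f \<xi> = cnj (f (- \<xi>))"

lemma measurable_til [measurable]: "f \<in> borel_measurable borel \<Longrightarrow> til f \<in> borel_measurable borel"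
  unfolding til_def[abs_def]
  by (intro measurable_cnj measurable_compose[OF borel_measurable_uminus[OF measurable_ident_sets]]) auto

lemma zbound_til:
  assumes "zbound l W M T r u"
  shows "zbound l W M T r (\<lambda>t. til (u t))"
proof -
  from assms obtain m where m: "zmajor W M T u m" "wsq l m \<le> ennreal (r\<^sup>2)" "0 \<le> r" "zcarrier T u"
    by (auto simp: zbound_def)
  have [measurable]: "m \<in> borel_measurable borel" using m by (simp add: zmajor_def)
  have "wsq l (\<lambda>\<xi>. m (- \<xi>)) = wsq l m"
    unfolding wsq_def by (subst (2) nn_integral_real_affine[where c="-1" and t=0]) auto
  moreover have "zmajor W M T (\<lambda>t. til (u t)) (\<lambda>\<xi>. m (- \<xi>))"
    unfolding zmajor_def til_def
  proof (intro conjI ballI allI)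
    fix t \<xi> assume "t \<in> {0..T}"
    then have "ennreal (exp ((W - M * t) * japanese (- \<xi>)) * cmod (u t (- \<xi>))) \<le> m (- \<xi>)"
      using m(1) unfolding zmajor_def by blast
    then show "ennreal (exp ((W - M * t) * japanese \<xi>) * cmod (cnj (u t (- \<xi>)))) \<le> m (- \<xi>)" by simp
  qed measurable
  moreover have "zcarrier T (\<lambda>t. til (u t))"
    using m(4) by (auto simp: zcarrier_def til_def[abs_def] intro!: continuous_intros)
  ultimately show ?thesis using m by (intro zboundI[where m="\<lambda>\<xi>. m (- \<xi>)"]) simp_all
qed

lemma sbound_til: "sbound W M T r u \<Longrightarrow> sbound W M T r (\<lambda>t. til (u t))"
  unfolding sbound_def til_def using japanese_uminus complex_mod_cnj by metis

section \<open>Convolution estimates in the weighted spaces\<close>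

lemma nn_integral_shift_reflect:
  assumes [measurable]: "f \<in> borel_measurable borel"
  shows "(\<integral>\<^sup>+ \<eta>. f (\<xi> - \<eta>) \<partial>lborel) = (\<integral>\<^sup>+ \<eta>. f \<eta> \<partial>(lborel :: real measure))"
  by (subst (2) nn_integral_real_affine[where c="-1" and t=\<xi>]) auto

text \<open>Cauchy-Schwarz with respect to the measure \<open>density lborel n\<close>, then Tonelli
  and translation invariance.\<close>

lemma young_nn_integral:
  fixes F n :: "real \<Rightarrow> ennreal"
  assumes [measurable]: "F \<in> borel_measurable borel" "n \<in> borel_measurable borel"
  shows "(\<integral>\<^sup>+ \<xi>. (\<integral>\<^sup>+ \<eta>. F (\<xi> - \<eta>) * n \<eta> \<partial>lborel)\<^sup>2 \<partial>lborel) \<le>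
    (\<integral>\<^sup>+ \<eta>. n \<eta> \<partial>lborel)\<^sup>2 * (\<integral>\<^sup>+ \<xi>. (F \<xi>)\<^sup>2 \<partial>lborel)"
proof -
  have "(\<integral>\<^sup>+ \<eta>. F (\<xi> - \<eta>) * n \<eta> \<partial>lborel)\<^sup>2 \<le>
      (\<integral>\<^sup>+ \<eta>. n \<eta> \<partial>lborel) * (\<integral>\<^sup>+ \<eta>. (F (\<xi> - \<eta>))\<^sup>2 * n \<eta> \<partial>lborel)" for \<xi>
    using Cauchy_Schwarz_nn_integral[of "\<lambda>\<eta>. F (\<xi> - \<eta>)" "density lborel n" "\<lambda>_. 1"]
    by (simp add: nn_integral_density mult.commute emeasure_density)
  then have "(\<integral>\<^sup>+ \<xi>. (\<integral>\<^sup>+ \<eta>. F (\<xi> - \<eta>) * n \<eta> \<partial>lborel)\<^sup>2 \<partial>lborel) \<le>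
      (\<integral>\<^sup>+ \<xi>. (\<integral>\<^sup>+ \<eta>. n \<eta> \<partial>lborel) * (\<integral>\<^sup>+ \<eta>. (F (\<xi> - \<eta>))\<^sup>2 * n \<eta> \<partial>lborel) \<partial>lborel)"
    by (intro nn_integral_mono)
  also have "\<dots> = (\<integral>\<^sup>+ \<eta>. n \<eta> \<partial>lborel) * (\<integral>\<^sup>+ \<xi>. \<integral>\<^sup>+ \<eta>. (F (\<xi> - \<eta>))\<^sup>2 * n \<eta> \<partial>lborel \<partial>lborel)"
    by (simp add: nn_integral_cmult)
  also have "(\<integral>\<^sup>+ \<xi>. \<integral>\<^sup>+ \<eta>. (F (\<xi> - \<eta>))\<^sup>2 * n \<eta> \<partial>lborel \<partial>lborel) =
      (\<integral>\<^sup>+ \<eta>. \<integral>\<^sup>+ \<xi>. (F (\<xi> - \<eta>))\<^sup>2 * n \<eta> \<partial>lborel \<partial>lborel)"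
    by (rule lborel_pair.Fubini') measurable
  also have "\<dots> = (\<integral>\<^sup>+ \<eta>. (\<integral>\<^sup>+ \<xi>. (F \<xi>)\<^sup>2 \<partial>lborel) * n \<eta> \<partial>lborel)"
  proof (intro nn_integral_cong)
    fix \<eta>
    have "(\<integral>\<^sup>+ \<xi>. (F (\<xi> - \<eta>))\<^sup>2 \<partial>lborel) = (\<integral>\<^sup>+ \<xi>. (F \<xi>)\<^sup>2 \<partial>lborel)"
      by (subst (2) nn_integral_real_affine[where c=1 and t="-\<eta>"]) auto
    then show "(\<integral>\<^sup>+ \<xi>. (F (\<xi> - \<eta>))\<^sup>2 * n \<eta> \<partial>lborel) = (\<integral>\<^sup>+ \<xi>. (F \<xi>)\<^sup>2 \<partial>lborel) * n \<eta>"
      by (simp add: nn_integral_multc)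
  qed
  also have "\<dots> = (\<integral>\<^sup>+ \<xi>. (F \<xi>)\<^sup>2 \<partial>lborel) * (\<integral>\<^sup>+ \<eta>. n \<eta> \<partial>lborel)"
    by (rule nn_integral_cmult) simp
  finally show ?thesis by (simp only: power2_eq_square mult_ac)
qed

lemma nn_integral_inverse_japanese:
  assumes "l \<ge> 1"
  shows "(\<integral>\<^sup>+ \<xi>. (ennreal (japanese \<xi> powr - l))\<^sup>2 \<partial>lborel) \<le> ennreal pi"
proof -
  have "(\<integral>\<^sup>+ \<xi>. (ennreal (japanese \<xi> powr - l))\<^sup>2 \<partial>lborel) \<le> (\<integral>\<^sup>+ \<xi>. ennreal (inverse (1 + \<xi>\<^sup>2)) \<partial>lborel)"
  proof (intro nn_integral_mono)
    fix \<xi>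
    have "japanese \<xi> powr - l \<le> japanese \<xi> powr - 1"
      using assms japanese_ge_1 by (intro powr_mono) auto
    then have "(japanese \<xi> powr - l)\<^sup>2 \<le> (japanese \<xi> powr - 1)\<^sup>2" by (intro power_mono) auto
    also have "\<dots> = inverse (1 + \<xi>\<^sup>2)"
      by (simp add: powr_minus power_inverse japanese_def)
    finally show "(ennreal (japanese \<xi> powr - l))\<^sup>2 \<le> ennreal (inverse (1 + \<xi>\<^sup>2))"
      by (simp add: ennreal_power ennreal_leI)
  qed
  also have "\<dots> = ennreal pi"
  proof -
    have "set_integrable lborel (einterval (-\<infinity>) \<infinity>) (\<lambda>x::real. inverse (1 + x\<^sup>2))"
      "(LBINT x=-\<infinity>..\<infinity>. inverse (1 + x\<^sup>2)) = pi"
      by (fact integrable_inverse_1_plus_square LBINT_inverse_1_plus_square)+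
    then show ?thesis
      by (subst nn_integral_eq_integral) (auto simp: set_integrable_def interval_lebesgue_integral_def set_lebesgue_integral_def)
  qed
  finally show ?thesis .
qed

text \<open>Cauchy-Schwarz against <xi>^-l, whose square has integral at most pi for l >= 1.\<close>

lemma nn_integral_le_wsq:
  assumes [measurable]: "m \<in> borel_measurable borel" and "l \<ge> 1" "wsq l m \<le> ennreal (r\<^sup>2)" "0 \<le> r"
  shows "(\<integral>\<^sup>+ \<xi>. m \<xi> \<partial>lborel) \<le> ennreal (sqrt pi * r)"
proof (rule ennreal_le_of_power2_le)
  have "ennreal (japanese \<xi> powr - l) * (ennreal (japanese \<xi> powr l) * m \<xi>) = m \<xi>" for \<xi>
    by (simp add: mult.assoc[symmetric] ennreal_mult[symmetric] powr_add[symmetric])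
  then have "(\<integral>\<^sup>+ \<xi>. m \<xi> \<partial>lborel)\<^sup>2 =
      (\<integral>\<^sup>+ \<xi>. ennreal (japanese \<xi> powr - l) * (ennreal (japanese \<xi> powr l) * m \<xi>) \<partial>lborel)\<^sup>2"
    by simp
  also have "\<dots> \<le> (\<integral>\<^sup>+ \<xi>. (ennreal (japanese \<xi> powr - l))\<^sup>2 \<partial>lborel) * wsq l m"
    unfolding wsq_def by (rule Cauchy_Schwarz_nn_integral) auto
  also have "\<dots> \<le> ennreal pi * ennreal (r\<^sup>2)"
    using assms by (intro mult_mono nn_integral_inverse_japanese) auto
  finally show "(\<integral>\<^sup>+ \<xi>. m \<xi> \<partial>lborel)\<^sup>2 \<le> ennreal ((sqrt pi * r)\<^sup>2)"
    by (simp add: ennreal_mult[symmetric] power_mult_distrib)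
  show "0 \<le> sqrt pi * r" using assms by simp
qed

text \<open>\<open>2 powr l\<close> stems from splitting the bracket, another factor 2 from the two
  terms of the splitting, and \<open>sqrt pi\<close> from the embedding into L1.\<close>

definition bilin_const :: "real \<Rightarrow> real" where "bilin_const l = 2 powr (l + 1) * sqrt pi"

lemma bilin_const_pos: "0 < bilin_const l" by (simp add: bilin_const_def)

text \<open>To be read with \<open>a\<close>, \<open>b\<close>, \<open>c\<close> the brackets of xi
  - eta, eta and xi. The quotient is a derivative on one factor, divided by the bracket of the
  output frequency; c^(l-1) <= (a+b)^(l-1) absorbs it since l >= 1.\<close>

lemma powr_kernel_bound:
  fixes a b c l :: real
  assumes "0 < c" "c \<le> a + b" "0 < a" "0 < b" "l \<ge> 1"
  shows "c powr l * ((a + b) / c) \<le> 2 powr l * (a powr l + b powr l)"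
proof -
  have "c powr l * ((a + b) / c) = c powr (l - 1) * (a + b)"
    using assms by (simp add: powr_diff)
  also have "\<dots> \<le> (a + b) powr (l - 1) * (a + b)"
    using assms by (intro mult_right_mono powr_mono2) auto
  also have "\<dots> = (a + b) powr l"
    using assms powr_add[of "a + b" "l - 1" 1] by simp
  also have "\<dots> \<le> (2 * max a b) powr l"
    using assms by (intro powr_mono2) auto
  also have "\<dots> = 2 powr l * max a b powr l"
    by (simp add: powr_mult)
  also have "\<dots> \<le> 2 powr l * (a powr l + b powr l)"
    by (intro mult_left_mono) (auto simp: max_def)
  finally show ?thesis .
qed

definition conv_major :: "(real \<Rightarrow> ennreal) \<Rightarrow> (real \<Rightarrow> ennreal) \<Rightarrow> real \<Rightarrow> ennreal" where
  "conv_major m n \<xi> = (\<integral>\<^sup>+ \<eta>. ennreal ((japanese (\<xi> - \<eta>) + japanese \<eta>) / japanese \<xi>) * (m (\<xi> - \<eta>) * n \<eta>) \<partial>lborel)"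

lemma measurable_conv_major [measurable]:
  assumes [measurable]: "m \<in> borel_measurable borel" "n \<in> borel_measurable borel"
  shows "conv_major m n \<in> borel_measurable borel"
  unfolding conv_major_def[abs_def] by measurable

lemma japanese_le_split: "japanese \<xi> \<le> japanese (\<xi> - \<eta>) + japanese \<eta>"
  using japanese_triangle[of "\<xi> - \<eta>" \<eta>] by simp

lemma le_weight_mult:
  assumes "0 \<le> l"
  shows "c \<le> ennreal (japanese \<xi> powr l) * c"
proof -
  have "ennreal 1 \<le> ennreal (japanese \<xi> powr l)"
    using japanese_ge_1 assms by (intro ennreal_leI ge_one_powr_ge_zero) auto
  from mult_right_mono[OF this, of c] show ?thesis by simp
qed

text \<open>The power of the bracket falls on one factor at a time; that factor is kept in L2, the
  other one in L1, and Young's inequality applies. For the pointwise bound both factors are weighted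
  and Cauchy-Schwarz gives it at every frequency.\<close>

lemma conv_major_bounds:
  assumes [measurable]: "m \<in> borel_measurable borel" "n \<in> borel_measurable borel" and l: "l \<ge> 1"
    and m: "wsq l m \<le> ennreal (r\<^sup>2)" "0 \<le> r" and n: "wsq l n \<le> ennreal (s\<^sup>2)" "0 \<le> s"
  shows "wsq l (conv_major m n) \<le> ennreal ((bilin_const l * r * s)\<^sup>2)"
    and "conv_major m n \<xi> \<le> ennreal (bilin_const l * r * s)"
proof -
  define F where "F \<xi> = ennreal (japanese \<xi> powr l) * m \<xi>" for \<xi>
  define G where "G \<xi> = ennreal (japanese \<xi> powr l) * n \<xi>" for \<xi>
  have [measurable]: "F \<in> borel_measurable borel" "G \<in> borel_measurable borel"
    unfolding F_def[abs_def] G_def[abs_def] by measurable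
  define A where "A \<xi> = (\<integral>\<^sup>+ \<eta>. F (\<xi> - \<eta>) * n \<eta> \<partial>lborel)" for \<xi>
  define B where "B \<xi> = (\<integral>\<^sup>+ \<eta>. G (\<xi> - \<eta>) * m \<eta> \<partial>lborel)" for \<xi>
  have [measurable]: "A \<in> borel_measurable borel" "B \<in> borel_measurable borel"
    unfolding A_def[abs_def] B_def[abs_def] by measurable
  have B': "B \<xi> = (\<integral>\<^sup>+ \<eta>. m (\<xi> - \<eta>) * G \<eta> \<partial>lborel)" for \<xi>
    unfolding B_def by (subst (2) nn_integral_real_affine[where c="-1" and t=\<xi>]) (auto simp: mult.commute)
  have FG: "(\<integral>\<^sup>+ \<xi>. (F \<xi>)\<^sup>2 \<partial>lborel) \<le> ennreal (r\<^sup>2)" "(\<integral>\<^sup>+ \<xi>. (G \<xi>)\<^sup>2 \<partial>lborel) \<le> ennreal (s\<^sup>2)"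
    using m n by (auto simp: wsq_def F_def G_def)
  have le: "ennreal (japanese \<xi> powr l) * conv_major m n \<xi> \<le> ennreal (2 powr l) * (A \<xi> + B \<xi>)" for \<xi>
  proof -
    have "ennreal (japanese \<xi> powr l) * conv_major m n \<xi> =
      (\<integral>\<^sup>+ \<eta>. ennreal (japanese \<xi> powr l * ((japanese (\<xi> - \<eta>) + japanese \<eta>) / japanese \<xi>)) * (m (\<xi> - \<eta>) * n \<eta>) \<partial>lborel)"
      unfolding conv_major_def by (subst nn_integral_cmult[symmetric]) (auto simp: ennreal_mult mult.assoc simp del: times_divide_eq_right)
    also have "\<dots> \<le> (\<integral>\<^sup>+ \<eta>. ennreal (2 powr l * (japanese (\<xi> - \<eta>) powr l + japanese \<eta> powr l)) * (m (\<xi> - \<eta>) * n \<eta>) \<partial>lborel)"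
      by (intro nn_integral_mono mult_right_mono ennreal_leI powr_kernel_bound l japanese_le_split) auto
    also have "\<dots> = (\<integral>\<^sup>+ \<eta>. ennreal (2 powr l) * (F (\<xi> - \<eta>) * n \<eta> + m (\<xi> - \<eta>) * G \<eta>) \<partial>lborel)"
      by (intro nn_integral_cong) (simp add: F_def G_def ennreal_mult distrib_left distrib_right mult_ac)
    also have "\<dots> = ennreal (2 powr l) * (A \<xi> + B \<xi>)"
      unfolding A_def B' by (simp add: nn_integral_cmult nn_integral_add)
    finally show ?thesis .
  qed
  have A: "(\<integral>\<^sup>+ \<xi>. (A \<xi>)\<^sup>2 \<partial>lborel) \<le> ennreal ((sqrt pi * r * s)\<^sup>2)"
  proof -
    have "(\<integral>\<^sup>+ \<xi>. (A \<xi>)\<^sup>2 \<partial>lborel) \<le> (\<integral>\<^sup>+ \<eta>. n \<eta> \<partial>lborel)\<^sup>2 * (\<integral>\<^sup>+ \<xi>. (F \<xi>)\<^sup>2 \<partial>lborel)"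
      unfolding A_def by (rule young_nn_integral) auto
    also have "\<dots> \<le> (ennreal (sqrt pi * s))\<^sup>2 * ennreal (r\<^sup>2)"
      using nn_integral_le_wsq[OF _ l n] by (intro mult_mono power_mono FG) auto
    finally show ?thesis using m n by (simp add: ennreal_power ennreal_mult[symmetric] power_mult_distrib mult_ac)
  qed
  have B: "(\<integral>\<^sup>+ \<xi>. (B \<xi>)\<^sup>2 \<partial>lborel) \<le> ennreal ((sqrt pi * r * s)\<^sup>2)"
  proof -
    have "(\<integral>\<^sup>+ \<xi>. (B \<xi>)\<^sup>2 \<partial>lborel) \<le> (\<integral>\<^sup>+ \<eta>. m \<eta> \<partial>lborel)\<^sup>2 * (\<integral>\<^sup>+ \<xi>. (G \<xi>)\<^sup>2 \<partial>lborel)"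
      unfolding B_def by (rule young_nn_integral) auto
    also have "\<dots> \<le> (ennreal (sqrt pi * r))\<^sup>2 * ennreal (s\<^sup>2)"
      using nn_integral_le_wsq[OF _ l m] by (intro mult_mono power_mono FG) auto
    finally show ?thesis using m n by (simp add: ennreal_power ennreal_mult[symmetric] power_mult_distrib mult_ac)
  qed
  have "wsq l (conv_major m n) \<le> (\<integral>\<^sup>+ \<xi>. (ennreal (2 powr l) * (A \<xi> + B \<xi>))\<^sup>2 \<partial>lborel)"
    unfolding wsq_def by (intro nn_integral_mono power_mono le) auto
  also have "\<dots> = ennreal ((2 powr l)\<^sup>2) * (\<integral>\<^sup>+ \<xi>. (A \<xi> + B \<xi>)\<^sup>2 \<partial>lborel)"
    by (subst nn_integral_cmult[symmetric]) (auto simp: power_mult_distrib ennreal_power)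
  also have "\<dots> \<le> ennreal ((2 powr l)\<^sup>2) * ennreal ((sqrt pi * r * s + sqrt pi * r * s)\<^sup>2)"
    using m n by (intro mult_left_mono nn_integral_minkowski A B) auto
  also have "\<dots> = ennreal ((bilin_const l * r * s)\<^sup>2)"
    unfolding bilin_const_def ennreal_mult[symmetric, OF zero_le_power2 zero_le_power2] power_mult_distrib[symmetric]
    by (simp add: powr_add algebra_simps)
  finally show "wsq l (conv_major m n) \<le> ennreal ((bilin_const l * r * s)\<^sup>2)" .
  have mn: "m \<xi> \<le> F \<xi>" "n \<xi> \<le> G \<xi>" for \<xi>
    using l by (auto simp: F_def G_def intro!: le_weight_mult)
  have pt: "(\<integral>\<^sup>+ \<eta>. F (\<xi> - \<eta>) * G \<eta> \<partial>lborel) \<le> ennreal (r * s)"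
  proof (rule ennreal_le_of_power2_le)
    have "(\<integral>\<^sup>+ \<eta>. F (\<xi> - \<eta>) * G \<eta> \<partial>lborel)\<^sup>2 \<le> (\<integral>\<^sup>+ \<eta>. (F (\<xi> - \<eta>))\<^sup>2 \<partial>lborel) * (\<integral>\<^sup>+ \<eta>. (G \<eta>)\<^sup>2 \<partial>lborel)"
      by (rule Cauchy_Schwarz_nn_integral) auto
    also have "(\<integral>\<^sup>+ \<eta>. (F (\<xi> - \<eta>))\<^sup>2 \<partial>lborel) = (\<integral>\<^sup>+ \<eta>. (F \<eta>)\<^sup>2 \<partial>lborel)"
      by (rule nn_integral_shift_reflect[of "\<lambda>x. (F x)\<^sup>2"]) simp
    also have "\<dots> * (\<integral>\<^sup>+ \<eta>. (G \<eta>)\<^sup>2 \<partial>lborel) \<le> ennreal (r\<^sup>2) * ennreal (s\<^sup>2)"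
      by (intro mult_mono FG) auto
    finally show "(\<integral>\<^sup>+ \<eta>. F (\<xi> - \<eta>) * G \<eta> \<partial>lborel)\<^sup>2 \<le> ennreal ((r * s)\<^sup>2)"
      by (simp add: ennreal_mult[symmetric] power_mult_distrib)
  qed (use m n in simp)
  have "conv_major m n \<xi> \<le> ennreal (japanese \<xi> powr l) * conv_major m n \<xi>"
    using l by (intro le_weight_mult) simp
  also have "\<dots> \<le> ennreal (2 powr l) * (A \<xi> + B \<xi>)" by (rule le)
  also have "\<dots> \<le> ennreal (2 powr l) * (ennreal (r * s) + ennreal (r * s))"
  proof (intro mult_left_mono add_mono)
    show "A \<xi> \<le> ennreal (r * s)" unfolding A_def
      by (rule order_trans[OF nn_integral_mono pt]) (auto intro!: mult_left_mono mn)
    show "B \<xi> \<le> ennreal (r * s)" unfolding B'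
      by (rule order_trans[OF nn_integral_mono pt]) (auto intro!: mult_right_mono mn)
  qed auto
  also have "\<dots> = ennreal (2 powr l * (r * s + r * s))"
    using m n by (simp add: ennreal_mult[symmetric] ennreal_plus[symmetric] del: ennreal_plus)
  \<comment> \<open>The pointwise estimate comes without \<open>sqrt pi\<close>; as this number is
    at least 1, one constant serves both bounds.\<close>
  also have "\<dots> \<le> ennreal (bilin_const l * r * s)"
  proof (rule ennreal_leI)
    have "1 \<le> sqrt pi" using pi_gt3 by (simp add: real_le_rsqrt)
    then have "2 powr (l + 1) * 1 * (r * s) \<le> 2 powr (l + 1) * sqrt pi * (r * s)"
      using m n by (intro mult_right_mono mult_left_mono) auto
    then show "2 powr l * (r * s + r * s) \<le> bilin_const l * r * s"
      by (simp add: bilin_const_def powr_add algebra_simps)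
  qed
  finally show "conv_major m n \<xi> \<le> ennreal (bilin_const l * r * s)" .
qed

definition bil :: "(real \<Rightarrow> real \<Rightarrow> complex) \<Rightarrow> (real \<Rightarrow> complex) \<Rightarrow> (real \<Rightarrow> complex) \<Rightarrow> real \<Rightarrow> complex" where
  "bil k f h \<xi> = (LBINT \<eta>. k \<xi> \<eta> * (f (\<xi> - \<eta>) * h \<eta>))"

text \<open>One derivative may fall on either factor, provided the bracket of the output frequency
  is divided out; that bracket reappears in \<open>duh\<close>. Constants of modulus at most 1 also
  qualify, by subadditivity of the bracket.\<close>

definition bilkernel :: "(real \<Rightarrow> real \<Rightarrow> complex) \<Rightarrow> bool" where
  "bilkernel k \<longleftrightarrow> (\<lambda>p. k (fst p) (snd p)) \<in> borel_measurable borel \<and>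
     (\<forall>\<xi> \<eta>. cmod (k \<xi> \<eta>) \<le> (japanese (\<xi> - \<eta>) + japanese \<eta>) / japanese \<xi>)"

lemma kernel_measurable [measurable (raw)]:
  assumes k: "bilkernel k" and [measurable]: "f \<in> borel_measurable N" "g \<in> borel_measurable N"
  shows "(\<lambda>x. k (f x) (g x)) \<in> borel_measurable N"
proof -
  have "(\<lambda>x. (f x, g x)) \<in> measurable N borel" unfolding borel_prod[symmetric] by measurable
  from measurable_compose[OF this, of "\<lambda>p. k (fst p) (snd p)" borel] k show ?thesis
    by (simp add: bilkernel_def)
qed

lemma measurable_bil:
  assumes k: "bilkernel k" and [measurable]: "f \<in> borel_measurable borel" "h \<in> borel_measurable borel"
  shows "bil k f h \<in> borel_measurable borel"
proof -
  note [measurable] = kernel_measurable[OF k]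
  show ?thesis unfolding bil_def[abs_def] by measurable
qed

text \<open>Algebra property of exponential weights: the bracket is subadditive and its coefficient
  nonnegative, so the weight at xi is at most the product of the weights at xi - eta and
  eta.\<close>

lemma bil_integrand_le:
  assumes adm: "admissible W M T" and u: "zmajor W M T u m" and v: "zmajor W M T v n"
    and k: "bilkernel k" and t: "t \<in> {0..T}"
  shows "ennreal (exp ((W - M * t) * japanese \<xi>) * cmod (k \<xi> \<eta> * (u t (\<xi> - \<eta>) * v t \<eta>))) \<le>
    ennreal ((japanese (\<xi> - \<eta>) + japanese \<eta>) / japanese \<xi>) * (m (\<xi> - \<eta>) * n \<eta>)"
proof -
  let ?w = "W - M * t"
  have k': "cmod (k \<xi> \<eta>) \<le> (japanese (\<xi> - \<eta>) + japanese \<eta>) / japanese \<xi>"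
    using k unfolding bilkernel_def by blast
  have "M * t \<le> M * T" using adm t by (auto simp: admissible_def intro!: mult_left_mono)
  then have w: "?w \<ge> 0" using adm by (simp add: admissible_def)
  have "?w * japanese \<xi> \<le> ?w * japanese (\<xi> - \<eta>) + ?w * japanese \<eta>"
    unfolding distrib_left[symmetric] by (intro mult_left_mono japanese_le_split w)
  then have e: "exp (?w * japanese \<xi>) \<le> exp (?w * japanese (\<xi> - \<eta>)) * exp (?w * japanese \<eta>)"
    by (simp add: exp_add[symmetric])
  have "exp (?w * japanese \<xi>) * cmod (k \<xi> \<eta> * (u t (\<xi> - \<eta>) * v t \<eta>)) \<le>
    exp (?w * japanese (\<xi> - \<eta>)) * exp (?w * japanese \<eta>) *
      (((japanese (\<xi> - \<eta>) + japanese \<eta>) / japanese \<xi>) * (cmod (u t (\<xi> - \<eta>)) * cmod (v t \<eta>)))"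
    unfolding norm_mult by (intro mult_mono e mult_right_mono[OF k'] mult_nonneg_nonneg) simp_all
  also have "\<dots> = ((japanese (\<xi> - \<eta>) + japanese \<eta>) / japanese \<xi>) *
      ((exp (?w * japanese (\<xi> - \<eta>)) * cmod (u t (\<xi> - \<eta>))) * (exp (?w * japanese \<eta>) * cmod (v t \<eta>)))"
    by (simp only: mult_ac)
  finally have "ennreal (exp (?w * japanese \<xi>) * cmod (k \<xi> \<eta> * (u t (\<xi> - \<eta>) * v t \<eta>))) \<le>
      ennreal ((japanese (\<xi> - \<eta>) + japanese \<eta>) / japanese \<xi>) *
      (ennreal (exp (?w * japanese (\<xi> - \<eta>)) * cmod (u t (\<xi> - \<eta>))) * ennreal (exp (?w * japanese \<eta>) * cmod (v t \<eta>)))"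
    by (simp only: ennreal_mult[symmetric] mult_nonneg_nonneg norm_ge_zero exp_ge_zero divide_nonneg_nonneg
        add_nonneg_nonneg japanese_pos ennreal_leI)
  also have "\<dots> \<le> ennreal ((japanese (\<xi> - \<eta>) + japanese \<eta>) / japanese \<xi>) * (m (\<xi> - \<eta>) * n \<eta>)"
    using u v t unfolding zmajor_def by (intro mult_left_mono mult_mono) auto
  finally show ?thesis .
qed

lemma weight_ge_1:
  assumes "admissible W M T" "t \<in> {0..T}"
  shows "1 \<le> exp ((W - M * t) * japanese \<xi>)"
proof -
  have "M * t \<le> M * T" using assms by (auto simp: admissible_def intro!: mult_left_mono)
  then show ?thesis using assms by (simp add: admissible_def)
qed

lemma zmajor_pointwise:
  assumes "admissible W M T" "zmajor W M T u m" "t \<in> {0..T}"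
  shows "ennreal (cmod (u t \<xi>)) \<le> m \<xi>"
proof -
  have "ennreal (cmod (u t \<xi>)) \<le> ennreal (exp ((W - M * t) * japanese \<xi>) * cmod (u t \<xi>))"
    using weight_ge_1[OF assms(1,3), of \<xi>] by (intro ennreal_leI) (simp add: mult_le_cancel_right1)
  also have "\<dots> \<le> m \<xi>" using assms unfolding zmajor_def by blast
  finally show ?thesis .
qed

lemma bil_integrand_norm_le:
  assumes "admissible W M T" "zmajor W M T u m" "zmajor W M T v n" "bilkernel k" "t \<in> {0..T}"
  shows "ennreal (cmod (k \<xi> \<eta> * (u t (\<xi> - \<eta>) * v t \<eta>))) \<le>
    ennreal ((japanese (\<xi> - \<eta>) + japanese \<eta>) / japanese \<xi>) * (m (\<xi> - \<eta>) * n \<eta>)"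
proof -
  have "ennreal (cmod (k \<xi> \<eta> * (u t (\<xi> - \<eta>) * v t \<eta>))) \<le>
      ennreal (exp ((W - M * t) * japanese \<xi>) * cmod (k \<xi> \<eta> * (u t (\<xi> - \<eta>) * v t \<eta>)))"
    using weight_ge_1[OF assms(1,5), of \<xi>] by (intro ennreal_leI) (simp add: mult_le_cancel_right1)
  then show ?thesis using bil_integrand_le[OF assms] by (rule order_trans)
qed

lemma bil_integrable:
  assumes l: "l \<ge> 1" and adm: "admissible W M T" and u: "zbound l W M T r u" and v: "zbound l W M T s v"
    and k: "bilkernel k" and t: "t \<in> {0..T}"
  shows "integrable lborel (\<lambda>\<eta>. k \<xi> \<eta> * (u t (\<xi> - \<eta>) * v t \<eta>))"
proof -
  from u v obtain m n where m: "zmajor W M T u m" "wsq l m \<le> ennreal (r\<^sup>2)"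
    and n: "zmajor W M T v n" "wsq l n \<le> ennreal (s\<^sup>2)" and rs: "0 \<le> r" "0 \<le> s"
    and c: "zcarrier T u" "zcarrier T v"
    by (auto simp: zbound_def)
  have [measurable]: "m \<in> borel_measurable borel" "n \<in> borel_measurable borel"
    "u t \<in> borel_measurable borel" "v t \<in> borel_measurable borel"
    using m n c t by (auto simp: zmajor_def zcarrier_def)
  note [measurable] = kernel_measurable[OF k]
  show ?thesis
  proof (rule integrableI_bounded)
    have "(\<integral>\<^sup>+ \<eta>. ennreal (cmod (k \<xi> \<eta> * (u t (\<xi> - \<eta>) * v t \<eta>))) \<partial>lborel) \<le> conv_major m n \<xi>"
      unfolding conv_major_def by (intro nn_integral_mono bil_integrand_norm_le[OF adm m(1) n(1) k t])
    also have "\<dots> < \<infinity>"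
      using conv_major_bounds(2)[OF _ _ l m(2) rs(1) n(2) rs(2)] by (rule le_less_trans) auto
    finally show "(\<integral>\<^sup>+ \<eta>. ennreal (cmod (k \<xi> \<eta> * (u t (\<xi> - \<eta>) * v t \<eta>))) \<partial>lborel) < \<infinity>" .
  qed measurable
qed

lemma zbound_bil:
  assumes l: "l \<ge> 1" and adm: "admissible W M T" and u: "zbound l W M T r u" and v: "zbound l W M T s v"
    and k: "bilkernel k"
  shows "zbound l W M T (bilin_const l * r * s) (\<lambda>t. bil k (u t) (v t))"
    and "sbound W M T (bilin_const l * r * s) (\<lambda>t. bil k (u t) (v t))"
proof -
  from u v obtain m n where m: "zmajor W M T u m" "wsq l m \<le> ennreal (r\<^sup>2)"
    and n: "zmajor W M T v n" "wsq l n \<le> ennreal (s\<^sup>2)" and rs: "0 \<le> r" "0 \<le> s"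
    and c: "zcarrier T u" "zcarrier T v"
    by (auto simp: zbound_def)
  have mm [measurable]: "m \<in> borel_measurable borel" "n \<in> borel_measurable borel"
    using m n by (auto simp: zmajor_def)
  note [measurable] = kernel_measurable[OF k]
  note cb = conv_major_bounds[OF mm l m(2) rs(1) n(2) rs(2)]
  have major: "zmajor W M T (\<lambda>t. bil k (u t) (v t)) (conv_major m n)"
    unfolding zmajor_def
  proof (intro conjI ballI allI)
    fix t \<xi> assume t: "t \<in> {0..T}"
    let ?e = "exp ((W - M * t) * japanese \<xi>)"
    have "ennreal (?e * cmod (bil k (u t) (v t) \<xi>)) = ennreal ?e * ennreal (cmod (bil k (u t) (v t) \<xi>))"
      by (simp add: ennreal_mult)
    also have "\<dots> \<le> ennreal ?e * (\<integral>\<^sup>+ \<eta>. ennreal (cmod (k \<xi> \<eta> * (u t (\<xi> - \<eta>) * v t \<eta>))) \<partial>lborel)"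
      unfolding bil_def by (intro mult_left_mono norm_integral_le_nn_integral) simp
    also have "\<dots> = (\<integral>\<^sup>+ \<eta>. ennreal (?e * cmod (k \<xi> \<eta> * (u t (\<xi> - \<eta>) * v t \<eta>))) \<partial>lborel)"
    proof -
      have [measurable]: "u t \<in> borel_measurable borel" "v t \<in> borel_measurable borel"
        using c t by (auto simp: zcarrier_def)
      show ?thesis by (subst nn_integral_cmult[symmetric]) (auto simp: ennreal_mult)
    qed
    also have "\<dots> \<le> conv_major m n \<xi>"
      unfolding conv_major_def by (intro nn_integral_mono bil_integrand_le[OF adm m(1) n(1) k t])
    finally show "ennreal (?e * cmod (bil k (u t) (v t) \<xi>)) \<le> conv_major m n \<xi>" .
  qed simp
  have carrier: "zcarrier T (\<lambda>t. bil k (u t) (v t))"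
    unfolding zcarrier_def
  proof (intro conjI ballI allI)
    show "bil k (u t) (v t) \<in> borel_measurable borel" if "t \<in> {0..T}" for t
      using c that by (intro measurable_bil k) (auto simp: zcarrier_def)
    fix \<xi>
    \<comment> \<open>The integrand of \<open>conv_major\<close> at the fixed frequency. The
      pointwise bound makes its integral finite for every \<open>\<xi>\<close>, and it dominates all
      times at once, so dominated convergence gives continuity without exceptional
      frequencies.\<close>
    define D where "D \<eta> = ennreal ((japanese (\<xi> - \<eta>) + japanese \<eta>) / japanese \<xi>) * (m (\<xi> - \<eta>) * n \<eta>)" for \<eta>
    have [measurable]: "D \<in> borel_measurable borel" unfolding D_def[abs_def] by measurable
    have Dfin: "(\<integral>\<^sup>+ \<eta>. D \<eta> \<partial>lborel) < \<infinity>"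
      using cb(2)[of \<xi>] unfolding conv_major_def D_def[symmetric] by (rule le_less_trans) auto
    have DAE: "AE \<eta> in lborel. D \<eta> \<noteq> \<infinity>" using Dfin by (intro nn_integral_PInf_AE) auto
    have Dint: "integrable lborel (\<lambda>\<eta>. enn2real (D \<eta>))"
    proof (rule integrableI_bounded)
      have "(\<integral>\<^sup>+ \<eta>. ennreal (norm (enn2real (D \<eta>))) \<partial>lborel) = (\<integral>\<^sup>+ \<eta>. D \<eta> \<partial>lborel)"
        by (intro nn_integral_cong_AE) (use DAE in eventually_elim, simp add: less_top)
      then show "(\<integral>\<^sup>+ \<eta>. ennreal (norm (enn2real (D \<eta>))) \<partial>lborel) < \<infinity>" using Dfin by simp
    qed simp
    show "continuous_on {0..T} (\<lambda>t. bil k (u t) (v t) \<xi>)"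
      unfolding continuous_on_sequentially comp_def
    proof (intro allI ballI impI, elim conjE)
      fix x :: "nat \<Rightarrow> real" and a assume a: "a \<in> {0..T}" and x: "\<forall>n. x n \<in> {0..T}" and lim: "x \<longlonglongrightarrow> a"
      have [measurable]: "u (x n) \<in> borel_measurable borel" "v (x n) \<in> borel_measurable borel"
        "u a \<in> borel_measurable borel" "v a \<in> borel_measurable borel" for n
        using c x a by (auto simp: zcarrier_def)
      show "(\<lambda>n. bil k (u (x n)) (v (x n)) \<xi>) \<longlonglongrightarrow> bil k (u a) (v a) \<xi>"
        unfolding bil_def
      proof (rule integral_dominated_convergence[where w="\<lambda>\<eta>. enn2real (D \<eta>)"])
        have "continuous_on {0..T} (\<lambda>t. u t \<zeta>)" "continuous_on {0..T} (\<lambda>t. v t \<zeta>)" for \<zeta>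
          using c by (auto simp: zcarrier_def)
        then have "(\<lambda>n. u (x n) \<zeta>) \<longlonglongrightarrow> u a \<zeta>" "(\<lambda>n. v (x n) \<zeta>) \<longlonglongrightarrow> v a \<zeta>" for \<zeta>
          using a x lim unfolding continuous_on_sequentially comp_def by blast+
        then show "AE \<eta> in lborel. (\<lambda>n. k \<xi> \<eta> * (u (x n) (\<xi> - \<eta>) * v (x n) \<eta>)) \<longlonglongrightarrow> k \<xi> \<eta> * (u a (\<xi> - \<eta>) * v a \<eta>)"
          by (intro AE_I2 tendsto_intros)
        show "AE \<eta> in lborel. cmod (k \<xi> \<eta> * (u (x n) (\<xi> - \<eta>) * v (x n) \<eta>)) \<le> enn2real (D \<eta>)" for n
          using DAE
        proof eventually_elim
          case (elim \<eta>)
          have "ennreal (cmod (k \<xi> \<eta> * (u (x n) (\<xi> - \<eta>) * v (x n) \<eta>))) \<le> D \<eta>"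
            unfolding D_def using x by (intro bil_integrand_norm_le[OF adm m(1) n(1) k]) auto
          from enn2real_mono[OF this] elim show ?case by (simp add: less_top)
        qed
        show "(\<lambda>\<eta>. k \<xi> \<eta> * (u a (\<xi> - \<eta>) * v a \<eta>)) \<in> borel_measurable lborel" by measurable
        show "(\<lambda>\<eta>. k \<xi> \<eta> * (u (x n) (\<xi> - \<eta>) * v (x n) \<eta>)) \<in> borel_measurable lborel" for n
          by measurable
      qed (rule Dint)
    qed
  qed
  show "zbound l W M T (bilin_const l * r * s) (\<lambda>t. bil k (u t) (v t))"
    using bilin_const_pos[of l] rs by (intro zboundI[OF _ carrier major] cb) auto
  show "sbound W M T (bilin_const l * r * s) (\<lambda>t. bil k (u t) (v t))"
    unfolding sbound_def
  proof (intro ballI allI)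
    fix t \<xi> assume t: "t \<in> {0..T}"
    have "ennreal (exp ((W - M * t) * japanese \<xi>) * cmod (bil k (u t) (v t) \<xi>)) \<le> ennreal (bilin_const l * r * s)"
      using major t unfolding zmajor_def by (intro order_trans[OF _ cb(2)[of \<xi>]]) blast
    then show "exp ((W - M * t) * japanese \<xi>) * cmod (bil k (u t) (v t) \<xi>) \<le> bilin_const l * r * s"
      using bilin_const_pos[of l] rs by (subst (asm) ennreal_le_iff) auto
  qed
qed

text \<open>Boundedness and Lipschitz continuity on balls of radius \<open>R\<close>, with one
  constant for all admissible weights and intervals. The flag \<open>st\<close> adds the uniform
  bound for differences: convolutions provide it, whereas it is not claimed for projections.\<close>

definition lipL :: "bool \<Rightarrow> real \<Rightarrow> real \<Rightarrow> real \<Rightarrow> (('i \<Rightarrow> real \<Rightarrow> complex) \<Rightarrow> real \<Rightarrow> complex) \<Rightarrow> bool" where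
  "lipL st l R L N \<longleftrightarrow> 0 \<le> L \<and> (\<forall>W M T U U' d. admissible W M T \<longrightarrow>
     (\<forall>i. zbound l W M T R (U i)) \<longrightarrow> (\<forall>i. zbound l W M T R (U' i)) \<longrightarrow>
     (\<forall>i. zbound l W M T d (\<lambda>t \<xi>. U i t \<xi> - U' i t \<xi>)) \<longrightarrow>
     zbound l W M T L (\<lambda>t. N (\<lambda>i. U i t)) \<and>
     zbound l W M T (L * d) (\<lambda>t \<xi>. N (\<lambda>i. U i t) \<xi> - N (\<lambda>i. U' i t) \<xi>) \<and>
     (st \<longrightarrow> sbound W M T (L * d) (\<lambda>t \<xi>. N (\<lambda>i. U i t) \<xi> - N (\<lambda>i. U' i t) \<xi>)))"

definition lip :: "bool \<Rightarrow> real \<Rightarrow> (('i \<Rightarrow> real \<Rightarrow> complex) \<Rightarrow> real \<Rightarrow> complex) \<Rightarrow> bool" where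
  "lip st l N \<longleftrightarrow> (\<forall>R\<ge>0. \<exists>L. lipL st l R L N)"

lemma lipLD:
  assumes "lipL st l R L N" "admissible W M T"
    "\<And>i. zbound l W M T R (U i)" "\<And>i. zbound l W M T R (U' i)"
    "\<And>i. zbound l W M T d (\<lambda>t \<xi>. U i t \<xi> - U' i t \<xi>)"
  shows "zbound l W M T L (\<lambda>t. N (\<lambda>i. U i t))"
    "zbound l W M T (L * d) (\<lambda>t \<xi>. N (\<lambda>i. U i t) \<xi> - N (\<lambda>i. U' i t) \<xi>)"
    "st \<Longrightarrow> sbound W M T (L * d) (\<lambda>t \<xi>. N (\<lambda>i. U i t) \<xi> - N (\<lambda>i. U' i t) \<xi>)"
    "0 \<le> L"
  using assms unfolding lipL_def by blast+

lemma zbound_nonneg: "zbound l W M T r u \<Longrightarrow> 0 \<le> r"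
  by (simp add: zbound_def)

lemma zbound_cong:
  assumes "\<And>t. t \<in> {0..T} \<Longrightarrow> f t = g t"
  shows "zbound l W M T r f \<longleftrightarrow> zbound l W M T r g"
proof -
  have "continuous_on {0..T} (\<lambda>t. f t \<xi>) \<longleftrightarrow> continuous_on {0..T} (\<lambda>t. g t \<xi>)" for \<xi>
    by (rule continuous_on_cong) (use assms in auto)
  then show ?thesis
    unfolding zbound_def zcarrier_def zmajor_def using assms by simp
qed

lemma lip_weaken: "lip True l N \<Longrightarrow> lip st l N"
  unfolding lip_def lipL_def by meson

lemma lip_proj: "lip False l (\<lambda>u. u (i :: 'i))"
  unfolding lip_def
proof (intro allI impI exI)
  fix R :: real assume R: "R \<ge> 0"
  show "lipL False l R (max R 1) (\<lambda>u. u i)"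
    unfolding lipL_def
  proof (intro conjI allI impI)
    fix W M T d and U U' :: "'i \<Rightarrow> real \<Rightarrow> real \<Rightarrow> complex"
    assume U: "\<forall>i. zbound l W M T R (U i)" and d: "\<forall>i. zbound l W M T d (\<lambda>t \<xi>. U i t \<xi> - U' i t \<xi>)"
    show "zbound l W M T (max R 1) (\<lambda>t. U i t)" using U by (auto intro: zbound_mono)
    have "d \<ge> 0" using zbound_nonneg d by blast
    then have "d \<le> max R 1 * d" using mult_right_mono[of 1 "max R 1" d] by simp
    then show "zbound l W M T (max R 1 * d) (\<lambda>t \<xi>. U i t \<xi> - U' i t \<xi>)" using d by (auto intro: zbound_mono)
  qed auto
qed

lemma lip_add:
  fixes N1 N2 :: "('i \<Rightarrow> real \<Rightarrow> complex) \<Rightarrow> real \<Rightarrow> complex"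
  assumes "lip st l N1" "lip st l N2"
  shows "lip st l (\<lambda>u \<xi>. N1 u \<xi> + N2 u \<xi>)"
  unfolding lip_def
proof (intro allI impI)
  fix R :: real assume R: "R \<ge> 0"
  obtain L1 L2 where L: "lipL st l R L1 N1" "lipL st l R L2 N2"
    using assms R unfolding lip_def by blast
  have "lipL st l R (L1 + L2) (\<lambda>u \<xi>. N1 u \<xi> + N2 u \<xi>)"
    unfolding lipL_def
  proof (intro conjI allI impI)
    show "0 \<le> L1 + L2" using L by (simp add: lipL_def)
    fix W M T d and U U' :: "'i \<Rightarrow> real \<Rightarrow> real \<Rightarrow> complex"
    assume a: "admissible W M T" "\<forall>i. zbound l W M T R (U i)" "\<forall>i. zbound l W M T R (U' i)"
      "\<forall>i. zbound l W M T d (\<lambda>t \<xi>. U i t \<xi> - U' i t \<xi>)"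
    note 1 = lipLD[OF L(1) a(1) a(2)[rule_format] a(3)[rule_format] a(4)[rule_format]]
      and 2 = lipLD[OF L(2) a(1) a(2)[rule_format] a(3)[rule_format] a(4)[rule_format]]
    show "zbound l W M T (L1 + L2) (\<lambda>t \<xi>. N1 (\<lambda>i. U i t) \<xi> + N2 (\<lambda>i. U i t) \<xi>)"
      by (rule zbound_add[OF 1(1) 2(1)])
    show "zbound l W M T ((L1 + L2) * d) (\<lambda>t \<xi>. N1 (\<lambda>i. U i t) \<xi> + N2 (\<lambda>i. U i t) \<xi> - (N1 (\<lambda>i. U' i t) \<xi> + N2 (\<lambda>i. U' i t) \<xi>))"
      using zbound_add[OF 1(2) 2(2)] by (simp add: algebra_simps)
    show "sbound W M T ((L1 + L2) * d) (\<lambda>t \<xi>. N1 (\<lambda>i. U i t) \<xi> + N2 (\<lambda>i. U i t) \<xi> - (N1 (\<lambda>i. U' i t) \<xi> + N2 (\<lambda>i. U' i t) \<xi>))" if st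
      using sbound_add[OF 1(3) 2(3)] that by (simp add: algebra_simps)
  qed
  then show "\<exists>L. lipL st l R L (\<lambda>u \<xi>. N1 u \<xi> + N2 u \<xi>)" by blast
qed

lemma lip_mult:
  fixes N :: "('i \<Rightarrow> real \<Rightarrow> complex) \<Rightarrow> real \<Rightarrow> complex"
  assumes "lip st l N" and [measurable]: "c \<in> borel_measurable borel" and c: "\<And>\<xi>. cmod (c \<xi>) \<le> C"
  shows "lip st l (\<lambda>u \<xi>. c \<xi> * N u \<xi>)"
  unfolding lip_def
proof (intro allI impI)
  fix R :: real assume R: "R \<ge> 0"
  obtain L where L: "lipL st l R L N" using assms R unfolding lip_def by blast
  have C: "0 \<le> C" using order_trans[OF norm_ge_zero c] .
  have "lipL st l R (C * L) (\<lambda>u \<xi>. c \<xi> * N u \<xi>)"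
    unfolding lipL_def
  proof (intro conjI allI impI)
    show "0 \<le> C * L" using L C by (simp add: lipL_def)
    fix W M T d and U U' :: "'i \<Rightarrow> real \<Rightarrow> real \<Rightarrow> complex"
    assume a: "admissible W M T" "\<forall>i. zbound l W M T R (U i)" "\<forall>i. zbound l W M T R (U' i)"
      "\<forall>i. zbound l W M T d (\<lambda>t \<xi>. U i t \<xi> - U' i t \<xi>)"
    note 1 = lipLD[OF L(1) a(1) a(2)[rule_format] a(3)[rule_format] a(4)[rule_format]]
    show "zbound l W M T (C * L) (\<lambda>t \<xi>. c \<xi> * N (\<lambda>i. U i t) \<xi>)"
      by (rule zbound_mult[OF 1(1) _ c]) simp
    show "zbound l W M T (C * L * d) (\<lambda>t \<xi>. c \<xi> * N (\<lambda>i. U i t) \<xi> - c \<xi> * N (\<lambda>i. U' i t) \<xi>)"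
      using zbound_mult[OF 1(2) _ c] by (simp add: right_diff_distrib mult.assoc)
    show "sbound W M T (C * L * d) (\<lambda>t \<xi>. c \<xi> * N (\<lambda>i. U i t) \<xi> - c \<xi> * N (\<lambda>i. U' i t) \<xi>)" if st
      using sbound_mult[OF 1(3)[OF that] c] by (simp add: right_diff_distrib mult.assoc)
  qed
  then show "\<exists>L. lipL st l R L (\<lambda>u \<xi>. c \<xi> * N u \<xi>)" by blast
qed

lemma lip_til:
  fixes N :: "('i \<Rightarrow> real \<Rightarrow> complex) \<Rightarrow> real \<Rightarrow> complex"
  assumes "lip st l N"
  shows "lip st l (\<lambda>u. til (N u))"
  unfolding lip_def
proof (intro allI impI)
  fix R :: real assume R: "R \<ge> 0"
  obtain L where L: "lipL st l R L N" using assms R unfolding lip_def by blast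
  have "lipL st l R L (\<lambda>u. til (N u))"
    unfolding lipL_def
  proof (intro conjI allI impI)
    show "0 \<le> L" using L by (simp add: lipL_def)
    fix W M T d and U U' :: "'i \<Rightarrow> real \<Rightarrow> real \<Rightarrow> complex"
    assume a: "admissible W M T" "\<forall>i. zbound l W M T R (U i)" "\<forall>i. zbound l W M T R (U' i)"
      "\<forall>i. zbound l W M T d (\<lambda>t \<xi>. U i t \<xi> - U' i t \<xi>)"
    note 1 = lipLD[OF L(1) a(1) a(2)[rule_format] a(3)[rule_format] a(4)[rule_format]]
    show "zbound l W M T L (\<lambda>t. til (N (\<lambda>i. U i t)))" by (rule zbound_til[OF 1(1)])
    have eq: "(\<lambda>t \<xi>. til (N (\<lambda>i. U i t)) \<xi> - til (N (\<lambda>i. U' i t)) \<xi>) =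
        (\<lambda>t. til (\<lambda>\<xi>. N (\<lambda>i. U i t) \<xi> - N (\<lambda>i. U' i t) \<xi>))"
      by (simp add: til_def fun_eq_iff)
    show "zbound l W M T (L * d) (\<lambda>t \<xi>. til (N (\<lambda>i. U i t)) \<xi> - til (N (\<lambda>i. U' i t)) \<xi>)"
      unfolding eq by (rule zbound_til[OF 1(2)])
    show "sbound W M T (L * d) (\<lambda>t \<xi>. til (N (\<lambda>i. U i t)) \<xi> - til (N (\<lambda>i. U' i t)) \<xi>)" if st
      unfolding eq by (rule sbound_til[OF 1(3)[OF that]])
  qed
  then show "\<exists>L. lipL st l R L (\<lambda>u. til (N u))" by blast
qed

text \<open>A difference of products is split as (N1 - N1') N2 + N1' (N2 - N2'). Convolution of two
  weighted L2 functions is bounded at every frequency, so the product has the strong form although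
  its factors are only assumed to have the weak one.\<close>

lemma lip_bil:
  fixes N1 N2 :: "('i \<Rightarrow> real \<Rightarrow> complex) \<Rightarrow> real \<Rightarrow> complex"
  assumes l: "l \<ge> 1" and k: "bilkernel k" and N: "lip False l N1" "lip False l N2"
  shows "lip True l (\<lambda>u. bil k (N1 u) (N2 u))"
  unfolding lip_def
proof (intro allI impI)
  fix R :: real assume R: "R \<ge> 0"
  obtain L1 L2 where L: "lipL False l R L1 N1" "lipL False l R L2 N2"
    using N R unfolding lip_def by blast
  let ?L = "bilin_const l * L1 * L2 + bilin_const l * L1 * L2"
  have L0: "0 \<le> L1" "0 \<le> L2" using L by (auto simp: lipL_def)
  have "lipL True l R ?L (\<lambda>u. bil k (N1 u) (N2 u))"
    unfolding lipL_def
  proof (intro conjI allI impI)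
    show "0 \<le> ?L" using L0 bilin_const_pos[of l] by simp
    fix W M T d and U U' :: "'i \<Rightarrow> real \<Rightarrow> real \<Rightarrow> complex"
    assume a: "admissible W M T" "\<forall>i. zbound l W M T R (U i)" "\<forall>i. zbound l W M T R (U' i)"
      "\<forall>i. zbound l W M T d (\<lambda>t \<xi>. U i t \<xi> - U' i t \<xi>)"
    note 1 = lipLD[OF L(1) a(1) a(2)[rule_format] a(3)[rule_format] a(4)[rule_format]]
      and 2 = lipLD[OF L(2) a(1) a(2)[rule_format] a(3)[rule_format] a(4)[rule_format]]
    have d': "zbound l W M T d (\<lambda>t \<xi>. U' i t \<xi> - U i t \<xi>)" for i
      using zbound_uminus[OF a(4)[rule_format, of i]] by simp
    note P = lipLD[OF L(1) a(1) a(3)[rule_format] a(2)[rule_format] d']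
    show "zbound l W M T ?L (\<lambda>t. bil k (N1 (\<lambda>i. U i t)) (N2 (\<lambda>i. U i t)))"
      using L0 bilin_const_pos[of l] by (intro zbound_mono[OF zbound_bil(1)[OF l a(1) 1(1) 2(1) k]]) auto
    let ?D1 = "\<lambda>t \<xi>. N1 (\<lambda>i. U i t) \<xi> - N1 (\<lambda>i. U' i t) \<xi>"
    let ?D2 = "\<lambda>t \<xi>. N2 (\<lambda>i. U i t) \<xi> - N2 (\<lambda>i. U' i t) \<xi>"
    have eq: "bil k (N1 (\<lambda>i. U i t)) (N2 (\<lambda>i. U i t)) \<xi> - bil k (N1 (\<lambda>i. U' i t)) (N2 (\<lambda>i. U' i t)) \<xi> =
        bil k (?D1 t) (N2 (\<lambda>i. U i t)) \<xi> + bil k (N1 (\<lambda>i. U' i t)) (?D2 t) \<xi>" if t: "t \<in> {0..T}" for t \<xi>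
    proof -
      note i1 = bil_integrable[OF l a(1) 1(1) 2(1) k t, of \<xi>]
      have Q: "zbound l W M T L2 (\<lambda>t. N2 (\<lambda>i. U' i t))"
        using lipLD(1)[OF L(2) a(1) a(3)[rule_format] a(2)[rule_format] d'] .
      note i2 = bil_integrable[OF l a(1) P(1) 2(1) k t, of \<xi>]
      note i3 = bil_integrable[OF l a(1) P(1) Q k t, of \<xi>]
      have "bil k (?D1 t) (N2 (\<lambda>i. U i t)) \<xi> =
          bil k (N1 (\<lambda>i. U i t)) (N2 (\<lambda>i. U i t)) \<xi> - bil k (N1 (\<lambda>i. U' i t)) (N2 (\<lambda>i. U i t)) \<xi>"
        unfolding bil_def by (subst Bochner_Integration.integral_diff[OF i1 i2, symmetric]) (simp add: algebra_simps)
      moreover have "bil k (N1 (\<lambda>i. U' i t)) (?D2 t) \<xi> =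
          bil k (N1 (\<lambda>i. U' i t)) (N2 (\<lambda>i. U i t)) \<xi> - bil k (N1 (\<lambda>i. U' i t)) (N2 (\<lambda>i. U' i t)) \<xi>"
        unfolding bil_def by (subst Bochner_Integration.integral_diff[OF i2 i3, symmetric]) (simp add: algebra_simps)
      ultimately show ?thesis by simp
    qed
    have "zbound l W M T (bilin_const l * (L1 * d) * L2 + bilin_const l * L1 * (L2 * d))
        (\<lambda>t \<xi>. bil k (?D1 t) (N2 (\<lambda>i. U i t)) \<xi> + bil k (N1 (\<lambda>i. U' i t)) (?D2 t) \<xi>)"
      by (intro zbound_add zbound_bil(1)[OF l a(1) _ _ k] 1 2 P)
    then show "zbound l W M T (?L * d) (\<lambda>t \<xi>. bil k (N1 (\<lambda>i. U i t)) (N2 (\<lambda>i. U i t)) \<xi> -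
        bil k (N1 (\<lambda>i. U' i t)) (N2 (\<lambda>i. U' i t)) \<xi>)"
      by (subst zbound_cong[where g="\<lambda>t \<xi>. bil k (?D1 t) (N2 (\<lambda>i. U i t)) \<xi> + bil k (N1 (\<lambda>i. U' i t)) (?D2 t) \<xi>"])
        (auto simp: eq algebra_simps)
    have "sbound W M T (bilin_const l * (L1 * d) * L2 + bilin_const l * L1 * (L2 * d))
        (\<lambda>t \<xi>. bil k (?D1 t) (N2 (\<lambda>i. U i t)) \<xi> + bil k (N1 (\<lambda>i. U' i t)) (?D2 t) \<xi>)"
      by (intro sbound_add zbound_bil(2)[OF l a(1) _ _ k] 1 2 P)
    then show "sbound W M T (?L * d) (\<lambda>t \<xi>. bil k (N1 (\<lambda>i. U i t)) (N2 (\<lambda>i. U i t)) \<xi> -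
        bil k (N1 (\<lambda>i. U' i t)) (N2 (\<lambda>i. U' i t)) \<xi>)"
      unfolding sbound_def by (auto simp: eq algebra_simps)
  qed
  then show "\<exists>L. lipL True l R L (\<lambda>u. bil k (N1 u) (N2 u))" by blast
qed

text \<open>Projection of the time axis onto [0, T], used to obtain functions measurable for all
  real times.\<close>

definition clip :: "real \<Rightarrow> real \<Rightarrow> real" where "clip T s = max 0 (min T s)"

lemma clip_in: "0 \<le> T \<Longrightarrow> clip T s \<in> {0..T}" by (simp add: clip_def)

lemma clip_id: "s \<in> {0..T} \<Longrightarrow> clip T s = s" by (simp add: clip_def)

text \<open>Continuity in time allows the time to be replaced by a grid point; each approximation is
  then composed of countably many functions measurable in frequency.\<close>

lemma measurable_caratheodory:
  fixes u :: "real \<Rightarrow> real \<Rightarrow> complex"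
  assumes T: "0 \<le> T" and u: "zcarrier T u"
    and [measurable]: "f \<in> borel_measurable N" "g \<in> borel_measurable N"
  shows "(\<lambda>x. u (clip T (f x)) (g x)) \<in> borel_measurable N"
proof -
  define r where "r n x = real_of_int \<lfloor>f x * real (Suc n)\<rfloor> / real (Suc n)" for n x
  have u_meas [measurable]: "u (clip T s) \<in> borel_measurable borel" for s
    using u clip_in[OF T] by (auto simp: zcarrier_def)
  have "(\<lambda>x. u (clip T (r n x)) (g x)) \<in> borel_measurable N" for n
  proof -
    have "(\<lambda>x. (\<lambda>i x. u (clip T (real_of_int i / real (Suc n))) (g x)) \<lfloor>f x * real (Suc n)\<rfloor> x) \<in> borel_measurable N"
      by (rule measurable_compose_countable) measurable
    then show ?thesis by (simp add: r_def)
  qed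
  moreover have "(\<lambda>n. u (clip T (r n x)) (g x)) \<longlonglongrightarrow> u (clip T (f x)) (g x)" for x
  proof -
    have "(\<lambda>n. r n x) \<longlonglongrightarrow> f x"
    proof (rule LIMSEQ_I)
      fix e :: real assume "e > 0"
      then obtain N where N: "inverse (real (Suc N)) < e" using reals_Archimedean by blast
      have "\<bar>r n x - f x\<bar> < e" if "n \<ge> N" for n
      proof -
        have "\<bar>r n x - f x\<bar> \<le> inverse (real (Suc n))"
        proof -
          have "\<bar>real_of_int \<lfloor>f x * real (Suc n)\<rfloor> - f x * real (Suc n)\<bar> \<le> 1" by linarith
          moreover have "r n x - f x = (real_of_int \<lfloor>f x * real (Suc n)\<rfloor> - f x * real (Suc n)) / real (Suc n)"
            by (simp add: r_def field_simps)
          ultimately show ?thesis by (simp add: abs_divide inverse_eq_divide divide_right_mono)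
        qed
        also have "\<dots> \<le> inverse (real (Suc N))" using that by (simp add: le_imp_inverse_le)
        finally show ?thesis using N by simp
      qed
      then show "\<exists>N. \<forall>n\<ge>N. norm (r n x - f x) < e" by auto
    qed
    then have lim: "(\<lambda>n. clip T (r n x)) \<longlonglongrightarrow> clip T (f x)"
      unfolding clip_def by (intro tendsto_intros)
    have c: "continuous_on {0..T} (\<lambda>t. u t (g x))" using u by (simp add: zcarrier_def)
    have "\<forall>\<^sub>F n in sequentially. clip T (r n x) \<in> {0..T}"
      by (rule always_eventually) (rule allI, rule clip_in[OF T])
    from continuous_on_tendsto_compose[OF c lim clip_in[OF T] this] show ?thesis .
  qed
  ultimately show ?thesis by (rule borel_measurable_LIMSEQ_metric)
qed

lemma continuous_on_set_integrable:
  fixes f :: "real \<Rightarrow> complex"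
  assumes "continuous_on {a..b} f"
  shows "set_integrable lborel {a..b} f"
  using borel_integrable_compact[OF compact_Icc assms] by (simp add: set_integrable_def)

lemma integral_eq_LBINT:
  fixes f :: "real \<Rightarrow> complex"
  assumes "continuous_on {a..b} f"
  shows "integral {a..b} f = (LBINT s:{a..b}. f s)"
  using set_borel_integral_eq_integral(2)[OF continuous_on_set_integrable[OF assms]] by simp

lemma measurable_integral_zcarrier:
  assumes T: "0 \<le> T" and u: "zcarrier T u" and t: "t \<in> {0..T}"
  shows "(\<lambda>\<xi>. integral {0..t} (\<lambda>s. u s \<xi>)) \<in> borel_measurable borel"
proof -
  have sub: "{0..t} \<subseteq> {0..T}" using t by auto
  have c: "continuous_on {0..t} (\<lambda>s. u s \<xi>)" for \<xi>
    using u by (intro continuous_on_subset[OF _ sub]) (simp add: zcarrier_def)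
  have "integral {0..t} (\<lambda>s. u s \<xi>) = (LBINT s:{0..t}. u (clip T s) \<xi>)" for \<xi>
    unfolding integral_eq_LBINT[OF c]
    by (rule set_lebesgue_integral_cong) (use sub in \<open>auto simp: clip_def\<close>)
  moreover note [measurable] = measurable_caratheodory[OF T u]
  ultimately show ?thesis unfolding set_lebesgue_integral_def by simp
qed

text \<open>The bracket in front is common to both equations: for the phase it comes from the choice
  of the unknown, for the amplitude from the derivative in the nonlinear terms, which is divided by
  it.\<close>

definition duh :: "(real \<Rightarrow> real) \<Rightarrow> (real \<Rightarrow> real \<Rightarrow> complex) \<Rightarrow> real \<Rightarrow> real \<Rightarrow> complex" where
  "duh \<theta> S t \<xi> = complex_of_real (japanese \<xi>) * (exp (- (\<i> * complex_of_real (\<theta> \<xi> * t))) *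
     integral {0..t} (\<lambda>s. exp (\<i> * complex_of_real (\<theta> \<xi> * s)) * S s \<xi>))"

lemma zcarrier_phase:
  assumes [measurable]: "\<theta> \<in> borel_measurable borel" and S: "zcarrier T S"
  shows "zcarrier T (\<lambda>s \<xi>. exp (\<i> * complex_of_real (\<theta> \<xi> * s)) * S s \<xi>)"
  unfolding zcarrier_def
proof (intro conjI ballI allI)
  fix t assume "t \<in> {0..T}"
  then have [measurable]: "S t \<in> borel_measurable borel" using S by (simp add: zcarrier_def)
  show "(\<lambda>\<xi>. exp (\<i> * complex_of_real (\<theta> \<xi> * t)) * S t \<xi>) \<in> borel_measurable borel" by measurable
next
  fix \<xi>
  have "continuous_on {0..T} (\<lambda>s. S s \<xi>)" using S by (simp add: zcarrier_def)
  then show "continuous_on {0..T} (\<lambda>s. exp (\<i> * complex_of_real (\<theta> \<xi> * s)) * S s \<xi>)"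
    by (intro continuous_intros)
qed

lemma zcarrier_duh:
  assumes [measurable]: "\<theta> \<in> borel_measurable borel" and T: "0 \<le> T" and S: "zcarrier T S"
  shows "zcarrier T (duh \<theta> S)"
  unfolding zcarrier_def
proof (intro conjI ballI allI)
  note P = zcarrier_phase[OF assms(1) S]
  fix t assume "t \<in> {0..T}"
  from measurable_integral_zcarrier[OF T P this]
  show "duh \<theta> S t \<in> borel_measurable borel" unfolding duh_def[abs_def] by measurable
next
  note P = zcarrier_phase[OF assms(1) S]
  fix \<xi>
  have "continuous_on {0..T} (\<lambda>t. integral {0..t} (\<lambda>s. exp (\<i> * complex_of_real (\<theta> \<xi> * s)) * S s \<xi>))"
    using P by (intro indefinite_integral_continuous_1 integrable_continuous_interval) (simp add: zcarrier_def)
  then show "continuous_on {0..T} (\<lambda>t. duh \<theta> S t \<xi>)"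
    unfolding duh_def by (intro continuous_intros)
qed

text \<open>The full derivative lost in the nonlinearity is regained here because the supremum in time
  is taken at fixed frequency: the decay rate $M\langle\xi\rangle$ of the weight integrates to
  $1/(M\langle\xi\rangle)$.\<close>

lemma duh_pointwise:
  assumes M: "M > 0" and t: "t \<in> {0..T}" and c: "continuous_on {0..T} (\<lambda>s. S s \<xi>)"
    and B: "\<And>s. s \<in> {0..T} \<Longrightarrow> exp ((W - M * s) * japanese \<xi>) * cmod (S s \<xi>) \<le> B"
  shows "exp ((W - M * t) * japanese \<xi>) * cmod (duh \<theta> S t \<xi>) \<le> B / M"
proof -
  let ?J = "japanese \<xi>"
  have sub: "{0..t} \<subseteq> {0..T}" using t by auto
  have B0: "0 \<le> B" using order_trans[OF _ B[OF t]] by simp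
  \<comment> \<open>A majorant of the integrand with an explicit primitive, which carries the factor
    1/(M<xi>). Its contribution at time 0 has a favourable sign and is dropped.\<close>
  define g where "g s = B * exp (- ((W - M * s) * ?J))" for s
  have "((\<lambda>s. B * exp (- ((W - M * s) * ?J)) / (M * ?J)) has_vector_derivative g s) (at s within {0..t})" for s
    unfolding has_real_derivative_iff_has_vector_derivative[symmetric] g_def
    using M by (auto intro!: derivative_eq_intros)
  then have gi: "(g has_integral (B * exp (- ((W - M * t) * ?J)) / (M * ?J) - B * exp (- ((W - M * 0) * ?J)) / (M * ?J))) {0..t}"
    using t by (intro fundamental_theorem_of_calculus) auto
  have "cmod (integral {0..t} (\<lambda>s. exp (\<i> * complex_of_real (\<theta> \<xi> * s)) * S s \<xi>)) \<le> integral {0..t} g"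
  proof (rule integral_norm_bound_integral)
    show "(\<lambda>s. exp (\<i> * complex_of_real (\<theta> \<xi> * s)) * S s \<xi>) integrable_on {0..t}"
      by (intro integrable_continuous_interval continuous_intros continuous_on_subset[OF c sub])
    show "g integrable_on {0..t}" using gi by blast
    fix s assume "s \<in> {0..t}"
    then have "s \<in> {0..T}" using sub by auto
    from B[OF this] have "cmod (S s \<xi>) \<le> B / exp ((W - M * s) * ?J)"
      by (simp add: field_simps)
    then show "cmod (exp (\<i> * complex_of_real (\<theta> \<xi> * s)) * S s \<xi>) \<le> g s"
      unfolding g_def norm_mult by (simp add: exp_minus divide_inverse)
  qed
  also have "\<dots> \<le> B * exp (- ((W - M * t) * ?J)) / (M * ?J)"
    unfolding integral_unique[OF gi] using M B0 by simp
  finally have "?J * cmod (integral {0..t} (\<lambda>s. exp (\<i> * complex_of_real (\<theta> \<xi> * s)) * S s \<xi>)) \<le>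
      ?J * (B * exp (- ((W - M * t) * ?J)) / (M * ?J))"
    by (rule mult_left_mono) simp
  also have "\<dots> = exp (- ((W - M * t) * ?J)) * (B / M)" by simp
  finally have "cmod (duh \<theta> S t \<xi>) \<le> exp (- ((W - M * t) * ?J)) * (B / M)"
    unfolding duh_def norm_mult by simp
  then have "exp ((W - M * t) * ?J) * cmod (duh \<theta> S t \<xi>) \<le>
      exp ((W - M * t) * ?J) * (exp (- ((W - M * t) * ?J)) * (B / M))"
    by (rule mult_left_mono) simp
  then show ?thesis unfolding mult.assoc[symmetric] mult_exp_exp by simp
qed

lemma sbound_duh:
  assumes "M > 0" "zcarrier T S" "sbound W M T r S"
  shows "sbound W M T (r / M) (duh \<theta> S)"
  using assms unfolding sbound_def zcarrier_def by (blast intro: duh_pointwise)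

lemma zbound_duh:
  assumes M: "M > 0" and T: "0 \<le> T" and \<theta>: "\<theta> \<in> borel_measurable borel" and S: "zbound l W M T r S"
  shows "zbound l W M T (r / M) (duh \<theta> S)"
proof -
  from S obtain m where m: "zmajor W M T S m" "wsq l m \<le> ennreal (r\<^sup>2)" "0 \<le> r" and c: "zcarrier T S"
    by (auto simp: zbound_def)
  have "zmajor W M T (duh \<theta> S) (\<lambda>\<xi>. ennreal (1 / M) * m \<xi>)"
    unfolding zmajor_def
  proof (intro conjI ballI allI)
    have [measurable]: "m \<in> borel_measurable borel" using m by (simp add: zmajor_def)
    show "(\<lambda>\<xi>. ennreal (1 / M) * m \<xi>) \<in> borel_measurable borel" by measurable
    fix t \<xi> assume t: "t \<in> {0..T}"
    show "ennreal (exp ((W - M * t) * japanese \<xi>) * cmod (duh \<theta> S t \<xi>)) \<le> ennreal (1 / M) * m \<xi>"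
    proof (cases "m \<xi>")
      case (real B)
      have "exp ((W - M * s) * japanese \<xi>) * cmod (S s \<xi>) \<le> B" if "s \<in> {0..T}" for s
        using m(1) that real unfolding zmajor_def by (metis ennreal_le_iff)
      then have "exp ((W - M * t) * japanese \<xi>) * cmod (duh \<theta> S t \<xi>) \<le> B / M"
        using c by (intro duh_pointwise[OF M t]) (auto simp: zcarrier_def)
      then show ?thesis using real M by (simp add: ennreal_mult[symmetric] ennreal_leI)
    qed (use M in \<open>simp add: ennreal_mult_top\<close>)
  qed
  moreover have "wsq l (\<lambda>\<xi>. ennreal (1 / M) * m \<xi>) \<le> ennreal ((1 / M * r)\<^sup>2)"
    using m M by (intro wsq_cmult) (auto simp: zmajor_def)
  ultimately show ?thesis
    using m M zcarrier_duh[OF \<theta> T c] by (intro zboundI) auto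
qed

lemma duh_diff:
  assumes "t \<in> {0..T}" "continuous_on {0..T} (\<lambda>s. S s \<xi>)" "continuous_on {0..T} (\<lambda>s. S' s \<xi>)"
  shows "duh \<theta> (\<lambda>s \<xi>. S s \<xi> - S' s \<xi>) t \<xi> = duh \<theta> S t \<xi> - duh \<theta> S' t \<xi>"
proof -
  have c: "continuous_on {0..t} (\<lambda>s. S s \<xi>)" "continuous_on {0..t} (\<lambda>s. S' s \<xi>)"
    using assms continuous_on_subset by (metis atLeastatMost_subset_iff atLeastAtMost_iff order_refl)+
  have "integral {0..t} (\<lambda>s. exp (\<i> * complex_of_real (\<theta> \<xi> * s)) * (S s \<xi> - S' s \<xi>)) =
      integral {0..t} (\<lambda>s. exp (\<i> * complex_of_real (\<theta> \<xi> * s)) * S s \<xi>) -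
      integral {0..t} (\<lambda>s. exp (\<i> * complex_of_real (\<theta> \<xi> * s)) * S' s \<xi>)"
    unfolding right_diff_distrib
    by (intro Henstock_Kurzweil_Integration.integral_diff integrable_continuous_interval continuous_intros c)
  then show ?thesis unfolding duh_def by (simp only: right_diff_distrib)
qed

text \<open>Setting the majorant to infinity on the exceptional null set does not change
  \<open>wsq\<close>.\<close>

lemma zbound_cong_AE:
  assumes u: "zbound l W M T r u" and v: "zcarrier T v"
    and eq: "AE \<xi> in lborel. \<forall>t\<in>{0..T}. v t \<xi> = u t \<xi>"
  shows "zbound l W M T r v"
proof -
  from u obtain m where m: "zmajor W M T u m" "wsq l m \<le> ennreal (r\<^sup>2)" "0 \<le> r" by (auto simp: zbound_def)
  obtain N where N: "{\<xi> \<in> space lborel. \<not> (\<forall>t\<in>{0..T}. v t \<xi> = u t \<xi>)} \<subseteq> N" "emeasure lborel N = 0" "N \<in> sets lborel"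
    using eq by (rule AE_E)
  have [measurable]: "N \<in> sets borel" "m \<in> borel_measurable borel" using N m by (auto simp: zmajor_def)
  have "zmajor W M T v (\<lambda>\<xi>. if \<xi> \<in> N then \<infinity> else m \<xi>)"
    unfolding zmajor_def
  proof (intro conjI ballI allI)
    fix t \<xi> assume t: "t \<in> {0..T}"
    show "ennreal (exp ((W - M * t) * japanese \<xi>) * cmod (v t \<xi>)) \<le> (if \<xi> \<in> N then \<infinity> else m \<xi>)"
    proof (cases "\<xi> \<in> N")
      case False
      have "\<forall>t\<in>{0..T}. v t \<xi> = u t \<xi>"
      proof (rule ccontr)
        assume "\<not> ?thesis"
        with N(1) have "\<xi> \<in> N" by (simp add: subset_iff)
        with False show False by simp
      qed
      then have "v t \<xi> = u t \<xi>" using t by blast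
      then show ?thesis using False m(1) t unfolding zmajor_def by auto
    qed simp
  qed simp
  moreover have "AE \<xi> in lborel. \<xi> \<notin> N" using N by (intro AE_not_in) auto
  then have "AE \<xi> in lborel. (if \<xi> \<in> N then \<infinity> else m \<xi>) = m \<xi>" by eventually_elim simp
  then have "wsq l (\<lambda>\<xi>. if \<xi> \<in> N then \<infinity> else m \<xi>) = wsq l m" by (rule wsq_cong_AE)
  ultimately show ?thesis using m v
    by (intro zboundI[where m="\<lambda>\<xi>. if \<xi> \<in> N then \<infinity> else m \<xi>"]) simp_all
qed

text \<open>Fatou for majorants: the radius is inherited without loss. The majorants themselves need
  not converge, so the lower limit of their squares is used, and its root bounds the limit
  trajectory.\<close>

lemma zbound_limit:
  assumes V: "\<And>n. zbound l W M T r (V n)" and v: "zcarrier T v"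
    and lim: "\<And>t \<xi>. t \<in> {0..T} \<Longrightarrow> (\<lambda>n. V n t \<xi>) \<longlonglongrightarrow> v t \<xi>"
  shows "zbound l W M T r v"
proof -
  from V have "\<forall>n. \<exists>m. zmajor W M T (V n) m \<and> wsq l m \<le> ennreal (r\<^sup>2)" by (simp add: zbound_def)
  then obtain m where m: "\<And>n. zmajor W M T (V n) (m n)" "\<And>n. wsq l (m n) \<le> ennreal (r\<^sup>2)" by metis
  have [measurable]: "m n \<in> borel_measurable borel" for n using m by (simp add: zmajor_def)
  define q where "q \<xi> = liminf (\<lambda>n. (m n \<xi>)\<^sup>2)" for \<xi>
  have [measurable]: "q \<in> borel_measurable borel" unfolding q_def[abs_def] by measurable
  define M0 where "M0 \<xi> = (if q \<xi> = \<infinity> then \<infinity> else ennreal (sqrt (enn2real (q \<xi>))))" for \<xi>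
  have [measurable]: "M0 \<in> borel_measurable borel" unfolding M0_def[abs_def] by measurable
  have M0: "(M0 \<xi>)\<^sup>2 = q \<xi>" for \<xi>
    by (simp add: M0_def ennreal_power less_top)
  have "zmajor W M T v M0"
    unfolding zmajor_def
  proof (intro conjI ballI allI)
    fix t \<xi> assume t: "t \<in> {0..T}"
    let ?x = "exp ((W - M * t) * japanese \<xi>) * cmod (v t \<xi>)"
    let ?y = "\<lambda>n. exp ((W - M * t) * japanese \<xi>) * cmod (V n t \<xi>)"
    have "(\<lambda>n. ennreal ((?y n)\<^sup>2)) \<longlonglongrightarrow> ennreal (?x\<^sup>2)"
      by (intro tendsto_intros lim t)
    then have "ennreal (?x\<^sup>2) = liminf (\<lambda>n. ennreal ((?y n)\<^sup>2))"
      using lim_imp_Liminf[OF sequentially_bot] by metis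
    also have "\<dots> \<le> q \<xi>"
      unfolding q_def
    proof (intro Liminf_mono always_eventually allI)
      fix n
      have "(ennreal (?y n))\<^sup>2 \<le> (m n \<xi>)\<^sup>2" using m(1)[of n] t unfolding zmajor_def by (intro power_mono) auto
      then show "ennreal ((?y n)\<^sup>2) \<le> (m n \<xi>)\<^sup>2" by (simp add: ennreal_power)
    qed
    finally have q: "ennreal (?x\<^sup>2) \<le> q \<xi>" .
    show "ennreal ?x \<le> M0 \<xi>"
    proof (cases "q \<xi>")
      case (real b)
      then have "?x\<^sup>2 \<le> b" using q by simp
      then have "?x \<le> sqrt b" by (rule real_le_rsqrt)
      then show ?thesis using real by (simp add: M0_def ennreal_leI)
    qed (simp add: M0_def)
  qed simp
  moreover have "wsq l M0 \<le> ennreal (r\<^sup>2)"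
  proof -
    let ?J = "\<lambda>\<xi>. (ennreal (japanese \<xi> powr l))\<^sup>2"
    have eq: "(\<integral>\<^sup>+ \<xi>. f \<xi> \<partial>density lborel ?J) = (\<integral>\<^sup>+ \<xi>. ?J \<xi> * f \<xi> \<partial>lborel)"
      if "f \<in> borel_measurable borel" for f using that by (subst nn_integral_density) auto
    have "wsq l M0 = (\<integral>\<^sup>+ \<xi>. q \<xi> \<partial>density lborel ?J)"
      unfolding wsq_def power_mult_distrib M0 by (subst eq) auto
    also have "\<dots> \<le> liminf (\<lambda>n. \<integral>\<^sup>+ \<xi>. (m n \<xi>)\<^sup>2 \<partial>density lborel ?J)"
      unfolding q_def by (rule nn_integral_liminf) simp
    also have "\<dots> = liminf (\<lambda>n. wsq l (m n))"
      unfolding wsq_def power_mult_distrib by (subst eq) auto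
    also have "\<dots> \<le> ennreal (r\<^sup>2)"
      by (rule Liminf_le) (auto intro!: always_eventually m)
    finally show ?thesis .
  qed
  ultimately show ?thesis using V[of 0] v by (intro zboundI) (auto simp: zbound_def)
qed

lemma sbound_abs_le:
  assumes "admissible W M T" "sbound W M T r u" "t \<in> {0..T}"
  shows "cmod (u t \<xi>) \<le> r"
proof -
  have "cmod (u t \<xi>) \<le> exp ((W - M * t) * japanese \<xi>) * cmod (u t \<xi>)"
    using weight_ge_1[OF assms(1,3), of \<xi>] by (simp add: mult_le_cancel_right1)
  also have "\<dots> \<le> r" using assms by (simp add: sbound_def)
  finally show ?thesis .
qed

lemma zbound_zcarrier: "zbound l W M T r u \<Longrightarrow> zcarrier T u"
  by (simp add: zbound_def)

definition duhamel_map :: "('i \<Rightarrow> real \<Rightarrow> real) \<Rightarrow> ('i \<Rightarrow> ('i \<Rightarrow> real \<Rightarrow> complex) \<Rightarrow> real \<Rightarrow> complex) \<Rightarrow>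
    ('i \<Rightarrow> real \<Rightarrow> real \<Rightarrow> complex) \<Rightarrow> ('i \<Rightarrow> real \<Rightarrow> real \<Rightarrow> complex) \<Rightarrow> 'i \<Rightarrow> real \<Rightarrow> real \<Rightarrow> complex" where
  "duhamel_map \<theta> N F U i t \<xi> = F i t \<xi> + duh (\<theta> i) (\<lambda>s. N i (\<lambda>j. U j s)) t \<xi>"

text \<open>The Lipschitz constant \<open>L\<close> meets the factor 1/M of the Duhamel integral, so
  2L <= M gives contraction by 1/2. The same factor holds for the uniform bound, whose right-hand
  side is still the L2 distance.\<close>

lemma duhamel_map_diff:
  fixes U U' :: "'i \<Rightarrow> real \<Rightarrow> real \<Rightarrow> complex"
  assumes adm: "admissible W M T" and M: "0 < M" and L: "lipL True l R L (N i)" and LM: "2 * L \<le> M"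
    and \<theta>: "\<theta> i \<in> borel_measurable borel"
    and U: "\<And>i. zbound l W M T R (U i)" and U': "\<And>i. zbound l W M T R (U' i)"
    and d: "\<And>i. zbound l W M T d (\<lambda>t \<xi>. U i t \<xi> - U' i t \<xi>)"
  shows "zbound l W M T (d / 2) (\<lambda>t \<xi>. duhamel_map \<theta> N F U i t \<xi> - duhamel_map \<theta> N F U' i t \<xi>)"
    and "sbound W M T (d / 2) (\<lambda>t \<xi>. duhamel_map \<theta> N F U i t \<xi> - duhamel_map \<theta> N F U' i t \<xi>)"
proof -
  note L1 = lipLD[OF L adm U U' d]
  have d': "zbound l W M T d (\<lambda>t \<xi>. U' i t \<xi> - U i t \<xi>)" for i
    using zbound_uminus[OF d, of i] by simp
  note L2 = lipLD[OF L adm U' U d']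
  have T: "0 \<le> T" using adm by (simp add: admissible_def)
  have d0: "0 \<le> d" using zbound_nonneg[OF d] .
  have "2 * (L * d) \<le> M * d" using mult_right_mono[OF LM d0] by (simp add: mult.assoc)
  then have le: "L * d / M \<le> d / 2" using M by (simp add: field_simps)
  have eq: "duhamel_map \<theta> N F U i t \<xi> - duhamel_map \<theta> N F U' i t \<xi> =
      duh (\<theta> i) (\<lambda>s \<xi>. N i (\<lambda>j. U j s) \<xi> - N i (\<lambda>j. U' j s) \<xi>) t \<xi>" if "t \<in> {0..T}" for t \<xi>
    using zbound_zcarrier[OF L1(1)] zbound_zcarrier[OF L2(1)] that
    unfolding duhamel_map_def by (subst duh_diff[of t T]) (auto simp: zcarrier_def)
  have "zbound l W M T (d / 2) (duh (\<theta> i) (\<lambda>s \<xi>. N i (\<lambda>j. U j s) \<xi> - N i (\<lambda>j. U' j s) \<xi>))"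
    by (rule zbound_mono[OF zbound_duh[OF M T \<theta> L1(2)] le])
  then show "zbound l W M T (d / 2) (\<lambda>t \<xi>. duhamel_map \<theta> N F U i t \<xi> - duhamel_map \<theta> N F U' i t \<xi>)"
    by (subst zbound_cong[where g="duh (\<theta> i) (\<lambda>s \<xi>. N i (\<lambda>j. U j s) \<xi> - N i (\<lambda>j. U' j s) \<xi>)"])
      (auto simp: eq)
  have "sbound W M T (d / 2) (duh (\<theta> i) (\<lambda>s \<xi>. N i (\<lambda>j. U j s) \<xi> - N i (\<lambda>j. U' j s) \<xi>))"
    by (rule sbound_mono[OF sbound_duh[OF M zbound_zcarrier[OF L1(2)] L1(3)] le]) simp
  then show "sbound W M T (d / 2) (\<lambda>t \<xi>. duhamel_map \<theta> N F U i t \<xi> - duhamel_map \<theta> N F U' i t \<xi>)"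
    by (simp add: sbound_def eq)
qed

text \<open>Separate radii \<open>\<rho> i\<close> keep the bounds of phase and amplitude apart. The
  limit is built from uniform convergence at all frequencies and times, and
  \<open>zbound_limit\<close> puts it into the balls.\<close>

lemma picard_exists:
  fixes N :: "'i \<Rightarrow> ('i \<Rightarrow> real \<Rightarrow> complex) \<Rightarrow> real \<Rightarrow> complex"
  assumes adm: "admissible W M T" and M: "0 < M" and L: "\<And>i. lipL True l R L (N i)" and LM: "2 * L \<le> M"
    and \<theta>: "\<And>i. \<theta> i \<in> borel_measurable borel"
    and \<rho>: "\<And>i. 0 \<le> \<rho> i" "\<And>i. \<rho> i \<le> R"
    and ball: "\<And>U i. (\<And>i. zbound l W M T (\<rho> i) (U i)) \<Longrightarrow> zbound l W M T (\<rho> i) (duhamel_map \<theta> N F U i)"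
  obtains U where "\<And>i. zbound l W M T (\<rho> i) (U i)"
    "\<And>i t \<xi>. t \<in> {0..T} \<Longrightarrow> U i t \<xi> = duhamel_map \<theta> N F U i t \<xi>"
proof -
  define P where "P n = ((duhamel_map \<theta> N F) ^^ n) (\<lambda>i t \<xi>. 0)" for n
  have P_Suc: "P (Suc n) = duhamel_map \<theta> N F (P n)" for n by (simp add: P_def)
  have P\<rho>: "zbound l W M T (\<rho> i) (P n i)" for n i
  proof (induction n arbitrary: i)
    case 0 then show ?case by (simp add: P_def zbound_zero \<rho>)
  next
    case (Suc n) then show ?case unfolding P_Suc by (rule ball)
  qed
  have PR: "zbound l W M T R (P n i)" for n i by (rule zbound_mono[OF P\<rho> \<rho>(2)])
  have D: "zbound l W M T (R / 2 ^ n) (\<lambda>t \<xi>. P (Suc n) i t \<xi> - P n i t \<xi>)" for n i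
  proof (induction n arbitrary: i)
    case 0
    have "P 0 = (\<lambda>i t \<xi>. 0)" by (simp add: P_def)
    then show ?case using PR[of "Suc 0" i] by simp
  next
    case (Suc n)
    have "zbound l W M T (R / 2 ^ n / 2) (\<lambda>t \<xi>. duhamel_map \<theta> N F (P (Suc n)) i t \<xi> - duhamel_map \<theta> N F (P n) i t \<xi>)"
      by (rule duhamel_map_diff[OF adm M L LM \<theta> PR PR Suc.IH])
    then show ?case by (simp add: P_Suc[symmetric] mult.commute)
  qed
  \<comment> \<open>Uniform control is available only after one application of the map, since the
    first difference is bounded in the weighted L2 norm alone; hence the index shift.\<close>
  have S: "cmod (P (Suc (Suc n)) i t \<xi> - P (Suc n) i t \<xi>) \<le> R / 2 ^ Suc n" if "t \<in> {0..T}" for n i t \<xi>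
  proof -
    have "sbound W M T (R / 2 ^ n / 2) (\<lambda>t \<xi>. duhamel_map \<theta> N F (P (Suc n)) i t \<xi> - duhamel_map \<theta> N F (P n) i t \<xi>)"
      by (rule duhamel_map_diff[OF adm M L LM \<theta> PR PR D])
    from sbound_abs_le[OF adm this that, of \<xi>] show ?thesis by (simp add: P_Suc[symmetric] mult.commute)
  qed
  have T: "0 \<le> T" using adm by (simp add: admissible_def)
  have R0: "0 \<le> R" using zbound_nonneg[OF PR] .
  \<comment> \<open>The radius is the exact partial sum of the geometric series, so that the
    induction on \<open>k\<close> closes.\<close>
  have Dk: "zbound l W M T (2 * R / 2 ^ n - R / 2 ^ (n + k) * 2) (\<lambda>t \<xi>. P (n + k) i t \<xi> - P n i t \<xi>)" for n k i
  proof (induction k)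
    case 0 then show ?case by (simp add: zbound_zero)
  next
    case (Suc k)
    have "zbound l W M T (R / 2 ^ (n + k) + (2 * R / 2 ^ n - R / 2 ^ (n + k) * 2))
        (\<lambda>t \<xi>. (P (Suc (n + k)) i t \<xi> - P (n + k) i t \<xi>) + (P (n + k) i t \<xi> - P n i t \<xi>))"
      by (rule zbound_add[OF D Suc.IH])
    then show ?case by (simp add: field_simps)
  qed
  have Dk': "zbound l W M T (2 * R / 2 ^ n) (\<lambda>t \<xi>. P (n + k) i t \<xi> - P n i t \<xi>)" for n k i
    by (rule zbound_mono[OF Dk]) (use R0 in simp)
  have Sk: "cmod (P (Suc n + k) i t \<xi> - P (Suc n) i t \<xi>) \<le> R / 2 ^ n - R / 2 ^ (n + k)" if t: "t \<in> {0..T}" for n k i t \<xi>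
  proof (induction k)
    case (Suc k)
    have "cmod ((P (Suc (Suc (n + k))) i t \<xi> - P (Suc (n + k)) i t \<xi>) + (P (Suc n + k) i t \<xi> - P (Suc n) i t \<xi>)) \<le>
        R / 2 ^ Suc (n + k) + (R / 2 ^ n - R / 2 ^ (n + k))"
      by (rule order_trans[OF norm_triangle_ineq add_mono[OF S[OF t] Suc.IH]])
    then show ?case by (simp add: field_simps)
  qed simp
  have conv: "convergent (\<lambda>n. P n i t \<xi>)" if t: "t \<in> {0..T}" for i t \<xi>
  proof (rule summable_diff_imp_convergent, subst summable_Suc_iff[symmetric], rule summable_norm_cancel,
      rule summable_comparison_test'[where N=0])
    show "summable (\<lambda>n. R * (1/2) ^ Suc n)" by (intro summable_mult summable_Suc_iff[THEN iffD2] summable_geometric) simp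
    show "norm (norm (P (Suc (Suc n)) i t \<xi> - P (Suc n) i t \<xi>)) \<le> R * (1/2) ^ Suc n" for n
      using S[OF t, of n i \<xi>] by (simp add: power_divide)
  qed
  define U where "U i t \<xi> = lim (\<lambda>n. P n i t \<xi>)" for i t \<xi>
  have lim: "(\<lambda>n. P n i t \<xi>) \<longlonglongrightarrow> U i t \<xi>" if "t \<in> {0..T}" for i t \<xi>
    using conv[OF that, of i \<xi>] by (simp add: U_def convergent_LIMSEQ_iff)
  have unif: "cmod (P (Suc n) i t \<xi> - U i t \<xi>) \<le> R / 2 ^ n" if t: "t \<in> {0..T}" for n i t \<xi>
  proof (rule tendsto_upperbound)
    have "(\<lambda>k. P (k + Suc n) i t \<xi>) \<longlonglongrightarrow> U i t \<xi>" by (rule LIMSEQ_ignore_initial_segment[OF lim[OF t]])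
    then show "(\<lambda>k. cmod (P (Suc n) i t \<xi> - P (Suc n + k) i t \<xi>)) \<longlonglongrightarrow> cmod (P (Suc n) i t \<xi> - U i t \<xi>)"
      by (intro tendsto_intros) (simp add: add.commute)
    show "\<forall>\<^sub>F k in sequentially. cmod (P (Suc n) i t \<xi> - P (Suc n + k) i t \<xi>) \<le> R / 2 ^ n"
    proof (intro always_eventually allI)
      fix k
      have "0 \<le> R / 2 ^ (n + k)" using R0 by simp
      with Sk[OF t, of n k i \<xi>] show "cmod (P (Suc n) i t \<xi> - P (Suc n + k) i t \<xi>) \<le> R / 2 ^ n"
        by (simp only: norm_minus_commute[of "P (Suc n) i t \<xi>"])
    qed
  qed simp
  have Uc: "zcarrier T (U i)" for i
    unfolding zcarrier_def
  proof (intro conjI ballI allI)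
    fix t assume t: "t \<in> {0..T}"
    have "P n i t \<in> borel_measurable borel" for n
      using zbound_zcarrier[OF PR, of n i] t by (simp add: zcarrier_def)
    then show "U i t \<in> borel_measurable borel" by (rule borel_measurable_LIMSEQ_metric) (rule lim[OF t])
  next
    fix \<xi>
    show "continuous_on {0..T} (\<lambda>t. U i t \<xi>)"
    proof (rule uniform_limit_theorem)
      show "\<forall>\<^sub>F n in sequentially. continuous_on {0..T} (\<lambda>t. P (Suc n) i t \<xi>)"
        using zbound_zcarrier[OF PR] by (simp add: zcarrier_def)
      show "uniform_limit {0..T} (\<lambda>n t. P (Suc n) i t \<xi>) (\<lambda>t. U i t \<xi>) sequentially"
      proof (rule uniform_limitI)
        fix e :: real assume "e > 0"
        have "(\<lambda>n. R * (1/2) ^ n) \<longlonglongrightarrow> R * 0" by (intro tendsto_intros) simp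
        then have "\<forall>\<^sub>F n in sequentially. R * (1/2) ^ n < e" using \<open>e > 0\<close> by (intro order_tendstoD) auto
        then show "\<forall>\<^sub>F n in sequentially. \<forall>t\<in>{0..T}. dist (P (Suc n) i t \<xi>) (U i t \<xi>) < e"
        proof eventually_elim
          case (elim n)
          then have e: "R / 2 ^ n < e" by (simp add: power_divide)
          show ?case unfolding dist_norm by (intro ballI le_less_trans[OF unif e])
        qed
      qed
    qed simp
  qed
  have U\<rho>: "zbound l W M T (\<rho> i) (U i)" for i
    by (rule zbound_limit[OF P\<rho> Uc lim])
  have UR: "zbound l W M T R (U i)" for i by (rule zbound_mono[OF U\<rho> \<rho>(2)])
  have PU: "zbound l W M T (2 * R / 2 ^ n) (\<lambda>t \<xi>. U i t \<xi> - P n i t \<xi>)" for n i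
  proof (rule zbound_limit[OF Dk'])
    show "zcarrier T (\<lambda>t \<xi>. U i t \<xi> - P n i t \<xi>)" by (intro zcarrier_diff Uc zbound_zcarrier[OF PR])
    fix t \<xi> assume t: "t \<in> {0..T}"
    have "(\<lambda>k. P (k + n) i t \<xi>) \<longlonglongrightarrow> U i t \<xi>" by (rule LIMSEQ_ignore_initial_segment[OF lim[OF t]])
    then show "(\<lambda>k. P (n + k) i t \<xi> - P n i t \<xi>) \<longlonglongrightarrow> U i t \<xi> - P n i t \<xi>"
      by (intro tendsto_intros) (simp add: add.commute)
  qed
  have fixed: "U i t \<xi> = duhamel_map \<theta> N F U i t \<xi>" if t: "t \<in> {0..T}" for i t \<xi>
  proof (rule LIMSEQ_unique)
    show "(\<lambda>n. P (Suc n) i t \<xi>) \<longlonglongrightarrow> U i t \<xi>" using lim[OF t] by (rule LIMSEQ_Suc)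
    have le: "cmod (duhamel_map \<theta> N F U i t \<xi> - P (Suc n) i t \<xi>) \<le> R * (1/2) ^ n" for n
    proof -
      have "sbound W M T (2 * R / 2 ^ n / 2) (\<lambda>t \<xi>. duhamel_map \<theta> N F U i t \<xi> - duhamel_map \<theta> N F (P n) i t \<xi>)"
        by (rule duhamel_map_diff[OF adm M L LM \<theta> UR PR PU])
      from sbound_abs_le[OF adm this t, of \<xi>] show ?thesis by (simp add: P_Suc power_divide)
    qed
    have "(\<lambda>n. R * (1/2) ^ n) \<longlonglongrightarrow> R * 0" by (intro tendsto_intros) simp
    then have "(\<lambda>n. duhamel_map \<theta> N F U i t \<xi> - P (Suc n) i t \<xi>) \<longlonglongrightarrow> 0"
      by (intro Lim_null_comparison[OF always_eventually[OF allI[OF le]]]) simp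
    from tendsto_diff[OF tendsto_const[of "duhamel_map \<theta> N F U i t \<xi>"] this]
    show "(\<lambda>n. P (Suc n) i t \<xi>) \<longlonglongrightarrow> duhamel_map \<theta> N F U i t \<xi>" by simp
  qed
  show thesis by (rule that[OF U\<rho> fixed])
qed

text \<open>The difference lies in a ball of radius 2R, and every use of the equations halves the
  radius; the infimum of all these majorants has norm zero. The equations hold for almost every
  frequency, so \<open>zbound_cong_AE\<close> enters at each step.\<close>

lemma picard_unique:
  fixes U U' :: "'i::finite \<Rightarrow> real \<Rightarrow> real \<Rightarrow> complex"
  assumes adm: "admissible W M T" and M: "0 < M" and L: "\<And>i. lipL True l R L (N i)" and LM: "2 * L \<le> M"
    and \<theta>: "\<And>i. \<theta> i \<in> borel_measurable borel"
    and U: "\<And>i. zbound l W M T R (U i)" and U': "\<And>i. zbound l W M T R (U' i)"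
    and eq: "\<And>i. AE \<xi> in lborel. \<forall>t\<in>{0..T}. U i t \<xi> = duhamel_map \<theta> N F U i t \<xi>"
    and eq': "\<And>i. AE \<xi> in lborel. \<forall>t\<in>{0..T}. U' i t \<xi> = duhamel_map \<theta> N F U' i t \<xi>"
  shows "AE \<xi> in lborel. \<forall>t\<in>{0..T}. U i t \<xi> = U' i t \<xi>"
proof -
  have D: "zbound l W M T (2 * R / 2 ^ n) (\<lambda>t \<xi>. U i t \<xi> - U' i t \<xi>)" for n i
  proof (induction n arbitrary: i)
    case 0 then show ?case using zbound_diff[OF U U', of i i] by simp
  next
    case (Suc n)
    have "zbound l W M T (2 * R / 2 ^ n / 2) (\<lambda>t \<xi>. duhamel_map \<theta> N F U i t \<xi> - duhamel_map \<theta> N F U' i t \<xi>)"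
      by (rule duhamel_map_diff[OF adm M L LM \<theta> U U' Suc.IH])
    then have "zbound l W M T (2 * R / 2 ^ n / 2) (\<lambda>t \<xi>. U i t \<xi> - U' i t \<xi>)"
    proof (rule zbound_cong_AE)
      show "zcarrier T (\<lambda>t \<xi>. U i t \<xi> - U' i t \<xi>)"
        by (intro zcarrier_diff zbound_zcarrier[OF U] zbound_zcarrier[OF U'])
      show "AE \<xi> in lborel. \<forall>t\<in>{0..T}. U i t \<xi> - U' i t \<xi> = duhamel_map \<theta> N F U i t \<xi> - duhamel_map \<theta> N F U' i t \<xi>"
        using eq[of i] eq'[of i] by eventually_elim auto
    qed
    then show ?case by (simp add: mult.commute)
  qed
  then have "\<forall>n. \<exists>m. zmajor W M T (\<lambda>t \<xi>. U i t \<xi> - U' i t \<xi>) m \<and> wsq l m \<le> ennreal ((2 * R / 2 ^ n)\<^sup>2)"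
    by (simp add: zbound_def)
  then obtain m where m: "\<And>n. zmajor W M T (\<lambda>t \<xi>. U i t \<xi> - U' i t \<xi>) (m n)"
    "\<And>n. wsq l (m n) \<le> ennreal ((2 * R / 2 ^ n)\<^sup>2)" by metis
  have [measurable]: "m n \<in> borel_measurable borel" for n using m by (simp add: zmajor_def)
  define q where "q \<xi> = (INF n. m n \<xi>)" for \<xi>
  have [measurable]: "q \<in> borel_measurable borel" unfolding q_def[abs_def] by measurable
  have "wsq l q \<le> ennreal ((2 * R / 2 ^ n)\<^sup>2)" for n
    by (rule order_trans[OF wsq_mono m(2)]) (unfold q_def, rule INF_lower, simp)
  moreover have "(\<lambda>n. ennreal ((2 * R * (1/2) ^ n)\<^sup>2)) \<longlonglongrightarrow> ennreal ((2 * R * 0)\<^sup>2)"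
    by (intro tendsto_intros) simp
  ultimately have "wsq l q \<le> 0"
    by (intro tendsto_lowerbound[where F=sequentially and f="\<lambda>n. ennreal ((2 * R * (1/2) ^ n)\<^sup>2)"])
      (auto simp: power_divide)
  then have "wsq l q = 0" by simp
  then have "AE \<xi> in lborel. q \<xi> = 0"
    unfolding wsq_def by (subst (asm) nn_integral_0_iff_AE) auto
  then show ?thesis
  proof eventually_elim
    case (elim \<xi>)
    show ?case
    proof
      fix t assume t: "t \<in> {0..T}"
      have "ennreal (cmod (U i t \<xi> - U' i t \<xi>)) \<le> q \<xi>"
        unfolding q_def by (intro INF_greatest zmajor_pointwise[OF adm m(1) t])
      then show "U i t \<xi> = U' i t \<xi>" using elim by simp
    qed
  qed
qed

section \<open>Functions with exponentially decaying Fourier transform\<close>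

text \<open>An L1 form of the weight condition: it makes \<open>ift h\<close> smooth, is stable
  under convolution, and survives multiplication by powers of the bracket at a smaller rate.\<close>

definition exp_decay :: "real \<Rightarrow> (real \<Rightarrow> complex) \<Rightarrow> bool" where
  "exp_decay c h \<longleftrightarrow> 0 < c \<and> integrable lborel (\<lambda>\<xi>. complex_of_real (exp (c * japanese \<xi>)) * h \<xi>)"

lemma exp_decay_measurable:
  assumes "exp_decay c h"
  shows "h \<in> borel_measurable borel"
proof -
  have "(\<lambda>\<xi>. complex_of_real (exp (c * japanese \<xi>)) * h \<xi>) \<in> borel_measurable borel"
    using assms borel_measurable_integrable by (auto simp: exp_decay_def)
  then have "(\<lambda>\<xi>. complex_of_real (exp (- c * japanese \<xi>)) * (complex_of_real (exp (c * japanese \<xi>)) * h \<xi>)) \<in> borel_measurable borel"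
    by measurable
  moreover have "complex_of_real (exp (- c * japanese \<xi>)) * (complex_of_real (exp (c * japanese \<xi>)) * h \<xi>) = h \<xi>" for \<xi>
    unfolding mult.assoc[symmetric] of_real_mult[symmetric] mult_exp_exp by simp
  ultimately show ?thesis by (simp only:)
qed

lemma exp_decay_bound:
  assumes "exp_decay c h" "g \<in> borel_measurable borel" "0 < d"
    and le: "\<And>\<xi>. exp (d * japanese \<xi>) * cmod (g \<xi>) \<le> C * (exp (c * japanese \<xi>) * cmod (h \<xi>))"
  shows "exp_decay d g"
  unfolding exp_decay_def
proof
  note [measurable] = assms(2)
  show "integrable lborel (\<lambda>\<xi>. complex_of_real (exp (d * japanese \<xi>)) * g \<xi>)"
  proof (rule Bochner_Integration.integrable_bound)
    show "integrable lborel (\<lambda>\<xi>. complex_of_real C * (complex_of_real (exp (c * japanese \<xi>)) * h \<xi>))"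
      using assms(1) by (intro integrable_mult_right) (simp add: exp_decay_def)
    show "AE \<xi> in lborel. cmod (complex_of_real (exp (d * japanese \<xi>)) * g \<xi>) \<le>
        cmod (complex_of_real C * (complex_of_real (exp (c * japanese \<xi>)) * h \<xi>))"
    proof (intro AE_I2)
      fix \<xi>
      have "C * (exp (c * japanese \<xi>) * cmod (h \<xi>)) \<le> \<bar>C\<bar> * (exp (c * japanese \<xi>) * cmod (h \<xi>))"
        by (intro mult_right_mono) auto
      with le[of \<xi>] show "cmod (complex_of_real (exp (d * japanese \<xi>)) * g \<xi>) \<le>
          cmod (complex_of_real C * (complex_of_real (exp (c * japanese \<xi>)) * h \<xi>))"
        by (simp only: norm_mult norm_of_real abs_exp_cancel)
    qed
  qed measurable
qed (rule assms(3))

lemma exp_decay_integrable: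
  assumes "exp_decay c h" shows "integrable lborel h"
proof (rule Bochner_Integration.integrable_bound)
  show "integrable lborel (\<lambda>\<xi>. complex_of_real (exp (c * japanese \<xi>)) * h \<xi>)"
    using assms by (simp add: exp_decay_def)
  show "h \<in> borel_measurable lborel" using exp_decay_measurable[OF assms] by simp
  have "1 \<le> exp (c * japanese \<xi>)" for \<xi> using assms by (simp add: exp_decay_def)
  then show "AE \<xi> in lborel. cmod (h \<xi>) \<le> cmod (complex_of_real (exp (c * japanese \<xi>)) * h \<xi>)"
    by (simp only: norm_mult norm_of_real abs_exp_cancel) (simp add: mult_le_cancel_right1)
qed

lemma exp_decay_mono:
  assumes "exp_decay c h" "0 < d" "d \<le> c"
  shows "exp_decay d h"
proof (rule exp_decay_bound[OF assms(1) exp_decay_measurable[OF assms(1)] assms(2), where C=1])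
  show "exp (d * japanese \<xi>) * cmod (h \<xi>) \<le> 1 * (exp (c * japanese \<xi>) * cmod (h \<xi>))" for \<xi>
    using assms by (simp add: mult_right_mono)
qed

text \<open>A single term of the exponential series.\<close>

lemma japanese_power_le_exp:
  assumes "0 < c"
  shows "japanese \<xi> ^ k \<le> (fact k / c ^ k) * exp (c * japanese \<xi>)"
proof -
  have "(c * japanese \<xi>) ^ k / fact k \<le> exp (c * japanese \<xi>)"
  proof -
    have "(\<Sum>i\<in>{k}. (c * japanese \<xi>) ^ i /\<^sub>R fact i) \<le> (\<Sum>i. (c * japanese \<xi>) ^ i /\<^sub>R fact i)"
      using assms by (intro sum_le_suminf summable_exp_generic) auto
    then show ?thesis by (simp add: exp_def divide_inverse mult.commute)
  qed
  then have "(c * japanese \<xi>) ^ k \<le> exp (c * japanese \<xi>) * fact k" by (simp add: divide_le_eq)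
  then have "c ^ k * japanese \<xi> ^ k \<le> exp (c * japanese \<xi>) * fact k" by (simp add: power_mult_distrib)
  then show ?thesis using assms by (simp add: field_simps)
qed

text \<open>Polynomial growth is paid for with the part \<open>c - d\<close> of the exponential
  rate.\<close>

lemma exp_decay_mult:
  assumes h: "exp_decay c h" and [measurable]: "p \<in> borel_measurable borel"
    and p: "\<And>\<xi>. cmod (p \<xi>) \<le> C * japanese \<xi> ^ k" and d: "0 < d" "d < c"
  shows "exp_decay d (\<lambda>\<xi>. p \<xi> * h \<xi>)"
proof (rule exp_decay_bound[OF h _ d(1)])
  note [measurable] = exp_decay_measurable[OF h]
  show "(\<lambda>\<xi>. p \<xi> * h \<xi>) \<in> borel_measurable borel" by measurable
  fix \<xi>
  have "cmod (p \<xi>) \<le> \<bar>C\<bar> * japanese \<xi> ^ k" by (rule order_trans[OF p]) (simp add: mult_right_mono)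
  also have "\<dots> \<le> \<bar>C\<bar> * ((fact k / (c - d) ^ k) * exp ((c - d) * japanese \<xi>))"
    using d by (intro mult_left_mono japanese_power_le_exp) auto
  finally have "exp (d * japanese \<xi>) * (cmod (p \<xi>) * cmod (h \<xi>)) \<le>
      exp (d * japanese \<xi>) * ((\<bar>C\<bar> * ((fact k / (c - d) ^ k) * exp ((c - d) * japanese \<xi>))) * cmod (h \<xi>))"
    by (intro mult_left_mono mult_right_mono) auto
  also have "\<dots> = (\<bar>C\<bar> * (fact k / (c - d) ^ k)) * ((exp (d * japanese \<xi>) * exp ((c - d) * japanese \<xi>)) * cmod (h \<xi>))"
    by (simp only: mult_ac)
  also have "exp (d * japanese \<xi>) * exp ((c - d) * japanese \<xi>) = exp (c * japanese \<xi>)"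
    unfolding mult_exp_exp by (simp add: algebra_simps)
  finally show "exp (d * japanese \<xi>) * cmod (p \<xi> * h \<xi>) \<le>
      (\<bar>C\<bar> * (fact k / (c - d) ^ k)) * (exp (c * japanese \<xi>) * cmod (h \<xi>))"
    by (simp add: norm_mult)
qed

lemma exp_decay_bounded_mult:
  assumes h: "exp_decay c h" and [measurable]: "p \<in> borel_measurable borel" and p: "\<And>\<xi>. cmod (p \<xi>) \<le> C"
  shows "exp_decay c (\<lambda>\<xi>. p \<xi> * h \<xi>)"
proof (rule exp_decay_bound[OF h, where C=C])
  note [measurable] = exp_decay_measurable[OF h]
  show "(\<lambda>\<xi>. p \<xi> * h \<xi>) \<in> borel_measurable borel" by measurable
  show "0 < c" using h by (simp add: exp_decay_def)
  show "exp (c * japanese \<xi>) * cmod (p \<xi> * h \<xi>) \<le> C * (exp (c * japanese \<xi>) * cmod (h \<xi>))" for \<xi>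
    using mult_right_mono[OF p, of "exp (c * japanese \<xi>) * cmod (h \<xi>)" \<xi>] by (simp add: norm_mult mult_ac)
qed

lemma exp_decay_add: "exp_decay c f \<Longrightarrow> exp_decay c h \<Longrightarrow> exp_decay c (\<lambda>\<xi>. f \<xi> + h \<xi>)"
  by (simp add: exp_decay_def distrib_left)

lemma exp_decay_cmult: "exp_decay c f \<Longrightarrow> exp_decay c (\<lambda>\<xi>. k * f \<xi>)"
  by (rule exp_decay_bounded_mult[where C="cmod k"]) auto

lemma exp_decay_til:
  assumes "exp_decay c f" shows "exp_decay c (til f)"
proof -
  have "integrable lborel (\<lambda>\<xi>. complex_of_real (exp (c * japanese (- \<xi>))) * f (- \<xi>))"
    using assms integrable_reflect[of "\<lambda>\<xi>. complex_of_real (exp (c * japanese \<xi>)) * f \<xi>"] by (simp add: exp_decay_def)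
  then have "integrable lborel (\<lambda>\<xi>. cnj (complex_of_real (exp (c * japanese \<xi>)) * f (- \<xi>)))"
    unfolding japanese_uminus by (rule integrable_bounded_linear[OF bounded_linear_cnj])
  then show ?thesis using assms by (simp add: exp_decay_def til_def)
qed

section \<open>Convolution on the Fourier side and products in x\<close>

definition conv :: "(real \<Rightarrow> complex) \<Rightarrow> (real \<Rightarrow> complex) \<Rightarrow> real \<Rightarrow> complex" where
  "conv = bil (\<lambda>_ _. complex_of_real (1 / sqrt (2 * pi)))"

lemma conv_eq: "conv f h \<xi> = complex_of_real (1 / sqrt (2 * pi)) * (LBINT \<eta>. f (\<xi> - \<eta>) * h \<eta>)"
  by (simp add: conv_def bil_def)

lemma measurable_conv [measurable]:
  assumes [measurable]: "f \<in> borel_measurable borel" "h \<in> borel_measurable borel"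
  shows "conv f h \<in> borel_measurable borel"
  unfolding conv_eq[abs_def] by measurable

lemma integrable_convolution:
  fixes f h :: "real \<Rightarrow> complex"
  assumes f: "integrable lborel f" and h: "integrable lborel h"
  shows "integrable (lborel \<Otimes>\<^sub>M lborel) (\<lambda>(\<xi>, \<eta>). f (\<xi> - \<eta>) * h \<eta>)"
proof -
  note [measurable] = borel_measurable_integrable[OF f, simplified] borel_measurable_integrable[OF h, simplified]
  have fs: "integrable lborel (\<lambda>\<xi>. f (\<xi> - \<eta>))" for \<eta>
    using lborel_integrable_real_affine[OF f, of 1 "- \<eta>"] by simp
  have fn: "(LBINT \<xi>. cmod (f (\<xi> - \<eta>))) = (LBINT \<xi>. cmod (f \<xi>))" for \<eta>
    using lborel_integral_real_affine[of 1 "\<lambda>\<xi>. cmod (f \<xi>)" "- \<eta>"] by simp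
  have "integrable (lborel \<Otimes>\<^sub>M lborel) (\<lambda>(\<eta>, \<xi>). f (\<xi> - \<eta>) * h \<eta>)"
  proof (rule lborel_pair.Fubini_integrable)
    show "integrable lborel (\<lambda>\<eta>. LBINT \<xi>. cmod (case (\<eta>, \<xi>) of (\<eta>, \<xi>) \<Rightarrow> f (\<xi> - \<eta>) * h \<eta>))"
      using h by (simp add: norm_mult fn)
    show "AE \<eta> in lborel. integrable lborel (\<lambda>\<xi>. case (\<eta>, \<xi>) of (\<eta>, \<xi>) \<Rightarrow> f (\<xi> - \<eta>) * h \<eta>)"
      using fs by simp
  qed measurable
  from lborel_pair.integrable_product_swap[OF this] show ?thesis by simp
qed

text \<open>The exponential of the bracket is submultiplicative, so the weighted convolution is
  dominated by the convolution of the weighted functions, which is integrable.\<close>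

lemma exp_decay_conv:
  assumes f: "exp_decay c f" and h: "exp_decay c h"
  shows "exp_decay c (conv f h)"
proof -
  note [measurable] = exp_decay_measurable[OF f] exp_decay_measurable[OF h]
  let ?f = "\<lambda>\<xi>. complex_of_real (exp (c * japanese \<xi>)) * f \<xi>"
  let ?h = "\<lambda>\<xi>. complex_of_real (exp (c * japanese \<xi>)) * h \<xi>"
  have c: "0 < c" using f by (simp add: exp_decay_def)
  have "integrable (lborel \<Otimes>\<^sub>M lborel) (\<lambda>(\<xi>, \<eta>). ?f (\<xi> - \<eta>) * ?h \<eta>)"
    using f h by (intro integrable_convolution) (auto simp: exp_decay_def)
  then have "integrable (lborel \<Otimes>\<^sub>M lborel) (\<lambda>(\<xi>, \<eta>). complex_of_real (exp (c * japanese \<xi>)) * (f (\<xi> - \<eta>) * h \<eta>))"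
  proof (rule Bochner_Integration.integrable_bound)
    show "AE z in lborel \<Otimes>\<^sub>M lborel. cmod (case z of (\<xi>, \<eta>) \<Rightarrow> complex_of_real (exp (c * japanese \<xi>)) * (f (\<xi> - \<eta>) * h \<eta>)) \<le>
        cmod (case z of (\<xi>, \<eta>) \<Rightarrow> ?f (\<xi> - \<eta>) * ?h \<eta>)"
    proof (intro AE_I2, clarsimp simp only: norm_mult norm_of_real abs_exp_cancel split: prod.splits)
      fix \<xi> \<eta>
      have "exp (c * japanese \<xi>) \<le> exp (c * japanese (\<xi> - \<eta>)) * exp (c * japanese \<eta>)"
        unfolding mult_exp_exp distrib_left[symmetric] using c japanese_le_split by simp
      then have "exp (c * japanese \<xi>) * (cmod (f (\<xi> - \<eta>)) * cmod (h \<eta>)) \<le>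
          (exp (c * japanese (\<xi> - \<eta>)) * exp (c * japanese \<eta>)) * (cmod (f (\<xi> - \<eta>)) * cmod (h \<eta>))"
        by (rule mult_right_mono) simp
      then show "exp (c * japanese \<xi>) * (cmod (f (\<xi> - \<eta>)) * cmod (h \<eta>)) \<le>
          exp (c * japanese (\<xi> - \<eta>)) * cmod (f (\<xi> - \<eta>)) * (exp (c * japanese \<eta>) * cmod (h \<eta>))"
        by (simp only: mult_ac)
    qed
  qed measurable
  from lborel_pair.integrable_fst'[OF this]
  have int: "integrable lborel (\<lambda>\<xi>. LBINT \<eta>. complex_of_real (exp (c * japanese \<xi>)) * (f (\<xi> - \<eta>) * h \<eta>))"
    by simp
  have "integrable lborel (\<lambda>\<xi>. complex_of_real (1 / sqrt (2 * pi)) *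
      (LBINT \<eta>. complex_of_real (exp (c * japanese \<xi>)) * (f (\<xi> - \<eta>) * h \<eta>)))"
    by (rule integrable_mult_right) (rule int)
  moreover have "complex_of_real (1 / sqrt (2 * pi)) *
      (LBINT \<eta>. complex_of_real (exp (c * japanese \<xi>)) * (f (\<xi> - \<eta>) * h \<eta>)) =
      complex_of_real (exp (c * japanese \<xi>)) * conv f h \<xi>" for \<xi>
    unfolding Bochner_Integration.integral_mult_right_zero conv_eq by (rule mult.left_commute)
  ultimately show ?thesis using c unfolding exp_decay_def by (simp only:)
qed

lemma ift_eq: "ift h x = complex_of_real (1 / sqrt (2 * pi)) * (LBINT \<xi>. exp (\<i> * complex_of_real (x * \<xi>)) * h \<xi>)"
  by (simp add: ift_def ft_def mult.commute)

lemma integrable_ift: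
  "integrable lborel h \<Longrightarrow> integrable lborel (\<lambda>\<xi>. exp (\<i> * complex_of_real (x * \<xi>)) * h \<xi>)"
  using integrable_character_mult[of h "- x"] by (simp add: mult.commute)

lemma ift_conv:
  assumes f: "integrable lborel f" and h: "integrable lborel h"
  shows "ift (conv f h) x = ift f x * ift h x"
proof -
  define F where "F \<xi> = exp (\<i> * complex_of_real (x * \<xi>)) * f \<xi>" for \<xi>
  define H where "H \<xi> = exp (\<i> * complex_of_real (x * \<xi>)) * h \<xi>" for \<xi>
  have Fi: "integrable lborel F" "integrable lborel H"
    using integrable_ift[OF f, of x] integrable_ift[OF h, of x] by (simp_all only: F_def[abs_def] H_def[abs_def])
  have FH: "exp (\<i> * complex_of_real (x * \<xi>)) * (f (\<xi> - \<eta>) * h \<eta>) = F (\<xi> - \<eta>) * H \<eta>" for \<xi> \<eta>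
  proof -
    have "exp (\<i> * complex_of_real (x * \<xi>)) = exp (\<i> * complex_of_real (x * (\<xi> - \<eta>))) * exp (\<i> * complex_of_real (x * \<eta>))"
      unfolding mult_exp_exp by (simp add: algebra_simps)
    then show ?thesis unfolding F_def H_def by (simp only: mult_ac)
  qed
  have int: "integrable (lborel \<Otimes>\<^sub>M lborel) (\<lambda>(\<xi>, \<eta>). F (\<xi> - \<eta>) * H \<eta>)"
    by (rule integrable_convolution[OF Fi])
  have "(LBINT \<xi>. LBINT \<eta>. F (\<xi> - \<eta>) * H \<eta>) = (LBINT \<eta>. LBINT \<xi>. F (\<xi> - \<eta>) * H \<eta>)"
    by (rule lborel_pair.Fubini_integral[symmetric, OF int])
  also have "\<dots> = (LBINT \<eta>. (LBINT \<xi>. F \<xi>) * H \<eta>)"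
  proof -
    have "(LBINT \<xi>. F (\<xi> - \<eta>)) = (LBINT \<xi>. F \<xi>)" for \<eta>
      using lborel_integral_real_affine[of 1 F "- \<eta>"] by simp
    then show ?thesis by simp
  qed
  also have "\<dots> = (LBINT \<xi>. F \<xi>) * (LBINT \<eta>. H \<eta>)" by simp
  finally have main: "(LBINT \<xi>. LBINT \<eta>. F (\<xi> - \<eta>) * H \<eta>) = (LBINT \<xi>. F \<xi>) * (LBINT \<eta>. H \<eta>)" .
  have "(LBINT \<xi>. exp (\<i> * complex_of_real (x * \<xi>)) * conv f h \<xi>) =
      complex_of_real (1 / sqrt (2 * pi)) * (LBINT \<xi>. LBINT \<eta>. F (\<xi> - \<eta>) * H \<eta>)"
  proof -
    have inner: "(LBINT \<eta>. F (\<xi> - \<eta>) * H \<eta>) = exp (\<i> * complex_of_real (x * \<xi>)) * (LBINT \<eta>. f (\<xi> - \<eta>) * h \<eta>)" for \<xi>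
      by (simp only: FH[symmetric] Bochner_Integration.integral_mult_right_zero)
    have "exp (\<i> * complex_of_real (x * \<xi>)) * conv f h \<xi> =
        complex_of_real (1 / sqrt (2 * pi)) * (LBINT \<eta>. F (\<xi> - \<eta>) * H \<eta>)" for \<xi>
      unfolding inner conv_eq by (rule mult.left_commute)
    then show ?thesis by (simp only: Bochner_Integration.integral_mult_right_zero)
  qed
  also note main
  finally show ?thesis unfolding ift_eq F_def[symmetric] H_def[symmetric] by (simp only: mult_ac)
qed

lemma ift_cmult: "ift (\<lambda>\<xi>. k * f \<xi>) x = k * ift f x"
  unfolding ift_eq by (simp add: mult.left_commute[of _ k])

lemma ift_add:
  assumes "integrable lborel f" "integrable lborel h"
  shows "ift (\<lambda>\<xi>. f \<xi> + h \<xi>) x = ift f x + ift h x"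
  using integrable_ift[OF assms(1), of x] integrable_ift[OF assms(2), of x]
  unfolding ift_eq distrib_left by (subst Bochner_Integration.integral_add) (simp_all only: distrib_left)

lemma ift_til: "ift (til f) x = cnj (ift f x)"
  unfolding ift_def til_def cnj_ft using ft_reflect[of "\<lambda>\<xi>. cnj (f \<xi>)" "- x"] by simp

lemma ift_cong_AE:
  assumes "AE \<xi> in lborel. f \<xi> = h \<xi>" "f \<in> borel_measurable borel" "h \<in> borel_measurable borel"
  shows "ift f x = ift h x"
  unfolding ift_eq
  by (intro arg_cong2[where f="(*)"] refl integral_cong_AE) (use assms in auto)

text \<open>Dominated convergence for the linearisation error: by the mean value inequality it is at
  most 2m times the increment. \<open>S\<close> may be a closed time interval, which covers
  one-sided derivatives.\<close>

lemma has_vector_derivative_integral: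
  fixes h h' :: "real \<Rightarrow> real \<Rightarrow> complex"
  assumes S: "convex S" and t0: "t0 \<in> S" and int: "\<And>t. t \<in> S \<Longrightarrow> integrable lborel (h t)"
    and int': "integrable lborel (h' t0)" and m: "integrable lborel m"
    and der: "AE \<xi> in lborel. \<forall>t\<in>S. ((\<lambda>t. h t \<xi>) has_vector_derivative h' t \<xi>) (at t within S)"
    and bd: "AE \<xi> in lborel. \<forall>t\<in>S. cmod (h' t \<xi>) \<le> m \<xi>"
  shows "((\<lambda>t. LBINT \<xi>. h t \<xi>) has_vector_derivative (LBINT \<xi>. h' t0 \<xi>)) (at t0 within S)"
  unfolding has_vector_derivative_def has_derivative_within
proof
  show "bounded_linear (\<lambda>x. x *\<^sub>R (LBINT \<xi>. h' t0 \<xi>))" by (rule bounded_linear_scaleR_left)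
  let ?q = "\<lambda>t \<xi>. (1 / norm (t - t0)) *\<^sub>R (h t \<xi> - (h t0 \<xi> + (t - t0) *\<^sub>R h' t0 \<xi>))"
  have "((\<lambda>t. LBINT \<xi>. ?q t \<xi>) \<longlongrightarrow> (LBINT \<xi>::real. 0)) (at t0 within S)"
    unfolding tendsto_at_iff_sequentially comp_def
  proof (intro allI impI)
    fix X :: "nat \<Rightarrow> real" assume X: "\<forall>i. X i \<in> S - {t0}" "X \<longlonglongrightarrow> t0"
    then have XS: "X i \<in> S" "X i \<noteq> t0" for i by auto
    show "(\<lambda>i. LBINT \<xi>. ?q (X i) \<xi>) \<longlonglongrightarrow> (LBINT \<xi>::real. 0)"
    proof (rule integral_dominated_convergence[where w="\<lambda>\<xi>. 2 * m \<xi>"])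
      show "integrable lborel (\<lambda>\<xi>. 2 * m \<xi>)" using m by simp
      have [measurable]: "h (X i) \<in> borel_measurable lborel" "h t0 \<in> borel_measurable lborel" "h' t0 \<in> borel_measurable lborel" for i
        using int[OF XS(1)] int[OF t0] int' by auto
      show "?q (X i) \<in> borel_measurable lborel" for i by measurable
      show "AE \<xi> in lborel. (\<lambda>i. ?q (X i) \<xi>) \<longlonglongrightarrow> 0"
        using der
      proof eventually_elim
        case (elim \<xi>)
        then have "((\<lambda>t. ?q t \<xi>) \<longlongrightarrow> 0) (at t0 within S)"
          using t0 unfolding has_vector_derivative_def has_derivative_within by blast
        then show ?case using X unfolding tendsto_at_iff_sequentially comp_def by blast
      qed
      show "AE \<xi> in lborel. norm (?q (X i) \<xi>) \<le> 2 * m \<xi>" for i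
        using der bd
      proof eventually_elim
        case (elim \<xi>)
        have "norm (h (X i) \<xi> - h t0 \<xi> - (X i - t0) *\<^sub>R h' t0 \<xi>) \<le> norm (X i - t0) * (2 * m \<xi>)"
        proof (rule vector_differentiable_bound_linearization[where S=S and f="\<lambda>t. h t \<xi>" and f'="\<lambda>t. h' t \<xi>" and ?x0.0=t0])
          show "closed_segment t0 (X i) \<subseteq> S" using S t0 XS by (simp add: closed_segment_subset)
          fix t assume t: "t \<in> S"
          have "norm (h' t \<xi> - h' t0 \<xi>) \<le> cmod (h' t \<xi>) + cmod (h' t0 \<xi>)" by (rule norm_triangle_ineq4)
          also have "\<dots> \<le> m \<xi> + m \<xi>" using elim(2) t t0 by (intro add_mono) blast+
          also have "\<dots> = 2 * m \<xi>" by simp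
          finally show "norm (h' t \<xi> - h' t0 \<xi>) \<le> 2 * m \<xi>" .
        qed (use elim t0 in auto)
        moreover have "\<bar>1 / norm d\<bar> * norm D \<le> 2 * c" if "norm D \<le> norm d * (2 * c)" "d \<noteq> 0" for D :: complex and c d :: real
          using that by (simp add: field_simps)
        ultimately show ?case unfolding norm_scaleR diff_diff_eq[symmetric] using XS(2)[of i] by simp
      qed
    qed simp
  qed
  then have lim: "((\<lambda>t. LBINT \<xi>. ?q t \<xi>) \<longlongrightarrow> 0) (at t0 within S)" by simp
  have eq: "(LBINT \<xi>. ?q t \<xi>) = (1 / norm (t - t0)) *\<^sub>R ((LBINT \<xi>. h t \<xi>) - ((LBINT \<xi>. h t0 \<xi>) + (t - t0) *\<^sub>R (LBINT \<xi>. h' t0 \<xi>)))"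
    if "t \<in> S" for t
    using int[OF that] int[OF t0] int' by simp
  show "((\<lambda>t. (1 / norm (t - t0)) *\<^sub>R ((LBINT \<xi>. h t \<xi>) - ((LBINT \<xi>. h t0 \<xi>) + (t - t0) *\<^sub>R (LBINT \<xi>. h' t0 \<xi>)))) \<longlongrightarrow> 0) (at t0 within S)"
    by (rule Lim_cong_within[OF refl refl refl, THEN iffD1, OF _ lim]) (rule eq)
qed

lemma ift_has_vector_derivative:
  assumes h: "exp_decay c h"
  shows "((\<lambda>x. ift h x) has_vector_derivative ift (\<lambda>\<xi>. \<i> * complex_of_real \<xi> * h \<xi>) x) (at x)"
proof -
  have c: "0 < c" using h by (simp add: exp_decay_def)
  have ih: "integrable lborel h" by (rule exp_decay_integrable[OF h])
  have ih': "integrable lborel (\<lambda>\<xi>. \<i> * complex_of_real \<xi> * h \<xi>)"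
  proof -
    have "exp_decay (c / 2) (\<lambda>\<xi>. (\<i> * complex_of_real \<xi>) * h \<xi>)"
      using c by (intro exp_decay_mult[OF h, where k=1 and C=1]) (auto simp: norm_mult abs_le_japanese)
    then show ?thesis by (rule exp_decay_integrable)
  qed
  have "((\<lambda>x. LBINT \<xi>. exp (\<i> * complex_of_real (x * \<xi>)) * h \<xi>) has_vector_derivative
      (LBINT \<xi>. exp (\<i> * complex_of_real (x * \<xi>)) * (\<i> * complex_of_real \<xi> * h \<xi>))) (at x within UNIV)"
  proof (rule has_vector_derivative_integral[where m="\<lambda>\<xi>. cmod (\<i> * complex_of_real \<xi> * h \<xi>)"])
    show "integrable lborel (\<lambda>\<xi>. exp (\<i> * complex_of_real (t * \<xi>)) * h \<xi>)" for t by (rule integrable_ift[OF ih])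
    show "integrable lborel (\<lambda>\<xi>. exp (\<i> * complex_of_real (x * \<xi>)) * (\<i> * complex_of_real \<xi> * h \<xi>))" by (rule integrable_ift[OF ih'])
    show "integrable lborel (\<lambda>\<xi>. cmod (\<i> * complex_of_real \<xi> * h \<xi>))" using ih' by (rule integrable_norm)
    have "((\<lambda>t. exp (\<i> * complex_of_real (t * \<xi>)) * h \<xi>) has_vector_derivative
        exp (\<i> * complex_of_real (t * \<xi>)) * (\<i> * complex_of_real \<xi> * h \<xi>)) (at t)" for t \<xi>
    proof -
      have "((\<lambda>t. exp (\<i> * (t * complex_of_real \<xi>)) * h \<xi>) has_field_derivative
          exp (\<i> * (complex_of_real t * complex_of_real \<xi>)) * (\<i> * complex_of_real \<xi> * h \<xi>)) (at (complex_of_real t))"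
        by (auto intro!: derivative_eq_intros)
      from has_vector_derivative_real_field[OF this] show ?thesis by (simp add: o_def)
    qed
    then show "AE \<xi> in lborel. \<forall>t\<in>UNIV. ((\<lambda>t. exp (\<i> * complex_of_real (t * \<xi>)) * h \<xi>) has_vector_derivative
        exp (\<i> * complex_of_real (t * \<xi>)) * (\<i> * complex_of_real \<xi> * h \<xi>)) (at t within UNIV)" by simp
    show "AE \<xi> in lborel. \<forall>t\<in>UNIV. cmod (exp (\<i> * complex_of_real (t * \<xi>)) * (\<i> * complex_of_real \<xi> * h \<xi>)) \<le> cmod (\<i> * complex_of_real \<xi> * h \<xi>)"
      by (intro AE_I2 ballI) (simp only: norm_mult[of "exp (\<i> * complex_of_real _)"] norm_exp_imaginary mult_1_left order_refl)
  qed auto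
  from has_vector_derivative_mult_right[OF this, of "complex_of_real (1 / sqrt (2 * pi))"]
  show ?thesis unfolding ift_eq by simp
qed

section \<open>The nonlinear terms on the Fourier side\<close>

text \<open>The unknowns are indexed by \<^typ>\<open>bool\<close>: \<^term>\<open>False\<close> stands for
  $\langle\xi\rangle\hat\phi$ and \<^term>\<open>True\<close> for $\hat a$, so that both lie in the same
  weighted space.\<close>

definition deriv_symbol :: "(real \<Rightarrow> complex) \<Rightarrow> real \<Rightarrow> complex" where
  "deriv_symbol f \<xi> = (\<i> * complex_of_real (\<xi> / japanese \<xi>)) * f \<xi>"

text \<open>If \<open>f\<close> and \<open>h\<close> are transforms, this is the transform of the
  first function times the derivative of the second, divided by the bracket.\<close>

definition conv_deriv :: "(real \<Rightarrow> complex) \<Rightarrow> (real \<Rightarrow> complex) \<Rightarrow> real \<Rightarrow> complex" where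
  "conv_deriv = bil (\<lambda>\<xi> \<eta>. \<i> * complex_of_real (\<eta> / (japanese \<xi> * sqrt (2 * pi))))"

text \<open>Transform of the power \<open>Suc k\<close> of the squared modulus. Index 0 is the first
  power, so positive exponents enter as \<open>\<gamma> - 1\<close> and
  \<open>\<sigma> - 1\<close>.\<close>

primrec modulus_power :: "nat \<Rightarrow> (real \<Rightarrow> complex) \<Rightarrow> real \<Rightarrow> complex" where
  "modulus_power 0 f = conv f (til f)"
| "modulus_power (Suc k) f = conv (modulus_power k f) (conv f (til f))"

text \<open>The transform of minus the nonlinear terms of the phase equation; the bracket in
  \<open>duh\<close> turns it into the equation for <xi> times the transform of phi.\<close>

definition source_phase :: "real \<Rightarrow> real \<Rightarrow> nat \<Rightarrow> nat \<Rightarrow> (bool \<Rightarrow> real \<Rightarrow> complex) \<Rightarrow> real \<Rightarrow> complex" where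
  "source_phase \<alpha> lam \<gamma> \<sigma> u \<xi> =
     - (1/2) * conv (deriv_symbol (u False)) (deriv_symbol (u False)) \<xi> +
     (- (complex_of_real \<alpha> / 2) * conv (modulus_power (\<gamma> - 1) (u True)) (deriv_symbol (u False)) \<xi> +
      - complex_of_real lam * modulus_power (\<sigma> - 1) (u True) \<xi>)"

text \<open>The amplitude unknown carries no bracket, so here the nonlinear terms are divided by
  <xi>. In terms of the two unknowns each of them contains exactly one derivative, including the one
  with the second derivative of phi.\<close>

definition source_amplitude :: "real \<Rightarrow> nat \<Rightarrow> (bool \<Rightarrow> real \<Rightarrow> complex) \<Rightarrow> real \<Rightarrow> complex" where
  "source_amplitude \<alpha> \<gamma> u \<xi> =
     - 1 * conv_deriv (deriv_symbol (u False)) (u True) \<xi> +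
     (- (1/2) * conv_deriv (u True) (deriv_symbol (u False)) \<xi> +
      - (complex_of_real \<alpha> / 2) * deriv_symbol (conv (modulus_power (\<gamma> - 1) (u True)) (u True)) \<xi>)"

lemma inverse_sqrt_2pi_le: "1 / sqrt (2 * pi) \<le> 1"
  using pi_gt3 by (simp add: real_le_rsqrt)

lemma bilkernel_conv: "bilkernel (\<lambda>_ _. complex_of_real (1 / sqrt (2 * pi)))"
  unfolding bilkernel_def
proof (intro conjI allI)
  fix \<xi> \<eta>
  have "cmod (complex_of_real (1 / sqrt (2 * pi))) \<le> 1"
    unfolding norm_of_real using inverse_sqrt_2pi_le by simp
  also have "1 \<le> (japanese (\<xi> - \<eta>) + japanese \<eta>) / japanese \<xi>"
    using japanese_le_split[of \<xi> \<eta>] by (simp add: le_divide_eq)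
  finally show "cmod (complex_of_real (1 / sqrt (2 * pi))) \<le> (japanese (\<xi> - \<eta>) + japanese \<eta>) / japanese \<xi>" .
qed simp

lemma bilkernel_conv_deriv: "bilkernel (\<lambda>\<xi> \<eta>. \<i> * complex_of_real (\<eta> / (japanese \<xi> * sqrt (2 * pi))))"
  unfolding bilkernel_def
proof (intro conjI allI)
  fix \<xi> \<eta>
  have "cmod (\<i> * complex_of_real (\<eta> / (japanese \<xi> * sqrt (2 * pi)))) = (\<bar>\<eta>\<bar> / japanese \<xi>) * (1 / sqrt (2 * pi))"
    by (simp only: norm_mult norm_ii norm_of_real abs_divide abs_mult) simp
  also have "\<dots> \<le> (\<bar>\<eta>\<bar> / japanese \<xi>) * 1" by (intro mult_left_mono inverse_sqrt_2pi_le) simp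
  also have "\<dots> \<le> (japanese (\<xi> - \<eta>) + japanese \<eta>) / japanese \<xi>"
    unfolding mult_1_right using abs_le_japanese[of \<eta>] japanese_pos(2)[of "\<xi> - \<eta>"]
    by (intro divide_right_mono japanese_pos(2)) linarith
  finally show "cmod (\<i> * complex_of_real (\<eta> / (japanese \<xi> * sqrt (2 * pi)))) \<le> (japanese (\<xi> - \<eta>) + japanese \<eta>) / japanese \<xi>" .
next
  show "(\<lambda>p. \<i> * complex_of_real (snd p / (japanese (fst p) * sqrt (2 * pi)))) \<in> borel_measurable borel"
    unfolding borel_prod[symmetric] by measurable
qed

lemma norm_deriv_factor: "cmod (\<i> * complex_of_real (\<xi> / japanese \<xi>)) \<le> 1"
  using abs_le_japanese[of \<xi>] by (simp only: norm_mult norm_ii norm_of_real abs_divide) (simp add: divide_le_eq)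

lemma measurable_deriv_symbol [measurable]:
  assumes [measurable]: "f \<in> borel_measurable borel"
  shows "deriv_symbol f \<in> borel_measurable borel"
  unfolding deriv_symbol_def[abs_def] by measurable

lemma lip_deriv_symbol: "lip st l N \<Longrightarrow> lip st l (\<lambda>u. deriv_symbol (N u))"
  unfolding deriv_symbol_def[abs_def] by (rule lip_mult[OF _ _ norm_deriv_factor]) measurable

lemma lip_conv: "l \<ge> 1 \<Longrightarrow> lip False l N1 \<Longrightarrow> lip False l N2 \<Longrightarrow> lip True l (\<lambda>u. conv (N1 u) (N2 u))"
  unfolding conv_def by (intro lip_bil bilkernel_conv)

lemma lip_conv_deriv: "l \<ge> 1 \<Longrightarrow> lip False l N1 \<Longrightarrow> lip False l N2 \<Longrightarrow> lip True l (\<lambda>u. conv_deriv (N1 u) (N2 u))"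
  unfolding conv_deriv_def by (intro lip_bil bilkernel_conv_deriv)

lemma lip_modulus_power: "l \<ge> 1 \<Longrightarrow> lip False l N \<Longrightarrow> lip True l (\<lambda>u. modulus_power k (N u))"
proof (induction k)
  case 0 then show ?case by (simp add: lip_conv lip_til)
next
  case (Suc k)
  show ?case unfolding modulus_power.simps
    by (intro lip_conv lip_weaken[OF Suc.IH] lip_weaken[OF lip_conv] lip_til Suc.prems)
qed

lemma lip_cmult: "lip st l N \<Longrightarrow> lip st l (\<lambda>u \<xi>. k * N u \<xi>)"
  by (rule lip_mult[where C="cmod k"]) auto

lemma lip_source_phase: "l \<ge> 1 \<Longrightarrow> lip True l (source_phase \<alpha> lam \<gamma> \<sigma>)"
  unfolding source_phase_def[abs_def]
  by (intro lip_add lip_cmult lip_conv lip_deriv_symbol lip_weaken[OF lip_modulus_power] lip_modulus_power lip_proj)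

lemma lip_source_amplitude: "l \<ge> 1 \<Longrightarrow> lip True l (source_amplitude \<alpha> \<gamma>)"
  unfolding source_amplitude_def[abs_def]
  by (intro lip_add lip_cmult lip_conv lip_conv_deriv lip_deriv_symbol lip_weaken[OF lip_modulus_power] lip_proj)

lemma conv_deriv_eq: "conv_deriv f h \<xi> = complex_of_real (1 / japanese \<xi>) * conv f (\<lambda>\<eta>. \<i> * complex_of_real \<eta> * h \<eta>) \<xi>"
proof -
  have eq: "\<i> * complex_of_real (\<eta> / (japanese \<xi> * sqrt (2 * pi))) * (f (\<xi> - \<eta>) * h \<eta>) =
      complex_of_real (1 / japanese \<xi>) * (complex_of_real (1 / sqrt (2 * pi)) * (f (\<xi> - \<eta>) * (\<i> * complex_of_real \<eta> * h \<eta>)))" for \<eta>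
    by (simp add: field_simps)
  show ?thesis unfolding conv_deriv_def conv_def bil_def eq
    by (simp only: Bochner_Integration.integral_mult_right_zero)
qed

lemma ift_modulus_power:
  assumes "exp_decay c f"
  shows "exp_decay c (modulus_power k f)" "ift (modulus_power k f) x = (complex_of_real ((cmod (ift f x))\<^sup>2)) ^ Suc k"
proof -
  have f: "integrable lborel f" "integrable lborel (til f)"
    using exp_decay_integrable[OF assms] exp_decay_integrable[OF exp_decay_til[OF assms]] by auto
  have c: "exp_decay c (conv f (til f))" by (intro exp_decay_conv exp_decay_til assms)
  have b: "ift (conv f (til f)) x = complex_of_real ((cmod (ift f x))\<^sup>2)"
    by (simp only: ift_conv[OF f] ift_til complex_norm_square)
  have "exp_decay c (modulus_power k f) \<and> ift (modulus_power k f) x = (complex_of_real ((cmod (ift f x))\<^sup>2)) ^ Suc k"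
  proof (induction k)
    case 0 then show ?case using b c by simp
  next
    case (Suc k)
    then show ?case
      using c by (auto simp: exp_decay_conv ift_conv[OF exp_decay_integrable exp_decay_integrable] b mult.commute simp del: of_real_power)
  qed
  then show "exp_decay c (modulus_power k f)" "ift (modulus_power k f) x = (complex_of_real ((cmod (ift f x))\<^sup>2)) ^ Suc k"
    by auto
qed

lemma exp_decay_pos: "exp_decay c f \<Longrightarrow> 0 < c"
  by (simp add: exp_decay_def)

lemma exp_decay_derivative:
  assumes h: "exp_decay c h" and d: "0 < d" "d < c"
  shows "exp_decay d (\<lambda>\<xi>. \<i> * complex_of_real \<xi> * h \<xi>)"
  using d by (intro exp_decay_mult[OF h, where k=1 and C=1]) (auto simp: norm_mult abs_le_japanese)

lemma deriv_symbol_japanese: "deriv_symbol (\<lambda>\<xi>. complex_of_real (japanese \<xi>) * p \<xi>) = (\<lambda>\<xi>. \<i> * complex_of_real \<xi> * p \<xi>)"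
  by (simp add: deriv_symbol_def fun_eq_iff)

text \<open>Convolutions become products and the derivative symbol becomes multiplication by i xi.
  The drop of the rate from \<open>c\<close> to \<open>d\<close> pays for the derivative of the
  phase.\<close>

lemma ift_source_phase:
  assumes p: "exp_decay c p" and b: "exp_decay c b" and \<gamma>: "\<gamma> \<ge> 1" and \<sigma>: "\<sigma> \<ge> 1" and d: "0 < d" "d < c"
  defines "u \<equiv> \<lambda>i. if i then b else (\<lambda>\<xi>. complex_of_real (japanese \<xi>) * p \<xi>)"
  shows "exp_decay d (source_phase \<alpha> lam \<gamma> \<sigma> u)"
    and "ift (source_phase \<alpha> lam \<gamma> \<sigma> u) x =
      - (1 / 2 * (ift (\<lambda>\<xi>. \<i> * complex_of_real \<xi> * p \<xi>) x)\<^sup>2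
         + 1 / 2 * complex_of_real (\<alpha> * ((cmod (ift b x))\<^sup>2) ^ \<gamma>) * ift (\<lambda>\<xi>. \<i> * complex_of_real \<xi> * p \<xi>) x
         + complex_of_real (lam * ((cmod (ift b x))\<^sup>2) ^ \<sigma>))"
proof -
  let ?q = "\<lambda>\<xi>. \<i> * complex_of_real \<xi> * p \<xi>"
  have q: "exp_decay d ?q" by (rule exp_decay_derivative[OF p d])
  have bd: "exp_decay d b" using exp_decay_mono[OF b] d by simp
  note mp = ift_modulus_power[OF bd]
  have eq: "source_phase \<alpha> lam \<gamma> \<sigma> u = (\<lambda>\<xi>. - (1/2) * conv ?q ?q \<xi> +
     (- (complex_of_real \<alpha> / 2) * conv (modulus_power (\<gamma> - 1) b) ?q \<xi> + - complex_of_real lam * modulus_power (\<sigma> - 1) b \<xi>))"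
    by (simp add: source_phase_def fun_eq_iff u_def deriv_symbol_japanese)
  have e: "exp_decay d (\<lambda>\<xi>. - (1/2) * conv ?q ?q \<xi>)"
    "exp_decay d (\<lambda>\<xi>. - (complex_of_real \<alpha> / 2) * conv (modulus_power (\<gamma> - 1) b) ?q \<xi>)"
    "exp_decay d (\<lambda>\<xi>. - complex_of_real lam * modulus_power (\<sigma> - 1) b \<xi>)"
    by (intro exp_decay_cmult exp_decay_conv q mp)+
  show "exp_decay d (source_phase \<alpha> lam \<gamma> \<sigma> u)" unfolding eq by (intro exp_decay_add e)
  have "ift (source_phase \<alpha> lam \<gamma> \<sigma> u) x = - (1/2) * (ift ?q x * ift ?q x) +
     (- (complex_of_real \<alpha> / 2) * (ift (modulus_power (\<gamma> - 1) b) x * ift ?q x) + - complex_of_real lam * ift (modulus_power (\<sigma> - 1) b) x)"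
    unfolding eq
    by (subst ift_add[OF exp_decay_integrable[OF e(1)] exp_decay_integrable[OF exp_decay_add[OF e(2,3)]]],
        subst ift_add[OF exp_decay_integrable[OF e(2)] exp_decay_integrable[OF e(3)]])
      (simp only: ift_cmult ift_conv[OF exp_decay_integrable[OF q] exp_decay_integrable[OF q]]
        ift_conv[OF exp_decay_integrable[OF mp(1)] exp_decay_integrable[OF q]])
  moreover have "Suc (\<gamma> - 1) = \<gamma>" "Suc (\<sigma> - 1) = \<sigma>" using \<gamma> \<sigma> by auto
  ultimately show "ift (source_phase \<alpha> lam \<gamma> \<sigma> u) x =
      - (1 / 2 * (ift ?q x)\<^sup>2 + 1 / 2 * complex_of_real (\<alpha> * ((cmod (ift b x))\<^sup>2) ^ \<gamma>) * ift ?q x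
         + complex_of_real (lam * ((cmod (ift b x))\<^sup>2) ^ \<sigma>))"
    unfolding mp by (simp add: power2_eq_square algebra_simps)
qed

text \<open>The bracket multiplied in front cancels the one divided out in the source, leaving
  convolutions of true derivatives.\<close>

lemma ift_source_amplitude:
  assumes p: "exp_decay c p" and b: "exp_decay c b" and \<gamma>: "\<gamma> \<ge> 1" and d: "0 < d" "d < c"
  defines "u \<equiv> \<lambda>i. if i then b else (\<lambda>\<xi>. complex_of_real (japanese \<xi>) * p \<xi>)"
  shows "exp_decay d (\<lambda>\<xi>. complex_of_real (japanese \<xi>) * source_amplitude \<alpha> \<gamma> u \<xi>)"
    and "ift (\<lambda>\<xi>. complex_of_real (japanese \<xi>) * source_amplitude \<alpha> \<gamma> u \<xi>) x =
      - (ift (\<lambda>\<xi>. \<i> * complex_of_real \<xi> * p \<xi>) x * ift (\<lambda>\<xi>. \<i> * complex_of_real \<xi> * b \<xi>) x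
         + 1 / 2 * ift b x * ift (\<lambda>\<xi>. \<i> * complex_of_real \<xi> * (\<i> * complex_of_real \<xi> * p \<xi>)) x
         + 1 / 2 * vector_derivative (\<lambda>y. complex_of_real (\<alpha> * ((cmod (ift b y))\<^sup>2) ^ \<gamma>) * ift b y) (at x))"
proof -
  let ?q = "\<lambda>\<xi>. \<i> * complex_of_real \<xi> * p \<xi>"
  let ?r = "\<lambda>\<xi>. \<i> * complex_of_real \<xi> * b \<xi>"
  let ?s = "\<lambda>\<xi>. \<i> * complex_of_real \<xi> * ?q \<xi>"
  let ?G = "conv (modulus_power (\<gamma> - 1) b) b"
  let ?g = "\<lambda>\<xi>. \<i> * complex_of_real \<xi> * ?G \<xi>"
  have bd: "exp_decay d b" using exp_decay_mono[OF b] d by simp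
  have q: "exp_decay d ?q" and r: "exp_decay d ?r"
    by (rule exp_decay_derivative[OF p d], rule exp_decay_derivative[OF b d])
  \<comment> \<open>Two derivatives are taken in turn; the midpoint of the rates is reserved for the
    first of them.\<close>
  have "exp_decay ((c + d) / 2) ?q" using d by (intro exp_decay_derivative[OF p]) auto
  then have s: "exp_decay d ?s" by (rule exp_decay_derivative) (use d in auto)
  note mp = ift_modulus_power[OF b] and mpd = ift_modulus_power[OF bd]
  have Gc: "exp_decay c ?G" by (intro exp_decay_conv mp b)
  have g: "exp_decay d ?g" by (rule exp_decay_derivative[OF Gc d])
  have eq: "(\<lambda>\<xi>. complex_of_real (japanese \<xi>) * source_amplitude \<alpha> \<gamma> u \<xi>) =
     (\<lambda>\<xi>. - 1 * conv ?q ?r \<xi> + (- (1/2) * conv b ?s \<xi> + - (complex_of_real \<alpha> / 2) * ?g \<xi>))"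
  proof
    fix \<xi>
    have alg: "j * (- 1 * (1 / j * A) + (- (1/2) * (1 / j * B) + - (a / 2) * ((\<i> * (y / j)) * C))) =
        - 1 * A + (- (1/2) * B + - (a / 2) * (\<i> * y * C))" if "j \<noteq> 0" for j A B C a y :: complex
      using that by (simp add: field_simps)
    show "complex_of_real (japanese \<xi>) * source_amplitude \<alpha> \<gamma> u \<xi> =
        - 1 * conv ?q ?r \<xi> + (- (1/2) * conv b ?s \<xi> + - (complex_of_real \<alpha> / 2) * ?g \<xi>)"
      unfolding source_amplitude_def conv_deriv_eq u_def if_True if_False deriv_symbol_japanese
        deriv_symbol_def[of "conv _ _"] of_real_divide of_real_1
      by (rule alg) simp
  qed
  have e: "exp_decay d (\<lambda>\<xi>. - 1 * conv ?q ?r \<xi>)" "exp_decay d (\<lambda>\<xi>. - (1/2) * conv b ?s \<xi>)"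
    "exp_decay d (\<lambda>\<xi>. - (complex_of_real \<alpha> / 2) * ?g \<xi>)"
    by (intro exp_decay_cmult exp_decay_conv q r bd s g)+
  show "exp_decay d (\<lambda>\<xi>. complex_of_real (japanese \<xi>) * source_amplitude \<alpha> \<gamma> u \<xi>)"
    unfolding eq by (intro exp_decay_add e)
  have v: "vector_derivative (\<lambda>y. complex_of_real (\<alpha> * ((cmod (ift b y))\<^sup>2) ^ \<gamma>) * ift b y) (at x) =
      complex_of_real \<alpha> * ift ?g x"
  proof (rule vector_derivative_at)
    have "Suc (\<gamma> - 1) = \<gamma>" using \<gamma> by auto
    then have "(\<lambda>y. complex_of_real (\<alpha> * ((cmod (ift b y))\<^sup>2) ^ \<gamma>) * ift b y) = (\<lambda>y. complex_of_real \<alpha> * ift ?G y)"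
      by (simp add: ift_conv[OF exp_decay_integrable[OF mp(1)] exp_decay_integrable[OF b]] mp mult.assoc)
    moreover have "((\<lambda>y. complex_of_real \<alpha> * ift ?G y) has_vector_derivative complex_of_real \<alpha> * ift ?g x) (at x)"
      by (rule has_vector_derivative_mult_right[OF ift_has_vector_derivative[OF Gc]])
    ultimately show "((\<lambda>y. complex_of_real (\<alpha> * ((cmod (ift b y))\<^sup>2) ^ \<gamma>) * ift b y) has_vector_derivative
        complex_of_real \<alpha> * ift ?g x) (at x)" by (simp only:)
  qed
  have "ift (\<lambda>\<xi>. complex_of_real (japanese \<xi>) * source_amplitude \<alpha> \<gamma> u \<xi>) x =
      - 1 * (ift ?q x * ift ?r x) + (- (1/2) * (ift b x * ift ?s x) + - (complex_of_real \<alpha> / 2) * ift ?g x)"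
    unfolding eq
    by (subst ift_add[OF exp_decay_integrable[OF e(1)] exp_decay_integrable[OF exp_decay_add[OF e(2,3)]]],
        subst ift_add[OF exp_decay_integrable[OF e(2)] exp_decay_integrable[OF e(3)]])
      (simp only: ift_cmult ift_conv[OF exp_decay_integrable[OF q] exp_decay_integrable[OF r]]
        ift_conv[OF exp_decay_integrable[OF bd] exp_decay_integrable[OF s]])
  then show "ift (\<lambda>\<xi>. complex_of_real (japanese \<xi>) * source_amplitude \<alpha> \<gamma> u \<xi>) x =
      - (ift ?q x * ift ?r x + 1 / 2 * ift b x * ift ?s x
         + 1 / 2 * vector_derivative (\<lambda>y. complex_of_real (\<alpha> * ((cmod (ift b y))\<^sup>2) ^ \<gamma>) * ift b y) (at x))"
    unfolding v by (simp add: algebra_simps)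
qed

text \<open>The weight is smallest at the final time, and the majorant is integrable by the
  embedding into L1.\<close>

lemma zbound_exp_decay:
  assumes l: "l \<ge> 1" and u: "zbound l W M T r u" and t: "t \<in> {0..T}" and M: "0 \<le> M" and W: "M * T < W"
  shows "exp_decay (W - M * T) (u t)" "u t \<in> L2"
proof -
  from u obtain m where m: "zmajor W M T u m" "wsq l m \<le> ennreal (r\<^sup>2)" "0 \<le> r" "zcarrier T u"
    by (auto simp: zbound_def)
  have adm: "admissible W M T" using t M W by (auto simp: admissible_def)
  have [measurable]: "u t \<in> borel_measurable borel" using m t by (simp add: zcarrier_def)
  have mm [measurable]: "m \<in> borel_measurable borel" using m by (simp add: zmajor_def)
  have "M * t \<le> M * T" using M t by (auto intro: mult_left_mono)
  then have le: "exp ((W - M * T) * japanese \<xi>) \<le> exp ((W - M * t) * japanese \<xi>)" for \<xi>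
    by (simp add: mult_right_mono)
  have pt: "ennreal (cmod (complex_of_real (exp ((W - M * T) * japanese \<xi>)) * u t \<xi>)) \<le> m \<xi>" for \<xi>
  proof -
    have "ennreal (cmod (complex_of_real (exp ((W - M * T) * japanese \<xi>)) * u t \<xi>)) \<le>
        ennreal (exp ((W - M * t) * japanese \<xi>) * cmod (u t \<xi>))"
      unfolding norm_mult norm_of_real abs_exp_cancel by (intro ennreal_leI mult_right_mono le) simp
    also have "\<dots> \<le> m \<xi>" using m(1) t unfolding zmajor_def by blast
    finally show ?thesis .
  qed
  have "integrable lborel (\<lambda>\<xi>. complex_of_real (exp ((W - M * T) * japanese \<xi>)) * u t \<xi>)"
  proof (rule integrableI_bounded)
    have "(\<integral>\<^sup>+ \<xi>. ennreal (cmod (complex_of_real (exp ((W - M * T) * japanese \<xi>)) * u t \<xi>)) \<partial>lborel) \<le> (\<integral>\<^sup>+ \<xi>. m \<xi> \<partial>lborel)"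
      by (intro nn_integral_mono pt)
    also have "\<dots> < \<infinity>" using nn_integral_le_wsq[OF mm l m(2,3)] by (rule le_less_trans) simp
    finally show "(\<integral>\<^sup>+ \<xi>. ennreal (cmod (complex_of_real (exp ((W - M * T) * japanese \<xi>)) * u t \<xi>)) \<partial>lborel) < \<infinity>" .
  qed measurable
  then show "exp_decay (W - M * T) (u t)" using W by (simp add: exp_decay_def)
  have "l2n (u t) \<le> wsq l m"
    unfolding l2n_def wsq_def
  proof (intro nn_integral_mono)
    fix \<xi>
    have "ennreal (cmod (u t \<xi>)) \<le> ennreal (japanese \<xi> powr l) * m \<xi>"
      using order_trans[OF zmajor_pointwise[OF adm m(1) t] le_weight_mult] l by simp
    then have "(ennreal (cmod (u t \<xi>)))\<^sup>2 \<le> (ennreal (japanese \<xi> powr l) * m \<xi>)\<^sup>2"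
      by (rule power_mono) simp
    then show "ennreal ((cmod (u t \<xi>))\<^sup>2) \<le> (ennreal (japanese \<xi> powr l) * m \<xi>)\<^sup>2" by (simp add: ennreal_power)
  qed
  then show "u t \<in> L2" using m(2) le_less_trans[of _ "ennreal (r\<^sup>2)"] by (auto simp: L2_iff intro: le_less_trans)
qed

section \<open>From weighted bounds to the solution space\<close>

lemma H_norm_sq_eq:
  assumes "AE \<xi> in lborel. fourier \<psi> \<xi> = q \<xi>"
  shows "H_norm_sq w l \<psi> = (\<integral>\<^sup>+ \<xi>. ennreal (japanese \<xi> powr (2 * l) * exp (2 * w * japanese \<xi>) * (cmod (q \<xi>))\<^sup>2) \<partial>lborel)"
  unfolding H_norm_sq_def by (rule nn_integral_cong_AE) (use assms in eventually_elim, simp)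

lemma powr_double: "(japanese \<xi> powr l)\<^sup>2 = japanese \<xi> powr (2 * l)"
  by (simp add: powr_power mult.commute)

lemma exp_double: "(exp x)\<^sup>2 = exp (2 * x :: real)"
  by (simp add: exp_double)

lemma nn_integral_exp_decay_time:
  assumes a: "0 < a" and T: "0 \<le> T"
  shows "(\<integral>\<^sup>+ t. ennreal (exp (- (a * t))) * indicator {0..T} t \<partial>lborel) \<le> ennreal (1 / a)"
proof -
  have "(\<integral>\<^sup>+ t. ennreal (exp (- (a * t))) * indicator {0..T} t \<partial>lborel) =
      ennreal (- exp (- (a * T)) / a - - exp (- (a * 0)) / a)"
    using a T by (intro nn_integral_FTC_Icc) (auto intro!: derivative_eq_intros)
  also have "\<dots> \<le> ennreal (1 / a)" using a by (intro ennreal_leI) simp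
  finally show ?thesis .
qed

text \<open>\<open>V\<close> is <xi>^s times the transform of a component, with \<open>s = 1\<close>
  for the phase and \<open>s = 0\<close> for the amplitude. It is bounded for the rate
  \<open>M / 3\<close>, whereas the solution space concerns the rate \<open>M\<close>.\<close>

locale weighted_solution =
  fixes l s w0 M T \<rho> :: real and V :: "real \<Rightarrow> real \<Rightarrow> complex"
  assumes l: "1 \<le> l" and M: "0 < M" and T: "0 \<le> T" and MT: "M * T < w0"
    and V: "zbound l w0 (M / 3) T \<rho> V"
begin

definition q :: "real \<Rightarrow> real \<Rightarrow> complex" where
  "q t \<xi> = complex_of_real (japanese \<xi> powr (- s)) * V t \<xi>"

definition u :: "real \<Rightarrow> real \<Rightarrow> complex" where "u t = ift (q t)"

lemma MT3: "M / 3 * T < w0"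
proof -
  have "0 \<le> M * T" using M T by simp
  then show ?thesis using MT by simp
qed

lemma adm: "admissible w0 (M / 3) T"
  using MT3 M T by (simp add: admissible_def)

lemma V_meas: "t \<in> {0..T} \<Longrightarrow> V t \<in> borel_measurable borel"
  using zbound_zcarrier[OF V] by (simp add: zcarrier_def)

lemma q_meas: "t \<in> {0..T} \<Longrightarrow> q t \<in> borel_measurable borel"
  using V_meas unfolding q_def[abs_def] by measurable

lemma q_props:
  assumes s: "0 \<le> s" and t: "t \<in> {0..T}"
  shows "exp_decay (w0 - M / 3 * T) (q t)" "q t \<in> L2"
proof -
  have b: "cmod (complex_of_real (japanese \<xi> powr (- s))) \<le> 1" for \<xi>
  proof -
    have "1 \<le> japanese \<xi> powr s" using s japanese_ge_1 by (intro ge_one_powr_ge_zero) auto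
    then show ?thesis by (simp add: powr_minus norm_inverse inverse_le_1_iff)
  qed
  have VV: "exp_decay (w0 - M / 3 * T) (V t)" "V t \<in> L2"
    using zbound_exp_decay[OF l V t _ MT3] M by auto
  show "exp_decay (w0 - M / 3 * T) (q t)"
    unfolding q_def[abs_def] by (rule exp_decay_bounded_mult[OF VV(1) _ b]) measurable
  have "l2n (q t) \<le> l2n (V t)"
    using b by (intro l2n_mono) (simp add: q_def norm_mult mult_left_le_one_le del: norm_of_real)
  then show "q t \<in> L2" using VV(2) q_meas[OF t] by (auto simp: L2_iff)
qed

lemma u_props:
  assumes s: "0 \<le> s" and t: "t \<in> {0..T}"
  shows "u t \<in> L2" "AE \<xi> in lborel. fourier (u t) \<xi> = q t \<xi>"
  using q_props[OF assms] exp_decay_integrable unfolding u_def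
  by (auto intro: ift_L2 fourier_ift)

text \<open>The squared weights differ by exp(2(M - M/3)t<xi>). This surplus is kept on the right as
  a decaying exponential; everything else is the squared majorant.\<close>

lemma weighted_norm_le:
  assumes m: "zmajor w0 (M / 3) T V m" and t: "t \<in> {0..T}"
  shows "ennreal (japanese \<xi> powr (2 * (l + s)) * exp (2 * weight w0 M t * japanese \<xi>) * (cmod (q t \<xi>))\<^sup>2) \<le>
    (ennreal (japanese \<xi> powr l) * m \<xi>)\<^sup>2 * ennreal (exp (- (4 * M / 3 * t * japanese \<xi>)))"
proof -
  let ?J = "japanese \<xi>"
  have J: "?J powr (2 * (l + s)) * (?J powr (- s))\<^sup>2 = (?J powr l)\<^sup>2"
    unfolding powr_double by (simp add: powr_add[symmetric])
  have e: "exp (2 * weight w0 M t * ?J) = (exp ((w0 - M / 3 * t) * ?J))\<^sup>2 * exp (- (4 * M / 3 * t * ?J))"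
    unfolding exp_double mult_exp_exp by (simp add: weight_def algebra_simps)
  have "?J powr (2 * (l + s)) * exp (2 * weight w0 M t * ?J) * (cmod (q t \<xi>))\<^sup>2 =
      (?J powr (2 * (l + s)) * (?J powr (- s))\<^sup>2) * exp (2 * weight w0 M t * ?J) * (cmod (V t \<xi>))\<^sup>2"
    by (simp add: q_def norm_mult power_mult_distrib)
  also have "\<dots> = (?J powr l * (exp ((w0 - M / 3 * t) * ?J) * cmod (V t \<xi>)))\<^sup>2 * exp (- (4 * M / 3 * t * ?J))"
    unfolding J e by (simp add: power_mult_distrib)
  finally have "ennreal (?J powr (2 * (l + s)) * exp (2 * weight w0 M t * ?J) * (cmod (q t \<xi>))\<^sup>2) =
      (ennreal (?J powr l) * ennreal (exp ((w0 - M / 3 * t) * ?J) * cmod (V t \<xi>)))\<^sup>2 * ennreal (exp (- (4 * M / 3 * t * ?J)))"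
    by (simp add: ennreal_mult ennreal_power power_mult_distrib)
  also have "\<dots> \<le> (ennreal (?J powr l) * m \<xi>)\<^sup>2 * ennreal (exp (- (4 * M / 3 * t * ?J)))"
    using m t unfolding zmajor_def by (intro mult_right_mono power_mono mult_left_mono) auto
  finally show ?thesis .
qed

lemma obtain_major:
  obtains m where "zmajor w0 (M / 3) T V m" "wsq l m \<le> ennreal (\<rho>\<^sup>2)" "m \<in> borel_measurable borel"
  using V by (auto simp: zbound_def zmajor_def)

lemma exp_neg_le_1: "t \<in> {0..T} \<Longrightarrow> ennreal (exp (- (4 * M / 3 * t * japanese \<xi>))) \<le> 1"
  using M by (simp add: ennreal_le_1)

lemma H_norm_sq_u_le:
  assumes s: "0 \<le> s" and t: "t \<in> {0..T}"
  shows "H_norm_sq (weight w0 M t) (l + s) (u t) \<le> ennreal (\<rho>\<^sup>2)"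
proof -
  obtain m where m: "zmajor w0 (M / 3) T V m" "wsq l m \<le> ennreal (\<rho>\<^sup>2)" "m \<in> borel_measurable borel"
    by (rule obtain_major)
  have "H_norm_sq (weight w0 M t) (l + s) (u t) \<le> wsq l m"
    unfolding H_norm_sq_eq[OF u_props(2)[OF assms]] wsq_def
  proof (intro nn_integral_mono order_trans[OF weighted_norm_le[OF m(1) t]])
    fix \<xi>
    show "(ennreal (japanese \<xi> powr l) * m \<xi>)\<^sup>2 * ennreal (exp (- (4 * M / 3 * t * japanese \<xi>))) \<le>
        (ennreal (japanese \<xi> powr l) * m \<xi>)\<^sup>2"
      using mult_left_mono[OF exp_neg_le_1[OF t, of \<xi>], of "(ennreal (japanese \<xi> powr l) * m \<xi>)\<^sup>2"] by simp
  qed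
  then show ?thesis using m(2) by (rule order_trans)
qed

lemma weighted_norm_half:
  "japanese \<xi> powr (2 * (l + s + 1 / 2)) = japanese \<xi> * japanese \<xi> powr (2 * (l + s))"
proof -
  have "2 * (l + s + 1 / 2) = 1 + 2 * (l + s)" by simp
  then show ?thesis by (simp only: powr_add powr_one japanese_pos)
qed

text \<open>The chosen transform is replaced by the Caratheodory function \<open>V\<close> at
  clipped times, which is jointly measurable, so the frequency integral is measurable in
  time.\<close>

lemma measurable_H_norm_sq_u:
  assumes s: "0 \<le> s"
  shows "(\<lambda>t. H_norm_sq (weight w0 M t) l' (u t) * indicator {0..T} t) \<in> borel_measurable lborel"
proof -
  note [measurable] = measurable_caratheodory[OF T zbound_zcarrier[OF V]]
  have "H_norm_sq (weight w0 M t) l' (u t) * indicator {0..T} t =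
      (\<integral>\<^sup>+ \<xi>. ennreal (japanese \<xi> powr (2 * l') * exp (2 * (w0 - M * t) * japanese \<xi>) *
        (cmod (complex_of_real (japanese \<xi> powr (- s)) * V (clip T t) \<xi>))\<^sup>2) \<partial>lborel) * indicator {0..T} t" for t
  proof (cases "t \<in> {0..T}")
    case True
    then show ?thesis
      unfolding H_norm_sq_eq[OF u_props(2)[OF s True]] by (simp add: clip_id q_def weight_def)
  qed simp
  then show ?thesis by (simp only:) measurable
qed

text \<open>Tonelli: at fixed frequency the surplus exponential has time integral at most
  3/(4M<xi>), and this bracket cancels the one produced by the extra half derivative.\<close>

lemma time_integral_le:
  assumes s: "0 \<le> s"
  shows "(\<integral>\<^sup>+ t\<in>{0..T}. H_norm_sq (weight w0 M t) (l + s + 1 / 2) (u t) \<partial>lborel) \<le> ennreal (3 / (4 * M) * \<rho>\<^sup>2)"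
proof -
  obtain m where m: "zmajor w0 (M / 3) T V m" "wsq l m \<le> ennreal (\<rho>\<^sup>2)" and [measurable]: "m \<in> borel_measurable borel"
    by (rule obtain_major)
  let ?F = "\<lambda>\<xi>. (ennreal (japanese \<xi> powr l) * m \<xi>)\<^sup>2"
  let ?g = "\<lambda>t \<xi>. ?F \<xi> * (ennreal (japanese \<xi>) * (ennreal (exp (- (4 * M / 3 * japanese \<xi> * t))) * indicator {0..T} t))"
  have "(\<integral>\<^sup>+ t\<in>{0..T}. H_norm_sq (weight w0 M t) (l + s + 1 / 2) (u t) \<partial>lborel) \<le> (\<integral>\<^sup>+ t. \<integral>\<^sup>+ \<xi>. ?g t \<xi> \<partial>lborel \<partial>lborel)"
  proof (intro nn_integral_mono)
    fix t :: real
    show "H_norm_sq (weight w0 M t) (l + s + 1 / 2) (u t) * indicator {0..T} t \<le> (\<integral>\<^sup>+ \<xi>. ?g t \<xi> \<partial>lborel)"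
    proof (cases "t \<in> {0..T}")
      case t: True
      have "H_norm_sq (weight w0 M t) (l + s + 1 / 2) (u t) \<le> (\<integral>\<^sup>+ \<xi>. ?g t \<xi> \<partial>lborel)"
        unfolding H_norm_sq_eq[OF u_props(2)[OF s t]]
      proof (intro nn_integral_mono)
        fix \<xi>
        have "ennreal (japanese \<xi> powr (2 * (l + s + 1 / 2)) * exp (2 * weight w0 M t * japanese \<xi>) * (cmod (q t \<xi>))\<^sup>2) =
            ennreal (japanese \<xi>) * ennreal (japanese \<xi> powr (2 * (l + s)) * exp (2 * weight w0 M t * japanese \<xi>) * (cmod (q t \<xi>))\<^sup>2)"
          unfolding weighted_norm_half by (simp add: ennreal_mult[symmetric] mult.assoc)
        also have "\<dots> \<le> ennreal (japanese \<xi>) * (?F \<xi> * ennreal (exp (- (4 * M / 3 * t * japanese \<xi>))))"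
          by (intro mult_left_mono weighted_norm_le[OF m(1) t]) simp
        also have "\<dots> = ?g t \<xi>" using t by (simp add: mult_ac)
        finally show "ennreal (japanese \<xi> powr (2 * (l + s + 1 / 2)) * exp (2 * weight w0 M t * japanese \<xi>) * (cmod (q t \<xi>))\<^sup>2) \<le> ?g t \<xi>" .
      qed
      then show ?thesis using t by simp
    qed simp
  qed
  also have "\<dots> = (\<integral>\<^sup>+ \<xi>. \<integral>\<^sup>+ t. ?g t \<xi> \<partial>lborel \<partial>lborel)"
    by (rule lborel_pair.Fubini') measurable
  also have "\<dots> \<le> (\<integral>\<^sup>+ \<xi>. ?F \<xi> * ennreal (3 / (4 * M)) \<partial>lborel)"
  proof (intro nn_integral_mono)
    fix \<xi> :: real
    have a: "0 < 4 * M / 3 * japanese \<xi>" using M by simp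
    have "(\<integral>\<^sup>+ t. ?g t \<xi> \<partial>lborel) = ?F \<xi> * (ennreal (japanese \<xi>) *
        (\<integral>\<^sup>+ t. ennreal (exp (- (4 * M / 3 * japanese \<xi> * t))) * indicator {0..T} t \<partial>lborel))"
      by (simp add: nn_integral_cmult)
    also have "\<dots> \<le> ?F \<xi> * (ennreal (japanese \<xi>) * ennreal (1 / (4 * M / 3 * japanese \<xi>)))"
      by (intro mult_left_mono nn_integral_exp_decay_time a T) auto
    also have "ennreal (japanese \<xi>) * ennreal (1 / (4 * M / 3 * japanese \<xi>)) = ennreal (3 / (4 * M))"
      using M by (subst ennreal_mult[symmetric]) auto
    finally show "(\<integral>\<^sup>+ t. ?g t \<xi> \<partial>lborel) \<le> ?F \<xi> * ennreal (3 / (4 * M))" .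
  qed
  also have "\<dots> = wsq l m * ennreal (3 / (4 * M))" unfolding wsq_def by (rule nn_integral_multc) measurable
  also have "\<dots> \<le> ennreal (\<rho>\<^sup>2) * ennreal (3 / (4 * M))" by (intro mult_right_mono m) simp
  also have "\<dots> = ennreal (3 / (4 * M) * \<rho>\<^sup>2)" using M by (subst ennreal_mult[symmetric]) (auto simp: mult.commute)
  finally show ?thesis .
qed

text \<open>3/2 is 2M times 3/(4M); it exceeds the factor 1 with which the supremum is
  bounded.\<close>

lemma triple_norm_le:
  assumes s: "0 \<le> s"
  shows "triple_norm_sq w0 M (l + s) T u \<le> ennreal (3 / 2 * \<rho>\<^sup>2)"
  unfolding triple_norm_sq_def
proof (rule max.boundedI)
  have r: "ennreal (\<rho>\<^sup>2) \<le> ennreal (3 / 2 * \<rho>\<^sup>2)" by (intro ennreal_leI) simp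
  show "(SUP t\<in>{0..T}. H_norm_sq (weight w0 M t) (l + s) (u t)) \<le> ennreal (3 / 2 * \<rho>\<^sup>2)"
    by (intro SUP_least order_trans[OF H_norm_sq_u_le[OF s] r])
  have "ennreal (2 * M) * (\<integral>\<^sup>+ t\<in>{0..T}. H_norm_sq (weight w0 M t) (l + s + 1 / 2) (u t) \<partial>lborel) \<le>
      ennreal (2 * M) * ennreal (3 / (4 * M) * \<rho>\<^sup>2)"
    by (intro mult_left_mono time_integral_le s) simp
  also have "\<dots> = ennreal (3 / 2 * \<rho>\<^sup>2)"
    using M by (subst ennreal_mult[symmetric]) auto
  finally show "ennreal (2 * M) * (\<integral>\<^sup>+ t\<in>{0..T}. H_norm_sq (weight w0 M t) (l + s + 1 / 2) (u t) \<partial>lborel) \<le> ennreal (3 / 2 * \<rho>\<^sup>2)" .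
qed

lemma u_L2_H: 
  assumes s: "0 \<le> s"
  shows "u \<in> L2_H (weight w0 M) T (l + s + 1 / 2)"
  unfolding L2_H_def using u_props(1)[OF s] measurable_H_norm_sq_u[OF s] time_integral_le[OF s]
  by (auto intro: le_less_trans)

lemma weighted_q_L2:
  assumes s: "0 \<le> s" and t: "t \<in> {0..T}"
  shows "(\<lambda>\<xi>. complex_of_real (exp (weight w0 M t * japanese \<xi>)) * q t \<xi>) \<in> L2"
proof -
  note [measurable] = q_meas[OF t]
  have "l2n (\<lambda>\<xi>. complex_of_real (exp (weight w0 M t * japanese \<xi>)) * q t \<xi>) \<le> H_norm_sq (weight w0 M t) (l + s) (u t)"
    unfolding H_norm_sq_eq[OF u_props(2)[OF assms]] l2n_def
  proof (intro nn_integral_mono ennreal_leI)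
    fix \<xi>
    have "1 \<le> japanese \<xi> powr (2 * (l + s))" using l s japanese_ge_1 by (intro ge_one_powr_ge_zero) auto
    then have "1 * (exp (2 * weight w0 M t * japanese \<xi>) * (cmod (q t \<xi>))\<^sup>2) \<le>
        japanese \<xi> powr (2 * (l + s)) * (exp (2 * weight w0 M t * japanese \<xi>) * (cmod (q t \<xi>))\<^sup>2)"
      by (intro mult_right_mono) auto
    then show "(cmod (complex_of_real (exp (weight w0 M t * japanese \<xi>)) * q t \<xi>))\<^sup>2 \<le>
        japanese \<xi> powr (2 * (l + s)) * exp (2 * weight w0 M t * japanese \<xi>) * (cmod (q t \<xi>))\<^sup>2"
      by (simp add: norm_mult power_mult_distrib exp_double mult.assoc)
  qed
  also have "\<dots> < \<infinity>" using H_norm_sq_u_le[OF assms] by (rule le_less_trans) simp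
  finally show ?thesis by (simp add: L2_iff)
qed

text \<open>Dominated convergence in frequency: \<open>V\<close> is continuous in time at each
  frequency, and four times the squared weighted majorant dominates the squared differences for all
  times.\<close>

lemma u_C_H:
  assumes s: "0 \<le> s"
  shows "u \<in> C_H (weight w0 M) T (l + s)"
proof -
  define h where "h t \<xi> = complex_of_real (exp (weight w0 M t * japanese \<xi>)) * fourier (u t) \<xi>" for t \<xi>
  define z where "z t = inv_fourier (h t)" for t
  have hq: "AE \<xi> in lborel. complex_of_real (exp (weight w0 M t * japanese \<xi>)) * q t \<xi> = h t \<xi>" if "t \<in> {0..T}" for t
    using u_props(2)[OF s that] by eventually_elim (simp add: h_def)
  have h: "h t \<in> L2" if t: "t \<in> {0..T}" for t
  proof (rule L2_cong_AE[OF hq[OF t] weighted_q_L2[OF s t]])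
    have [measurable]: "fourier (u t) \<in> borel_measurable borel"
      using fourier_L2[OF u_props(1)[OF s t]] by (rule L2_measurable)
    show "h t \<in> borel_measurable borel" unfolding h_def[abs_def] by measurable
  qed
  have z: "z t \<in> L2" "AE \<xi> in lborel. fourier (z t) \<xi> = complex_of_real (exp (weight w0 M t * japanese \<xi>)) * q t \<xi>"
    if t: "t \<in> {0..T}" for t
  proof -
    show "z t \<in> L2" unfolding z_def by (rule inv_fourier(1)[OF h[OF t]])
    show "AE \<xi> in lborel. fourier (z t) \<xi> = complex_of_real (exp (weight w0 M t * japanese \<xi>)) * q t \<xi>"
      using inv_fourier(2)[OF h[OF t]] hq[OF t] by eventually_elim (simp add: z_def)
  qed
  have eq0: "H_norm_sq 0 (l + s) (z t) = H_norm_sq (weight w0 M t) (l + s) (u t)" if t: "t \<in> {0..T}" for t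
    unfolding H_norm_sq_eq[OF u_props(2)[OF s t]] H_norm_sq_eq[OF z(2)[OF t]]
    by (intro nn_integral_cong) (simp add: norm_mult power_mult_distrib exp_double mult.assoc)
  have "z \<in> C_sobolev T (l + s)"
    unfolding C_sobolev_def mem_Collect_eq
  proof (intro ballI conjI)
    fix t assume t: "t \<in> {0..T}"
    show "z t \<in> H_space 0 (l + s)"
      unfolding H_space_def using z(1)[OF t] le_less_trans[OF H_norm_sq_u_le[OF s t]] by (simp add: eq0[OF t])
    obtain m where m: "zmajor w0 (M / 3) T V m" "wsq l m \<le> ennreal (\<rho>\<^sup>2)" and [measurable]: "m \<in> borel_measurable borel"
      by (rule obtain_major)
    let ?e = "\<lambda>r \<xi>. complex_of_real (exp (weight w0 M r * japanese \<xi>)) * q r \<xi>"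
    let ?d = "\<lambda>r \<xi>. ennreal (japanese \<xi> powr (2 * (l + s)) * exp (2 * 0 * japanese \<xi>) * (cmod (?e r \<xi> - ?e t \<xi>))\<^sup>2)"
    have diff: "H_norm_sq 0 (l + s) (\<lambda>x. z r x - z t x) = (\<integral>\<^sup>+ \<xi>. ?d r \<xi> \<partial>lborel)" if r: "r \<in> {0..T}" for r
    proof (rule H_norm_sq_eq)
      show "AE \<xi> in lborel. fourier (\<lambda>x. z r x - z t x) \<xi> = ?e r \<xi> - ?e t \<xi>"
        using fourier_diff[OF z(1)[OF r] z(1)[OF t]] z(2)[OF r] z(2)[OF t] by eventually_elim simp
    qed
    have one: "ennreal (japanese \<xi> powr (2 * (l + s)) * (cmod (?e r \<xi>))\<^sup>2) \<le> (ennreal (japanese \<xi> powr l) * m \<xi>)\<^sup>2"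
      if r: "r \<in> {0..T}" for r \<xi>
    proof -
      have "ennreal (japanese \<xi> powr (2 * (l + s)) * (cmod (?e r \<xi>))\<^sup>2) =
          ennreal (japanese \<xi> powr (2 * (l + s)) * exp (2 * weight w0 M r * japanese \<xi>) * (cmod (q r \<xi>))\<^sup>2)"
        by (simp add: norm_mult power_mult_distrib exp_double mult.assoc)
      also have "\<dots> \<le> (ennreal (japanese \<xi> powr l) * m \<xi>)\<^sup>2 * ennreal (exp (- (4 * M / 3 * r * japanese \<xi>)))"
        by (rule weighted_norm_le[OF m(1) r])
      also have "\<dots> \<le> (ennreal (japanese \<xi> powr l) * m \<xi>)\<^sup>2"
        using mult_left_mono[OF exp_neg_le_1[OF r, of \<xi>], of "(ennreal (japanese \<xi> powr l) * m \<xi>)\<^sup>2"] by simp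
      finally show ?thesis .
    qed
    have dom: "?d r \<xi> \<le> 4 * (ennreal (japanese \<xi> powr l) * m \<xi>)\<^sup>2" if r: "r \<in> {0..T}" for r \<xi>
    proof -
      have "(cmod (?e r \<xi> - ?e t \<xi>))\<^sup>2 \<le> (cmod (?e r \<xi>) + cmod (?e t \<xi>))\<^sup>2"
        by (rule power_mono[OF norm_triangle_ineq4 norm_ge_zero])
      also have "\<dots> \<le> 2 * (cmod (?e r \<xi>))\<^sup>2 + 2 * (cmod (?e t \<xi>))\<^sup>2"
        using sum_squares_bound[of "cmod (?e r \<xi>)" "cmod (?e t \<xi>)"] unfolding power2_sum by linarith
      finally have "japanese \<xi> powr (2 * (l + s)) * (cmod (?e r \<xi> - ?e t \<xi>))\<^sup>2 \<le>
          japanese \<xi> powr (2 * (l + s)) * (2 * (cmod (?e r \<xi>))\<^sup>2 + 2 * (cmod (?e t \<xi>))\<^sup>2)"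
        by (rule mult_left_mono) simp
      also have "\<dots> = 2 * (japanese \<xi> powr (2 * (l + s)) * (cmod (?e r \<xi>))\<^sup>2) + 2 * (japanese \<xi> powr (2 * (l + s)) * (cmod (?e t \<xi>))\<^sup>2)"
        by (simp only: distrib_left mult.left_commute)
      finally have "?d r \<xi> \<le> ennreal (2 * (japanese \<xi> powr (2 * (l + s)) * (cmod (?e r \<xi>))\<^sup>2) + 2 * (japanese \<xi> powr (2 * (l + s)) * (cmod (?e t \<xi>))\<^sup>2))"
        by (intro ennreal_leI) simp
      also have "\<dots> = 2 * ennreal (japanese \<xi> powr (2 * (l + s)) * (cmod (?e r \<xi>))\<^sup>2) + 2 * ennreal (japanese \<xi> powr (2 * (l + s)) * (cmod (?e t \<xi>))\<^sup>2)"
        by (simp add: ennreal_mult)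
      also have "\<dots> \<le> 2 * (ennreal (japanese \<xi> powr l) * m \<xi>)\<^sup>2 + 2 * (ennreal (japanese \<xi> powr l) * m \<xi>)\<^sup>2"
        by (intro add_mono mult_left_mono one r t) auto
      also have "\<dots> = 4 * (ennreal (japanese \<xi> powr l) * m \<xi>)\<^sup>2"
        by (simp add: distrib_right[symmetric])
      finally show ?thesis .
    qed
    show "((\<lambda>r. H_norm_sq 0 (l + s) (\<lambda>x. z r x - z t x)) \<longlongrightarrow> 0) (at t within {0..T})"
      unfolding tendsto_at_iff_sequentially comp_def
    proof (intro allI impI)
      fix X :: "nat \<Rightarrow> real" assume X: "\<forall>i. X i \<in> {0..T} - {t}" "X \<longlonglongrightarrow> t"
      then have XT: "X i \<in> {0..T}" for i by auto
      have "(\<lambda>i. \<integral>\<^sup>+ \<xi>. ?d (X i) \<xi> \<partial>lborel) \<longlonglongrightarrow> (\<integral>\<^sup>+ \<xi>. 0 \<partial>(lborel :: real measure))"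
      proof (rule nn_integral_dominated_convergence[where w="\<lambda>\<xi>. 4 * (ennreal (japanese \<xi> powr l) * m \<xi>)\<^sup>2"])
        note [measurable] = q_meas[OF XT] q_meas[OF t]
        show "?d (X i) \<in> borel_measurable lborel" for i by measurable
        show "(\<integral>\<^sup>+ \<xi>. 4 * (ennreal (japanese \<xi> powr l) * m \<xi>)\<^sup>2 \<partial>lborel) < \<infinity>"
          using m(2) unfolding wsq_def
          by (subst nn_integral_cmult) (auto simp: ennreal_mult_less_top intro: le_less_trans)
        show "AE \<xi> in lborel. ?d (X i) \<xi> \<le> 4 * (ennreal (japanese \<xi> powr l) * m \<xi>)\<^sup>2" for i
          by (intro AE_I2 dom XT)
        show "AE \<xi> in lborel. (\<lambda>i. ?d (X i) \<xi>) \<longlonglongrightarrow> 0"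
        proof (intro AE_I2)
          fix \<xi>
          have c: "continuous_on {0..T} (\<lambda>t. V t \<xi>)" using zbound_zcarrier[OF V] by (simp add: zcarrier_def)
          have lim: "(\<lambda>i. V (X i) \<xi>) \<longlonglongrightarrow> V t \<xi>"
            by (rule continuous_on_tendsto_compose[OF c X(2) t]) (intro always_eventually allI XT)
          have "(\<lambda>i. ?d (X i) \<xi>) \<longlonglongrightarrow> ennreal (japanese \<xi> powr (2 * (l + s)) * exp (2 * 0 * japanese \<xi>) * (cmod (?e t \<xi> - ?e t \<xi>))\<^sup>2)"
            unfolding q_def weight_def by (intro tendsto_intros lim X(2))
          then show "(\<lambda>i. ?d (X i) \<xi>) \<longlonglongrightarrow> 0" by simp
        qed
      qed auto
      then show "(\<lambda>i. H_norm_sq 0 (l + s) (\<lambda>x. z (X i) x - z t x)) \<longlonglongrightarrow> 0"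
        by (simp add: diff[OF XT])
    qed
  qed
  then show ?thesis
    unfolding C_H_def mem_Collect_eq using u_props(1)[OF s] h by (simp add: z_def[abs_def] h_def[abs_def])
qed

lemma u_Y_space: "0 \<le> s \<Longrightarrow> u \<in> Y_space (weight w0 M) T (l + s)"
  unfolding Y_space_def using u_C_H u_L2_H by blast

end

section \<open>Existence on the Fourier side\<close>

lemma lipL_mono:
  fixes N :: "('i \<Rightarrow> real \<Rightarrow> complex) \<Rightarrow> real \<Rightarrow> complex"
  assumes "lipL st l R L N" "L \<le> L'"
  shows "lipL st l R L' N"
  unfolding lipL_def
proof (intro conjI allI impI)
  show "0 \<le> L'" using assms by (simp add: lipL_def)
  fix W M T d and U U' :: "'i \<Rightarrow> real \<Rightarrow> real \<Rightarrow> complex"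
  assume a: "admissible W M T" "\<forall>i. zbound l W M T R (U i)" "\<forall>i. zbound l W M T R (U' i)"
    "\<forall>i. zbound l W M T d (\<lambda>t \<xi>. U i t \<xi> - U' i t \<xi>)"
  note 1 = lipLD[OF assms(1) a(1) a(2)[rule_format] a(3)[rule_format] a(4)[rule_format]]
  have d: "0 \<le> d" using a(4) zbound_nonneg by blast
  have le: "L * d \<le> L' * d" by (intro mult_right_mono assms d)
  show "zbound l W M T L' (\<lambda>t. N (\<lambda>i. U i t))" by (rule zbound_mono[OF 1(1) assms(2)])
  show "zbound l W M T (L' * d) (\<lambda>t \<xi>. N (\<lambda>i. U i t) \<xi> - N (\<lambda>i. U' i t) \<xi>)" by (rule zbound_mono[OF 1(2) le])
  show "sbound W M T (L' * d) (\<lambda>t \<xi>. N (\<lambda>i. U i t) \<xi> - N (\<lambda>i. U' i t) \<xi>)" if st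
    by (rule sbound_mono[OF 1(3)[OF that] le])
qed

text \<open>Projection onto transforms of real functions. Inserted into the nonlinearity, it
  produces a real phase without restricting the iteration to a subset: the fixed point turns out
  hermitian, and there the modified equation is the original one.\<close>

definition hermitian_part :: "(real \<Rightarrow> complex) \<Rightarrow> real \<Rightarrow> complex" where
  "hermitian_part f \<xi> = (1/2) * (f \<xi> + til f \<xi>)"

lemma til_til [simp]: "til (til f) = f" by (simp add: til_def fun_eq_iff)

lemma til_hermitian_part: "til (hermitian_part f) = hermitian_part f"
  by (simp add: til_def hermitian_part_def fun_eq_iff add.commute)

lemma hermitian_part_id: "til f = f \<Longrightarrow> hermitian_part f = f"
  by (simp add: hermitian_part_def fun_eq_iff)

lemma zbound_hermitian_part:
  assumes "zbound l W M T r u" shows "zbound l W M T r (\<lambda>t. hermitian_part (u t))"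
  using zbound_mult[OF zbound_add[OF assms zbound_til[OF assms]], of "\<lambda>_. 1/2" "1/2"]
  by (simp add: hermitian_part_def[abs_def])

lemma lipL_hermitian_part:
  fixes N :: "(bool \<Rightarrow> real \<Rightarrow> complex) \<Rightarrow> real \<Rightarrow> complex"
  assumes "lipL st l R L N"
  shows "lipL st l R L (\<lambda>u. N (\<lambda>j. if j then u True else hermitian_part (u False)))"
  unfolding lipL_def
proof (intro conjI allI impI)
  show "0 \<le> L" using assms by (simp add: lipL_def)
  fix W M T d and U U' :: "bool \<Rightarrow> real \<Rightarrow> real \<Rightarrow> complex"
  assume a: "admissible W M T" "\<forall>i. zbound l W M T R (U i)" "\<forall>i. zbound l W M T R (U' i)"
    "\<forall>i. zbound l W M T d (\<lambda>t \<xi>. U i t \<xi> - U' i t \<xi>)"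
  define H where "H X j t = (if j then X True t else hermitian_part (X False t))"
    for X :: "bool \<Rightarrow> real \<Rightarrow> real \<Rightarrow> complex" and j t
  have H: "zbound l W M T r (H X j)" if "\<forall>i. zbound l W M T r (X i)" for X j r
    using that by (cases j) (auto simp: H_def[abs_def] zbound_hermitian_part)
  have diff: "(\<lambda>t \<xi>. H U j t \<xi> - H U' j t \<xi>) = H (\<lambda>i t \<xi>. U i t \<xi> - U' i t \<xi>) j" for j
    by (cases j) (auto simp: H_def fun_eq_iff hermitian_part_def til_def algebra_simps)
  have D: "zbound l W M T d (\<lambda>t \<xi>. H U j t \<xi> - H U' j t \<xi>)" for j
    unfolding diff by (rule H[OF a(4)])
  note 1 = lipLD[OF assms a(1) H[OF a(2)] H[OF a(3)] D]
  show "zbound l W M T L (\<lambda>t. N (\<lambda>j. if j then U True t else hermitian_part (U False t)))"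
    using 1(1) by (simp add: H_def)
  show "zbound l W M T (L * d) (\<lambda>t \<xi>. N (\<lambda>j. if j then U True t else hermitian_part (U False t)) \<xi> -
      N (\<lambda>j. if j then U' True t else hermitian_part (U' False t)) \<xi>)"
    using 1(2) by (simp add: H_def)
  show "sbound W M T (L * d) (\<lambda>t \<xi>. N (\<lambda>j. if j then U True t else hermitian_part (U False t)) \<xi> -
      N (\<lambda>j. if j then U' True t else hermitian_part (U' False t)) \<xi>)" if st
    using 1(3)[OF that] by (simp add: H_def)
qed

lemma conv_commute: "conv f h = conv h f"
proof
  fix \<xi>
  have "(LBINT \<eta>. f (\<xi> - \<eta>) * h \<eta>) = (LBINT \<eta>. h (\<xi> - \<eta>) * f \<eta>)"
    by (subst lborel_integral_real_affine[where c="-1" and t=\<xi>]) (auto simp: mult.commute)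
  then show "conv f h \<xi> = conv h f \<xi>" by (simp only: conv_eq)
qed

lemma til_conv: "til (conv f h) = conv (til f) (til h)"
proof
  fix \<xi>
  have "(LBINT \<eta>. cnj (f (- \<xi> - \<eta>) * h \<eta>)) = (LBINT \<eta>. cnj (f (- \<xi> - - \<eta>) * h (- \<eta>)))"
    by (rule lborel_integral_reflect[symmetric, of "\<lambda>\<eta>. cnj (f (- \<xi> - \<eta>) * h \<eta>)"])
  then show "til (conv f h) \<xi> = conv (til f) (til h) \<xi>"
    unfolding til_def conv_eq complex_cnj_mult[of "complex_of_real _"] complex_cnj_complex_of_real
      Bochner_Integration.integral_cnj[symmetric]
    by simp
qed

lemma til_modulus_power: "til (modulus_power k f) = modulus_power k f"
proof (induction k)
  case 0
  have "til (conv f (til f)) = conv (til f) f" by (simp add: til_conv)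
  then show ?case by (simp add: conv_commute[of f])
next
  case (Suc k)
  have "til (conv f (til f)) = conv f (til f)" using conv_commute[of "til f" f] by (simp add: til_conv)
  with Suc show ?case by (simp add: til_conv[of "modulus_power k f"])
qed

lemma til_deriv_symbol: "til (deriv_symbol f) = deriv_symbol (til f)"
  by (simp add: til_def deriv_symbol_def fun_eq_iff)

lemma til_source_phase:
  assumes "til (u False) = u False"
  shows "til (source_phase \<alpha> lam \<gamma> \<sigma> u) = source_phase \<alpha> lam \<gamma> \<sigma> u"
proof
  fix \<xi>
  let ?q = "deriv_symbol (u False)" and ?b = "u True"
  have q: "til ?q = ?q" by (simp add: til_deriv_symbol assms)
  have e: "til (conv ?q ?q) = conv ?q ?q" "til (conv (modulus_power (\<gamma> - 1) ?b) ?q) = conv (modulus_power (\<gamma> - 1) ?b) ?q"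
    by (simp_all add: til_conv q til_modulus_power)
  have "cnj (conv ?q ?q (- \<xi>)) = conv ?q ?q \<xi>"
    "cnj (conv (modulus_power (\<gamma> - 1) ?b) ?q (- \<xi>)) = conv (modulus_power (\<gamma> - 1) ?b) ?q \<xi>"
    "cnj (modulus_power (\<sigma> - 1) ?b (- \<xi>)) = modulus_power (\<sigma> - 1) ?b \<xi>"
    using e til_modulus_power[of "\<sigma> - 1" ?b] by (metis til_def)+
  then show "til (source_phase \<alpha> lam \<gamma> \<sigma> u) \<xi> = source_phase \<alpha> lam \<gamma> \<sigma> u \<xi>"
    by (simp add: til_def source_phase_def)
qed

lemma conv_zero [simp]: "conv f (\<lambda>_. 0) = (\<lambda>_. 0)" "conv (\<lambda>_. 0) f = (\<lambda>_. 0)"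
  by (simp_all add: conv_eq fun_eq_iff)

lemma conv_deriv_zero [simp]: "conv_deriv f (\<lambda>_. 0) = (\<lambda>_. 0)" "conv_deriv (\<lambda>_. 0) f = (\<lambda>_. 0)"
  by (simp_all add: conv_deriv_def bil_def fun_eq_iff)

lemma deriv_symbol_zero [simp]: "deriv_symbol (\<lambda>_. 0) = (\<lambda>_. 0)"
  by (simp add: deriv_symbol_def fun_eq_iff)

lemma hermitian_part_zero [simp]: "hermitian_part (\<lambda>_. 0) = (\<lambda>_. 0)"
  by (simp add: hermitian_part_def til_def fun_eq_iff)

text \<open>Vanishing amplitude is the comparison state that makes the amplitude source proportional
  to the radius of the amplitude alone.\<close>

lemma source_amplitude_zero: "u True = (\<lambda>_. 0) \<Longrightarrow> source_amplitude \<alpha> \<gamma> u = (\<lambda>_. 0)"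
  by (rule ext) (simp add: source_amplitude_def)

text \<open>With vanishing phase only the power of the amplitude survives; it is the origin of the
  term with exponent \<open>2 * \<sigma>\<close> in the radius of the phase.\<close>

lemma source_phase_zero:
  "u False = (\<lambda>_. 0) \<Longrightarrow> source_phase \<alpha> lam \<gamma> \<sigma> u = (\<lambda>\<xi>. - complex_of_real lam * modulus_power (\<sigma> - 1) (u True) \<xi>)"
  by (rule ext) (simp add: source_phase_def)

text \<open>The exponents count 2k+1 convolutions of 2k+2 factors.\<close>

lemma zbound_modulus_power:
  assumes l: "l \<ge> 1" and adm: "admissible W M T" and u: "zbound l W M T r u"
  shows "zbound l W M T (bilin_const l ^ (2 * k + 1) * r ^ (2 * k + 2)) (\<lambda>t. modulus_power k (u t))"
proof (induction k)
  case 0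
  show ?case using zbound_bil(1)[OF l adm u zbound_til[OF u] bilkernel_conv]
    by (simp add: conv_def power2_eq_square mult.assoc)
next
  case (Suc k)
  have c: "zbound l W M T (bilin_const l * r * r) (\<lambda>t. conv (u t) (til (u t)))"
    unfolding conv_def by (rule zbound_bil(1)[OF l adm u zbound_til[OF u] bilkernel_conv])
  have "bilin_const l * (bilin_const l ^ (2 * k + 1) * r ^ (2 * k + 2)) * (bilin_const l * r * r) =
      bilin_const l ^ (2 * Suc k + 1) * r ^ (2 * Suc k + 2)"
    by (simp add: power_add mult_ac power2_eq_square)
  with zbound_bil(1)[OF l adm Suc.IH c bilkernel_conv]
  show ?case unfolding conv_def[symmetric] modulus_power.simps by (simp only:)
qed

lemma zbound_free:
  assumes M: "0 \<le> M" and \<theta> [measurable]: "\<theta> \<in> borel_measurable borel" and h [measurable]: "h \<in> borel_measurable borel"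
    and le: "wsq l (\<lambda>\<xi>. ennreal (exp (W * japanese \<xi>) * cmod (h \<xi>))) \<le> ennreal (r\<^sup>2)" and r: "0 \<le> r"
  shows "zbound l W M T r (\<lambda>t \<xi>. exp (- (\<i> * complex_of_real (\<theta> \<xi> * t))) * h \<xi>)"
proof (rule zboundI[OF r _ _ le])
  show "zcarrier T (\<lambda>t \<xi>. exp (- (\<i> * complex_of_real (\<theta> \<xi> * t))) * h \<xi>)"
    unfolding zcarrier_def by (auto intro!: continuous_intros) 
  show "zmajor W M T (\<lambda>t \<xi>. exp (- (\<i> * complex_of_real (\<theta> \<xi> * t))) * h \<xi>) (\<lambda>\<xi>. ennreal (exp (W * japanese \<xi>) * cmod (h \<xi>)))"
    unfolding zmajor_def
  proof (intro conjI ballI allI ennreal_leI)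
    fix t \<xi> assume t: "t \<in> {0..T}"
    have "(W - M * t) * japanese \<xi> \<le> W * japanese \<xi>" using M t by (intro mult_right_mono) auto
    then show "exp ((W - M * t) * japanese \<xi>) * cmod (exp (- (\<i> * complex_of_real (\<theta> \<xi> * t))) * h \<xi>) \<le> exp (W * japanese \<xi>) * cmod (h \<xi>)"
      unfolding norm_mult norm_exp_imaginary mult_1_left by (intro mult_right_mono) auto
  qed measurable
qed

text \<open>\<open>M0\<close> is fixed before the weight, the interval and the dispersion
  \<open>\<theta>\<close>; this is the uniformity in epsilon. The exact data norms \<open>A\<close>
  and \<open>B\<close> enter the radii, while \<open>C\<close> only determines the Lipschitz
  constants.\<close>

theorem fourier_side_existence:
  fixes \<alpha> lam l C :: real and \<gamma> \<sigma> :: nat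
  assumes l: "l \<ge> 1" and C: "0 \<le> C" and \<sigma>: "\<sigma> \<ge> 1"
  shows "\<exists>M0>0. \<forall>M\<ge>M0. \<forall>W T A B. \<forall>(\<theta> :: real \<Rightarrow> real) V0 b0. admissible W M T \<longrightarrow> 0 \<le> A \<longrightarrow> A \<le> C \<longrightarrow> 0 \<le> B \<longrightarrow> B \<le> C \<longrightarrow>
    \<theta> \<in> borel_measurable borel \<longrightarrow> V0 \<in> borel_measurable borel \<longrightarrow> b0 \<in> borel_measurable borel \<longrightarrow> til V0 = V0 \<longrightarrow>
    wsq l (\<lambda>\<xi>. ennreal (exp (W * japanese \<xi>) * cmod (V0 \<xi>))) \<le> ennreal (A\<^sup>2) \<longrightarrow>
    wsq l (\<lambda>\<xi>. ennreal (exp (W * japanese \<xi>) * cmod (b0 \<xi>))) \<le> ennreal (B\<^sup>2) \<longrightarrow>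
    (\<exists>V b. zbound l W M T (8/7 * (A + B ^ (2 * \<sigma>) / 2)) V \<and> zbound l W M T (8/7 * B) b \<and>
      (\<forall>t\<in>{0..T}. til (V t) = V t) \<and>
      (\<forall>t\<in>{0..T}. \<forall>\<xi>.
         V t \<xi> = V0 \<xi> + duh (\<lambda>_. 0) (\<lambda>s. source_phase \<alpha> lam \<gamma> \<sigma> (\<lambda>j. if j then b s else V s)) t \<xi> \<and>
         b t \<xi> = exp (- (\<i> * complex_of_real (\<theta> \<xi> * t))) * b0 \<xi> +
           duh \<theta> (\<lambda>s. source_amplitude \<alpha> \<gamma> (\<lambda>j. if j then b s else V s)) t \<xi>))"
proof -
  \<comment> \<open>A common bound for both radii: it dominates 8/7 C and 8/7 (C + C^(2
    sigma)/2).\<close>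
  define R where "R = 2 * C + C ^ (2 * \<sigma>)"
  have R: "0 \<le> R" using C by (simp add: R_def)
  obtain L1 L2 where L12: "lipL True l R L1 (source_phase \<alpha> lam \<gamma> \<sigma>)" "lipL True l R L2 (source_amplitude \<alpha> \<gamma>)"
    using lip_source_phase[OF l, of \<alpha> lam \<gamma> \<sigma>] lip_source_amplitude[OF l, of \<alpha> \<gamma>] R unfolding lip_def by blast
  define L where "L = L1 + L2"
  have L12n: "0 \<le> L1" "0 \<le> L2" using L12 by (auto simp: lipL_def)
  define Q where "Q = \<bar>lam\<bar> * (bilin_const l ^ (2 * (\<sigma> - 1) + 1) * (8/7) ^ (2 * \<sigma>))"
  \<comment> \<open>\<open>8 * L\<close> keeps the Lipschitz contribution below 1/8 of the radius,
    \<open>2 * Q\<close> keeps the pure power of the amplitude below B^(2 sigma)/2, and 1 ensures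
    positivity.\<close>
  define M0 where "M0 = max (8 * L) (max (2 * Q) 1)"
  define N where "N i = (if i then source_amplitude \<alpha> \<gamma> else source_phase \<alpha> lam \<gamma> \<sigma>)" for i
  define N' where "N' i u = N i (\<lambda>j. if j then u True else hermitian_part (u False))" for i and u :: "bool \<Rightarrow> real \<Rightarrow> complex"
  have LN: "lipL True l R L (N' i)" for i
  proof -
    have "lipL True l R L (N i)"
      using lipL_mono[OF L12(1), of L] lipL_mono[OF L12(2), of L] L12n by (cases i) (auto simp: N_def L_def)
    then show ?thesis unfolding N'_def[abs_def] by (rule lipL_hermitian_part)
  qed
  show ?thesis
  proof (intro exI[of _ M0] conjI allI impI)
    show "0 < M0" by (simp add: M0_def)
    fix M W T A B and \<theta> :: "real \<Rightarrow> real" and V0 b0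
    assume MM: "M0 \<le> M" and adm: "admissible W M T" and A: "0 \<le> A" "A \<le> C" and B: "0 \<le> B" "B \<le> C"
      and meas: "\<theta> \<in> borel_measurable borel" "V0 \<in> borel_measurable borel" "b0 \<in> borel_measurable borel"
      and herm: "til V0 = V0"
      and V0: "wsq l (\<lambda>\<xi>. ennreal (exp (W * japanese \<xi>) * cmod (V0 \<xi>))) \<le> ennreal (A\<^sup>2)"
      and b0: "wsq l (\<lambda>\<xi>. ennreal (exp (W * japanese \<xi>) * cmod (b0 \<xi>))) \<le> ennreal (B\<^sup>2)"
    have M: "0 < M" "8 * L \<le> M" "2 * Q \<le> M" using MM by (auto simp: M0_def)
    have T: "0 \<le> T" using adm by (simp add: admissible_def)
    \<comment> \<open>The factor 8/7 solves rho = x + rho/8, where x is the contribution that does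
      not depend on the radius.\<close>
    define \<rho> where "\<rho> i = (if i then 8/7 * B else 8/7 * (A + B ^ (2 * \<sigma>) / 2))" for i
    define \<Theta> where "\<Theta> i = (if i then \<theta> else (\<lambda>_. 0))" for i
    define F where "F i t \<xi> = exp (- (\<i> * complex_of_real (\<Theta> i \<xi> * t))) * (if i then b0 \<xi> else V0 \<xi>)" for i t \<xi>
    have \<Theta>: "\<Theta> i \<in> borel_measurable borel" for i using meas by (simp add: \<Theta>_def)
    have F: "zbound l W M T (if i then B else A) (F i)" for i
      using zbound_free[OF less_imp_le[OF M(1)] meas(1) meas(3) b0 B(1), of T]
        zbound_free[OF less_imp_le[OF M(1)] borel_measurable_const meas(2) V0 A(1), of T 0]
      by (cases i) (simp_all add: F_def[abs_def] \<Theta>_def)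
    have BC: "B ^ (2 * \<sigma>) \<le> C ^ (2 * \<sigma>)" using B by (intro power_mono)
    have Bp: "0 \<le> B ^ (2 * \<sigma>)" using B by simp
    have Cp: "0 \<le> C ^ (2 * \<sigma>)" using C by simp
    have \<rho>0: "0 \<le> \<rho> i" for i using A B Bp by (simp add: \<rho>_def)
    have \<rho>R: "\<rho> i \<le> R" for i
    proof -
      have gen: "8/7 * (a + b / 2) \<le> 2 * c + d" if "a \<le> c" "b \<le> d" "0 \<le> c" "0 \<le> d" for a b c d :: real
        using that by (simp add: field_simps)
      have "8/7 * B \<le> 2 * C + C ^ (2 * \<sigma>)" "8/7 * (A + B ^ (2 * \<sigma>) / 2) \<le> 2 * C + C ^ (2 * \<sigma>)"
        using gen[OF B(2) _ C Cp, of 0] Cp gen[OF A(2) BC C Cp] by simp_all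
      then show ?thesis unfolding \<rho>_def R_def by (cases i) (simp_all only: if_True if_False)
    qed
    have L0: "0 \<le> L" using L12n by (simp add: L_def)
    have ball: "zbound l W M T (\<rho> i) (duhamel_map \<Theta> N' F U i)" if U: "\<And>i. zbound l W M T (\<rho> i) (U i)" for U i
    proof -
      have UR: "zbound l W M T R (U i)" for i by (rule zbound_mono[OF U \<rho>R])
      have zero: "zbound l W M T r (\<lambda>t \<xi>. 0)" if "0 \<le> r" for r by (rule zbound_zero[OF that])
      show ?thesis
      proof (cases i)
        case True
        \<comment> \<open>The amplitude is set to zero, where its source vanishes; the Lipschitz
          estimate then bounds the source itself, linearly in the radius of the amplitude.\<close>
        define U' where "U' j = (if j then (\<lambda>t \<xi>. 0) else U False)" for j
        have U': "zbound l W M T R (U' j)" for j using UR zero[OF R] by (simp add: U'_def)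
        have d: "zbound l W M T (\<rho> True) (\<lambda>t \<xi>. U j t \<xi> - U' j t \<xi>)" for j
          using U[of True] zero[OF \<rho>0[of True]] by (cases j) (auto simp: U'_def)
        have z: "N' True (\<lambda>j. U' j t) = (\<lambda>_. 0)" for t
          unfolding N'_def N_def if_True by (rule source_amplitude_zero) (simp add: U'_def)
        have "zbound l W M T (L * \<rho> True) (\<lambda>t \<xi>. N' True (\<lambda>j. U j t) \<xi> - N' True (\<lambda>j. U' j t) \<xi>)"
          by (rule lipLD(2)[OF LN adm UR U' d])
        then have "zbound l W M T (L * \<rho> True) (\<lambda>t. N' True (\<lambda>j. U j t))" by (simp add: z)
        from zbound_add[OF F[of True] zbound_duh[OF M(1) T \<Theta> this]]
        have "zbound l W M T (B + L * \<rho> True / M) (duhamel_map \<Theta> N' F U True)"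
          by (simp add: duhamel_map_def[abs_def])
        moreover have "B + L * \<rho> True / M \<le> \<rho> True"
        proof -
          have "L * \<rho> True / M \<le> \<rho> True / 8"
            using mult_right_mono[OF M(2) \<rho>0[of True]] M(1) by (simp add: field_simps)
          then show ?thesis by (simp add: \<rho>_def)
        qed
        ultimately have "zbound l W M T (\<rho> True) (duhamel_map \<Theta> N' F U True)" by (rule zbound_mono)
        then show ?thesis using True by simp
      next
        case False
        \<comment> \<open>The phase is set to zero; what remains is the power of the amplitude,
          estimated separately through \<open>Q\<close>.\<close>
        define U' where "U' j = (if j then U True else (\<lambda>t \<xi>. 0))" for j
        have U': "zbound l W M T R (U' j)" for j using UR zero[OF R] by (simp add: U'_def)
        have d: "zbound l W M T (\<rho> False) (\<lambda>t \<xi>. U j t \<xi> - U' j t \<xi>)" for j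
          using U[of False] zero[OF \<rho>0[of False]] by (cases j) (auto simp: U'_def)
        have z: "N' False (\<lambda>j. U' j t) = (\<lambda>\<xi>. - complex_of_real lam * modulus_power (\<sigma> - 1) (U True t) \<xi>)" for t
          unfolding N'_def N_def if_False by (subst source_phase_zero) (simp_all add: U'_def)
        have 1: "zbound l W M T (L * \<rho> False) (\<lambda>t \<xi>. N' False (\<lambda>j. U j t) \<xi> - N' False (\<lambda>j. U' j t) \<xi>)"
          by (rule lipLD(2)[OF LN adm UR U' d])
        have "zbound l W M T (\<bar>lam\<bar> * (bilin_const l ^ (2 * (\<sigma> - 1) + 1) * \<rho> True ^ (2 * (\<sigma> - 1) + 2)))
            (\<lambda>t \<xi>. - complex_of_real lam * modulus_power (\<sigma> - 1) (U True t) \<xi>)"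
          by (rule zbound_mult[OF zbound_modulus_power[OF l adm U]]) auto
        moreover have "\<bar>lam\<bar> * (bilin_const l ^ (2 * (\<sigma> - 1) + 1) * \<rho> True ^ (2 * (\<sigma> - 1) + 2)) = Q * B ^ (2 * \<sigma>)"
        proof -
          have "2 * (\<sigma> - 1) + 2 = 2 * \<sigma>" using \<sigma> by auto
          then show ?thesis by (simp only: \<rho>_def Q_def if_True power_mult_distrib mult_ac)
        qed
        ultimately have 2: "zbound l W M T (Q * B ^ (2 * \<sigma>)) (\<lambda>t. N' False (\<lambda>j. U' j t))" by (simp only: z)
        have "zbound l W M T (L * \<rho> False + Q * B ^ (2 * \<sigma>)) (\<lambda>t. N' False (\<lambda>j. U j t))"
          using zbound_add[OF 1 2] by simp
        from zbound_add[OF F[of False] zbound_duh[OF M(1) T \<Theta> this]]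
        have "zbound l W M T (A + (L * \<rho> False + Q * B ^ (2 * \<sigma>)) / M) (duhamel_map \<Theta> N' F U False)"
          by (simp add: duhamel_map_def[abs_def])
        moreover have "A + (L * \<rho> False + Q * B ^ (2 * \<sigma>)) / M \<le> \<rho> False"
        proof -
          have "L * \<rho> False / M \<le> \<rho> False / 8"
            using mult_right_mono[OF M(2) \<rho>0[of False]] M(1) by (simp add: field_simps)
          moreover have "Q * B ^ (2 * \<sigma>) / M \<le> B ^ (2 * \<sigma>) / 2"
            using mult_right_mono[OF M(3) Bp] M(1) by (simp add: field_simps)
          ultimately show ?thesis by (simp add: \<rho>_def add_divide_distrib)
        qed
        ultimately have "zbound l W M T (\<rho> False) (duhamel_map \<Theta> N' F U False)" by (rule zbound_mono)
        then show ?thesis using False by simp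
      qed
    qed
    obtain U where U: "\<And>i. zbound l W M T (\<rho> i) (U i)"
      "\<And>i t \<xi>. t \<in> {0..T} \<Longrightarrow> U i t \<xi> = duhamel_map \<Theta> N' F U i t \<xi>"
      by (rule picard_exists[OF adm M(1) LN _ \<Theta> \<rho>0 \<rho>R ball]) (use M L0 in auto)
    \<comment> \<open>The modified phase source is hermitian whatever \<open>U\<close> is, and so is
      its time integral; together with the hermitian datum this passes to the fixed point.\<close>
    have herm_U: "til (U False t) = U False t" if t: "t \<in> {0..T}" for t
    proof
      fix \<xi>
      have S: "til (N' False (\<lambda>j. U j s)) = N' False (\<lambda>j. U j s)" for s
        unfolding N'_def N_def if_False by (rule til_source_phase) (simp add: til_hermitian_part)
      have "cnj (N' False (\<lambda>j. U j s) (- \<xi>)) = N' False (\<lambda>j. U j s) \<xi>" for s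
        using fun_cong[OF S, of s \<xi>] by (simp only: til_def)
      then have "cnj (integral {0..t} (\<lambda>s. N' False (\<lambda>j. U j s) (- \<xi>))) = integral {0..t} (\<lambda>s. N' False (\<lambda>j. U j s) \<xi>)"
        by (simp only: integral_cnj)
      moreover have "cnj (V0 (- \<xi>)) = V0 \<xi>" using fun_cong[OF herm, of \<xi>] by (simp only: til_def)
      ultimately show "til (U False t) \<xi> = U False t \<xi>"
        unfolding til_def U(2)[OF t] by (simp add: duhamel_map_def duh_def F_def \<Theta>_def)
    qed
    have NU: "N' i (\<lambda>j. U j s) = N i (\<lambda>j. if j then U True s else U False s)" if "s \<in> {0..T}" for i s
      by (simp add: N'_def hermitian_part_id[OF herm_U[OF that]] cong: if_cong)
    have duh_eq: "duh \<theta>' (\<lambda>s. N' i (\<lambda>j. U j s)) t \<xi> = duh \<theta>' (\<lambda>s. N i (\<lambda>j. if j then U True s else U False s)) t \<xi>"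
      if t: "t \<in> {0..T}" for \<theta>' i t \<xi>
    proof -
      have "integral {0..t} (\<lambda>s. exp (\<i> * complex_of_real (\<theta>' \<xi> * s)) * N' i (\<lambda>j. U j s) \<xi>) =
          integral {0..t} (\<lambda>s. exp (\<i> * complex_of_real (\<theta>' \<xi> * s)) * N i (\<lambda>j. if j then U True s else U False s) \<xi>)"
        by (rule Henstock_Kurzweil_Integration.integral_cong) (subst NU, use t in auto)
      then show ?thesis unfolding duh_def by (simp only:)
    qed
    show "\<exists>V b. zbound l W M T (8/7 * (A + B ^ (2 * \<sigma>) / 2)) V \<and> zbound l W M T (8/7 * B) b \<and>
      (\<forall>t\<in>{0..T}. til (V t) = V t) \<and>
      (\<forall>t\<in>{0..T}. \<forall>\<xi>.
         V t \<xi> = V0 \<xi> + duh (\<lambda>_. 0) (\<lambda>s. source_phase \<alpha> lam \<gamma> \<sigma> (\<lambda>j. if j then b s else V s)) t \<xi> \<and>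
         b t \<xi> = exp (- (\<i> * complex_of_real (\<theta> \<xi> * t))) * b0 \<xi> +
           duh \<theta> (\<lambda>s. source_amplitude \<alpha> \<gamma> (\<lambda>j. if j then b s else V s)) t \<xi>)"
    proof (rule exI[of _ "U False"], rule exI[of _ "U True"], intro conjI ballI allI)
      show "zbound l W M T (8/7 * (A + B ^ (2 * \<sigma>) / 2)) (U False)" using U(1)[of False] by (simp add: \<rho>_def)
      show "zbound l W M T (8/7 * B) (U True)" using U(1)[of True] by (simp add: \<rho>_def)
      fix t \<xi> assume t: "t \<in> {0..T}"
      show "til (U False t) = U False t" by (rule herm_U[OF t])
      show "U False t \<xi> = V0 \<xi> + duh (\<lambda>_. 0) (\<lambda>s. source_phase \<alpha> lam \<gamma> \<sigma> (\<lambda>j. if j then U True s else U False s)) t \<xi>"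
        unfolding U(2)[OF t, of False \<xi>] duhamel_map_def duh_eq[OF t] by (simp add: F_def \<Theta>_def N_def)
      show "U True t \<xi> = exp (- (\<i> * complex_of_real (\<theta> \<xi> * t))) * b0 \<xi> +
           duh \<theta> (\<lambda>s. source_amplitude \<alpha> \<gamma> (\<lambda>j. if j then U True s else U False s)) t \<xi>"
        unfolding U(2)[OF t, of True \<xi>] duhamel_map_def duh_eq[OF t] by (simp add: F_def \<Theta>_def N_def)
    qed
  qed
qed

section \<open>Classical solutions\<close>

lemma spatial_derivative:
  assumes p: "exp_decay c p" and u: "u t = ift p"
  shows "u t differentiable (at x)" "dx u t x = ift (\<lambda>\<xi>. \<i> * complex_of_real \<xi> * p \<xi>) x"
  using ift_has_vector_derivative[OF p, of x] u
  by (auto simp: dx_def intro: differentiableI_vector vector_derivative_at)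

lemma spatial_derivative2:
  assumes p: "exp_decay c p" and u: "u t = ift p"
  shows "dx u t differentiable (at x)"
    "dx (dx u) t x = ift (\<lambda>\<xi>. \<i> * complex_of_real \<xi> * (\<i> * complex_of_real \<xi> * p \<xi>)) x"
proof -
  have c: "0 < c" by (rule exp_decay_pos[OF p])
  have q: "exp_decay (c / 2) (\<lambda>\<xi>. \<i> * complex_of_real \<xi> * p \<xi>)"
    by (rule exp_decay_derivative[OF p]) (use c in auto)
  have "dx u t = ift (\<lambda>\<xi>. \<i> * complex_of_real \<xi> * p \<xi>)"
    using spatial_derivative(2)[OF p, of u, OF u] by (simp add: fun_eq_iff)
  from spatial_derivative[OF q, of "dx u", OF this]
  show "dx u t differentiable (at x)"
    "dx (dx u) t x = ift (\<lambda>\<xi>. \<i> * complex_of_real \<xi> * (\<i> * complex_of_real \<xi> * p \<xi>)) x" .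
qed

text \<open>Both components are inverse transforms with exponential decay, so all spatial
  derivatives act as multipliers and the pointwise nonlinear terms are inverse transforms of the
  sources.\<close>

lemma nonlinearity_eq_ift:
  assumes p: "exp_decay c p" and b: "exp_decay c b" and \<phi>: "\<phi> t = ift p" and a: "a t = ift b"
    and \<gamma>: "\<gamma> \<ge> 1" and \<sigma>: "\<sigma> \<ge> 1"
    and g: "g = (\<lambda>s. \<alpha> * s ^ \<gamma>)" and f: "f = (\<lambda>s. lam * s ^ \<sigma>)"
  defines "u \<equiv> \<lambda>i. if i then b else (\<lambda>\<xi>. complex_of_real (japanese \<xi>) * p \<xi>)"
  shows "1 / 2 * (dx \<phi> t x)\<^sup>2 + 1 / 2 * complex_of_real (g ((cmod (a t x))\<^sup>2)) * dx \<phi> t x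
          + complex_of_real (f ((cmod (a t x))\<^sup>2)) = - ift (source_phase \<alpha> lam \<gamma> \<sigma> u) x"
    and "dx \<phi> t x * dx a t x + 1 / 2 * a t x * dx (dx \<phi>) t x
          + 1 / 2 * dx (\<lambda>s y. complex_of_real (g ((cmod (a s y))\<^sup>2)) * a s y) t x =
        - ift (\<lambda>\<xi>. complex_of_real (japanese \<xi>) * source_amplitude \<alpha> \<gamma> u \<xi>) x"
proof -
  have c: "0 < c / 2" "c / 2 < c" using exp_decay_pos[OF p] by auto
  note sp = spatial_derivative(2)[where u=\<phi> and t=t, OF p \<phi>] spatial_derivative(2)[where u=a and t=t, OF b a]
    spatial_derivative2(2)[where u=\<phi> and t=t, OF p \<phi>]
  show "1 / 2 * (dx \<phi> t x)\<^sup>2 + 1 / 2 * complex_of_real (g ((cmod (a t x))\<^sup>2)) * dx \<phi> t x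
          + complex_of_real (f ((cmod (a t x))\<^sup>2)) = - ift (source_phase \<alpha> lam \<gamma> \<sigma> u) x"
    unfolding u_def ift_source_phase(2)[OF p b \<gamma> \<sigma> c] sp g f a by simp
  show "dx \<phi> t x * dx a t x + 1 / 2 * a t x * dx (dx \<phi>) t x
          + 1 / 2 * dx (\<lambda>s y. complex_of_real (g ((cmod (a s y))\<^sup>2)) * a s y) t x =
        - ift (\<lambda>\<xi>. complex_of_real (japanese \<xi>) * source_amplitude \<alpha> \<gamma> u \<xi>) x"
    unfolding u_def ift_source_amplitude(2)[OF p b \<gamma> c] sp
    unfolding dx_def g a by simp
qed

text \<open>Domination for differentiating in time under the integral: the weight that is left at
  time \<open>T\<close> absorbs the powers of the bracket.\<close>

lemma zbound_dominated:
  assumes l: "l \<ge> 1" and u: "zbound l W M T r u" and M: "0 \<le> M" and W: "M * T < W"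
  obtains m where "integrable lborel m" "AE \<xi> in lborel. \<forall>t\<in>{0..T}. japanese \<xi> ^ k * cmod (u t \<xi>) \<le> m \<xi>"
proof -
  from u obtain n where n: "zmajor W M T u n" "wsq l n \<le> ennreal (r\<^sup>2)" "0 \<le> r" by (auto simp: zbound_def)
  have nm [measurable]: "n \<in> borel_measurable borel" using n by (simp add: zmajor_def)
  define c where "c = W - M * T"
  have c: "0 < c" using W by (simp add: c_def)
  have fin: "(\<integral>\<^sup>+ \<xi>. n \<xi> \<partial>lborel) < \<infinity>" using nn_integral_le_wsq[OF nm l n(2,3)] by (rule le_less_trans) simp
  have nAE: "AE \<xi> in lborel. n \<xi> \<noteq> \<infinity>" using fin by (intro nn_integral_PInf_AE) auto
  have int: "integrable lborel (\<lambda>\<xi>. enn2real (n \<xi>))"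
  proof (rule integrableI_bounded)
    have "(\<integral>\<^sup>+ \<xi>. ennreal (norm (enn2real (n \<xi>))) \<partial>lborel) = (\<integral>\<^sup>+ \<xi>. n \<xi> \<partial>lborel)"
      by (intro nn_integral_cong_AE) (use nAE in eventually_elim, simp add: less_top)
    then show "(\<integral>\<^sup>+ \<xi>. ennreal (norm (enn2real (n \<xi>))) \<partial>lborel) < \<infinity>" using fin by simp
  qed simp
  show thesis
  proof (rule that)
    show "integrable lborel (\<lambda>\<xi>. (fact k / c ^ k) * enn2real (n \<xi>))" using int by simp
    show "AE \<xi> in lborel. \<forall>t\<in>{0..T}. japanese \<xi> ^ k * cmod (u t \<xi>) \<le> (fact k / c ^ k) * enn2real (n \<xi>)"
      using nAE
    proof eventually_elim
      case (elim \<xi>)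
      show ?case
      proof
        fix t assume t: "t \<in> {0..T}"
        have "M * t \<le> M * T" using M t by (auto intro: mult_left_mono)
        then have "exp (c * japanese \<xi>) \<le> exp ((W - M * t) * japanese \<xi>)"
          by (simp add: c_def mult_right_mono)
        then have "exp (c * japanese \<xi>) * cmod (u t \<xi>) \<le> exp ((W - M * t) * japanese \<xi>) * cmod (u t \<xi>)"
          by (rule mult_right_mono) simp
        also have "\<dots> \<le> enn2real (n \<xi>)"
        proof -
          have "ennreal (exp ((W - M * t) * japanese \<xi>) * cmod (u t \<xi>)) \<le> n \<xi>"
            using n(1) t unfolding zmajor_def by blast
          from enn2real_mono[OF this] elim show ?thesis by (simp add: less_top)
        qed
        finally have e: "exp (c * japanese \<xi>) * cmod (u t \<xi>) \<le> enn2real (n \<xi>)" .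
        have "japanese \<xi> ^ k * cmod (u t \<xi>) \<le> ((fact k / c ^ k) * exp (c * japanese \<xi>)) * cmod (u t \<xi>)"
          by (intro mult_right_mono japanese_power_le_exp c) simp
        also have "\<dots> \<le> (fact k / c ^ k) * enn2real (n \<xi>)"
          unfolding mult.assoc using c by (intro mult_left_mono e) simp
        finally show "japanese \<xi> ^ k * cmod (u t \<xi>) \<le> (fact k / c ^ k) * enn2real (n \<xi>)" .
      qed
    qed
  qed
qed

lemma ift_time_derivative:
  fixes y y' :: "real \<Rightarrow> real \<Rightarrow> complex"
  assumes t0: "t0 \<in> {0..T}" and int: "\<And>t. t \<in> {0..T} \<Longrightarrow> integrable lborel (y t)"
    and int': "integrable lborel (y' t0)" and m: "integrable lborel m"
    and der: "\<And>\<xi> t. t \<in> {0..T} \<Longrightarrow> ((\<lambda>t. y t \<xi>) has_vector_derivative y' t \<xi>) (at t within {0..T})"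
    and bd: "AE \<xi> in lborel. \<forall>t\<in>{0..T}. cmod (y' t \<xi>) \<le> m \<xi>"
  shows "((\<lambda>t. ift (y t) x) has_vector_derivative ift (y' t0) x) (at t0 within {0..T})"
proof -
  have "((\<lambda>t. LBINT \<xi>. exp (\<i> * complex_of_real (x * \<xi>)) * y t \<xi>) has_vector_derivative
      (LBINT \<xi>. exp (\<i> * complex_of_real (x * \<xi>)) * y' t0 \<xi>)) (at t0 within {0..T})"
  proof (rule has_vector_derivative_integral[OF _ t0 _ _ m])
    show "integrable lborel (\<lambda>\<xi>. exp (\<i> * complex_of_real (x * \<xi>)) * y t \<xi>)" if "t \<in> {0..T}" for t
      by (rule integrable_ift[OF int[OF that]])
    show "integrable lborel (\<lambda>\<xi>. exp (\<i> * complex_of_real (x * \<xi>)) * y' t0 \<xi>)" by (rule integrable_ift[OF int'])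
    show "AE \<xi> in lborel. \<forall>t\<in>{0..T}. ((\<lambda>t. exp (\<i> * complex_of_real (x * \<xi>)) * y t \<xi>) has_vector_derivative
        exp (\<i> * complex_of_real (x * \<xi>)) * y' t \<xi>) (at t within {0..T})"
      by (intro AE_I2 ballI has_vector_derivative_mult_right der)
    show "AE \<xi> in lborel. \<forall>t\<in>{0..T}. cmod (exp (\<i> * complex_of_real (x * \<xi>)) * y' t \<xi>) \<le> m \<xi>"
      using bd by eventually_elim (simp only: norm_mult norm_exp_imaginary mult_1_left)
  qed auto
  from has_vector_derivative_mult_right[OF this, of "complex_of_real (1 / sqrt (2 * pi))"]
  show ?thesis unfolding ift_eq by simp
qed

lemma phase_derivative:
  "((\<lambda>t. exp (\<i> * complex_of_real (k * t))) has_vector_derivative \<i> * complex_of_real k * exp (\<i> * complex_of_real (k * t))) (at t within S)"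
proof -
  have "((\<lambda>t. exp (\<i> * (complex_of_real k * t))) has_field_derivative
      \<i> * complex_of_real k * exp (\<i> * (complex_of_real k * complex_of_real t))) (at (complex_of_real t))"
    by (auto intro!: derivative_eq_intros)
  from has_vector_derivative_real_field[OF this]
  have "((\<lambda>t. exp (\<i> * complex_of_real (k * t))) has_vector_derivative \<i> * complex_of_real k * exp (\<i> * complex_of_real (k * t))) (at t)"
    by (simp add: o_def)
  then show ?thesis by (rule has_vector_derivative_at_within)
qed

lemma duh_derivative:
  assumes c: "continuous_on {0..T} (\<lambda>s. S s \<xi>)" and t: "t \<in> {0..T}"
  shows "((\<lambda>t. duh \<theta> S t \<xi>) has_vector_derivative
      - (\<i> * complex_of_real (\<theta> \<xi>)) * duh \<theta> S t \<xi> + complex_of_real (japanese \<xi>) * S t \<xi>) (at t within {0..T})"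
proof -
  let ?E = "\<lambda>t. exp (- (\<i> * complex_of_real (\<theta> \<xi> * t)))"
  let ?f = "\<lambda>s. exp (\<i> * complex_of_real (\<theta> \<xi> * s)) * S s \<xi>"
  have I: "((\<lambda>t. integral {0..t} ?f) has_vector_derivative ?f t) (at t within {0..T})"
    using t by (intro integral_has_vector_derivative continuous_intros c)
  have E: "(?E has_vector_derivative - (\<i> * complex_of_real (\<theta> \<xi>)) * ?E t) (at t within {0..T})"
    using phase_derivative[of "- \<theta> \<xi>" t "{0..T}"] by simp
  have "((\<lambda>t. complex_of_real (japanese \<xi>) * (?E t * integral {0..t} ?f)) has_vector_derivative
      complex_of_real (japanese \<xi>) * (?E t * ?f t + (- (\<i> * complex_of_real (\<theta> \<xi>)) * ?E t) * integral {0..t} ?f)) (at t within {0..T})"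
    by (rule has_vector_derivative_mult_right[OF has_vector_derivative_mult[OF E I]])
  moreover have "?E t * ?f t = S t \<xi>"
    unfolding mult.assoc[symmetric] mult_exp_exp by simp
  ultimately show ?thesis unfolding duh_def by (simp only:) (simp add: algebra_simps)
qed

lemma duh_0: "duh \<theta> S 0 \<xi> = 0"
  by (simp add: duh_def)

text \<open>Comparing a trajectory with itself, at distance 0, extracts the plain bound from the
  Lipschitz property.\<close>

lemma source_zbound:
  fixes U :: "'i \<Rightarrow> real \<Rightarrow> real \<Rightarrow> complex"
  assumes N: "lip st l N" and adm: "admissible W M T" and U: "\<And>i. zbound l W M T R (U i)"
  obtains L where "zbound l W M T L (\<lambda>t. N (\<lambda>i. U i t))"
proof -
  have R: "0 \<le> R" using zbound_nonneg[OF U] .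
  obtain L where L: "lipL st l R L N" using N R unfolding lip_def by blast
  have "zbound l W M T 0 (\<lambda>t \<xi>. U i t \<xi> - U i t \<xi>)" for i using zbound_zero[of 0] by simp
  from lipLD(1)[OF L adm U U this] show thesis by (rule that)
qed

lemma H_norm_sq_initial:
  assumes "\<psi> \<in> H_space w k"
  shows "H_norm_sq w k \<psi> = ennreal ((H_norm w k \<psi>)\<^sup>2)" "0 \<le> H_norm w k \<psi>" "\<psi> \<in> L2"
  using assms by (auto simp: H_space_def H_norm_def less_top)

lemma wsq_weight_eq:
  assumes "AE \<xi> in lborel. fourier \<psi> \<xi> = h \<xi>"
  shows "wsq l (\<lambda>\<xi>. ennreal (exp (w * japanese \<xi>) * cmod (complex_of_real (japanese \<xi> powr s) * h \<xi>))) = H_norm_sq w (l + s) \<psi>"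
  unfolding wsq_def H_norm_sq_eq[OF assms]
proof (intro nn_integral_cong)
  fix \<xi>
  have "(japanese \<xi> powr l * (exp (w * japanese \<xi>) * cmod (complex_of_real (japanese \<xi> powr s) * h \<xi>)))\<^sup>2 =
      ((japanese \<xi> powr l)\<^sup>2 * (japanese \<xi> powr s)\<^sup>2) * (exp (w * japanese \<xi>))\<^sup>2 * (cmod (h \<xi>))\<^sup>2"
    by (simp add: norm_mult power_mult_distrib)
  also have "\<dots> = japanese \<xi> powr (2 * (l + s)) * exp (2 * w * japanese \<xi>) * (cmod (h \<xi>))\<^sup>2"
    unfolding powr_double exp_double powr_add[symmetric] by (simp add: algebra_simps)
  finally show "(ennreal (japanese \<xi> powr l) * ennreal (exp (w * japanese \<xi>) * cmod (complex_of_real (japanese \<xi> powr s) * h \<xi>)))\<^sup>2 =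
      ennreal (japanese \<xi> powr (2 * (l + s)) * exp (2 * w * japanese \<xi>) * (cmod (h \<xi>))\<^sup>2)"
    by (simp add: ennreal_mult[symmetric] ennreal_power)
qed

theorem classical_existence:
  fixes \<alpha> lam l C w0 :: real and \<gamma> \<sigma> :: nat
  assumes l: "l \<ge> 1" and C: "0 \<le> C" and \<gamma>: "\<gamma> \<ge> 1" and \<sigma>: "\<sigma> \<ge> 1"
    and g: "g = (\<lambda>s. \<alpha> * s ^ \<gamma>)" and f: "f = (\<lambda>s. lam * s ^ \<sigma>)"
  shows "\<exists>M0>0. \<forall>M\<ge>M0. \<forall>T \<epsilon> \<phi>0 a0. 0 < T \<longrightarrow> T < w0 / M \<longrightarrow> \<bar>\<epsilon>\<bar> \<le> 1 \<longrightarrow>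
    \<phi>0 \<in> H_space w0 (l + 1) \<longrightarrow> a0 \<in> H_space w0 l \<longrightarrow>
    H_norm w0 (l + 1) \<phi>0 \<le> C \<longrightarrow> H_norm w0 l a0 \<le> C \<longrightarrow> (\<forall>x. \<phi>0 x \<in> \<real>) \<longrightarrow>
    (\<exists>\<phi> a. (\<phi>, a) \<in> X_space (weight w0 M) T l \<and> classical_solution g f \<epsilon> T \<phi>0 a0 \<phi> a \<and>
      (\<forall>t\<in>{0..T}. \<forall>x. \<phi> t x \<in> \<real>) \<and>
      triple_norm_sq w0 M (l + 1) T \<phi> \<le> ennreal (3 / 2 * (8/7 * (H_norm w0 (l + 1) \<phi>0 + H_norm w0 l a0 ^ (2 * \<sigma>) / 2))\<^sup>2) \<and>
      triple_norm_sq w0 M l T a \<le> ennreal (3 / 2 * (8/7 * H_norm w0 l a0)\<^sup>2))"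
proof -
  obtain M' where M': "0 < M'" and ex: "\<forall>M\<ge>M'. \<forall>W T A B. \<forall>(\<theta> :: real \<Rightarrow> real) V0 b0. admissible W M T \<longrightarrow> 0 \<le> A \<longrightarrow> A \<le> C \<longrightarrow> 0 \<le> B \<longrightarrow> B \<le> C \<longrightarrow>
    \<theta> \<in> borel_measurable borel \<longrightarrow> V0 \<in> borel_measurable borel \<longrightarrow> b0 \<in> borel_measurable borel \<longrightarrow> til V0 = V0 \<longrightarrow>
    wsq l (\<lambda>\<xi>. ennreal (exp (W * japanese \<xi>) * cmod (V0 \<xi>))) \<le> ennreal (A\<^sup>2) \<longrightarrow>
    wsq l (\<lambda>\<xi>. ennreal (exp (W * japanese \<xi>) * cmod (b0 \<xi>))) \<le> ennreal (B\<^sup>2) \<longrightarrow>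
    (\<exists>V b. zbound l W M T (8/7 * (A + B ^ (2 * \<sigma>) / 2)) V \<and> zbound l W M T (8/7 * B) b \<and>
      (\<forall>t\<in>{0..T}. til (V t) = V t) \<and>
      (\<forall>t\<in>{0..T}. \<forall>\<xi>.
         V t \<xi> = V0 \<xi> + duh (\<lambda>_. 0) (\<lambda>s. source_phase \<alpha> lam \<gamma> \<sigma> (\<lambda>j. if j then b s else V s)) t \<xi> \<and>
         b t \<xi> = exp (- (\<i> * complex_of_real (\<theta> \<xi> * t))) * b0 \<xi> +
           duh \<theta> (\<lambda>s. source_amplitude \<alpha> \<gamma> (\<lambda>j. if j then b s else V s)) t \<xi>))"
  proof -
    from fourier_side_existence[OF l C \<sigma>, of \<alpha> lam \<gamma>] show thesis
      by (elim exE conjE) (rule that)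
  qed
  show ?thesis
  \<comment> \<open>The Fourier-side result is applied with rate \<open>M / 3\<close>, so its
    threshold is tripled.\<close>
  proof (intro exI[of _ "3 * M'"] conjI allI impI)
    show "0 < 3 * M'" using M' by simp
    fix M T \<epsilon> :: real and \<phi>0 a0 :: "real \<Rightarrow> complex"
    assume MM: "3 * M' \<le> M" and T: "0 < T" "T < w0 / M" and \<epsilon>: "\<bar>\<epsilon>\<bar> \<le> 1"
      and \<phi>0: "\<phi>0 \<in> H_space w0 (l + 1)" and a0: "a0 \<in> H_space w0 l"
      and nC: "H_norm w0 (l + 1) \<phi>0 \<le> C" "H_norm w0 l a0 \<le> C" and real: "\<forall>x. \<phi>0 x \<in> \<real>"
    have M: "0 < M" "M' \<le> M / 3" using MM M' by auto
    have MT: "M * T < w0" using T M by (simp add: field_simps)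
    have MT0: "0 < M * T" using M T by simp
    have w0: "0 < w0" using MT MT0 by linarith
    then have adm: "admissible w0 (M / 3) T" using MT M T by (simp add: admissible_def)
    have MT3: "M / 3 * T < w0" using MT MT0 by simp
    define A where "A = H_norm w0 (l + 1) \<phi>0"
    define B where "B = H_norm w0 l a0"
    note HA = H_norm_sq_initial[OF \<phi>0, folded A_def] and HB = H_norm_sq_initial[OF a0, folded B_def]
    \<comment> \<open>\<open>fourier\<close> is fixed by choice and hermitian only almost everywhere
      for real data. The symmetrised representative is hermitian at every frequency, as
      \<open>til V0 = V0\<close> demands.\<close>
    define p0 where "p0 = hermitian_part (fourier \<phi>0)"
    define b0 where "b0 = fourier a0"
    define V0 where "V0 \<xi> = complex_of_real (japanese \<xi> powr 1) * p0 \<xi>" for \<xi>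
    define \<theta> where "\<theta> \<xi> = \<epsilon> * \<xi>\<^sup>2 / 2" for \<xi>
    have \<theta>le: "\<bar>\<theta> \<xi>\<bar> \<le> japanese \<xi> ^ 2" for \<xi>
    proof -
      have "\<bar>\<epsilon>\<bar> * \<xi>\<^sup>2 \<le> 1 * \<xi>\<^sup>2" by (intro mult_right_mono \<epsilon>) simp
      moreover have "\<bar>\<theta> \<xi>\<bar> = \<bar>\<epsilon>\<bar> * \<xi>\<^sup>2 / 2" by (simp add: \<theta>_def abs_mult)
      moreover have "japanese \<xi> ^ 2 = 1 + \<xi>\<^sup>2" by (simp add: japanese_def)
      ultimately show ?thesis using zero_le_power2[of \<xi>] by linarith
    qed
    have F [measurable]: "fourier \<phi>0 \<in> borel_measurable borel" "b0 \<in> borel_measurable borel"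
      using fourier_L2[OF HA(3)] fourier_L2[OF HB(3)] by (auto simp: b0_def L2_iff)
    have [measurable]: "p0 \<in> borel_measurable borel" unfolding p0_def hermitian_part_def[abs_def] by measurable
    have meas: "\<theta> \<in> borel_measurable borel" "V0 \<in> borel_measurable borel"
      unfolding \<theta>_def[abs_def] V0_def[abs_def] by measurable
    have tilp: "til p0 = p0" unfolding p0_def by (rule til_hermitian_part)
    then have tilV: "til V0 = V0" by (simp add: fun_eq_iff til_def V0_def)
    have Fp: "AE \<xi> in lborel. fourier \<phi>0 \<xi> = p0 \<xi>"
    proof -
      have "AE \<xi> in lborel. fourier \<phi>0 \<xi> = cnj (fourier \<phi>0 (- \<xi>))" by (rule fourier_real[OF HA(3)]) (use real in blast)
      then show ?thesis by eventually_elim (simp add: p0_def hermitian_part_def til_def)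
    qed
    have wA: "wsq l (\<lambda>\<xi>. ennreal (exp (w0 * japanese \<xi>) * cmod (V0 \<xi>))) \<le> ennreal (A\<^sup>2)"
      unfolding V0_def wsq_weight_eq[OF Fp] HA(1) ..
    have wB: "wsq l (\<lambda>\<xi>. ennreal (exp (w0 * japanese \<xi>) * cmod (b0 \<xi>))) \<le> ennreal (B\<^sup>2)"
      using wsq_weight_eq[of a0 b0 l w0 0] by (simp add: b0_def HB(1))
    from ex[rule_format, OF M(2) adm HA(2) nC(1)[folded A_def] HB(2) nC(2)[folded B_def] meas F(2) tilV wA wB]
    obtain V b where V: "zbound l w0 (M / 3) T (8/7 * (A + B ^ (2 * \<sigma>) / 2)) V" and b: "zbound l w0 (M / 3) T (8/7 * B) b"
      and herm: "\<And>t. t \<in> {0..T} \<Longrightarrow> til (V t) = V t"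
      and Veq: "\<And>t \<xi>. t \<in> {0..T} \<Longrightarrow> V t \<xi> = V0 \<xi> + duh (\<lambda>_. 0) (\<lambda>s. source_phase \<alpha> lam \<gamma> \<sigma> (\<lambda>j. if j then b s else V s)) t \<xi>"
      and beq: "\<And>t \<xi>. t \<in> {0..T} \<Longrightarrow> b t \<xi> = exp (- (\<i> * complex_of_real (\<theta> \<xi> * t))) * b0 \<xi> +
           duh \<theta> (\<lambda>s. source_amplitude \<alpha> \<gamma> (\<lambda>j. if j then b s else V s)) t \<xi>"
      by blast
    interpret P: weighted_solution l 1 w0 M T "8/7 * (A + B ^ (2 * \<sigma>) / 2)" V
      by unfold_locales (use l M T MT V in auto)
    interpret Q: weighted_solution l 0 w0 M T "8/7 * B" b
      by unfold_locales (use l M T MT b in auto)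
    have Qq: "Q.q t = b t" for t by (simp add: Q.q_def fun_eq_iff)
    let ?c = "w0 - M / 3 * T"
    have p: "exp_decay ?c (P.q t)" and bd: "exp_decay ?c (b t)" if "t \<in> {0..T}" for t
      using P.q_props(1)[OF _ that] Q.q_props(1)[OF _ that] by (simp_all add: Qq)
    have ut: "P.u t = ift (P.q t)" "Q.u t = ift (b t)" for t by (simp_all add: P.u_def Q.u_def Qq)
    have JP: "(\<lambda>\<xi>. complex_of_real (japanese \<xi>) * P.q t \<xi>) = V t" for t
      by (simp add: P.q_def fun_eq_iff powr_minus)
    define S1 where "S1 t = source_phase \<alpha> lam \<gamma> \<sigma> (\<lambda>j. if j then b t else V t)" for t
    define S2 where "S2 t = source_amplitude \<alpha> \<gamma> (\<lambda>j. if j then b t else V t)" for t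
    define R where "R = max (8/7 * (A + B ^ (2 * \<sigma>) / 2)) (8/7 * B)"
    define U where "U j = (if j then b else V)" for j
    have U: "zbound l w0 (M / 3) T R (U j)" for j
      using V b by (cases j) (auto simp: U_def R_def intro: zbound_mono)
    have Ut: "(\<lambda>j. U j t) = (\<lambda>j. if j then b t else V t)" for t by (simp add: U_def fun_eq_iff)
    obtain L1 where "zbound l w0 (M / 3) T L1 (\<lambda>t. source_phase \<alpha> lam \<gamma> \<sigma> (\<lambda>j. U j t))"
      by (rule source_zbound[where U=U and R=R, OF lip_source_phase[OF l] adm U])
    then have zS1: "zbound l w0 (M / 3) T L1 S1" by (simp only: Ut S1_def[abs_def])
    obtain L2 where "zbound l w0 (M / 3) T L2 (\<lambda>t. source_amplitude \<alpha> \<gamma> (\<lambda>j. U j t))"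
      by (rule source_zbound[where U=U and R=R, OF lip_source_amplitude[OF l] adm U])
    then have zS2: "zbound l w0 (M / 3) T L2 S2" by (simp only: Ut S2_def[abs_def])
    have cS: "continuous_on {0..T} (\<lambda>s. S1 s \<xi>)" "continuous_on {0..T} (\<lambda>s. S2 s \<xi>)" for \<xi>
      using zbound_zcarrier[OF zS1] zbound_zcarrier[OF zS2] by (auto simp: zcarrier_def)
    have M3: "0 \<le> M / 3" using M by simp
    have time\<phi>: "((\<lambda>t. P.u t x) has_vector_derivative ift (S1 t) x) (at t within {0..T})" if t: "t \<in> {0..T}" for t x
    proof -
      obtain m where m: "integrable lborel m" "AE \<xi> in lborel. \<forall>t\<in>{0..T}. japanese \<xi> ^ 0 * cmod (S1 t \<xi>) \<le> m \<xi>"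
        by (rule zbound_dominated[OF l zS1 M3 MT3])
      show ?thesis unfolding ut
      proof (rule ift_time_derivative[OF t _ _ m(1)])
        show "integrable lborel (P.q t)" if "t \<in> {0..T}" for t by (rule exp_decay_integrable[OF p[OF that]])
        show "integrable lborel (S1 t)" by (rule exp_decay_integrable[OF zbound_exp_decay(1)[OF l zS1 t M3 MT3]])
        show "AE \<xi> in lborel. \<forall>t\<in>{0..T}. cmod (S1 t \<xi>) \<le> m \<xi>" using m(2) by simp
        fix \<xi> t assume t: "t \<in> {0..T}"
        have "((\<lambda>t. complex_of_real (japanese \<xi> powr - 1) * (V0 \<xi> + duh (\<lambda>_. 0) S1 t \<xi>)) has_vector_derivative
            complex_of_real (japanese \<xi> powr - 1) * (0 + (- (\<i> * complex_of_real 0) * duh (\<lambda>_. 0) S1 t \<xi> + complex_of_real (japanese \<xi>) * S1 t \<xi>))) (at t within {0..T})"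
          by (intro has_vector_derivative_mult_right has_vector_derivative_add has_vector_derivative_const duh_derivative cS t)
        moreover have "complex_of_real (japanese \<xi> powr - 1) * (0 + (- (\<i> * complex_of_real 0) * duh (\<lambda>_. 0) S1 t \<xi> + complex_of_real (japanese \<xi>) * S1 t \<xi>)) = S1 t \<xi>"
          by (simp add: powr_minus field_simps)
        ultimately have "((\<lambda>t. complex_of_real (japanese \<xi> powr - 1) * (V0 \<xi> + duh (\<lambda>_. 0) S1 t \<xi>)) has_vector_derivative S1 t \<xi>) (at t within {0..T})"
          by (simp only:)
        then show "((\<lambda>t. P.q t \<xi>) has_vector_derivative S1 t \<xi>) (at t within {0..T})"
          by (rule has_vector_derivative_transform[OF t, rotated]) (simp add: P.q_def Veq S1_def[abs_def])
      qed
    qed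
    have timea: "((\<lambda>t. Q.u t x) has_vector_derivative
        ift (\<lambda>\<xi>. - (\<i> * complex_of_real (\<theta> \<xi>)) * b t \<xi> + complex_of_real (japanese \<xi>) * S2 t \<xi>) x) (at t within {0..T})" if t: "t \<in> {0..T}" for t x
    proof -
      obtain m1 where m1: "integrable lborel m1" "AE \<xi> in lborel. \<forall>t\<in>{0..T}. japanese \<xi> ^ 2 * cmod (b t \<xi>) \<le> m1 \<xi>"
        by (rule zbound_dominated[OF l b M3 MT3])
      obtain m2 where m2: "integrable lborel m2" "AE \<xi> in lborel. \<forall>t\<in>{0..T}. japanese \<xi> ^ 1 * cmod (S2 t \<xi>) \<le> m2 \<xi>"
        by (rule zbound_dominated[OF l zS2 M3 MT3])
      show ?thesis unfolding ut
      proof (rule ift_time_derivative[OF t])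
        show "integrable lborel (b t)" if "t \<in> {0..T}" for t by (rule exp_decay_integrable[OF bd[OF that]])
        show "integrable lborel (\<lambda>\<xi>. m1 \<xi> + m2 \<xi>)" using m1 m2 by simp
        have bound: "AE \<xi> in lborel. \<forall>t\<in>{0..T}. cmod (- (\<i> * complex_of_real (\<theta> \<xi>)) * b t \<xi> + complex_of_real (japanese \<xi>) * S2 t \<xi>) \<le> m1 \<xi> + m2 \<xi>"
          using m1(2) m2(2)
        proof eventually_elim
          case (elim \<xi>)
          show ?case
          proof
            fix t assume t: "t \<in> {0..T}"
            have "cmod (- (\<i> * complex_of_real (\<theta> \<xi>)) * b t \<xi> + complex_of_real (japanese \<xi>) * S2 t \<xi>) \<le>
                \<bar>\<theta> \<xi>\<bar> * cmod (b t \<xi>) + japanese \<xi> * cmod (S2 t \<xi>)"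
              by (rule order_trans[OF norm_triangle_ineq]) (simp add: norm_mult)
            also have "\<dots> \<le> japanese \<xi> ^ 2 * cmod (b t \<xi>) + japanese \<xi> ^ 1 * cmod (S2 t \<xi>)"
              unfolding power_one_right by (intro add_right_mono mult_right_mono \<theta>le) simp
            also have "\<dots> \<le> m1 \<xi> + m2 \<xi>" using elim t by (intro add_mono) blast+
            finally show "cmod (- (\<i> * complex_of_real (\<theta> \<xi>)) * b t \<xi> + complex_of_real (japanese \<xi>) * S2 t \<xi>) \<le> m1 \<xi> + m2 \<xi>" .
          qed
        qed
        then show "AE \<xi> in lborel. \<forall>t\<in>{0..T}. cmod (- (\<i> * complex_of_real (\<theta> \<xi>)) * b t \<xi> + complex_of_real (japanese \<xi>) * S2 t \<xi>) \<le> m1 \<xi> + m2 \<xi>" .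
        have [measurable]: "b t \<in> borel_measurable borel" "S2 t \<in> borel_measurable borel"
          using zbound_zcarrier[OF b] zbound_zcarrier[OF zS2] t by (auto simp: zcarrier_def)
        note [measurable] = meas(1)
        show "integrable lborel (\<lambda>\<xi>. - (\<i> * complex_of_real (\<theta> \<xi>)) * b t \<xi> + complex_of_real (japanese \<xi>) * S2 t \<xi>)"
        proof (rule Bochner_Integration.integrable_bound[where f="\<lambda>\<xi>. m1 \<xi> + m2 \<xi>"])
          show "AE \<xi> in lborel. cmod (- (\<i> * complex_of_real (\<theta> \<xi>)) * b t \<xi> + complex_of_real (japanese \<xi>) * S2 t \<xi>) \<le> norm (m1 \<xi> + m2 \<xi>)"
            using bound by eventually_elim (use t in fastforce)
        qed (use m1 m2 in auto)
        fix \<xi> t assume t: "t \<in> {0..T}"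
        have E: "((\<lambda>t. exp (- (\<i> * complex_of_real (\<theta> \<xi> * t)))) has_vector_derivative
            - (\<i> * complex_of_real (\<theta> \<xi>)) * exp (- (\<i> * complex_of_real (\<theta> \<xi> * t)))) (at t within {0..T})"
          using phase_derivative[of "- \<theta> \<xi>" t "{0..T}"] by simp
        have "((\<lambda>t. exp (- (\<i> * complex_of_real (\<theta> \<xi> * t))) * b0 \<xi> + duh \<theta> S2 t \<xi>) has_vector_derivative
            (- (\<i> * complex_of_real (\<theta> \<xi>)) * exp (- (\<i> * complex_of_real (\<theta> \<xi> * t)))) * b0 \<xi> +
            (- (\<i> * complex_of_real (\<theta> \<xi>)) * duh \<theta> S2 t \<xi> + complex_of_real (japanese \<xi>) * S2 t \<xi>)) (at t within {0..T})"
          by (intro has_vector_derivative_add has_vector_derivative_mult_left E duh_derivative cS t)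
        moreover have "(- (\<i> * complex_of_real (\<theta> \<xi>)) * exp (- (\<i> * complex_of_real (\<theta> \<xi> * t)))) * b0 \<xi> +
            (- (\<i> * complex_of_real (\<theta> \<xi>)) * duh \<theta> S2 t \<xi> + complex_of_real (japanese \<xi>) * S2 t \<xi>) =
            - (\<i> * complex_of_real (\<theta> \<xi>)) * b t \<xi> + complex_of_real (japanese \<xi>) * S2 t \<xi>"
          unfolding beq[OF t] S2_def[abs_def] by (simp only: distrib_left mult.assoc add.assoc)
        ultimately have "((\<lambda>t. exp (- (\<i> * complex_of_real (\<theta> \<xi> * t))) * b0 \<xi> + duh \<theta> S2 t \<xi>) has_vector_derivative
            - (\<i> * complex_of_real (\<theta> \<xi>)) * b t \<xi> + complex_of_real (japanese \<xi>) * S2 t \<xi>) (at t within {0..T})"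
          by (simp only:)
        then show "((\<lambda>t. b t \<xi>) has_vector_derivative - (\<i> * complex_of_real (\<theta> \<xi>)) * b t \<xi> + complex_of_real (japanese \<xi>) * S2 t \<xi>) (at t within {0..T})"
          by (rule has_vector_derivative_transform[OF t, rotated]) (simp only: beq S2_def[abs_def])
      qed
    qed
    have t0: "0 \<in> {0..T}" using T by simp
    have "classical_solution g f \<epsilon> T \<phi>0 a0 P.u Q.u"
      unfolding classical_solution_def
    proof (intro conjI ballI allI)
      have "P.q 0 = p0" by (simp add: P.q_def Veq[OF t0] duh_0 V0_def fun_eq_iff powr_minus)
      then show "AE x in lborel. P.u 0 x = \<phi>0 x"
        using fourier_inversion[OF HA(3) exp_decay_integrable[OF p[OF t0]]] Fp by (simp add: ut eq_commute)
      have "b 0 = b0" by (simp add: beq[OF t0] duh_0 fun_eq_iff)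
      then show "AE x in lborel. Q.u 0 x = a0 x"
        using fourier_inversion[OF HB(3) exp_decay_integrable[OF bd[OF t0]]] by (simp add: ut b0_def eq_commute)
      fix t x assume t: "t \<in> {0..T}"
      note sp = spatial_derivative[where u=P.u and t=t, OF p[OF t] ut(1)] spatial_derivative[where u=Q.u and t=t, OF bd[OF t] ut(2)]
        spatial_derivative2[where u=P.u and t=t, OF p[OF t] ut(1)] spatial_derivative2[where u=Q.u and t=t, OF bd[OF t] ut(2)]
      show "P.u t differentiable at x" "dx P.u t differentiable at x" "Q.u t differentiable at x" "dx Q.u t differentiable at x"
        by (rule sp)+
      show "(\<lambda>s. P.u s x) differentiable at t within {0..T}" "(\<lambda>s. Q.u s x) differentiable at t within {0..T}"
        using time\<phi>[OF t] timea[OF t] by (auto intro: differentiableI_vector)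
      have dt1: "dt T P.u t x = ift (S1 t) x"
        unfolding dt_def by (rule vector_derivative_within_closed_interval[OF T(1) t time\<phi>[OF t]])
      have dt2: "dt T Q.u t x = ift (\<lambda>\<xi>. - (\<i> * complex_of_real (\<theta> \<xi>)) * b t \<xi> + complex_of_real (japanese \<xi>) * S2 t \<xi>) x"
        unfolding dt_def by (rule vector_derivative_within_closed_interval[OF T(1) t timea[OF t]])
      note nl = nonlinearity_eq_ift[where \<phi>=P.u and a=Q.u and t=t, OF p[OF t] bd[OF t] ut(1) ut(2) \<gamma> \<sigma> g f, of x, unfolded JP]
      show "dt T P.u t x + 1 / 2 * (dx P.u t x)\<^sup>2 + 1 / 2 * complex_of_real (g ((cmod (Q.u t x))\<^sup>2)) * dx P.u t x
          + complex_of_real (f ((cmod (Q.u t x))\<^sup>2)) = 0"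
        using nl(1) unfolding dt1 S1_def by (simp only: add.assoc) simp
      have c2: "0 < ?c / 2" "?c / 2 < ?c" using exp_decay_pos[OF p[OF t]] by auto
      have "exp_decay (?c / 2) (\<lambda>\<xi>. - (\<i> * complex_of_real (\<theta> \<xi>)) * b t \<xi>)"
      proof (rule exp_decay_mult[OF bd[OF t] _ _ c2, where C=1 and k=2])
        note [measurable] = meas(1)
        show "(\<lambda>\<xi>. - (\<i> * complex_of_real (\<theta> \<xi>))) \<in> borel_measurable borel" by measurable
        fix \<xi>
        show "cmod (- (\<i> * complex_of_real (\<theta> \<xi>))) \<le> 1 * (japanese \<xi>)\<^sup>2"
          unfolding norm_minus_cancel norm_mult norm_ii norm_of_real using \<theta>le by simp
      qed
      note e1 = exp_decay_integrable[OF this]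
      have zj: "exp_decay (?c / 2) (\<lambda>\<xi>. complex_of_real (japanese \<xi>) * S2 t \<xi>)"
        using ift_source_amplitude(1)[OF p[OF t] bd[OF t] \<gamma> c2, of \<alpha>] by (simp only: JP S2_def)
      note e2 = exp_decay_integrable[OF zj]
      \<comment> \<open>Since (i xi)^2 = -xi^2, the dispersive multiplier is i epsilon/2 times the
        symbol of the second derivative.\<close>
      have k: "ift (\<lambda>\<xi>. - (\<i> * complex_of_real (\<theta> \<xi>)) * b t \<xi>) x = \<i> * complex_of_real \<epsilon> / 2 * dx (dx Q.u) t x"
      proof -
        have "(\<lambda>\<xi>. - (\<i> * complex_of_real (\<theta> \<xi>)) * b t \<xi>) =
            (\<lambda>\<xi>. (\<i> * complex_of_real \<epsilon> / 2) * (\<i> * complex_of_real \<xi> * (\<i> * complex_of_real \<xi> * b t \<xi>)))"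
          by (simp add: fun_eq_iff \<theta>_def power2_eq_square) (simp add: mult_ac)
        then show ?thesis unfolding sp by (simp only: ift_cmult)
      qed
      show "dt T Q.u t x + dx P.u t x * dx Q.u t x + 1 / 2 * Q.u t x * dx (dx P.u) t x
          + 1 / 2 * dx (\<lambda>s y. complex_of_real (g ((cmod (Q.u s y))\<^sup>2)) * Q.u s y) t x
          = \<i> * complex_of_real \<epsilon> / 2 * dx (dx Q.u) t x"
      proof -
        have dt2': "dt T Q.u t x = \<i> * complex_of_real \<epsilon> / 2 * dx (dx Q.u) t x + ift (\<lambda>\<xi>. complex_of_real (japanese \<xi>) * S2 t \<xi>) x"
          unfolding dt2 by (subst ift_add[OF e1 e2]) (simp only: k)
        have gen: "D + S + X + Y + Z = D" if "X + Y + Z = - S" for D S X Y Z :: complex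
          using that by (simp add: add.assoc)
        show ?thesis unfolding dt2' S2_def by (rule gen[OF nl(2)])
      qed
    qed
    moreover have "(P.u, Q.u) \<in> X_space (weight w0 M) T l"
      unfolding X_space_def using P.u_Y_space Q.u_Y_space by simp
    moreover have "\<forall>t\<in>{0..T}. \<forall>x. P.u t x \<in> \<real>"
    proof (intro ballI allI)
      fix t x assume t: "t \<in> {0..T}"
      have "til (P.q t) = P.q t"
        using herm[OF t] by (simp add: fun_eq_iff til_def P.q_def)
      then have "cnj (P.u t x) = P.u t x" unfolding ut ift_til[symmetric] by simp
      then show "P.u t x \<in> \<real>" by (simp add: Reals_cnj_iff)
    qed
    moreover have "triple_norm_sq w0 M (l + 1) T P.u \<le> ennreal (3 / 2 * (8/7 * (A + B ^ (2 * \<sigma>) / 2))\<^sup>2)"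
      by (rule P.triple_norm_le) simp
    moreover have "triple_norm_sq w0 M l T Q.u \<le> ennreal (3 / 2 * (8/7 * B)\<^sup>2)"
      using Q.triple_norm_le by simp
    ultimately show "\<exists>\<phi> a. (\<phi>, a) \<in> X_space (weight w0 M) T l \<and> classical_solution g f \<epsilon> T \<phi>0 a0 \<phi> a \<and>
      (\<forall>t\<in>{0..T}. \<forall>x. \<phi> t x \<in> \<real>) \<and>
      triple_norm_sq w0 M (l + 1) T \<phi> \<le> ennreal (3 / 2 * (8/7 * (H_norm w0 (l + 1) \<phi>0 + H_norm w0 l a0 ^ (2 * \<sigma>) / 2))\<^sup>2) \<and>
      triple_norm_sq w0 M l T a \<le> ennreal (3 / 2 * (8/7 * H_norm w0 l a0)\<^sup>2)"
      unfolding A_def B_def by blast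
  qed
qed

section \<open>Uniqueness\<close>

text \<open>The set where the functions differ is open, and a null set contains no interval.\<close>

lemma continuous_AE_eq:
  fixes f g :: "real \<Rightarrow> complex"
  assumes f: "continuous_on UNIV f" and g: "continuous_on UNIV g" and eq: "AE x in lborel. f x = g x"
  shows "f x = g x"
proof (rule ccontr)
  assume "f x \<noteq> g x"
  have op: "open {x. f x \<noteq> g x}"
    by (rule open_Collect_neq[OF f g])
  obtain N where N: "{x \<in> space lborel. \<not> f x = g x} \<subseteq> N" "emeasure lborel N = 0" "N \<in> sets lborel"
    using eq by (rule AE_E)
  obtain e where e: "e > 0" "ball x e \<subseteq> {x. f x \<noteq> g x}"
    using op[unfolded open_contains_ball] \<open>f x \<noteq> g x\<close> by (metis (mono_tags, lifting) CollectI)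
  have "{x - e / 2..x + e / 2} \<subseteq> ball x e" using e by (auto simp: dist_real_def)
  then have "{x - e / 2..x + e / 2} \<subseteq> N" using e N(1) by auto
  then have "emeasure lborel {x - e / 2..x + e / 2} \<le> emeasure lborel N"
    using N(3) by (intro emeasure_mono) auto
  then show False using N(2) e(1) by simp
qed

section \<open>Jointly measurable representatives\<close>

lemma measurable_curried:
  assumes Y: "(\<lambda>p. Y (fst p) (snd p)) \<in> borel_measurable (borel \<Otimes>\<^sub>M borel)"
    and [measurable]: "f \<in> borel_measurable N" "g \<in> borel_measurable N"
  shows "(\<lambda>x. Y (f x :: real) (g x :: real) :: complex) \<in> borel_measurable N"
proof -
  have "(\<lambda>x. (f x, g x)) \<in> measurable N (borel \<Otimes>\<^sub>M borel)" by measurable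
  from measurable_compose[OF this Y] show ?thesis by simp
qed

definition jointly_measurable :: "(real \<Rightarrow> real \<Rightarrow> complex) \<Rightarrow> bool" where
  "jointly_measurable Y \<longleftrightarrow> (\<lambda>p. Y (fst p) (snd p)) \<in> borel_measurable (borel \<Otimes>\<^sub>M borel)"

lemma jointly_measurableD:
  "jointly_measurable Y \<Longrightarrow> f \<in> borel_measurable N \<Longrightarrow> g \<in> borel_measurable N \<Longrightarrow> (\<lambda>x. Y (f x) (g x)) \<in> borel_measurable N"
  unfolding jointly_measurable_def by (rule measurable_curried)

text \<open>The functions \<open>y t\<close> are chosen separately for each time, so nothing is
  known about joint measurability. Step functions in time with squared error 2^-n are jointly
  measurable, and summability of the errors gives almost everywhere convergence at each
  time.\<close>

lemma L2_continuous_version: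
  fixes y :: "real \<Rightarrow> real \<Rightarrow> complex"
  assumes T: "0 \<le> T" and y: "\<And>t. t \<in> {0..T} \<Longrightarrow> y t \<in> L2"
    and cont: "\<And>t. t \<in> {0..T} \<Longrightarrow> ((\<lambda>s. l2n (\<lambda>\<xi>. y s \<xi> - y t \<xi>)) \<longlongrightarrow> 0) (at t within {0..T})"
  obtains Y B where "jointly_measurable Y" "0 \<le> B"
    "\<And>t. t \<in> {0..T} \<Longrightarrow> AE \<xi> in lborel. Y t \<xi> = y t \<xi>"
    "\<And>t. t \<in> {0..T} \<Longrightarrow> l2n (y t) \<le> ennreal B"
proof -
  have ym: "y t \<in> borel_measurable borel" if "t \<in> {0..T}" for t using y[OF that] by (rule L2_measurable)
  \<comment> \<open>Uniform continuity from a Lebesgue number of the cover; the quarters of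
    \<open>e\<close> compensate the factors 2 in \<open>l2n_diff_triangle\<close>.\<close>
  have unif: "\<exists>d>0. \<forall>s\<in>{0..T}. \<forall>t\<in>{0..T}. \<bar>s - t\<bar> < d \<longrightarrow> l2n (\<lambda>\<xi>. y s \<xi> - y t \<xi>) \<le> ennreal e" if e: "e > 0" for e
  proof -
    have "\<exists>d>0. \<forall>s\<in>{0..T}. \<bar>s - t\<bar> < d \<longrightarrow> l2n (\<lambda>\<xi>. y s \<xi> - y t \<xi>) \<le> ennreal (e / 4)" if t: "t \<in> {0..T}" for t
    proof -
      have "\<forall>\<^sub>F s in at t within {0..T}. l2n (\<lambda>\<xi>. y s \<xi> - y t \<xi>) < ennreal (e / 4)"
        using cont[OF t] e by (intro order_tendstoD) auto
      then obtain d where d: "d > 0" "\<And>s. s \<in> {0..T} \<Longrightarrow> s \<noteq> t \<Longrightarrow> dist s t < d \<Longrightarrow> l2n (\<lambda>\<xi>. y s \<xi> - y t \<xi>) < ennreal (e / 4)"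
        unfolding eventually_at by blast
      have "l2n (\<lambda>\<xi>. y s \<xi> - y t \<xi>) \<le> ennreal (e / 4)" if s: "s \<in> {0..T}" "\<bar>s - t\<bar> < d" for s
      proof (cases "s = t")
        case False
        then show ?thesis using d(2)[OF s(1) False] s by (simp add: dist_real_def less_imp_le)
      qed (simp add: l2n_def)
      with d(1) show ?thesis by blast
    qed
    then obtain d where d: "\<And>t. t \<in> {0..T} \<Longrightarrow> d t > 0"
      "\<And>t s. t \<in> {0..T} \<Longrightarrow> s \<in> {0..T} \<Longrightarrow> \<bar>s - t\<bar> < d t \<Longrightarrow> l2n (\<lambda>\<xi>. y s \<xi> - y t \<xi>) \<le> ennreal (e / 4)"
      by metis
    have cover: "{0..T} \<subseteq> \<Union>((\<lambda>t. ball t (d t)) ` {0..T})" using d(1) by force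
    obtain \<delta> where \<delta>: "0 < \<delta>" "\<And>x. x \<in> {0..T} \<Longrightarrow> \<exists>G\<in>(\<lambda>t. ball t (d t)) ` {0..T}. ball x \<delta> \<subseteq> G"
      by (rule Heine_Borel_lemma[OF compact_Icc cover]) auto
    have "l2n (\<lambda>\<xi>. y s \<xi> - y t \<xi>) \<le> ennreal e" if s: "s \<in> {0..T}" and t: "t \<in> {0..T}" and st: "\<bar>s - t\<bar> < \<delta>" for s t
    proof -
      obtain r where r: "r \<in> {0..T}" "ball s \<delta> \<subseteq> ball r (d r)" using \<delta>(2)[OF s] by auto
      have "s \<in> ball s \<delta>" "t \<in> ball s \<delta>" using \<delta>(1) st by (auto simp: dist_real_def)
      then have "s \<in> ball r (d r)" "t \<in> ball r (d r)" using r(2) by blast+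
      then have "\<bar>s - r\<bar> < d r" "\<bar>t - r\<bar> < d r" by (simp_all add: dist_real_def abs_minus_commute)
      then have "l2n (\<lambda>\<xi>. y s \<xi> - y r \<xi>) \<le> ennreal (e / 4)" "l2n (\<lambda>\<xi>. y r \<xi> - y t \<xi>) \<le> ennreal (e / 4)"
        using d(2)[OF r(1) s] d(2)[OF r(1) t] by (auto simp: l2n_diff_commute[of "y r"])
      then have "2 * l2n (\<lambda>\<xi>. y s \<xi> - y r \<xi>) + 2 * l2n (\<lambda>\<xi>. y r \<xi> - y t \<xi>) \<le> 2 * ennreal (e / 4) + 2 * ennreal (e / 4)"
        by (intro add_mono mult_left_mono) auto
      also have "\<dots> = ennreal e"
        using e by (simp add: ennreal_plus[symmetric] ennreal_mult[symmetric]
          ennreal_numeral[symmetric] del: ennreal_plus ennreal_numeral)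
      finally show ?thesis using l2n_diff_triangle[OF ym[OF s] ym[OF r(1)] ym[OF t]] order_trans by blast
    qed
    with \<delta>(1) show ?thesis by blast
  qed
  have "\<exists>K>0. \<forall>s\<in>{0..T}. \<forall>t\<in>{0..T}. \<bar>s - t\<bar> \<le> 1 / K \<longrightarrow> l2n (\<lambda>\<xi>. y s \<xi> - y t \<xi>) \<le> ennreal ((1/2) ^ n)" for n
  proof -
    obtain d where d: "d > 0" "\<And>s t. s \<in> {0..T} \<Longrightarrow> t \<in> {0..T} \<Longrightarrow> \<bar>s - t\<bar> < d \<Longrightarrow> l2n (\<lambda>\<xi>. y s \<xi> - y t \<xi>) \<le> ennreal ((1/2) ^ n)"
      using unif[of "(1/2) ^ n"] by auto
    have "1 / (2 / d) < d" using d(1) by simp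
    then show ?thesis using d by (intro exI[of _ "2 / d"]) fastforce
  qed
  then obtain K where K: "\<And>n. K n > 0"
    "\<And>n s t. s \<in> {0..T} \<Longrightarrow> t \<in> {0..T} \<Longrightarrow> \<bar>s - t\<bar> \<le> 1 / K n \<Longrightarrow> l2n (\<lambda>\<xi>. y s \<xi> - y t \<xi>) \<le> ennreal ((1/2) ^ n)"
    by metis
  define r where "r n s = clip T (real_of_int \<lfloor>s * K n\<rfloor> / K n)" for n s
  have r_in: "r n s \<in> {0..T}" for n s unfolding r_def by (rule clip_in[OF T])
  have r_near: "\<bar>r n s - s\<bar> \<le> 1 / K n" if "s \<in> {0..T}" for n s
  proof -
    have "real_of_int \<lfloor>s * K n\<rfloor> \<le> s * K n" "s * K n \<le> real_of_int \<lfloor>s * K n\<rfloor> + 1" by linarith+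
    then have "real_of_int \<lfloor>s * K n\<rfloor> / K n \<le> s" "s \<le> real_of_int \<lfloor>s * K n\<rfloor> / K n + 1 / K n"
      using K(1)[of n] by (auto simp: field_simps)
    then show ?thesis using that by (auto simp: r_def clip_def)
  qed
  define Z where "Z n s \<xi> = y (r n s) \<xi>" for n s \<xi>
  have Zm: "(\<lambda>p. Z n (fst p) (snd p)) \<in> borel_measurable (borel \<Otimes>\<^sub>M borel)" for n
  proof -
    have [measurable]: "y (clip T c) \<in> borel_measurable borel" for c by (rule ym[OF clip_in[OF T]])
    have "(\<lambda>p. (\<lambda>i p. y (clip T (real_of_int i / K n)) (snd p)) \<lfloor>fst p * K n\<rfloor> p) \<in> borel_measurable (borel \<Otimes>\<^sub>M borel)"
      by (rule measurable_compose_countable) measurable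
    then show ?thesis by (simp add: Z_def r_def)
  qed
  define Y where "Y s \<xi> = lim (\<lambda>n. Z n s \<xi>)" for s \<xi>
  have near: "l2n (\<lambda>\<xi>. Z n s \<xi> - y s \<xi>) \<le> ennreal ((1/2) ^ n)" if "s \<in> {0..T}" for n s
    unfolding Z_def by (rule K(2)[OF r_in that r_near[OF that]])
  show thesis
  proof (rule that)
    show "jointly_measurable Y"
      unfolding jointly_measurable_def Y_def by (rule borel_measurable_lim_metric[OF Zm])
    fix t assume t: "t \<in> {0..T}"
    have [measurable]: "Z n t \<in> borel_measurable borel" "y t \<in> borel_measurable borel" for n
      unfolding Z_def[abs_def] by (rule ym[OF r_in], rule ym[OF t])
    have "(\<integral>\<^sup>+ \<xi>. (\<Sum>n. ennreal ((cmod (Z n t \<xi> - y t \<xi>))\<^sup>2)) \<partial>lborel) = (\<Sum>n. l2n (\<lambda>\<xi>. Z n t \<xi> - y t \<xi>))"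
      unfolding l2n_def by (rule nn_integral_suminf) simp
    also have "\<dots> \<le> (\<Sum>n. ennreal ((1/2) ^ n))" by (intro suminf_le summableI near t)
    also have "\<dots> = ennreal (\<Sum>n. (1/2) ^ n)" by (intro suminf_ennreal2 summable_geometric) auto
    also have "\<dots> < \<infinity>" by simp
    finally have "AE \<xi> in lborel. (\<Sum>n. ennreal ((cmod (Z n t \<xi> - y t \<xi>))\<^sup>2)) \<noteq> \<infinity>"
      by (intro nn_integral_PInf_AE) auto
    then show "AE \<xi> in lborel. Y t \<xi> = y t \<xi>"
    proof eventually_elim
      case (elim \<xi>)
      have "summable (\<lambda>n. (cmod (Z n t \<xi> - y t \<xi>))\<^sup>2)" using elim by (intro summable_suminf_not_top) auto
      then have "(\<lambda>n. (cmod (Z n t \<xi> - y t \<xi>))\<^sup>2) \<longlonglongrightarrow> 0" by (rule summable_LIMSEQ_zero)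
      then have "(\<lambda>n. sqrt ((cmod (Z n t \<xi> - y t \<xi>))\<^sup>2)) \<longlonglongrightarrow> sqrt 0" by (rule tendsto_real_sqrt)
      then have "(\<lambda>n. Z n t \<xi>) \<longlonglongrightarrow> y t \<xi>" by (simp add: tendsto_norm_zero_iff LIM_zero_iff)
      then show ?case unfolding Y_def by (rule limI)
    qed
  next
    let ?I = "{0..\<lfloor>T * K 0\<rfloor>}"
    \<comment> \<open>At level 0 there are finitely many grid points and the squared error is at
      most 1, so a finite sum bounds all norms.\<close>
    let ?B = "2 * (\<Sum>i\<in>?I. enn2real (l2n (y (clip T (real_of_int i / K 0))))) + 2"
    show "0 \<le> ?B" by (intro add_nonneg_nonneg mult_nonneg_nonneg sum_nonneg) auto
    fix t assume t: "t \<in> {0..T}"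
    have fin: "l2n (y s) = ennreal (enn2real (l2n (y s)))" if "s \<in> {0..T}" for s
      using y[OF that] by (simp add: L2_iff less_top)
    have i: "\<lfloor>t * K 0\<rfloor> \<in> ?I" using t K(1)[of 0] by (auto intro!: floor_mono mult_right_mono)
    have "enn2real (l2n (y (r 0 t))) \<le> (\<Sum>i\<in>?I. enn2real (l2n (y (clip T (real_of_int i / K 0)))))"
      unfolding r_def by (rule member_le_sum[OF i]) auto
    then have le: "l2n (y (r 0 t)) \<le> ennreal (\<Sum>i\<in>?I. enn2real (l2n (y (clip T (real_of_int i / K 0)))))"
      using fin[OF r_in[of 0 t]] by (metis ennreal_leI)
    have "l2n (y t) \<le> 2 * l2n (\<lambda>\<xi>. y (r 0 t) \<xi>) + 2 * l2n (\<lambda>\<xi>. y (r 0 t) \<xi> - y t \<xi>)"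
      using l2n_diff_le[of "y (r 0 t)" "\<lambda>\<xi>. y (r 0 t) \<xi> - y t \<xi>"] ym[OF t] ym[OF r_in[of 0 t]] by simp
    also have "\<dots> \<le> 2 * ennreal (\<Sum>i\<in>?I. enn2real (l2n (y (clip T (real_of_int i / K 0))))) + 2 * ennreal 1"
      using near[OF t, of 0] by (intro add_mono mult_left_mono le) (auto simp: Z_def)
    also have "\<dots> = ennreal ?B"
      by (simp add: ennreal_plus[symmetric] ennreal_mult[symmetric] sum_nonneg
          ennreal_numeral[symmetric] del: ennreal_plus ennreal_numeral)
    finally show "l2n (y t) \<le> ennreal ?B" .
  qed
qed

text \<open>The solution space is continuous for a weight varying in time. A jointly measurable
  version is found for the weighted function and the weight is divided out afterwards; the weight at
  the final time, being the smallest, gives one bound for all times.\<close>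

lemma C_H_version:
  assumes M: "0 \<le> M" and T: "0 \<le> T" and psi: "\<psi> \<in> C_H (weight w0 M) T k"
  obtains P B where "jointly_measurable P" "0 \<le> B"
    "\<And>t. t \<in> {0..T} \<Longrightarrow> \<psi> t \<in> L2"
    "\<And>t. t \<in> {0..T} \<Longrightarrow> AE \<xi> in lborel. fourier (\<psi> t) \<xi> = P t \<xi>"
    "\<And>t. t \<in> {0..T} \<Longrightarrow> wsq k (\<lambda>\<xi>. ennreal (exp ((w0 - M * T) * japanese \<xi>) * cmod (P t \<xi>))) \<le> ennreal (B\<^sup>2)"
proof -
  define h where "h t \<xi> = complex_of_real (exp (weight w0 M t * japanese \<xi>)) * fourier (\<psi> t) \<xi>" for t \<xi>
  define z where "z t = inv_fourier (h t)" for t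
  have psi2: "\<psi> t \<in> L2" and h2: "h t \<in> L2" if "t \<in> {0..T}" for t
    using psi that unfolding C_H_def h_def[abs_def] by auto
  have zC: "z \<in> C_sobolev T k"
    using psi unfolding C_H_def z_def[abs_def] h_def[abs_def] by auto
  have z2: "z t \<in> L2" "AE \<xi> in lborel. fourier (z t) \<xi> = h t \<xi>" if "t \<in> {0..T}" for t
    using inv_fourier[OF h2[OF that]] by (auto simp: z_def)
  define y where "y t \<xi> = complex_of_real (japanese \<xi> powr k) * h t \<xi>" for t \<xi>
  have ym [measurable]: "y t \<in> borel_measurable borel" if "t \<in> {0..T}" for t
  proof -
    have [measurable]: "h t \<in> borel_measurable borel" using h2[OF that] by (rule L2_measurable)
    show ?thesis unfolding y_def[abs_def] by measurable
  qed
  have sq: "japanese \<xi> powr (2 * k) * exp (2 * 0 * japanese \<xi>) * (cmod c)\<^sup>2 = (cmod (complex_of_real (japanese \<xi> powr k) * c))\<^sup>2" for \<xi> c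
    by (simp add: norm_mult power_mult_distrib powr_double)
  have y2: "y t \<in> L2" if t: "t \<in> {0..T}" for t
  proof -
    have "l2n (y t) = H_norm_sq 0 k (z t)"
      unfolding H_norm_sq_eq[OF z2(2)[OF t]] l2n_def sq y_def ..
    then show ?thesis using zC t ym[OF t] by (auto simp: C_sobolev_def H_space_def L2_iff)
  qed
  have diff: "H_norm_sq 0 k (\<lambda>x. z s x - z t x) = l2n (\<lambda>\<xi>. y s \<xi> - y t \<xi>)" if s: "s \<in> {0..T}" and t: "t \<in> {0..T}" for s t
  proof -
    have F: "AE \<xi> in lborel. fourier (\<lambda>x. z s x - z t x) \<xi> = h s \<xi> - h t \<xi>"
      using fourier_diff[OF z2(1)[OF s] z2(1)[OF t]] z2(2)[OF s] z2(2)[OF t] by eventually_elim simp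
    show ?thesis unfolding H_norm_sq_eq[OF F] l2n_def sq y_def by (simp add: right_diff_distrib)
  qed
  have cont: "((\<lambda>s. l2n (\<lambda>\<xi>. y s \<xi> - y t \<xi>)) \<longlongrightarrow> 0) (at t within {0..T})" if t: "t \<in> {0..T}" for t
  proof -
    have "((\<lambda>s. H_norm_sq 0 k (\<lambda>x. z s x - z t x)) \<longlongrightarrow> 0) (at t within {0..T})"
      using zC t by (auto simp: C_sobolev_def)
    then show ?thesis
      by (rule Lim_transform_within[OF _ zero_less_one]) (rule diff[OF _ t])
  qed
  obtain Y B where Y: "jointly_measurable Y" "0 \<le> B" "\<And>t. t \<in> {0..T} \<Longrightarrow> AE \<xi> in lborel. Y t \<xi> = y t \<xi>"
    "\<And>t. t \<in> {0..T} \<Longrightarrow> l2n (y t) \<le> ennreal B"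
    using L2_continuous_version[OF T y2 cont] by blast
  define P where "P t \<xi> = complex_of_real (japanese \<xi> powr (- k) * exp (- (weight w0 M t * japanese \<xi>))) * Y t \<xi>" for t \<xi>
  have Py: "P t \<xi> = fourier (\<psi> t) \<xi>" if "Y t \<xi> = y t \<xi>" for t \<xi>
    unfolding P_def that y_def h_def by (simp add: powr_minus exp_minus mult_ac)
  show thesis
  proof (rule that)
    show "jointly_measurable P"
      unfolding jointly_measurable_def P_def weight_def
      by (intro borel_measurable_times jointly_measurableD[OF Y(1)]) measurable
    show "0 \<le> sqrt B" using Y(2) by simp
    fix t assume t: "t \<in> {0..T}"
    show "\<psi> t \<in> L2" by (rule psi2[OF t])
    show P: "AE \<xi> in lborel. fourier (\<psi> t) \<xi> = P t \<xi>"
      using Y(3)[OF t] by eventually_elim (simp add: Py)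
    have "wsq k (\<lambda>\<xi>. ennreal (exp ((w0 - M * T) * japanese \<xi>) * cmod (P t \<xi>))) \<le> l2n (Y t)"
      unfolding wsq_def l2n_def
    proof (intro nn_integral_mono)
      fix \<xi>
      have "M * t \<le> M * T" using M t by (auto intro: mult_left_mono)
      then have "exp ((w0 - M * T) * japanese \<xi>) \<le> exp (weight w0 M t * japanese \<xi>)"
        by (simp add: weight_def mult_right_mono)
      then have "japanese \<xi> powr k * (exp ((w0 - M * T) * japanese \<xi>) * cmod (P t \<xi>)) \<le>
          japanese \<xi> powr k * (exp (weight w0 M t * japanese \<xi>) * cmod (P t \<xi>))"
        by (intro mult_left_mono mult_right_mono) auto
      also have "\<dots> = cmod (Y t \<xi>)"
        unfolding P_def norm_mult norm_of_real abs_mult abs_exp_cancel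
        by (simp add: powr_minus exp_minus field_simps)
      finally have "(japanese \<xi> powr k * (exp ((w0 - M * T) * japanese \<xi>) * cmod (P t \<xi>)))\<^sup>2 \<le> (cmod (Y t \<xi>))\<^sup>2"
        by (rule power_mono) simp
      then show "(ennreal (japanese \<xi> powr k) * ennreal (exp ((w0 - M * T) * japanese \<xi>) * cmod (P t \<xi>)))\<^sup>2 \<le> ennreal ((cmod (Y t \<xi>))\<^sup>2)"
        by (simp add: ennreal_mult[symmetric] ennreal_power ennreal_leI)
    qed
    also have "\<dots> = l2n (y t)" by (rule l2n_cong_AE[OF Y(3)[OF t]])
    also have "\<dots> \<le> ennreal ((sqrt B)\<^sup>2)" using Y(2,4) t by simp
    finally show "wsq k (\<lambda>\<xi>. ennreal (exp ((w0 - M * T) * japanese \<xi>) * cmod (P t \<xi>))) \<le> ennreal ((sqrt B)\<^sup>2)" .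
  qed
qed

section \<open>Uniqueness for the Duhamel equation\<close>

lemma duh_restart:
  assumes c: "continuous_on {0..T} (\<lambda>s. S s \<xi>)" and t0: "0 \<le> t0" and t: "0 \<le> t" "t0 + t \<le> T"
    and eq: "\<And>t. t \<in> {0..T} \<Longrightarrow> y t = exp (- (\<i> * complex_of_real (\<theta> \<xi> * t))) * y 0 + duh \<theta> S t \<xi>"
  shows "y (t0 + t) = exp (- (\<i> * complex_of_real (\<theta> \<xi> * t))) * y t0 + duh \<theta> (\<lambda>s. S (t0 + s)) t \<xi>"
proof -
  let ?E = "\<lambda>t. exp (- (\<i> * complex_of_real (\<theta> \<xi> * t)))"
  let ?f = "\<lambda>s. exp (\<i> * complex_of_real (\<theta> \<xi> * s)) * S s \<xi>"
  have cf: "continuous_on {0..T} ?f" by (intro continuous_intros c)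
  have "integral {0..t0 + t} ?f = integral {0..t0} ?f + integral {t0..t0 + t} ?f"
    using t0 t by (intro Henstock_Kurzweil_Integration.integral_combine[symmetric] integrable_continuous_interval
        continuous_on_subset[OF cf]) auto
  also have "integral {t0..t0 + t} ?f = integral {0..t} (\<lambda>s. ?f (s + t0))"
  proof -
    have "(?f has_integral integral {t0..t0 + t} ?f) {t0..t0 + t}"
      using t0 t by (intro integrable_integral integrable_continuous_interval continuous_on_subset[OF cf]) auto
    from has_integral_affinity'[OF this[folded cbox_interval], of 1 t0]
    have "((\<lambda>s. ?f (s + t0)) has_integral integral {t0..t0 + t} ?f) {0..t}" by simp
    then show ?thesis by (rule integral_unique[symmetric])
  qed
  also have "integral {0..t} (\<lambda>s. ?f (s + t0)) =
      exp (\<i> * complex_of_real (\<theta> \<xi> * t0)) * integral {0..t} (\<lambda>s. exp (\<i> * complex_of_real (\<theta> \<xi> * s)) * S (t0 + s) \<xi>)"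
  proof -
    have "?f (s + t0) = exp (\<i> * complex_of_real (\<theta> \<xi> * t0)) * (exp (\<i> * complex_of_real (\<theta> \<xi> * s)) * S (t0 + s) \<xi>)" for s
      unfolding mult.assoc[symmetric] mult_exp_exp by (simp add: algebra_simps)
    then show ?thesis by (simp only: integral_mult_right)
  qed
  finally have I: "integral {0..t0 + t} ?f = integral {0..t0} ?f + exp (\<i> * complex_of_real (\<theta> \<xi> * t0)) *
      integral {0..t} (\<lambda>s. exp (\<i> * complex_of_real (\<theta> \<xi> * s)) * S (t0 + s) \<xi>)" .
  have E: "?E (t0 + t) = ?E t * ?E t0" "?E t0 * exp (\<i> * complex_of_real (\<theta> \<xi> * t0)) = 1"
    unfolding mult_exp_exp by (simp_all add: algebra_simps)
  have "y (t0 + t) = ?E t * ?E t0 * y 0 + complex_of_real (japanese \<xi>) * (?E t * ?E t0 * integral {0..t0 + t} ?f)"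
    using eq[of "t0 + t"] t0 t unfolding duh_def E(1) by simp
  also have "\<dots> = ?E t * (?E t0 * y 0 + complex_of_real (japanese \<xi>) * (?E t0 * integral {0..t0} ?f)) +
     complex_of_real (japanese \<xi>) * (?E t * ((?E t0 * exp (\<i> * complex_of_real (\<theta> \<xi> * t0))) *
      integral {0..t} (\<lambda>s. exp (\<i> * complex_of_real (\<theta> \<xi> * s)) * S (t0 + s) \<xi>)))"
    unfolding I by (simp only: distrib_left mult_ac add_ac)
  also have "?E t0 * y 0 + complex_of_real (japanese \<xi>) * (?E t0 * integral {0..t0} ?f) = y t0"
    using eq[of t0] t0 t by (simp add: duh_def)
  finally show ?thesis unfolding E(2) duh_def by simp
qed

text \<open>Since no smallness of the data is available, the contraction argument is run on successive
  short time intervals, each time with a new weight decreasing from \<open>W\<close>.\<close>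

lemma duhamel_unique:
  fixes Q Q' :: "'i::finite \<Rightarrow> real \<Rightarrow> real \<Rightarrow> complex"
  assumes W: "0 < W" and N: "\<And>i. lip True l (N i)" and \<theta> [measurable]: "\<And>i. \<theta> i \<in> borel_measurable borel"
    and Q: "\<And>i. zbound l W 0 T R (Q i)" and Q': "\<And>i. zbound l W 0 T R (Q' i)" and T: "0 \<le> T"
    and eq: "\<And>i. AE \<xi> in lborel. \<forall>t\<in>{0..T}. Q i t \<xi> = exp (- (\<i> * complex_of_real (\<theta> i \<xi> * t))) * Q i 0 \<xi> + duh (\<theta> i) (\<lambda>s. N i (\<lambda>j. Q j s)) t \<xi>"
    and eq': "\<And>i. AE \<xi> in lborel. \<forall>t\<in>{0..T}. Q' i t \<xi> = exp (- (\<i> * complex_of_real (\<theta> i \<xi> * t))) * Q' i 0 \<xi> + duh (\<theta> i) (\<lambda>s. N i (\<lambda>j. Q' j s)) t \<xi>"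
    and init: "\<And>i. AE \<xi> in lborel. Q i 0 \<xi> = Q' i 0 \<xi>"
  shows "AE \<xi> in lborel. \<forall>t\<in>{0..T}. Q i t \<xi> = Q' i t \<xi>"
proof -
  have R: "0 \<le> R" using zbound_nonneg[OF Q] .
  have "\<forall>i. \<exists>L. lipL True l R L (N i)" using N R unfolding lip_def by blast
  then obtain Li where Li: "\<And>i. lipL True l R (Li i) (N i)" by metis
  have Li0: "0 \<le> Li i" for i using Li[of i] by (simp add: lipL_def)
  \<comment> \<open>The index type is finite, so one constant serves all components.\<close>
  define L where "L = (\<Sum>i\<in>UNIV. Li i)"
  have L: "lipL True l R L (N i)" for i
    by (rule lipL_mono[OF Li[of i]]) (auto simp: L_def Li0 intro!: member_le_sum)
  have L0: "0 \<le> L" unfolding L_def by (intro sum_nonneg Li0)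
  define M where "M = 2 * L + 1"
  have M: "0 < M" "2 * L \<le> M" using L0 by (auto simp: M_def)
  \<comment> \<open>The time for which a weight starting at \<open>W\<close> and decreasing at rate
    \<open>M\<close> stays nonnegative. It is the same after every restart, because the bound with
    weight \<open>W\<close> holds on the whole interval.\<close>
  define \<tau> where "\<tau> = W / M"
  have \<tau>: "0 < \<tau>" "M * \<tau> = W" using W M by (auto simp: \<tau>_def)
  \<comment> \<open>A bound with constant weight survives translation in time and holds all the more
    for a weight decreasing from \<open>W\<close>.\<close>
  have sub: "zbound l W M T' R (\<lambda>t. u (t0 + t))"
    if u: "zbound l W 0 T R u" and t0: "0 \<le> t0" "t0 + T' \<le> T" for u t0 T'
  proof -
    from u obtain m where m: "zmajor W 0 T u m" "wsq l m \<le> ennreal (R\<^sup>2)" "zcarrier T u" by (auto simp: zbound_def)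
    show ?thesis
    proof (rule zboundI[OF R _ _ m(2)])
      show "zcarrier T' (\<lambda>t. u (t0 + t))"
        unfolding zcarrier_def
      proof (intro conjI ballI allI)
        show "u (t0 + t) \<in> borel_measurable borel" if "t \<in> {0..T'}" for t
          using m(3) that t0 unfolding zcarrier_def by auto
        fix \<xi>
        have "continuous_on {0..T} (\<lambda>t. u t \<xi>)" using m(3) unfolding zcarrier_def by blast
        then show "continuous_on {0..T'} (\<lambda>t. u (t0 + t) \<xi>)"
          by (rule continuous_on_compose2) (use t0 in \<open>auto intro!: continuous_intros\<close>)
      qed
      show "zmajor W M T' (\<lambda>t. u (t0 + t)) m"
        unfolding zmajor_def
      proof (intro conjI ballI allI)
        show "m \<in> borel_measurable borel" using m by (simp add: zmajor_def)
        fix t \<xi> assume t: "t \<in> {0..T'}"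
        have "exp ((W - M * t) * japanese \<xi>) * cmod (u (t0 + t) \<xi>) \<le> exp ((W - 0 * (t0 + t)) * japanese \<xi>) * cmod (u (t0 + t) \<xi>)"
          using t M by (intro mult_right_mono) auto
        moreover have "ennreal (exp ((W - 0 * (t0 + t)) * japanese \<xi>) * cmod (u (t0 + t) \<xi>)) \<le> m \<xi>"
          using m(1) t t0 unfolding zmajor_def by auto
        ultimately show "ennreal (exp ((W - M * t) * japanese \<xi>) * cmod (u (t0 + t) \<xi>)) \<le> m \<xi>"
          using order_trans ennreal_leI by blast
      qed
    qed
  qed
  have NQ: "continuous_on {0..T} (\<lambda>s. N i (\<lambda>j. U j s) \<xi>)" if U: "\<And>j. zbound l W 0 T R (U j)" for U i \<xi>
  proof -
    have "admissible W 0 T" using W T by (simp add: admissible_def)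
    then obtain L' where "zbound l W 0 T L' (\<lambda>t. N i (\<lambda>j. U j t))"
      by (rule source_zbound[where U=U and R=R, OF N[of i] _ U])
    then show ?thesis using zbound_zcarrier unfolding zcarrier_def by blast
  qed
  have "AE \<xi> in lborel. \<forall>i. \<forall>t\<in>{0..min T (real n * \<tau>)}. Q i t \<xi> = Q' i t \<xi>" for n
  proof (induction n)
    case 0
    have "AE \<xi> in lborel. \<forall>i. Q i 0 \<xi> = Q' i 0 \<xi>" using init by (subst AE_all_countable) blast
    then show ?case by eventually_elim (use T in auto)
  next
    case (Suc n)
    define t0 where "t0 = real n * \<tau>"
    have t00: "0 \<le> t0" using \<tau> by (simp add: t0_def)
    show ?case
    proof (cases "T \<le> t0")
      case True
      then have "min T (real (Suc n) * \<tau>) = min T (real n * \<tau>)" using \<tau> by (simp add: t0_def algebra_simps)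
      then show ?thesis using Suc by simp
    next
      case False
      define T' where "T' = min \<tau> (T - t0)"
      have T': "0 \<le> T'" "t0 + T' \<le> T" using False \<tau> by (auto simp: T'_def)
      have "M * T' \<le> M * \<tau>" using M by (intro mult_left_mono) (auto simp: T'_def)
      then have adm: "admissible W M T'" using M T' \<tau> by (simp add: admissible_def)
      \<comment> \<open>The free evolution of the state reached at \<open>t0\<close>. By the
        induction hypothesis both solutions have the same state there, so the same \<open>F\<close>
        serves for both.\<close>
      define F where "F i t \<xi> = exp (- (\<i> * complex_of_real (\<theta> i \<xi> * t))) * Q i t0 \<xi>" for i t \<xi>
      have r: "\<forall>t\<in>{0..T'}. U i (t0 + t) \<xi> = exp (- (\<i> * complex_of_real (\<theta> i \<xi> * t))) * U i t0 \<xi> + duh (\<theta> i) (\<lambda>s. N i (\<lambda>j. U j (t0 + s))) t \<xi>"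
        if U: "\<And>j. zbound l W 0 T R (U j)"
          and e: "\<forall>t\<in>{0..T}. U i t \<xi> = exp (- (\<i> * complex_of_real (\<theta> i \<xi> * t))) * U i 0 \<xi> + duh (\<theta> i) (\<lambda>s. N i (\<lambda>j. U j s)) t \<xi>" for U i \<xi>
      proof
        fix t assume "t \<in> {0..T'}"
        then have t: "0 \<le> t" "t0 + t \<le> T" using T' by auto
        show "U i (t0 + t) \<xi> = exp (- (\<i> * complex_of_real (\<theta> i \<xi> * t))) * U i t0 \<xi> + duh (\<theta> i) (\<lambda>s. N i (\<lambda>j. U j (t0 + s))) t \<xi>"
          using e by (intro duh_restart[where y="\<lambda>t. U i t \<xi>" and S="\<lambda>s. N i (\<lambda>j. U j s)", OF NQ[OF U] t00 t]) blast
      qed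
      have "AE \<xi> in lborel. \<forall>t\<in>{0..T'}. Q i (t0 + t) \<xi> = Q' i (t0 + t) \<xi>" for i
      proof (rule picard_unique[where U="\<lambda>i t. Q i (t0 + t)" and U'="\<lambda>i t. Q' i (t0 + t)" and F=F, OF adm M(1) L M(2) \<theta>])
        show "zbound l W M T' R (\<lambda>t. Q i (t0 + t))" "zbound l W M T' R (\<lambda>t. Q' i (t0 + t))" for i
          by (rule sub[OF Q t00 T'(2)], rule sub[OF Q' t00 T'(2)])
        show "AE \<xi> in lborel. \<forall>t\<in>{0..T'}. Q i (t0 + t) \<xi> = duhamel_map \<theta> N F (\<lambda>i t. Q i (t0 + t)) i t \<xi>" for i
          using eq[of i]
        proof eventually_elim
          case (elim \<xi>)
          show ?case using r[of Q, OF Q elim] by (simp add: duhamel_map_def F_def)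
        qed
        show "AE \<xi> in lborel. \<forall>t\<in>{0..T'}. Q' i (t0 + t) \<xi> = duhamel_map \<theta> N F (\<lambda>i t. Q' i (t0 + t)) i t \<xi>" for i
          using eq'[of i] Suc
        proof eventually_elim
          case (elim \<xi>)
          have "Q i t0 \<xi> = Q' i t0 \<xi>" using elim(2) False t00 by (auto simp: t0_def)
          then show ?case using r[of Q', OF Q' elim(1)] by (simp add: duhamel_map_def F_def)
        qed
      qed
      then have "AE \<xi> in lborel. \<forall>i. \<forall>t\<in>{0..T'}. Q i (t0 + t) \<xi> = Q' i (t0 + t) \<xi>" by (subst AE_all_countable) blast
      then show ?thesis using Suc
      proof eventually_elim
        case (elim \<xi>)
        show ?case
        proof (intro allI ballI)
          fix i t assume t: "t \<in> {0..min T (real (Suc n) * \<tau>)}"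
          show "Q i t \<xi> = Q' i t \<xi>"
          proof (cases "t \<le> t0")
            case True then show ?thesis using elim(2) t by (auto simp: t0_def)
          next
            case False
            then have "t - t0 \<in> {0..T'}" using t by (auto simp: T'_def t0_def algebra_simps)
            then have "Q i (t0 + (t - t0)) \<xi> = Q' i (t0 + (t - t0)) \<xi>" using elim(1) by blast
            then show ?thesis by simp
          qed
        qed
      qed
    qed
  qed
  note main = this
  obtain n where "T / \<tau> \<le> real n" using real_arch_simple by blast
  then have n: "min T (real n * \<tau>) = T" using \<tau> by (simp add: field_simps)
  show ?thesis using main[of n] unfolding n by eventually_elim blast
qed

text \<open>A single function is encoded as a trajectory on [0, 0], which makes the bilinear
  estimates available at one fixed time.\<close>

lemma zbound_slice_iff:
  assumes "0 \<le> B"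
  shows "zbound l W 0 0 B (\<lambda>_. f) \<longleftrightarrow> f \<in> borel_measurable borel \<and>
    wsq l (\<lambda>\<xi>. ennreal (exp (W * japanese \<xi>) * cmod (f \<xi>))) \<le> ennreal (B\<^sup>2)"
proof
  assume z: "zbound l W 0 0 B (\<lambda>_. f)"
  then obtain m where m: "zmajor W 0 0 (\<lambda>_. f) m" "wsq l m \<le> ennreal (B\<^sup>2)" "zcarrier 0 (\<lambda>_. f)" by (auto simp: zbound_def)
  have "wsq l (\<lambda>\<xi>. ennreal (exp (W * japanese \<xi>) * cmod (f \<xi>))) \<le> wsq l m"
    using m(1) by (intro wsq_mono) (simp add: zmajor_def)
  then show "f \<in> borel_measurable borel \<and> wsq l (\<lambda>\<xi>. ennreal (exp (W * japanese \<xi>) * cmod (f \<xi>))) \<le> ennreal (B\<^sup>2)"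
    using m by (auto simp: zcarrier_def)
next
  assume f: "f \<in> borel_measurable borel \<and> wsq l (\<lambda>\<xi>. ennreal (exp (W * japanese \<xi>) * cmod (f \<xi>))) \<le> ennreal (B\<^sup>2)"
  then have [measurable]: "f \<in> borel_measurable borel" by blast
  show "zbound l W 0 0 B (\<lambda>_. f)"
    by (rule zboundI[OF assms, where m="\<lambda>\<xi>. ennreal (exp (W * japanese \<xi>) * cmod (f \<xi>))"])
      (use f in \<open>auto simp: zcarrier_def zmajor_def\<close>)
qed

text \<open>The hypothesis bounds the norm at each time, but \<open>zbound\<close> needs the norm of
  a supremum over time. Integration in time exchanges the two: the time integral of the modulus at
  fixed frequency majorises all partial integrals, and Cauchy-Schwarz in time bounds its norm by
  \<open>T * r\<close>.\<close>

lemma time_integral_zbound: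
  fixes \<sigma> :: "real \<Rightarrow> real \<Rightarrow> complex"
  assumes T: "0 \<le> T" and W: "0 \<le> W" and jm: "jointly_measurable \<sigma>"
    and \<sigma>: "\<And>s. s \<in> {0..T} \<Longrightarrow> zbound l W 0 0 r (\<lambda>_. \<sigma> s)" and y0: "zbound l W 0 0 r0 (\<lambda>_. y0)"
  obtains q R where "zbound l W 0 T R q"
    "AE \<xi> in lborel. \<forall>t\<in>{0..T}. q t \<xi> = y0 \<xi> + (LBINT s:{0..t}. \<sigma> s \<xi>)"
proof -
  have r: "0 \<le> r" "0 \<le> r0" using zbound_nonneg[OF \<sigma>[of 0]] zbound_nonneg[OF y0] T by auto
  have [measurable]: "y0 \<in> borel_measurable borel" using y0 zbound_slice_iff[OF r(2)] by blast
  note jmD [measurable] = jointly_measurableD[OF jm]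
  define e where "e \<xi> = exp (W * japanese \<xi>)" for \<xi>
  have [measurable]: "e \<in> borel_measurable borel" unfolding e_def[abs_def] by measurable
  have e1: "1 \<le> e \<xi>" for \<xi> using W japanese_ge_1[of \<xi>] by (simp add: e_def)
  have e0: "0 < e \<xi>" for \<xi> by (simp add: e_def)
  \<comment> \<open>The weighted majorant of all partial time integrals; it is finite almost
    everywhere only.\<close>
  define m1 where "m1 \<xi> = (\<integral>\<^sup>+ s. ennreal (e \<xi> * cmod (\<sigma> s \<xi>)) * indicator {0..T} s \<partial>lborel)" for \<xi>
  have [measurable]: "m1 \<in> borel_measurable borel" unfolding m1_def[abs_def] by measurable
  have w1: "wsq l m1 \<le> ennreal ((T * r)\<^sup>2)"
  proof -
    have "(ennreal (japanese \<xi> powr l) * m1 \<xi>)\<^sup>2 \<le>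
        ennreal T * (\<integral>\<^sup>+ s. (ennreal (japanese \<xi> powr l) * ennreal (e \<xi> * cmod (\<sigma> s \<xi>)))\<^sup>2 * indicator {0..T} s \<partial>lborel)" for \<xi>
    proof -
      let ?f = "\<lambda>s. ennreal (japanese \<xi> powr l) * (ennreal (e \<xi> * cmod (\<sigma> s \<xi>)) * indicator {0..T} s)"
      have "(ennreal (japanese \<xi> powr l) * m1 \<xi>)\<^sup>2 = (\<integral>\<^sup>+ s. ?f s * indicator {0..T} s \<partial>lborel)\<^sup>2"
        unfolding m1_def by (subst nn_integral_cmult[symmetric])
          (auto intro!: arg_cong2[where f=power] nn_integral_cong simp: indicator_def)
      also have "\<dots> \<le> (\<integral>\<^sup>+ s. (?f s)\<^sup>2 \<partial>lborel) * (\<integral>\<^sup>+ s. (indicator {0..T} s)\<^sup>2 \<partial>lborel)"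
        by (rule Cauchy_Schwarz_nn_integral) measurable
      also have "(\<integral>\<^sup>+ s. (indicator {0..T} s)\<^sup>2 \<partial>lborel) = (\<integral>\<^sup>+ s. indicator {0..T} s \<partial>lborel)"
        by (intro nn_integral_cong) (auto simp: indicator_def)
      also have "\<dots> = ennreal T" using T by simp
      also have "(\<integral>\<^sup>+ s. (?f s)\<^sup>2 \<partial>lborel) = (\<integral>\<^sup>+ s. (ennreal (japanese \<xi> powr l) * ennreal (e \<xi> * cmod (\<sigma> s \<xi>)))\<^sup>2 * indicator {0..T} s \<partial>lborel)"
        by (intro nn_integral_cong) (auto simp: indicator_def)
      finally show ?thesis by (simp only: mult.commute)
    qed
    then have "wsq l m1 \<le> (\<integral>\<^sup>+ \<xi>. ennreal T * (\<integral>\<^sup>+ s. (ennreal (japanese \<xi> powr l) * ennreal (e \<xi> * cmod (\<sigma> s \<xi>)))\<^sup>2 * indicator {0..T} s \<partial>lborel) \<partial>lborel)"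
      unfolding wsq_def by (rule nn_integral_mono)
    also have "\<dots> = ennreal T * (\<integral>\<^sup>+ \<xi>. (\<integral>\<^sup>+ s. (ennreal (japanese \<xi> powr l) * ennreal (e \<xi> * cmod (\<sigma> s \<xi>)))\<^sup>2 * indicator {0..T} s \<partial>lborel) \<partial>lborel)"
      by (rule nn_integral_cmult) measurable
    also have "(\<integral>\<^sup>+ \<xi>. (\<integral>\<^sup>+ s. (ennreal (japanese \<xi> powr l) * ennreal (e \<xi> * cmod (\<sigma> s \<xi>)))\<^sup>2 * indicator {0..T} s \<partial>lborel) \<partial>lborel) =
        (\<integral>\<^sup>+ s. (\<integral>\<^sup>+ \<xi>. (ennreal (japanese \<xi> powr l) * ennreal (e \<xi> * cmod (\<sigma> s \<xi>)))\<^sup>2 * indicator {0..T} s \<partial>lborel) \<partial>lborel)"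
      by (rule lborel_pair.Fubini'[symmetric]) measurable
    also have "\<dots> \<le> (\<integral>\<^sup>+ s. ennreal (r\<^sup>2) * indicator {0..T} s \<partial>lborel)"
    proof (intro nn_integral_mono)
      fix s
      show "(\<integral>\<^sup>+ \<xi>. (ennreal (japanese \<xi> powr l) * ennreal (e \<xi> * cmod (\<sigma> s \<xi>)))\<^sup>2 * indicator {0..T} s \<partial>lborel) \<le> ennreal (r\<^sup>2) * indicator {0..T} s"
      proof (cases "s \<in> {0..T}")
        case True
        then show ?thesis using \<sigma>[OF True] unfolding zbound_slice_iff[OF r(1)] wsq_def e_def by simp
      qed simp
    qed
    also have "\<dots> = ennreal (r\<^sup>2) * ennreal T" using T by (simp add: nn_integral_cmult)
    also have "ennreal T * (ennreal (r\<^sup>2) * ennreal T) = ennreal ((T * r)\<^sup>2)"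
      using T by (simp add: ennreal_mult[symmetric] power2_eq_square mult_ac)
    finally show ?thesis by (simp add: mult_left_mono)
  qed
  have fin: "AE \<xi> in lborel. m1 \<xi> \<noteq> \<infinity>"
  proof -
    have "AE \<xi> in lborel. (ennreal (japanese \<xi> powr l) * m1 \<xi>)\<^sup>2 \<noteq> \<infinity>"
      by (rule nn_integral_PInf_AE) (use w1 in \<open>auto simp: wsq_def top_unique\<close>)
    then show ?thesis by eventually_elim (auto simp: ennreal_mult_top)
  qed
  \<comment> \<open>Where \<open>m1\<close> is infinite, \<open>q\<close> is made constant in time,
    so that continuity holds at every frequency.\<close>
  define q where "q t \<xi> = y0 \<xi> + (if m1 \<xi> = \<infinity> then 0 else (LBINT s:{0..t}. \<sigma> s \<xi>))" for t \<xi>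
  have si: "set_integrable lborel {0..T} (\<lambda>s. \<sigma> s \<xi>)" if m: "m1 \<xi> \<noteq> \<infinity>" for \<xi>
    unfolding set_integrable_def
  proof (rule integrableI_bounded)
    have "(\<integral>\<^sup>+ s. ennreal (norm (indicator {0..T} s *\<^sub>R \<sigma> s \<xi>)) \<partial>lborel) \<le> m1 \<xi>"
      unfolding m1_def
      by (intro nn_integral_mono) (use e1[of \<xi>] in \<open>auto simp: indicator_def mult_le_cancel_right1 intro!: ennreal_leI\<close>)
    then show "(\<integral>\<^sup>+ s. ennreal (norm (indicator {0..T} s *\<^sub>R \<sigma> s \<xi>)) \<partial>lborel) < \<infinity>"
      using m by (auto simp: less_top intro: le_less_trans)
  qed measurable
  have zc: "zcarrier T q"
    unfolding zcarrier_def
  proof (intro conjI ballI allI)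
    fix t assume "t \<in> {0..T}"
    show "q t \<in> borel_measurable borel" unfolding q_def[abs_def] set_lebesgue_integral_def by measurable
  next
    fix \<xi>
    show "continuous_on {0..T} (\<lambda>t. q t \<xi>)"
    proof (cases "m1 \<xi> = \<infinity>")
      case False
      note s = si[OF False]
      have "continuous_on {0..T} (\<lambda>t. integral {0..t} (\<lambda>s. \<sigma> s \<xi>))"
        by (rule indefinite_integral_continuous_1[OF set_borel_integral_eq_integral(1)[OF s]])
      then have c: "continuous_on {0..T} (\<lambda>t. y0 \<xi> + integral {0..t} (\<lambda>s. \<sigma> s \<xi>))" by (intro continuous_intros)
      have eq: "(LBINT s:{0..t}. \<sigma> s \<xi>) = integral {0..t} (\<lambda>s. \<sigma> s \<xi>)" if "t \<in> {0..T}" for t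
        by (rule set_borel_integral_eq_integral(2)[OF set_integrable_subset[OF s]]) (use that in auto)
      show ?thesis
        using c by (rule continuous_on_eq) (use False in \<open>simp add: q_def eq\<close>)
    qed (simp add: q_def)
  qed
  define m where "m \<xi> = ennreal (e \<xi> * cmod (y0 \<xi>)) + m1 \<xi>" for \<xi>
  have [measurable]: "m \<in> borel_measurable borel" unfolding m_def[abs_def] by measurable
  have zm: "zmajor W 0 T q m"
    unfolding zmajor_def
  proof (intro conjI ballI allI)
    fix t \<xi> assume t: "t \<in> {0..T}"
    show "ennreal (exp ((W - 0 * t) * japanese \<xi>) * cmod (q t \<xi>)) \<le> m \<xi>"
    proof (cases "m1 \<xi> = \<infinity>")
      case False
      have "ennreal (cmod (LBINT s:{0..t}. \<sigma> s \<xi>)) \<le> (\<integral>\<^sup>+ s. ennreal (cmod (indicator {0..t} s *\<^sub>R \<sigma> s \<xi>)) \<partial>lborel)"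
        unfolding set_lebesgue_integral_def by (intro norm_integral_le_nn_integral) measurable
      then have "ennreal (e \<xi>) * ennreal (cmod (LBINT s:{0..t}. \<sigma> s \<xi>)) \<le> ennreal (e \<xi>) * (\<integral>\<^sup>+ s. ennreal (cmod (indicator {0..t} s *\<^sub>R \<sigma> s \<xi>)) \<partial>lborel)"
        by (rule mult_left_mono) simp
      also have "\<dots> = (\<integral>\<^sup>+ s. ennreal (e \<xi>) * ennreal (cmod (indicator {0..t} s *\<^sub>R \<sigma> s \<xi>)) \<partial>lborel)"
        by (rule nn_integral_cmult[symmetric]) measurable
      also have "\<dots> \<le> m1 \<xi>"
        unfolding m1_def using t e0[of \<xi>] by (intro nn_integral_mono) (auto simp: indicator_def ennreal_mult)
      finally have I: "ennreal (e \<xi>) * ennreal (cmod (LBINT s:{0..t}. \<sigma> s \<xi>)) \<le> m1 \<xi>" .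
      have "cmod (q t \<xi>) \<le> cmod (y0 \<xi>) + cmod (LBINT s:{0..t}. \<sigma> s \<xi>)"
        unfolding q_def using False by (simp add: norm_triangle_ineq)
      then have "ennreal (e \<xi> * cmod (q t \<xi>)) \<le> ennreal (e \<xi> * (cmod (y0 \<xi>) + cmod (LBINT s:{0..t}. \<sigma> s \<xi>)))"
        using e0[of \<xi>] by (intro ennreal_leI mult_left_mono) auto
      also have "\<dots> = ennreal (e \<xi> * cmod (y0 \<xi>)) + ennreal (e \<xi>) * ennreal (cmod (LBINT s:{0..t}. \<sigma> s \<xi>))"
        using e0[of \<xi>] by (simp add: distrib_left ennreal_mult ennreal_plus less_imp_le)
      also have "\<dots> \<le> m \<xi>" unfolding m_def by (intro add_left_mono I)
      finally show ?thesis by (simp add: e_def)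
    qed (simp add: m_def)
  qed simp
  have "wsq l m \<le> ennreal ((r0 + T * r)\<^sup>2)"
    unfolding m_def using y0 unfolding zbound_slice_iff[OF r(2)]
    by (intro wsq_add w1) (use T r in \<open>auto simp: e_def\<close>)
  then have "zbound l W 0 T (r0 + T * r) q"
    using T r by (intro zboundI[OF _ zc zm]) auto
  moreover have "AE \<xi> in lborel. \<forall>t\<in>{0..T}. q t \<xi> = y0 \<xi> + (LBINT s:{0..t}. \<sigma> s \<xi>)"
    using fin by eventually_elim (simp add: q_def)
  ultimately show thesis by (rule that)
qed

text \<open>The fundamental theorem of calculus at fixed x, followed by Fubini, which moves the time
  integral inside \<open>ift\<close>; the uniform L1 bound \<open>K\<close> justifies the
  exchange.\<close>

lemma ift_time_integral:
  fixes \<sigma> :: "real \<Rightarrow> real \<Rightarrow> complex"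
  assumes t: "0 \<le> t" and jm: "jointly_measurable \<sigma>"
    and K: "\<And>s. s \<in> {0..t} \<Longrightarrow> (\<integral>\<^sup>+ \<xi>. ennreal (cmod (\<sigma> s \<xi>)) \<partial>lborel) \<le> ennreal K"
    and der: "\<And>s. s \<in> {0..t} \<Longrightarrow> (\<psi> has_vector_derivative ift (\<sigma> s) x) (at s within {0..t})"
  shows "integrable lborel (\<lambda>\<xi>. LBINT s:{0..t}. \<sigma> s \<xi>)"
    "ift (\<lambda>\<xi>. LBINT s:{0..t}. \<sigma> s \<xi>) x = \<psi> t - \<psi> 0"
proof -
  note [measurable] = jointly_measurableD[OF jm]
  have int: "integrable (lborel \<Otimes>\<^sub>M lborel) (\<lambda>(s, \<xi>). indicator {0..t} s *\<^sub>R (w \<xi> * \<sigma> s \<xi>))"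
    if w: "\<And>\<xi>. cmod (w \<xi>) = 1" and [measurable]: "w \<in> borel_measurable borel" for w :: "real \<Rightarrow> complex"
  proof (rule integrableI_bounded)
    have "(\<integral>\<^sup>+ z. ennreal (norm (case z of (s, \<xi>) \<Rightarrow> indicator {0..t} s *\<^sub>R (w \<xi> * \<sigma> s \<xi>))) \<partial>(lborel \<Otimes>\<^sub>M lborel)) =
        (\<integral>\<^sup>+ s. (\<integral>\<^sup>+ \<xi>. ennreal (norm (indicator {0..t} s *\<^sub>R (w \<xi> * \<sigma> s \<xi>))) \<partial>lborel) \<partial>lborel)"
      by (subst lborel.nn_integral_fst[symmetric]) auto
    also have "\<dots> \<le> (\<integral>\<^sup>+ s. ennreal K * indicator {0..t} s \<partial>lborel)"
    proof (intro nn_integral_mono)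
      fix s
      show "(\<integral>\<^sup>+ \<xi>. ennreal (norm (indicator {0..t} s *\<^sub>R (w \<xi> * \<sigma> s \<xi>))) \<partial>lborel) \<le> ennreal K * indicator {0..t} s"
        using K[of s] by (cases "s \<in> {0..t}") (simp_all add: norm_mult w)
    qed
    also have "\<dots> < \<infinity>" using t by (simp add: nn_integral_cmult ennreal_mult_less_top)
    finally show "(\<integral>\<^sup>+ z. ennreal (norm (case z of (s, \<xi>) \<Rightarrow> indicator {0..t} s *\<^sub>R (w \<xi> * \<sigma> s \<xi>))) \<partial>(lborel \<Otimes>\<^sub>M lborel)) < \<infinity>" .
  qed measurable
  from lborel_pair.integrable_snd[OF int[of "\<lambda>_. 1"]]
  show "integrable lborel (\<lambda>\<xi>. LBINT s:{0..t}. \<sigma> s \<xi>)" by (simp add: set_lebesgue_integral_def)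
  let ?w = "\<lambda>\<xi>. exp (\<i> * complex_of_real (x * \<xi>))"
  have I: "integrable (lborel \<Otimes>\<^sub>M lborel) (\<lambda>(s, \<xi>). indicator {0..t} s *\<^sub>R (?w \<xi> * \<sigma> s \<xi>))"
    by (rule int) (simp_all add: norm_exp_imaginary)
  have ind: "(LBINT \<xi>. indicator {0..t} s *\<^sub>R (?w \<xi> * \<sigma> s \<xi>)) = indicator {0..t} s *\<^sub>R (LBINT \<xi>. ?w \<xi> * \<sigma> s \<xi>)" for s
    by simp
  from lborel_pair.integrable_fst[OF I]
  have "integrable lborel (\<lambda>s. complex_of_real (1 / sqrt (2 * pi)) * (indicator {0..t} s *\<^sub>R (LBINT \<xi>. ?w \<xi> * \<sigma> s \<xi>)))"
    unfolding ind by (rule integrable_mult_right)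
  then have si: "set_integrable lborel {0..t} (\<lambda>s. ift (\<sigma> s) x)"
    unfolding set_integrable_def ift_eq by simp
  have "((\<lambda>s. ift (\<sigma> s) x) has_integral \<psi> t - \<psi> 0) {0..t}"
    by (rule fundamental_theorem_of_calculus[OF t der])
  then have "\<psi> t - \<psi> 0 = (LBINT s:{0..t}. ift (\<sigma> s) x)"
    using set_borel_integral_eq_integral(2)[OF si] integral_unique by metis
  also have "\<dots> = complex_of_real (1 / sqrt (2 * pi)) * (LBINT s. LBINT \<xi>. indicator {0..t} s *\<^sub>R (?w \<xi> * \<sigma> s \<xi>))"
  proof -
    have "indicator {0..t} s *\<^sub>R (k * z) = k * (indicator {0..t} s *\<^sub>R z)" for s :: real and k z :: complex by simp
    then show ?thesis unfolding set_lebesgue_integral_def ift_eq ind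
      by (simp only: Bochner_Integration.integral_mult_right_zero)
  qed
  also have "(LBINT s. LBINT \<xi>. indicator {0..t} s *\<^sub>R (?w \<xi> * \<sigma> s \<xi>)) =
      (LBINT \<xi>. LBINT s. indicator {0..t} s *\<^sub>R (?w \<xi> * \<sigma> s \<xi>))"
    by (rule lborel_pair.Fubini_integral[symmetric, OF I])
  also have "\<dots> = (LBINT \<xi>. ?w \<xi> * (LBINT s:{0..t}. \<sigma> s \<xi>))"
    by (simp add: set_lebesgue_integral_def mult_scaleR_right[symmetric] del: mult_scaleR_right)
  finally show "ift (\<lambda>\<xi>. LBINT s:{0..t}. \<sigma> s \<xi>) x = \<psi> t - \<psi> 0" by (simp add: ift_eq)
qed

lemma zbound_slice_nn_integral:
  assumes l: "l \<ge> 1" and W: "0 \<le> W" and z: "zbound l W 0 0 r (\<lambda>_. f)"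
  shows "(\<integral>\<^sup>+ \<xi>. ennreal (cmod (f \<xi>)) \<partial>lborel) \<le> ennreal (sqrt pi * r)"
proof -
  have r: "0 \<le> r" by (rule zbound_nonneg[OF z])
  have f [measurable]: "f \<in> borel_measurable borel" "wsq l (\<lambda>\<xi>. ennreal (exp (W * japanese \<xi>) * cmod (f \<xi>))) \<le> ennreal (r\<^sup>2)"
    using z unfolding zbound_slice_iff[OF r] by auto
  have "(\<integral>\<^sup>+ \<xi>. ennreal (cmod (f \<xi>)) \<partial>lborel) \<le> (\<integral>\<^sup>+ \<xi>. ennreal (exp (W * japanese \<xi>) * cmod (f \<xi>)) \<partial>lborel)"
    using W by (intro nn_integral_mono ennreal_leI) (simp add: mult_le_cancel_right1)
  also have "\<dots> \<le> ennreal (sqrt pi * r)" by (rule nn_integral_le_wsq[OF _ l f(2) r]) measurable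
  finally show ?thesis .
qed

text \<open>Each function is recovered almost everywhere as the transform of its inverse
  transform.\<close>

lemma ift_inj_AE:
  assumes f: "integrable lborel f" "f \<in> L2" and h: "integrable lborel h" "h \<in> L2"
    and eq: "\<And>x. ift f x = ift h x"
  shows "AE \<xi> in lborel. f \<xi> = h \<xi>"
proof -
  have "ift f = ift h" using eq by (rule ext)
  then show ?thesis using fourier_ift[OF f] fourier_ift[OF h] by (auto elim: eventually_elim2)
qed

text \<open>The multiplier \<open>c\<close> allows to treat $\hat\phi$ and $\langle\xi\rangle\hat\phi$
  simultaneously.\<close>

lemma continuous_fourier_version:
  fixes y \<sigma> :: "real \<Rightarrow> real \<Rightarrow> complex"
  assumes l: "l \<ge> 1" and T: "0 \<le> T" and W: "0 < W" and jm: "jointly_measurable \<sigma>"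
    and \<sigma>: "\<And>s. s \<in> {0..T} \<Longrightarrow> zbound l W 0 0 r (\<lambda>_. \<sigma> s)"
    and y: "\<And>s. s \<in> {0..T} \<Longrightarrow> zbound l W 0 0 r0 (\<lambda>_. y s)"
    and c [measurable]: "c \<in> borel_measurable borel" and c1: "\<And>\<xi>. cmod (c \<xi>) \<le> 1" and c0: "\<And>\<xi>. c \<xi> \<noteq> 0"
    and \<psi>: "\<And>t x. t \<in> {0..T} \<Longrightarrow> \<psi> t x = ift (\<lambda>\<xi>. c \<xi> * y t \<xi>) x"
    and der: "\<And>s x. s \<in> {0..T} \<Longrightarrow> ((\<lambda>s. \<psi> s x) has_vector_derivative ift (\<lambda>\<xi>. c \<xi> * \<sigma> s \<xi>) x) (at s within {0..T})"
  obtains q R where "zbound l W 0 T R q"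
    "\<And>t. t \<in> {0..T} \<Longrightarrow> AE \<xi> in lborel. q t \<xi> = y t \<xi>"
    "AE \<xi> in lborel. \<forall>t\<in>{0..T}. q t \<xi> = y 0 \<xi> + (LBINT s:{0..t}. \<sigma> s \<xi>)"
proof -
  have T0: "0 \<in> {0..T}" using T by simp
  obtain q R where q: "zbound l W 0 T R q"
    "AE \<xi> in lborel. \<forall>t\<in>{0..T}. q t \<xi> = y 0 \<xi> + (LBINT s:{0..t}. \<sigma> s \<xi>)"
    by (rule time_integral_zbound[OF T less_imp_le[OF W] jm \<sigma> y[OF T0]])
  have r: "0 \<le> r" "0 \<le> r0" using zbound_nonneg[OF \<sigma>[OF T0]] zbound_nonneg[OF y[OF T0]] by auto
  note [measurable] = jointly_measurableD[OF jm]
  have slice: "exp_decay W f" "f \<in> L2" if "zbound l W 0 T' R' u" "s \<in> {0..T'}" "f = u s" for f u s T' R'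
    using zbound_exp_decay[OF l that(1,2)] W that(3) by simp_all
  have cint: "integrable lborel (\<lambda>\<xi>. c \<xi> * f \<xi>)" "(\<lambda>\<xi>. c \<xi> * f \<xi>) \<in> L2" if f: "exp_decay W f" "f \<in> L2" for f
  proof -
    have [measurable]: "f \<in> borel_measurable borel" by (rule exp_decay_measurable[OF f(1)])
    show "integrable lborel (\<lambda>\<xi>. c \<xi> * f \<xi>)" by (rule exp_decay_integrable[OF exp_decay_bounded_mult[OF f(1) c c1]])
    have "cmod (c \<xi> * f \<xi>) \<le> cmod (f \<xi>)" for \<xi>
      unfolding norm_mult using mult_right_mono[OF c1 norm_ge_zero, of \<xi> "f \<xi>"] by simp
    then have "l2n (\<lambda>\<xi>. c \<xi> * f \<xi>) \<le> l2n f"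
      unfolding l2n_def by (intro nn_integral_mono ennreal_leI power_mono) auto
    then show "(\<lambda>\<xi>. c \<xi> * f \<xi>) \<in> L2" using f(2) by (auto simp: L2_iff intro: le_less_trans)
  qed
  have "AE \<xi> in lborel. q t \<xi> = y t \<xi>" if t: "t \<in> {0..T}" for t
  proof -
    have ys: "exp_decay W (y s)" "y s \<in> L2" if "s \<in> {0..T}" for s
      using slice[OF y[OF that], of 0] by auto
    have qs: "exp_decay W (q t)" "q t \<in> L2" using slice[OF q(1) t refl] by auto
    have [measurable]: "q t \<in> borel_measurable borel" "y 0 \<in> borel_measurable borel" "y t \<in> borel_measurable borel"
      by (rule exp_decay_measurable[OF qs(1)], rule exp_decay_measurable[OF ys(1)[OF T0]], rule exp_decay_measurable[OF ys(1)[OF t]])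
    have sub: "{0..t} \<subseteq> {0..T}" using t by auto
    have jmc: "jointly_measurable (\<lambda>s \<xi>. c \<xi> * \<sigma> s \<xi>)"
      unfolding jointly_measurable_def by measurable
    have K: "(\<integral>\<^sup>+ \<xi>. ennreal (cmod (c \<xi> * \<sigma> s \<xi>)) \<partial>lborel) \<le> ennreal (sqrt pi * (1 * r))" if "s \<in> {0..t}" for s
      using that sub by (intro zbound_slice_nn_integral[OF l less_imp_le[OF W]] zbound_mult[OF \<sigma> c c1]) auto
    have d: "((\<lambda>s. \<psi> s x) has_vector_derivative ift (\<lambda>\<xi>. c \<xi> * \<sigma> s \<xi>) x) (at s within {0..t})" if "s \<in> {0..t}" for s x
      using der[of s x] that sub by (intro has_vector_derivative_within_subset[OF _ sub]) auto
    have t0: "0 \<le> t" using t by simp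
    note I = ift_time_integral[where \<sigma>="\<lambda>s \<xi>. c \<xi> * \<sigma> s \<xi>" and \<psi>="\<lambda>s. \<psi> s x" for x, OF t0 jmc K d]
    have cI: "(LBINT s:{0..t}. c \<xi> * \<sigma> s \<xi>) = c \<xi> * (LBINT s:{0..t}. \<sigma> s \<xi>)" for \<xi>
      by (simp add: set_lebesgue_integral_def)
    have Im [measurable]: "(\<lambda>\<xi>. LBINT s:{0..t}. \<sigma> s \<xi>) \<in> borel_measurable borel"
      unfolding set_lebesgue_integral_def by measurable
    \<comment> \<open>Both sides equal \<open>\<psi> t x\<close>: the right one by hypothesis, the
      left one by integrating the equation in time. Injectivity of \<open>ift\<close> and the
      nonvanishing of \<open>c\<close> then identify \<open>q t\<close> with
      \<open>y t\<close>.\<close>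
    have "ift (\<lambda>\<xi>. c \<xi> * q t \<xi>) x = ift (\<lambda>\<xi>. c \<xi> * y t \<xi>) x" for x
    proof -
      have "ift (\<lambda>\<xi>. c \<xi> * q t \<xi>) x = ift (\<lambda>\<xi>. c \<xi> * y 0 \<xi> + (LBINT s:{0..t}. c \<xi> * \<sigma> s \<xi>)) x"
      proof (rule ift_cong_AE)
        show "AE \<xi> in lborel. c \<xi> * q t \<xi> = c \<xi> * y 0 \<xi> + (LBINT s:{0..t}. c \<xi> * \<sigma> s \<xi>)"
          using q(2) by eventually_elim (use t in \<open>simp add: cI distrib_left\<close>)
      qed (unfold cI, measurable)
      also have "\<dots> = ift (\<lambda>\<xi>. c \<xi> * y 0 \<xi>) x + (\<psi> t x - \<psi> 0 x)"
        by (simp only: ift_add[OF cint(1)[OF ys[OF T0]] I(1)] I(2))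
      also have "\<dots> = ift (\<lambda>\<xi>. c \<xi> * y t \<xi>) x" using \<psi>[OF T0] \<psi>[OF t] by simp
      finally show ?thesis .
    qed
    from ift_inj_AE[OF cint[OF qs] cint[OF ys[OF t]] this]
    show ?thesis by eventually_elim (simp add: c0)
  qed
  then show thesis by (rule that[OF q(1) _ q(2)])
qed

text \<open>The defect of the formula solves the homogeneous equation; multiplied by the opposite
  phase it has derivative zero, and it starts at zero.\<close>

lemma integral_equation_duhamel:
  fixes y :: "real \<Rightarrow> complex"
  assumes y: "continuous_on {0..T} y" and S: "continuous_on {0..T} (\<lambda>s. S s \<xi>)"
    and eq: "\<And>t. t \<in> {0..T} \<Longrightarrow> y t = y 0 + integral {0..t} (\<lambda>s. - (\<i> * complex_of_real (\<theta> \<xi>)) * y s + complex_of_real (japanese \<xi>) * S s \<xi>)"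
    and t: "t \<in> {0..T}"
  shows "y t = exp (- (\<i> * complex_of_real (\<theta> \<xi> * t))) * y 0 + duh \<theta> S t \<xi>"
proof -
  let ?k = "- (\<i> * complex_of_real (\<theta> \<xi>))"
  let ?E = "\<lambda>t. exp (- (\<i> * complex_of_real (\<theta> \<xi> * t)))"
  define d where "d t = y t - (?E t * y 0 + duh \<theta> S t \<xi>)" for t
  have dy: "(y has_vector_derivative ?k * y t + complex_of_real (japanese \<xi>) * S t \<xi>) (at t within {0..T})" if t: "t \<in> {0..T}" for t
  proof -
    have "((\<lambda>t. integral {0..t} (\<lambda>s. ?k * y s + complex_of_real (japanese \<xi>) * S s \<xi>)) has_vector_derivative
        ?k * y t + complex_of_real (japanese \<xi>) * S t \<xi>) (at t within {0..T})"
      using t by (intro integral_has_vector_derivative continuous_intros y S)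
    from has_vector_derivative_add[OF has_vector_derivative_const[of "y 0"] this]
    have "((\<lambda>t. y 0 + integral {0..t} (\<lambda>s. ?k * y s + complex_of_real (japanese \<xi>) * S s \<xi>)) has_vector_derivative
        ?k * y t + complex_of_real (japanese \<xi>) * S t \<xi>) (at t within {0..T})" by simp
    then show ?thesis by (rule has_vector_derivative_transform[OF t eq, rotated])
  qed
  have E: "(?E has_vector_derivative ?k * ?E t) (at t within {0..T})" for t
    using phase_derivative[of "- \<theta> \<xi>" t "{0..T}"] by simp
  have dd: "(d has_vector_derivative ?k * d t) (at t within {0..T})" if t: "t \<in> {0..T}" for t
  proof -
    have "(d has_vector_derivative (?k * y t + complex_of_real (japanese \<xi>) * S t \<xi>) -
        ((?k * ?E t) * y 0 + (?k * duh \<theta> S t \<xi> + complex_of_real (japanese \<xi>) * S t \<xi>))) (at t within {0..T})"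
      unfolding d_def[abs_def]
      by (intro has_vector_derivative_diff has_vector_derivative_add has_vector_derivative_mult_left dy E duh_derivative S t)
    moreover have "(?k * y t + complex_of_real (japanese \<xi>) * S t \<xi>) -
        ((?k * ?E t) * y 0 + (?k * duh \<theta> S t \<xi> + complex_of_real (japanese \<xi>) * S t \<xi>)) = ?k * d t"
      by (simp add: d_def algebra_simps)
    ultimately show ?thesis by (simp only:)
  qed
  have "((\<lambda>t. exp (\<i> * complex_of_real (\<theta> \<xi> * t)) * d t) has_vector_derivative 0) (at t within {0..T})" if t: "t \<in> {0..T}" for t
    using has_vector_derivative_mult[OF phase_derivative dd[OF t], of "\<theta> \<xi>"] by (simp add: algebra_simps)
  then obtain c where c: "\<And>t. t \<in> {0..T} \<Longrightarrow> exp (\<i> * complex_of_real (\<theta> \<xi> * t)) * d t = c"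
    by (rule has_vector_derivative_zero_constant[OF convex_real_interval(5)]) blast+
  have "0 \<in> {0..T}" using t by simp
  with c[OF t] c have "exp (\<i> * complex_of_real (\<theta> \<xi> * t)) * d t = exp (\<i> * complex_of_real (\<theta> \<xi> * 0)) * d 0"
    by metis
  also have "d 0 = 0" by (simp add: d_def duh_0)
  finally have "d t = 0" by simp
  then show ?thesis by (simp add: d_def)
qed

text \<open>For each time, \<open>q\<close> and \<open>y\<close> agree for almost every frequency.
  Joint measurability and Fubini turn this into agreement at almost every time for almost every
  frequency, so the continuous \<open>q\<close> may replace \<open>y\<close> under the time
  integral.\<close>

lemma duhamel_of_time_integral:
  fixes q y S \<sigma> :: "real \<Rightarrow> real \<Rightarrow> complex"
  assumes T: "0 \<le> T" and q: "zcarrier T q" and jm: "jointly_measurable y" and S: "zcarrier T S"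
    and qy: "\<And>t. t \<in> {0..T} \<Longrightarrow> AE \<xi> in lborel. q t \<xi> = y t \<xi>"
    and \<sigma>: "\<And>s \<xi>. s \<in> {0..T} \<Longrightarrow> \<sigma> s \<xi> = - (\<i> * complex_of_real (\<theta> \<xi>)) * y s \<xi> + complex_of_real (japanese \<xi>) * S s \<xi>"
    and eq: "AE \<xi> in lborel. \<forall>t\<in>{0..T}. q t \<xi> = y 0 \<xi> + (LBINT s:{0..t}. \<sigma> s \<xi>)"
    and \<sigma>m: "jointly_measurable \<sigma>"
  shows "AE \<xi> in lborel. \<forall>t\<in>{0..T}. q t \<xi> = exp (- (\<i> * complex_of_real (\<theta> \<xi> * t))) * q 0 \<xi> + duh \<theta> S t \<xi>"
proof -
  note [measurable] = jointly_measurableD[OF jm] jointly_measurableD[OF \<sigma>m] measurable_caratheodory[OF T q]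
  have "AE s in lborel. AE \<xi> in lborel. s \<in> {0..T} \<longrightarrow> q (clip T s) \<xi> = y s \<xi>"
  proof (rule AE_I2)
    fix s
    show "AE \<xi> in lborel. s \<in> {0..T} \<longrightarrow> q (clip T s) \<xi> = y s \<xi>"
      using qy[of s] by (cases "s \<in> {0..T}") (auto simp: clip_id)
  qed
  then have swap: "AE \<xi> in lborel. AE s in lborel. s \<in> {0..T} \<longrightarrow> q (clip T s) \<xi> = y s \<xi>"
    by (subst lborel_pair.AE_commute[symmetric]) measurable
  show ?thesis using eq swap
  proof eventually_elim
    case (elim \<xi>)
    let ?f = "\<lambda>s. - (\<i> * complex_of_real (\<theta> \<xi>)) * q s \<xi> + complex_of_real (japanese \<xi>) * S s \<xi>"
    have qc: "continuous_on {0..T} (\<lambda>s. q s \<xi>)" and Sc: "continuous_on {0..T} (\<lambda>s. S s \<xi>)"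
      using q S by (auto simp: zcarrier_def)
    have "(LBINT s:{0..0}. \<sigma> s \<xi>) = 0"
      unfolding set_lebesgue_integral_def
      by (rule integral_eq_zero_AE) (use AE_lborel_singleton[of "0::real"] in eventually_elim, simp)
    then have q0: "q 0 \<xi> = y 0 \<xi>" using elim(1) T by force
    show ?case
    proof
      fix t assume t: "t \<in> {0..T}"
      show "q t \<xi> = exp (- (\<i> * complex_of_real (\<theta> \<xi> * t))) * q 0 \<xi> + duh \<theta> S t \<xi>"
      proof (rule integral_equation_duhamel[where y="\<lambda>s. q s \<xi>" and S=S, OF qc Sc _ t])
        fix t assume t: "t \<in> {0..T}"
        have sub: "{0..t} \<subseteq> {0..T}" using t by auto
        have c: "continuous_on {0..t} ?f" by (intro continuous_intros continuous_on_subset[OF qc sub] continuous_on_subset[OF Sc sub])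
        have "(LBINT s:{0..t}. \<sigma> s \<xi>) = (LBINT s:{0..t}. ?f s)"
          unfolding set_lebesgue_integral_def
        proof (rule integral_cong_AE)
          show "(\<lambda>s. indicator {0..t} s *\<^sub>R \<sigma> s \<xi>) \<in> borel_measurable lborel" by measurable
          show "(\<lambda>s. indicator {0..t} s *\<^sub>R ?f s) \<in> borel_measurable lborel"
            using continuous_on_set_integrable[OF c] unfolding set_integrable_def by (rule borel_measurable_integrable)
          show "AE s in lborel. indicator {0..t} s *\<^sub>R \<sigma> s \<xi> = indicator {0..t} s *\<^sub>R ?f s"
            using elim(2)
          proof eventually_elim
            case (elim s)
            then show ?case using sub \<sigma>[of s \<xi>] by (cases "s \<in> {0..t}") (auto simp: clip_id subset_iff)
          qed
        qed
        then show "q t \<xi> = q 0 \<xi> + integral {0..t} ?f"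
          unfolding integral_eq_LBINT[OF c] using elim(1) t q0 by metis
      qed
    qed
  qed
qed

section \<open>The sources: joint measurability and independence of representatives\<close>

lemma jointly_measurable_const: "f \<in> borel_measurable borel \<Longrightarrow> jointly_measurable (\<lambda>s \<xi>. f \<xi>)"
  unfolding jointly_measurable_def by (rule measurable_compose[OF measurable_snd])

lemma jointly_measurable_add: "jointly_measurable f \<Longrightarrow> jointly_measurable h \<Longrightarrow> jointly_measurable (\<lambda>s \<xi>. f s \<xi> + h s \<xi>)"
  unfolding jointly_measurable_def by (rule borel_measurable_add)

lemma jointly_measurable_mult: "jointly_measurable f \<Longrightarrow> jointly_measurable h \<Longrightarrow> jointly_measurable (\<lambda>s \<xi>. f s \<xi> * h s \<xi>)"
  unfolding jointly_measurable_def by (rule borel_measurable_times)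

lemma jointly_measurable_cmult: "p \<in> borel_measurable borel \<Longrightarrow> jointly_measurable f \<Longrightarrow> jointly_measurable (\<lambda>s \<xi>. p \<xi> * f s \<xi>)"
  by (intro jointly_measurable_mult jointly_measurable_const)

lemma jointly_measurable_til: "jointly_measurable f \<Longrightarrow> jointly_measurable (\<lambda>s. til (f s))"
  unfolding til_def[abs_def]
  by (subst jointly_measurable_def) (intro measurable_compose[OF _ measurable_cnj] jointly_measurableD[of f], measurable)

lemma jointly_measurable_deriv_symbol: "jointly_measurable f \<Longrightarrow> jointly_measurable (\<lambda>s. deriv_symbol (f s))"
  unfolding deriv_symbol_def[abs_def] by (rule jointly_measurable_cmult) measurable

lemma jointly_measurable_conv:
  assumes "jointly_measurable f" "jointly_measurable h" shows "jointly_measurable (\<lambda>s. conv (f s) (h s))"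
proof -
  note [measurable] = jointly_measurableD[OF assms(1)] jointly_measurableD[OF assms(2)]
  show ?thesis unfolding jointly_measurable_def conv_eq by measurable
qed

lemma jointly_measurable_conv_deriv:
  assumes "jointly_measurable f" "jointly_measurable h" shows "jointly_measurable (\<lambda>s. conv_deriv (f s) (h s))"
  unfolding conv_deriv_eq[abs_def]
  by (intro jointly_measurable_cmult jointly_measurable_conv assms) measurable

lemma jointly_measurable_modulus_power:
  assumes "jointly_measurable f" shows "jointly_measurable (\<lambda>s. modulus_power k (f s))"
  by (induction k) (simp_all add: jointly_measurable_conv jointly_measurable_til assms)

lemma jointly_measurable_source_phase:
  assumes "\<And>i. jointly_measurable (U i)"
  shows "jointly_measurable (\<lambda>s. source_phase \<alpha> lam \<gamma> \<sigma> (\<lambda>i. U i s))"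
  unfolding source_phase_def[abs_def]
  by (intro jointly_measurable_add jointly_measurable_cmult jointly_measurable_conv jointly_measurable_modulus_power
      jointly_measurable_deriv_symbol assms) auto

lemma jointly_measurable_source_amplitude:
  assumes "\<And>i. jointly_measurable (U i)"
  shows "jointly_measurable (\<lambda>s. source_amplitude \<alpha> \<gamma> (\<lambda>i. U i s))"
  unfolding source_amplitude_def[abs_def]
  by (intro jointly_measurable_add jointly_measurable_cmult jointly_measurable_conv jointly_measurable_modulus_power
      jointly_measurable_conv_deriv jointly_measurable_deriv_symbol assms) auto

definition ae_eq :: "(real \<Rightarrow> complex) \<Rightarrow> (real \<Rightarrow> complex) \<Rightarrow> bool" where
  "ae_eq f h \<longleftrightarrow> f \<in> borel_measurable borel \<and> h \<in> borel_measurable borel \<and> (AE \<xi> in lborel. f \<xi> = h \<xi>)"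

lemma conv_cong_AE:
  assumes "ae_eq f f'" "ae_eq h h'" shows "conv f h = conv f' h'"
proof
  fix \<xi>
  have [measurable]: "f \<in> borel_measurable borel" "f' \<in> borel_measurable borel" "h \<in> borel_measurable borel" "h' \<in> borel_measurable borel"
    using assms by (auto simp: ae_eq_def)
  have "AE \<eta> in lborel. f \<eta> = f' \<eta>" and h: "AE \<eta> in lborel. h \<eta> = h' \<eta>" using assms by (auto simp: ae_eq_def)
  from AE_lborel_affine[OF this(1), of "-1" \<xi>]
  have f: "AE \<eta> in lborel. f (\<xi> - \<eta>) = f' (\<xi> - \<eta>)" by simp
  have "(LBINT \<eta>. f (\<xi> - \<eta>) * h \<eta>) = (LBINT \<eta>. f' (\<xi> - \<eta>) * h' \<eta>)"
  proof (rule integral_cong_AE)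
    show "AE \<eta> in lborel. f (\<xi> - \<eta>) * h \<eta> = f' (\<xi> - \<eta>) * h' \<eta>" using f h by eventually_elim simp
  qed measurable
  then show "conv f h \<xi> = conv f' h' \<xi>" by (simp only: conv_eq)
qed

lemma ae_eq_refl: "f \<in> borel_measurable borel \<Longrightarrow> ae_eq f f" by (simp add: ae_eq_def)

lemma ae_eq_til: "ae_eq f h \<Longrightarrow> ae_eq (til f) (til h)"
  using AE_reflect[of "\<lambda>\<xi>. f \<xi> = h \<xi>"] by (auto simp: ae_eq_def til_def)

lemma ae_eq_cmult: "p \<in> borel_measurable borel \<Longrightarrow> ae_eq f h \<Longrightarrow> ae_eq (\<lambda>\<xi>. p \<xi> * f \<xi>) (\<lambda>\<xi>. p \<xi> * h \<xi>)"
  by (auto simp: ae_eq_def elim: eventually_mono)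

lemma ae_eq_deriv_symbol: "ae_eq f h \<Longrightarrow> ae_eq (deriv_symbol f) (deriv_symbol h)"
  unfolding deriv_symbol_def[abs_def] by (rule ae_eq_cmult) measurable

lemma conv_deriv_cong_AE: "ae_eq f f' \<Longrightarrow> ae_eq h h' \<Longrightarrow> conv_deriv f h = conv_deriv f' h'"
  by (rule ext) (simp add: conv_deriv_eq conv_cong_AE[OF _ ae_eq_cmult])

lemma modulus_power_cong_AE:
  assumes "ae_eq f h" shows "modulus_power k f = modulus_power k h"
  by (induction k) (simp_all add: conv_cong_AE[OF assms ae_eq_til[OF assms]])

lemma measurable_modulus_power: "f \<in> borel_measurable borel \<Longrightarrow> modulus_power k f \<in> borel_measurable borel"
  by (induction k) auto

text \<open>Every term is a convolution or a multiple of one, and a convolution sees its factors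
  only up to null sets; hence the sources agree at every frequency.\<close>

lemma source_cong_AE:
  assumes "\<And>i. ae_eq (u i) (v i)"
  shows "source_phase \<alpha> lam \<gamma> \<sigma> u = source_phase \<alpha> lam \<gamma> \<sigma> v" "source_amplitude \<alpha> \<gamma> u = source_amplitude \<alpha> \<gamma> v"
proof -
  note D = ae_eq_deriv_symbol[OF assms[of False]]
  have P: "ae_eq (modulus_power k (v True)) (modulus_power k (v True))" for k
    using assms[of True] by (intro ae_eq_refl measurable_modulus_power) (simp add: ae_eq_def)
  show "source_phase \<alpha> lam \<gamma> \<sigma> u = source_phase \<alpha> lam \<gamma> \<sigma> v"
    unfolding source_phase_def[abs_def] conv_cong_AE[OF D D] conv_cong_AE[OF P D] modulus_power_cong_AE[OF assms[of True]] ..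
  show "source_amplitude \<alpha> \<gamma> u = source_amplitude \<alpha> \<gamma> v"
    unfolding source_amplitude_def[abs_def] conv_deriv_cong_AE[OF D assms] conv_deriv_cong_AE[OF assms D] conv_cong_AE[OF P assms]
      modulus_power_cong_AE[OF assms[of True]] ..
qed

text \<open>The gap between \<open>w\<close> and \<open>d\<close> absorbs polynomial growth, such as
  that of the dispersion and of the bracket.\<close>

lemma zbound_slice_mult:
  assumes d: "0 < d" "d < w" and f: "zbound l w 0 0 r (\<lambda>_. f)" and [measurable]: "p \<in> borel_measurable borel"
    and p: "\<And>\<xi>. cmod (p \<xi>) \<le> japanese \<xi> ^ k"
  shows "zbound l d 0 0 (fact k / (w - d) ^ k * r) (\<lambda>_ \<xi>. p \<xi> * f \<xi>)"
proof -
  have r: "0 \<le> r" by (rule zbound_nonneg[OF f])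
  have [measurable]: "f \<in> borel_measurable borel"
    and w: "wsq l (\<lambda>\<xi>. ennreal (exp (w * japanese \<xi>) * cmod (f \<xi>))) \<le> ennreal (r\<^sup>2)"
    using f unfolding zbound_slice_iff[OF r] by auto
  let ?C = "fact k / (w - d) ^ k :: real"
  have C: "0 \<le> ?C" using d by simp
  have le: "ennreal (exp (d * japanese \<xi>) * cmod (p \<xi> * f \<xi>)) \<le> ennreal ?C * ennreal (exp (w * japanese \<xi>) * cmod (f \<xi>))" for \<xi>
  proof -
    have "cmod (p \<xi>) \<le> ?C * exp ((w - d) * japanese \<xi>)"
      using p[of \<xi>] japanese_power_le_exp[of "w - d" \<xi> k] d by simp
    then have "exp (d * japanese \<xi>) * (cmod (p \<xi>) * cmod (f \<xi>)) \<le> exp (d * japanese \<xi>) * ((?C * exp ((w - d) * japanese \<xi>)) * cmod (f \<xi>))"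
      by (intro mult_left_mono mult_right_mono) auto
    also have "\<dots> = ?C * ((exp (d * japanese \<xi>) * exp ((w - d) * japanese \<xi>)) * cmod (f \<xi>))" by (simp only: mult_ac)
    also have "exp (d * japanese \<xi>) * exp ((w - d) * japanese \<xi>) = exp (w * japanese \<xi>)"
      unfolding mult_exp_exp by (simp add: algebra_simps)
    finally show ?thesis using C by (simp add: norm_mult ennreal_mult[symmetric] ennreal_leI)
  qed
  have "wsq l (\<lambda>\<xi>. ennreal (exp (d * japanese \<xi>) * cmod (p \<xi> * f \<xi>))) \<le> wsq l (\<lambda>\<xi>. ennreal ?C * ennreal (exp (w * japanese \<xi>) * cmod (f \<xi>)))"
    by (rule wsq_mono[OF le])
  also have "\<dots> \<le> ennreal ((?C * r)\<^sup>2)" by (rule wsq_cmult[OF _ w C r]) measurable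
  finally show ?thesis
    unfolding zbound_slice_iff[OF mult_nonneg_nonneg[OF C r]] by simp
qed

text \<open>Differentiability makes \<open>f\<close> continuous, so the inversion formula, valid
  almost everywhere, holds at every point.\<close>

lemma L2_ift_everywhere:
  assumes f: "f \<in> L2" and d: "\<And>x. f differentiable at x" and h: "exp_decay c h" and eq: "AE \<xi> in lborel. fourier f \<xi> = h \<xi>"
  shows "f = ift h"
proof
  fix x
  have "continuous_on UNIV f"
    by (intro continuous_at_imp_continuous_on ballI differentiable_imp_continuous_within d)
  moreover have "continuous_on UNIV (ift h)"
    using ift_has_vector_derivative[OF h] by (intro continuous_at_imp_continuous_on ballI has_vector_derivative_continuous)
  moreover have "AE x in lborel. f x = ift h x" by (rule fourier_inversion[OF f exp_decay_integrable[OF h] eq])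
  ultimately show "f x = ift h x" by (rule continuous_AE_eq)
qed

section \<open>From solutions in the class to the Duhamel equation\<close>

definition dispersion :: "real \<Rightarrow> bool \<Rightarrow> real \<Rightarrow> real" where
  "dispersion \<epsilon> i \<xi> = (if i then \<epsilon> * \<xi>\<^sup>2 / 2 else 0)"

lemma measurable_dispersion [measurable]: "dispersion \<epsilon> i \<in> borel_measurable borel"
  unfolding dispersion_def[abs_def] by measurable

lemma dispersion_le: "\<bar>\<epsilon>\<bar> \<le> 1 \<Longrightarrow> \<bar>dispersion \<epsilon> i \<xi>\<bar> \<le> japanese \<xi> ^ 2"
proof -
  assume \<epsilon>: "\<bar>\<epsilon>\<bar> \<le> 1"
  have "\<bar>\<epsilon>\<bar> * \<xi>\<^sup>2 \<le> 1 * \<xi>\<^sup>2" by (intro mult_right_mono \<epsilon>) simp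
  moreover have "japanese \<xi> ^ 2 = 1 + \<xi>\<^sup>2" by (simp add: japanese_def)
  moreover have "\<bar>dispersion \<epsilon> i \<xi>\<bar> \<le> \<bar>\<epsilon>\<bar> * \<xi>\<^sup>2 / 2" by (simp add: dispersion_def abs_mult)
  ultimately show ?thesis using zero_le_power2[of \<xi>] by linarith
qed

definition source :: "real \<Rightarrow> real \<Rightarrow> nat \<Rightarrow> nat \<Rightarrow> bool \<Rightarrow> (bool \<Rightarrow> real \<Rightarrow> complex) \<Rightarrow> real \<Rightarrow> complex" where
  "source \<alpha> lam \<gamma> \<sigma> i = (if i then source_amplitude \<alpha> \<gamma> else source_phase \<alpha> lam \<gamma> \<sigma>)"

lemma lip_source: "l \<ge> 1 \<Longrightarrow> lip True l (source \<alpha> lam \<gamma> \<sigma> i)"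
  by (simp add: source_def lip_source_phase lip_source_amplitude)

text \<open>At a fixed time both components are inverse transforms, so solving the pointwise
  equations for the time derivative expresses it as an inverse transform.\<close>

lemma classical_solution_evolution:
  fixes p b :: "real \<Rightarrow> real \<Rightarrow> complex"
  assumes \<gamma>: "\<gamma> \<ge> 1" and \<sigma>: "\<sigma> \<ge> 1"
    and g: "g = (\<lambda>s. \<alpha> * s ^ \<gamma>)" and f: "f = (\<lambda>s. lam * s ^ \<sigma>)"
    and sol: "classical_solution g f \<epsilon> T \<phi>0 a0 \<phi> a" and t: "t \<in> {0..T}"
    and p: "exp_decay c (p t)" and b: "exp_decay c (b t)" and \<phi>: "\<phi> t = ift (p t)" and a: "a t = ift (b t)"
  defines "u \<equiv> \<lambda>i. if i then b t else (\<lambda>\<xi>. complex_of_real (japanese \<xi>) * p t \<xi>)"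
  shows "((\<lambda>s. \<phi> s x) has_vector_derivative ift (source_phase \<alpha> lam \<gamma> \<sigma> u) x) (at t within {0..T})"
    and "((\<lambda>s. a s x) has_vector_derivative
      ift (\<lambda>\<xi>. - (\<i> * complex_of_real (\<epsilon> * \<xi>\<^sup>2 / 2)) * b t \<xi> + complex_of_real (japanese \<xi>) * source_amplitude \<alpha> \<gamma> u \<xi>) x) (at t within {0..T})"
proof -
  note N = nonlinearity_eq_ift[where \<phi>=\<phi> and a=a and t=t and \<alpha>=\<alpha> and lam=lam and x=x, OF p b \<phi> a \<gamma> \<sigma> g f, folded u_def]
  have c: "0 < c / 2" "c / 2 < c" using exp_decay_pos[OF p] by auto
  have eqs: "dt T \<phi> t x + 1 / 2 * (dx \<phi> t x)\<^sup>2 + 1 / 2 * complex_of_real (g ((cmod (a t x))\<^sup>2)) * dx \<phi> t x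
      + complex_of_real (f ((cmod (a t x))\<^sup>2)) = 0"
    "dt T a t x + dx \<phi> t x * dx a t x + 1 / 2 * a t x * dx (dx \<phi>) t x
      + 1 / 2 * dx (\<lambda>s y. complex_of_real (g ((cmod (a s y))\<^sup>2)) * a s y) t x = \<i> * complex_of_real \<epsilon> / 2 * dx (dx a) t x"
    and d: "(\<lambda>s. \<phi> s x) differentiable (at t within {0..T})" "(\<lambda>s. a s x) differentiable (at t within {0..T})"
    using sol t unfolding classical_solution_def by blast+
  have "dt T \<phi> t x = - (1 / 2 * (dx \<phi> t x)\<^sup>2 + 1 / 2 * complex_of_real (g ((cmod (a t x))\<^sup>2)) * dx \<phi> t x
      + complex_of_real (f ((cmod (a t x))\<^sup>2)))"
    by (rule eq_neg_iff_add_eq_0[THEN iffD2]) (use eqs(1) in \<open>simp only: add.assoc\<close>)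
  then have "dt T \<phi> t x = ift (source_phase \<alpha> lam \<gamma> \<sigma> u) x" unfolding N(1) by simp
  then show "((\<lambda>s. \<phi> s x) has_vector_derivative ift (source_phase \<alpha> lam \<gamma> \<sigma> u) x) (at t within {0..T})"
    using d(1) by (simp add: dt_def vector_derivative_works)
  let ?D = "\<lambda>\<xi>. \<i> * complex_of_real \<xi> * (\<i> * complex_of_real \<xi> * b t \<xi>)"
  have dd: "dx (dx a) t x = ift ?D x" by (rule spatial_derivative2(2)[where u=a and t=t, OF b a])
  have c4: "0 < c / 4" "c / 4 < c / 2" using c by auto
  have iD: "integrable lborel ?D"
    by (rule exp_decay_integrable[OF exp_decay_derivative[OF exp_decay_derivative[OF b c] c4]])
  have iS: "integrable lborel (\<lambda>\<xi>. complex_of_real (japanese \<xi>) * source_amplitude \<alpha> \<gamma> u \<xi>)"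
    unfolding u_def by (rule exp_decay_integrable[OF ift_source_amplitude(1)[OF p b \<gamma> c]])
  have "dt T a t x = \<i> * complex_of_real \<epsilon> / 2 * dx (dx a) t x - (dx \<phi> t x * dx a t x + 1 / 2 * a t x * dx (dx \<phi>) t x
      + 1 / 2 * dx (\<lambda>s y. complex_of_real (g ((cmod (a s y))\<^sup>2)) * a s y) t x)"
    unfolding eqs(2)[symmetric] by (simp only: add.assoc add_diff_cancel_right')
  also have "\<dots> = ift (\<lambda>\<xi>. \<i> * complex_of_real \<epsilon> / 2 * ?D \<xi>) x + ift (\<lambda>\<xi>. complex_of_real (japanese \<xi>) * source_amplitude \<alpha> \<gamma> u \<xi>) x"
    unfolding N(2) dd ift_cmult by simp
  also have "\<dots> = ift (\<lambda>\<xi>. \<i> * complex_of_real \<epsilon> / 2 * ?D \<xi> + complex_of_real (japanese \<xi>) * source_amplitude \<alpha> \<gamma> u \<xi>) x"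
    by (rule ift_add[symmetric, OF integrable_mult_right[OF iD] iS])
  also have "(\<lambda>\<xi>. \<i> * complex_of_real \<epsilon> / 2 * ?D \<xi> + complex_of_real (japanese \<xi>) * source_amplitude \<alpha> \<gamma> u \<xi>) =
      (\<lambda>\<xi>. - (\<i> * complex_of_real (\<epsilon> * \<xi>\<^sup>2 / 2)) * b t \<xi> + complex_of_real (japanese \<xi>) * source_amplitude \<alpha> \<gamma> u \<xi>)"
    by (simp add: fun_eq_iff power2_eq_square field_simps)
  finally show "((\<lambda>s. a s x) has_vector_derivative
      ift (\<lambda>\<xi>. - (\<i> * complex_of_real (\<epsilon> * \<xi>\<^sup>2 / 2)) * b t \<xi> + complex_of_real (japanese \<xi>) * source_amplitude \<alpha> \<gamma> u \<xi>) x) (at t within {0..T})"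
    using d(2) by (simp only: dt_def vector_derivative_works)
qed

text \<open>Puts an arbitrary solution into the form required by \<open>duhamel_unique\<close>:
  transforms \<open>U\<close> at each time, their time derivative \<open>S\<close>, and the
  integrated representative \<open>Q\<close>, which is continuous in time and has a
  majorant.\<close>

lemma classical_solution_fourier:
  fixes \<phi> a :: "real \<Rightarrow> real \<Rightarrow> complex"
  assumes l: "l \<ge> 1" and \<gamma>: "\<gamma> \<ge> 1" and \<sigma>: "\<sigma> \<ge> 1"
    and g: "g = (\<lambda>s. \<alpha> * s ^ \<gamma>)" and f: "f = (\<lambda>s. lam * s ^ \<sigma>)"
    and \<epsilon>: "\<bar>\<epsilon>\<bar> \<le> 1" and M: "0 \<le> M" and T: "0 \<le> T" and MT: "M * T < w0"
    and X: "(\<phi>, a) \<in> X_space (weight w0 M) T l"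
    and sol: "classical_solution g f \<epsilon> T \<phi>0 a0 \<phi> a"
    and meas: "\<phi>0 \<in> borel_measurable borel" "a0 \<in> borel_measurable borel"
  obtains Q :: "bool \<Rightarrow> real \<Rightarrow> real \<Rightarrow> complex" and R where
    "\<And>i. zbound l ((w0 - M * T) / 2) 0 T R (Q i)"
    "\<And>t x. t \<in> {0..T} \<Longrightarrow> \<phi> t x = ift (\<lambda>\<xi>. complex_of_real (1 / japanese \<xi>) * Q False t \<xi>) x"
    "\<And>t x. t \<in> {0..T} \<Longrightarrow> a t x = ift (Q True t) x"
    "\<And>i. AE \<xi> in lborel. \<forall>t\<in>{0..T}. Q i t \<xi> = exp (- (\<i> * complex_of_real (dispersion \<epsilon> i \<xi> * t))) * Q i 0 \<xi>
       + duh (dispersion \<epsilon> i) (\<lambda>s. source \<alpha> lam \<gamma> \<sigma> i (\<lambda>j. Q j s)) t \<xi>"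
    "\<And>i. AE \<xi> in lborel. Q i 0 \<xi> = (if i then fourier a0 \<xi> else complex_of_real (japanese \<xi>) * fourier \<phi>0 \<xi>)"
proof -
  \<comment> \<open>The smallest value of the weight on the interval, positive by \<open>MT\<close>.
    Half of it is given up below to absorb the second-order multiplier and the bracket in
    \<open>S\<close>.\<close>
  define w where "w = w0 - M * T"
  have w: "0 < w" "0 < w / 2" "w / 2 < w" using MT by (auto simp: w_def)
  have T0: "0 \<in> {0..T}" using T by simp
  have CH: "\<phi> \<in> C_H (weight w0 M) T (l + 1)" "a \<in> C_H (weight w0 M) T l"
    using X by (auto simp: X_space_def Y_space_def)
  obtain P1 B1 where P1: "jointly_measurable P1" "0 \<le> B1" "\<And>t. t \<in> {0..T} \<Longrightarrow> \<phi> t \<in> L2"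
    "\<And>t. t \<in> {0..T} \<Longrightarrow> AE \<xi> in lborel. fourier (\<phi> t) \<xi> = P1 t \<xi>"
    "\<And>t. t \<in> {0..T} \<Longrightarrow> wsq (l + 1) (\<lambda>\<xi>. ennreal (exp (w * japanese \<xi>) * cmod (P1 t \<xi>))) \<le> ennreal (B1\<^sup>2)"
    by (rule C_H_version[OF M T CH(1), folded w_def]) (rule that)
  obtain P2 B2 where P2: "jointly_measurable P2" "0 \<le> B2" "\<And>t. t \<in> {0..T} \<Longrightarrow> a t \<in> L2"
    "\<And>t. t \<in> {0..T} \<Longrightarrow> AE \<xi> in lborel. fourier (a t) \<xi> = P2 t \<xi>"
    "\<And>t. t \<in> {0..T} \<Longrightarrow> wsq l (\<lambda>\<xi>. ennreal (exp (w * japanese \<xi>) * cmod (P2 t \<xi>))) \<le> ennreal (B2\<^sup>2)"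
    by (rule C_H_version[OF M T CH(2), folded w_def]) (rule that)
  define U where "U i t = (if i then P2 t else (\<lambda>\<xi>. complex_of_real (japanese \<xi>) * P1 t \<xi>))" for i t
  have Um: "jointly_measurable (U i)" for i
    unfolding U_def[abs_def] using P2(1) by (cases i) (auto intro!: jointly_measurable_cmult P1(1))
  have Us [measurable]: "U i t \<in> borel_measurable borel" for i t
    by (rule jointly_measurableD[OF Um[of i], of "\<lambda>_. t" borel "\<lambda>x. x"]) simp_all
  define R0 where "R0 = max B1 B2"
  have R0: "0 \<le> R0" "B1 \<le> R0" "B2 \<le> R0" using P1(2) by (auto simp: R0_def)
  have Uz: "zbound l w 0 0 R0 (\<lambda>_. U i t)" if t: "t \<in> {0..T}" for i t
  proof (cases i)
    case True
    have "zbound l w 0 0 B2 (\<lambda>_. U i t)"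
      unfolding zbound_slice_iff[OF P2(2)] using P2(5)[OF t] Us[of i t] True by (simp add: U_def)
    then show ?thesis using R0 zbound_mono by blast
  next
    case False
    have "wsq l (\<lambda>\<xi>. ennreal (exp (w * japanese \<xi>) * cmod (U i t \<xi>))) = wsq (l + 1) (\<lambda>\<xi>. ennreal (exp (w * japanese \<xi>) * cmod (P1 t \<xi>)))"
      using False unfolding wsq_def
      by (intro nn_integral_cong) (simp add: U_def norm_mult ennreal_mult[symmetric] powr_add mult_ac)
    then have "zbound l w 0 0 B1 (\<lambda>_. U i t)"
      unfolding zbound_slice_iff[OF P1(2)] using P1(5)[OF t] Us[of i t] by simp
    then show ?thesis using R0 zbound_mono by blast
  qed
  have Ud: "exp_decay w (U i t)" if "t \<in> {0..T}" for i t
    using zbound_exp_decay(1)[OF l Uz[OF that], of 0 i] w by simp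
  have P1U: "P1 t = (\<lambda>\<xi>. complex_of_real (1 / japanese \<xi>) * U False t \<xi>)" for t
    by (simp add: U_def fun_eq_iff)
  have inv1: "cmod (complex_of_real (1 / japanese \<xi>)) \<le> 1" for \<xi>
    using japanese_ge_1[of \<xi>] by (simp add: norm_of_real del: of_real_divide)
  have dec: "exp_decay w (P1 t)" "exp_decay w (P2 t)" if t: "t \<in> {0..T}" for t
  proof -
    show "exp_decay w (P1 t)" unfolding P1U
      by (rule exp_decay_bounded_mult[OF Ud[OF t] _ inv1]) measurable
    show "exp_decay w (P2 t)" using Ud[OF t, of True] by (simp add: U_def)
  qed
  have diff: "\<phi> t differentiable at x" "a t differentiable at x" if "t \<in> {0..T}" for t x
    using sol that unfolding classical_solution_def by blast+
  have ift: "\<phi> t = ift (P1 t)" "a t = ift (P2 t)" if t: "t \<in> {0..T}" for t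
    by (rule L2_ift_everywhere[OF P1(3)[OF t] diff(1)[OF t] dec(1)[OF t] P1(4)[OF t]],
        rule L2_ift_everywhere[OF P2(3)[OF t] diff(2)[OF t] dec(2)[OF t] P2(4)[OF t]])
  have Ueq: "(\<lambda>i. U i t) = (\<lambda>i. if i then P2 t else (\<lambda>\<xi>. complex_of_real (japanese \<xi>) * P1 t \<xi>))" for t
    by (simp add: U_def fun_eq_iff)
  \<comment> \<open>The multiplier that leads from the unknown \<open>U i\<close> back to the
    transform of phi or a.\<close>
  define c where "c i \<xi> = complex_of_real (if i then 1 else 1 / japanese \<xi>)" for i \<xi>
  have cm [measurable]: "c i \<in> borel_measurable borel" for i unfolding c_def[abs_def] by measurable
  have c1: "cmod (c i \<xi>) \<le> 1" and c0: "c i \<xi> \<noteq> 0" for i \<xi>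
    using inv1[of \<xi>] japanese_ge_1[of \<xi>] by (auto simp: c_def)
  define \<psi> where "\<psi> i = (if i then a else \<phi>)" for i
  have \<psi>: "\<psi> i t x = ift (\<lambda>\<xi>. c i \<xi> * U i t \<xi>) x" if "t \<in> {0..T}" for i t x
  proof (cases i)
    case True then show ?thesis using ift[OF that] by (simp add: \<psi>_def c_def U_def)
  next
    case False then show ?thesis using ift(1)[OF that] P1U[of t] by (simp add: \<psi>_def c_def)
  qed
  define N where "N i t = source \<alpha> lam \<gamma> \<sigma> i (\<lambda>j. U j t)" for i t
  define S where "S i t \<xi> = - (\<i> * complex_of_real (dispersion \<epsilon> i \<xi>)) * U i t \<xi> + complex_of_real (japanese \<xi>) * N i t \<xi>" for i t \<xi>
  have Nm: "jointly_measurable (N i)" for i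
    unfolding N_def[abs_def] source_def
    using jointly_measurable_source_phase[OF Um] jointly_measurable_source_amplitude[OF Um] by (cases i) auto
  have Sm: "jointly_measurable (S i)" for i
    unfolding S_def[abs_def] by (intro jointly_measurable_add jointly_measurable_cmult Um Nm) measurable
  have der: "((\<lambda>s. \<psi> i s x) has_vector_derivative ift (\<lambda>\<xi>. c i \<xi> * S i t \<xi>) x) (at t within {0..T})" if t: "t \<in> {0..T}" for i t x
  proof -
    note E = classical_solution_evolution[where p=P1 and b=P2 and x=x, OF \<gamma> \<sigma> g f sol t dec[OF t] ift[OF t], folded Ueq]
    show ?thesis
    proof (cases i)
      case True
      then have "(\<lambda>\<xi>. c i \<xi> * S i t \<xi>) = (\<lambda>\<xi>. - (\<i> * complex_of_real (\<epsilon> * \<xi>\<^sup>2 / 2)) * P2 t \<xi> + complex_of_real (japanese \<xi>) * source_amplitude \<alpha> \<gamma> (\<lambda>i. U i t) \<xi>)"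
        by (simp add: c_def S_def N_def source_def dispersion_def fun_eq_iff) (simp add: U_def)
      then show ?thesis using E(2) True by (simp only: \<psi>_def if_True)
    next
      case False
      then have "(\<lambda>\<xi>. c i \<xi> * S i t \<xi>) = source_phase \<alpha> lam \<gamma> \<sigma> (\<lambda>i. U i t)"
        by (simp add: c_def S_def N_def source_def dispersion_def fun_eq_iff)
      then show ?thesis using E(1) False by (simp only: \<psi>_def if_False)
    qed
  qed
  have "\<forall>i. \<exists>q R. zbound l (w / 2) 0 T R q \<and> (\<forall>t\<in>{0..T}. AE \<xi> in lborel. q t \<xi> = U i t \<xi>) \<and>
      (AE \<xi> in lborel. \<forall>t\<in>{0..T}. q t \<xi> = U i 0 \<xi> + (LBINT s:{0..t}. S i s \<xi>))"
  proof
    fix i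
    obtain L where L: "lipL True l R0 L (source \<alpha> lam \<gamma> \<sigma> i)" using lip_source[OF l] R0 unfolding lip_def by blast
    have adm: "admissible w 0 0" using w by (simp add: admissible_def)
    have zN: "zbound l w 0 0 L (\<lambda>_. N i t)" if t: "t \<in> {0..T}" for t
    proof -
      have "zbound l w 0 0 0 (\<lambda>_ \<xi>. U j t \<xi> - U j t \<xi>)" for j using zbound_zero[of 0] by simp
      from lipLD(1)[where U="\<lambda>j _. U j t" and U'="\<lambda>j _. U j t", OF L adm Uz[OF t] Uz[OF t] this]
      show ?thesis unfolding N_def .
    qed
    let ?r = "fact 2 / (w - w / 2) ^ 2 * R0 + fact 1 / (w - w / 2) ^ 1 * L"
    have zS: "zbound l (w / 2) 0 0 ?r (\<lambda>_. S i t)" if t: "t \<in> {0..T}" for t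
      unfolding S_def
    proof (intro zbound_add zbound_slice_mult[OF w(2,3) Uz[OF t]] zbound_slice_mult[OF w(2,3) zN[OF t]])
      show "cmod (- (\<i> * complex_of_real (dispersion \<epsilon> i \<xi>))) \<le> japanese \<xi> ^ 2" for \<xi>
        using dispersion_le[OF \<epsilon>, of i \<xi>] by (simp add: norm_mult)
    qed auto
    have zU: "zbound l (w / 2) 0 0 (fact 0 / (w - w / 2) ^ 0 * R0) (\<lambda>_. U i t)" if t: "t \<in> {0..T}" for t
      using zbound_slice_mult[OF w(2,3) Uz[OF t], of "\<lambda>_. 1" 0 i] by simp
    show "\<exists>q R. zbound l (w / 2) 0 T R q \<and> (\<forall>t\<in>{0..T}. AE \<xi> in lborel. q t \<xi> = U i t \<xi>) \<and>
      (AE \<xi> in lborel. \<forall>t\<in>{0..T}. q t \<xi> = U i 0 \<xi> + (LBINT s:{0..t}. S i s \<xi>))"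
      by (rule continuous_fourier_version[where \<psi>="\<psi> i" and c="c i" and y="U i" and \<sigma>="S i", OF l T w(2) Sm zS zU cm c1 c0 \<psi> der])
        blast+
  qed
  from choice[OF this] obtain Q where "\<forall>i. \<exists>R. zbound l (w / 2) 0 T R (Q i) \<and> (\<forall>t\<in>{0..T}. AE \<xi> in lborel. Q i t \<xi> = U i t \<xi>) \<and>
      (AE \<xi> in lborel. \<forall>t\<in>{0..T}. Q i t \<xi> = U i 0 \<xi> + (LBINT s:{0..t}. S i s \<xi>))"
    ..
  from choice[OF this] obtain Ri where Q': "\<forall>i. zbound l (w / 2) 0 T (Ri i) (Q i) \<and> (\<forall>t\<in>{0..T}. AE \<xi> in lborel. Q i t \<xi> = U i t \<xi>) \<and>
      (AE \<xi> in lborel. \<forall>t\<in>{0..T}. Q i t \<xi> = U i 0 \<xi> + (LBINT s:{0..t}. S i s \<xi>))"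
    ..
  have Q: "\<And>i. zbound l (w / 2) 0 T (Ri i) (Q i)" "\<And>i t. t \<in> {0..T} \<Longrightarrow> AE \<xi> in lborel. Q i t \<xi> = U i t \<xi>"
    "\<And>i. AE \<xi> in lborel. \<forall>t\<in>{0..T}. Q i t \<xi> = U i 0 \<xi> + (LBINT s:{0..t}. S i s \<xi>)"
    using Q' by auto
  define R where "R = max (Ri False) (Ri True)"
  have QR: "zbound l (w / 2) 0 T R (Q i)" for i
    by (rule zbound_mono[OF Q(1)]) (cases i, auto simp: R_def)
  have Qm: "Q i t \<in> borel_measurable borel" if "t \<in> {0..T}" for i t
    using zbound_zcarrier[OF QR[of i]] that unfolding zcarrier_def by blast
  have Qae: "ae_eq (Q i t) (U i t)" if t: "t \<in> {0..T}" for i t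
    using Qm[OF t] Q(2)[OF t] Us by (auto simp: ae_eq_def)
  have QN: "source \<alpha> lam \<gamma> \<sigma> i (\<lambda>j. Q j t) = N i t" if t: "t \<in> {0..T}" for i t
    using source_cong_AE[of "\<lambda>j. Q j t" "\<lambda>j. U j t", OF Qae[OF t]] by (simp add: N_def source_def)
  have ift_Q: "\<psi> i t x = ift (\<lambda>\<xi>. c i \<xi> * Q i t \<xi>) x" if t: "t \<in> {0..T}" for i t x
    unfolding \<psi>[OF t]
  proof (rule ift_cong_AE)
    show "AE \<xi> in lborel. c i \<xi> * U i t \<xi> = c i \<xi> * Q i t \<xi>" using Q(2)[OF t, of i] by eventually_elim simp
    note [measurable] = Qm[OF t]
    show "(\<lambda>\<xi>. c i \<xi> * U i t \<xi>) \<in> borel_measurable borel" "(\<lambda>\<xi>. c i \<xi> * Q i t \<xi>) \<in> borel_measurable borel" by measurable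
  qed
  show thesis
  proof (rule that[of R Q, folded w_def])
    show "zbound l (w / 2) 0 T R (Q i)" for i by (rule QR)
    show "\<phi> t x = ift (\<lambda>\<xi>. complex_of_real (1 / japanese \<xi>) * Q False t \<xi>) x" if "t \<in> {0..T}" for t x
      using ift_Q[OF that, of False x] by (simp only: \<psi>_def c_def if_False)
    show "a t x = ift (Q True t) x" if "t \<in> {0..T}" for t x
      using ift_Q[OF that, of True x] by (simp add: \<psi>_def c_def)
    show "AE \<xi> in lborel. Q i 0 \<xi> = (if i then fourier a0 \<xi> else complex_of_real (japanese \<xi>) * fourier \<phi>0 \<xi>)" for i
    proof -
      have m: "\<phi> 0 \<in> borel_measurable borel" "a 0 \<in> borel_measurable borel"
        using P1(3)[OF T0] P2(3)[OF T0] L2_measurable by auto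
      have AE: "AE x in lborel. \<phi> 0 x = \<phi>0 x" "AE x in lborel. a 0 x = a0 x"
        using sol unfolding classical_solution_def by auto
      have F: "fourier (\<phi> 0) = fourier \<phi>0" "fourier (a 0) = fourier a0"
        by (rule fourier_cong_AE[OF AE(1) m(1) meas(1)], rule fourier_cong_AE[OF AE(2) m(2) meas(2)])
      show ?thesis
        unfolding F[symmetric] using Q(2)[OF T0, of i] P1(4)[OF T0] P2(4)[OF T0] by eventually_elim (simp add: U_def)
    qed
    show "AE \<xi> in lborel. \<forall>t\<in>{0..T}. Q i t \<xi> = exp (- (\<i> * complex_of_real (dispersion \<epsilon> i \<xi> * t))) * Q i 0 \<xi>
       + duh (dispersion \<epsilon> i) (\<lambda>s. source \<alpha> lam \<gamma> \<sigma> i (\<lambda>j. Q j s)) t \<xi>" for i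
    proof (rule duhamel_of_time_integral[OF T zbound_zcarrier[OF QR] Um _ Q(2) _ Q(3) Sm])
      have "admissible (w / 2) 0 T" using w T by (simp add: admissible_def)
      then obtain L where "zbound l (w / 2) 0 T L (\<lambda>t. source \<alpha> lam \<gamma> \<sigma> i (\<lambda>j. Q j t))"
        by (rule source_zbound[where U=Q and R=R, OF lip_source[OF l, of _ _ _ _ i] _ QR])
      then show "zcarrier T (\<lambda>s. source \<alpha> lam \<gamma> \<sigma> i (\<lambda>j. Q j s))" by (rule zbound_zcarrier)
      show "S i s \<xi> = - (\<i> * complex_of_real (dispersion \<epsilon> i \<xi>)) * U i s \<xi> +
          complex_of_real (japanese \<xi>) * source \<alpha> lam \<gamma> \<sigma> i (\<lambda>j. Q j s) \<xi>" if "s \<in> {0..T}" for s \<xi>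
        unfolding QN[OF that] S_def ..
    qed
  qed
qed

theorem classical_uniqueness:
  fixes \<phi> a \<phi>' a' :: "real \<Rightarrow> real \<Rightarrow> complex"
  assumes l: "l \<ge> 1" and \<gamma>: "\<gamma> \<ge> 1" and \<sigma>: "\<sigma> \<ge> 1"
    and g: "g = (\<lambda>s. \<alpha> * s ^ \<gamma>)" and f: "f = (\<lambda>s. lam * s ^ \<sigma>)"
    and \<epsilon>: "\<bar>\<epsilon>\<bar> \<le> 1" and M: "0 \<le> M" and T: "0 \<le> T" and MT: "M * T < w0"
    and X: "(\<phi>, a) \<in> X_space (weight w0 M) T l" and X': "(\<phi>', a') \<in> X_space (weight w0 M) T l"
    and sol: "classical_solution g f \<epsilon> T \<phi>0 a0 \<phi> a" and sol': "classical_solution g f \<epsilon> T \<phi>0 a0 \<phi>' a'"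
    and meas: "\<phi>0 \<in> borel_measurable borel" "a0 \<in> borel_measurable borel" and t: "t \<in> {0..T}"
  shows "\<phi> t x = \<phi>' t x" "a t x = a' t x"
proof -
  let ?w = "(w0 - M * T) / 2"
  have w: "0 < ?w" using MT by simp
  obtain Q :: "bool \<Rightarrow> real \<Rightarrow> real \<Rightarrow> complex" and R where Q: "\<And>i. zbound l ?w 0 T R (Q i)"
    "\<And>t x. t \<in> {0..T} \<Longrightarrow> \<phi> t x = ift (\<lambda>\<xi>. complex_of_real (1 / japanese \<xi>) * Q False t \<xi>) x"
    "\<And>t x. t \<in> {0..T} \<Longrightarrow> a t x = ift (Q True t) x"
    "\<And>i. AE \<xi> in lborel. \<forall>t\<in>{0..T}. Q i t \<xi> = exp (- (\<i> * complex_of_real (dispersion \<epsilon> i \<xi> * t))) * Q i 0 \<xi>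
       + duh (dispersion \<epsilon> i) (\<lambda>s. source \<alpha> lam \<gamma> \<sigma> i (\<lambda>j. Q j s)) t \<xi>"
    "\<And>i. AE \<xi> in lborel. Q i 0 \<xi> = (if i then fourier a0 \<xi> else complex_of_real (japanese \<xi>) * fourier \<phi>0 \<xi>)"
    by (rule classical_solution_fourier[OF l \<gamma> \<sigma> g f \<epsilon> M T MT X sol meas]) blast
  obtain Q' :: "bool \<Rightarrow> real \<Rightarrow> real \<Rightarrow> complex" and R' where Q': "\<And>i. zbound l ?w 0 T R' (Q' i)"
    "\<And>t x. t \<in> {0..T} \<Longrightarrow> \<phi>' t x = ift (\<lambda>\<xi>. complex_of_real (1 / japanese \<xi>) * Q' False t \<xi>) x"
    "\<And>t x. t \<in> {0..T} \<Longrightarrow> a' t x = ift (Q' True t) x"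
    "\<And>i. AE \<xi> in lborel. \<forall>t\<in>{0..T}. Q' i t \<xi> = exp (- (\<i> * complex_of_real (dispersion \<epsilon> i \<xi> * t))) * Q' i 0 \<xi>
       + duh (dispersion \<epsilon> i) (\<lambda>s. source \<alpha> lam \<gamma> \<sigma> i (\<lambda>j. Q' j s)) t \<xi>"
    "\<And>i. AE \<xi> in lborel. Q' i 0 \<xi> = (if i then fourier a0 \<xi> else complex_of_real (japanese \<xi>) * fourier \<phi>0 \<xi>)"
    by (rule classical_solution_fourier[OF l \<gamma> \<sigma> g f \<epsilon> M T MT X' sol' meas]) blast
  have "AE \<xi> in lborel. \<forall>t\<in>{0..T}. Q i t \<xi> = Q' i t \<xi>" for i
  proof (rule duhamel_unique[OF w lip_source[OF l] measurable_dispersion _ _ T Q(4) Q'(4)])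
    show "zbound l ?w 0 T (max R R') (Q i)" "zbound l ?w 0 T (max R R') (Q' i)" for i
      by (rule zbound_mono[OF Q(1)], simp, rule zbound_mono[OF Q'(1)], simp)
    show "AE \<xi> in lborel. Q i 0 \<xi> = Q' i 0 \<xi>" for i using Q(5)[of i] Q'(5)[of i] by eventually_elim simp
  qed
  then have eq: "AE \<xi> in lborel. Q i t \<xi> = Q' i t \<xi>" for i by (rule eventually_mono) (use t in blast)
  have [measurable]: "Q i t \<in> borel_measurable borel" "Q' i t \<in> borel_measurable borel" for i
    using zbound_zcarrier[OF Q(1)[of i]] zbound_zcarrier[OF Q'(1)[of i]] t unfolding zcarrier_def by auto
  show "\<phi> t x = \<phi>' t x"
    unfolding Q(2)[OF t] Q'(2)[OF t]
    by (rule ift_cong_AE) (use eq[of False] in eventually_elim, simp, measurable)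
  show "a t x = a' t x"
    unfolding Q(3)[OF t] Q'(3)[OF t] by (rule ift_cong_AE[OF eq]) measurable
qed

lemma triple_norm_sq_cong:
  assumes "\<And>s. s \<in> {0..T} \<Longrightarrow> u s = v s"
  shows "triple_norm_sq w0 M l T u = triple_norm_sq w0 M l T v"
proof -
  have "(\<integral>\<^sup>+ s\<in>{0..T}. H_norm_sq (weight w0 M s) (l + 1 / 2) (u s) \<partial>lborel) =
      (\<integral>\<^sup>+ s\<in>{0..T}. H_norm_sq (weight w0 M s) (l + 1 / 2) (v s) \<partial>lborel)"
    by (intro nn_integral_cong) (use assms in \<open>auto simp: indicator_def\<close>)
  moreover have "(SUP s\<in>{0..T}. H_norm_sq (weight w0 M s) l (u s)) = (SUP s\<in>{0..T}. H_norm_sq (weight w0 M s) l (v s))"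
    by (intro SUP_cong refl) (simp add: assms)
  ultimately show ?thesis by (simp add: triple_norm_sq_def)
qed

text \<open>3/2 (8/7)^2 = 96/49. With b = B^(2 sigma), the parallelogram identity for A and b/2
  replaces (A + b/2)^2 by 2A^2 + b^2/2 minus a square, and the remainders 4 - 192/49 and 1 - 48/49
  are positive.\<close>

lemma bound_constants:
  fixes A B :: real
  shows "3 / 2 * (8/7 * (A + B ^ (2 * \<sigma>) / 2))\<^sup>2 \<le> 4 * A\<^sup>2 + B ^ (4 * \<sigma>)" "3 / 2 * (8/7 * B)\<^sup>2 \<le> 2 * B\<^sup>2"
proof -
  have b: "B ^ (4 * \<sigma>) = (B ^ (2 * \<sigma>))\<^sup>2" by (simp add: power_mult[symmetric] mult.commute)
  have "3 / 2 * (8/7 * (A + b / 2))\<^sup>2 \<le> 4 * A\<^sup>2 + b\<^sup>2" for b :: real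
  proof -
    have "4 * A\<^sup>2 + b\<^sup>2 - 3 / 2 * (8/7 * (A + b / 2))\<^sup>2 = 1/49 * (A - b / 2)\<^sup>2 * 96 + 4 / 49 * A\<^sup>2 + 1 / 49 * b\<^sup>2"
      by (simp add: power2_eq_square field_simps)
    moreover have "0 \<le> 1/49 * (A - b / 2)\<^sup>2 * 96 + 4 / 49 * A\<^sup>2 + 1 / 49 * b\<^sup>2" by simp
    ultimately show ?thesis by linarith
  qed
  then show "3 / 2 * (8/7 * (A + B ^ (2 * \<sigma>) / 2))\<^sup>2 \<le> 4 * A\<^sup>2 + B ^ (4 * \<sigma>)" unfolding b .
  show "3 / 2 * (8/7 * B)\<^sup>2 \<le> 2 * B\<^sup>2" by (simp add: power_mult_distrib power_divide)
qed

theorem theorem1p1: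
  fixes \<alpha> lam w0 l :: real and \<gamma> \<sigma> :: nat
    and g f :: "real \<Rightarrow> real"
    and \<phi>0 a0 :: "real \<Rightarrow> real \<Rightarrow> complex"
  assumes "\<gamma> \<ge> 1" and "\<sigma> \<ge> 1"
    and "g = (\<lambda>s. \<alpha> * s ^ \<gamma>)" and "f = (\<lambda>s. lam * s ^ \<sigma>)"
    and "w0 > 0" and "l > 1"
    and "\<forall>\<epsilon>\<in>{0..1}. \<phi>0 \<epsilon> \<in> H_space w0 (l + 1) \<and> a0 \<epsilon> \<in> H_space w0 l"
    and "\<exists>C. \<forall>\<epsilon>\<in>{0..1}. H_norm w0 (l + 1) (\<phi>0 \<epsilon>) \<le> C \<and> H_norm w0 l (a0 \<epsilon>) \<le> C"
    and "\<forall>\<epsilon>\<in>{0..1}. \<forall>x. \<phi>0 \<epsilon> x \<in> \<real>"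
  shows "\<exists>M0>0.
    (\<forall>M\<ge>M0. \<forall>T. 0 < T \<and> T < w0 / M \<longrightarrow> (\<forall>\<epsilon>\<in>{0..1}.
       (\<exists>\<phi> a. (\<phi>, a) \<in> X_space (weight w0 M) T l \<and>
          classical_solution g f \<epsilon> T (\<phi>0 \<epsilon>) (a0 \<epsilon>) \<phi> a \<and>
          (\<forall>t\<in>{0..T}. \<forall>x. \<phi> t x \<in> \<real>)) \<and>
       (\<forall>\<phi>1 a1 \<phi>2 a2.
          (\<phi>1, a1) \<in> X_space (weight w0 M) T l \<and>
          classical_solution g f \<epsilon> T (\<phi>0 \<epsilon>) (a0 \<epsilon>) \<phi>1 a1 \<and>
          (\<phi>2, a2) \<in> X_space (weight w0 M) T l \<and>
          classical_solution g f \<epsilon> T (\<phi>0 \<epsilon>) (a0 \<epsilon>) \<phi>2 a2 \<longrightarrow>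
          (\<forall>t\<in>{0..T}. \<forall>x. \<phi>1 t x = \<phi>2 t x \<and> a1 t x = a2 t x)))) \<and>
    (\<exists>M1\<ge>M0. \<forall>M\<ge>M1. \<forall>T. 0 < T \<and> T < w0 / M \<longrightarrow> (\<forall>\<epsilon>\<in>{0..1}. \<forall>\<phi> a.
       (\<phi>, a) \<in> X_space (weight w0 M) T l \<and>
       classical_solution g f \<epsilon> T (\<phi>0 \<epsilon>) (a0 \<epsilon>) \<phi> a \<longrightarrow>
       triple_norm_sq w0 M (l + 1) T \<phi>
         \<le> ennreal (4 * (H_norm w0 (l + 1) (\<phi>0 \<epsilon>))\<^sup>2 + (H_norm w0 l (a0 \<epsilon>)) ^ (4 * \<sigma>)) \<and>
       triple_norm_sq w0 M l T a \<le> ennreal (2 * (H_norm w0 l (a0 \<epsilon>))\<^sup>2)))"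
proof -
  note \<gamma> = assms(1) and \<sigma> = assms(2) and g = assms(3) and f = assms(4) and w0 = assms(5)
  have l: "l \<ge> 1" using assms(6) by simp
  have data: "\<phi>0 \<epsilon> \<in> H_space w0 (l + 1)" "a0 \<epsilon> \<in> H_space w0 l" "\<phi>0 \<epsilon> x \<in> \<real>" if "\<epsilon> \<in> {0..1}" for \<epsilon> x
    using assms(7,9) that by auto
  have meas: "\<phi>0 \<epsilon> \<in> borel_measurable borel" "a0 \<epsilon> \<in> borel_measurable borel" if "\<epsilon> \<in> {0..1}" for \<epsilon>
    using H_norm_sq_initial(3)[OF data(1)[OF that]] H_norm_sq_initial(3)[OF data(2)[OF that]] L2_measurable by auto
  obtain C where C: "\<And>\<epsilon>. \<epsilon> \<in> {0..1} \<Longrightarrow> H_norm w0 (l + 1) (\<phi>0 \<epsilon>) \<le> C \<and> H_norm w0 l (a0 \<epsilon>) \<le> C"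
    using assms(8) by blast
  have C': "H_norm w0 (l + 1) (\<phi>0 \<epsilon>) \<le> \<bar>C\<bar>" "H_norm w0 l (a0 \<epsilon>) \<le> \<bar>C\<bar>" if "\<epsilon> \<in> {0..1}" for \<epsilon>
    using C[OF that] by auto
  obtain M0 where M0: "0 < M0" and ex: "\<forall>M\<ge>M0. \<forall>T \<epsilon> \<phi>0 a0. 0 < T \<longrightarrow> T < w0 / M \<longrightarrow> \<bar>\<epsilon>\<bar> \<le> 1 \<longrightarrow>
    \<phi>0 \<in> H_space w0 (l + 1) \<longrightarrow> a0 \<in> H_space w0 l \<longrightarrow>
    H_norm w0 (l + 1) \<phi>0 \<le> \<bar>C\<bar> \<longrightarrow> H_norm w0 l a0 \<le> \<bar>C\<bar> \<longrightarrow> (\<forall>x. \<phi>0 x \<in> \<real>) \<longrightarrow>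
    (\<exists>\<phi> a. (\<phi>, a) \<in> X_space (weight w0 M) T l \<and> classical_solution g f \<epsilon> T \<phi>0 a0 \<phi> a \<and>
      (\<forall>t\<in>{0..T}. \<forall>x. \<phi> t x \<in> \<real>) \<and>
      triple_norm_sq w0 M (l + 1) T \<phi> \<le> ennreal (3 / 2 * (8/7 * (H_norm w0 (l + 1) \<phi>0 + H_norm w0 l a0 ^ (2 * \<sigma>) / 2))\<^sup>2) \<and>
      triple_norm_sq w0 M l T a \<le> ennreal (3 / 2 * (8/7 * H_norm w0 l a0)\<^sup>2))"
  proof -
    from classical_existence[where ?w0.0=w0, OF l abs_ge_zero[of C] \<gamma> \<sigma> g f] show thesis
      by (elim exE conjE) (rule that)
  qed
  have small: "0 \<le> M" "M * T < w0" if "M0 \<le> M" "0 < T \<and> T < w0 / M" for M T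
    using that M0 by (auto simp: field_simps)
  have unique: "\<phi>1 t x = \<phi>2 t x" "a1 t x = a2 t x"
    if M: "M0 \<le> M" and T: "0 < T \<and> T < w0 / M" and \<epsilon>: "\<epsilon> \<in> {0..1}"
      and s1: "(\<phi>1, a1) \<in> X_space (weight w0 M) T l" "classical_solution g f \<epsilon> T (\<phi>0 \<epsilon>) (a0 \<epsilon>) \<phi>1 a1"
      and s2: "(\<phi>2, a2) \<in> X_space (weight w0 M) T l" "classical_solution g f \<epsilon> T (\<phi>0 \<epsilon>) (a0 \<epsilon>) \<phi>2 a2"
      and t: "t \<in> {0..T}" for M T \<epsilon> \<phi>1 a1 \<phi>2 a2 t x
  proof -
    have e: "\<bar>\<epsilon>\<bar> \<le> 1" "0 \<le> T" using \<epsilon> T by auto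
    show "\<phi>1 t x = \<phi>2 t x" "a1 t x = a2 t x"
      using classical_uniqueness[OF l \<gamma> \<sigma> g f e(1) small(1)[OF M T] e(2) small(2)[OF M T] s1(1) s2(1) s1(2) s2(2) meas[OF \<epsilon>] t]
      by auto
  qed
  have exist: "\<exists>\<phi> a. (\<phi>, a) \<in> X_space (weight w0 M) T l \<and> classical_solution g f \<epsilon> T (\<phi>0 \<epsilon>) (a0 \<epsilon>) \<phi> a \<and>
      (\<forall>t\<in>{0..T}. \<forall>x. \<phi> t x \<in> \<real>) \<and>
      triple_norm_sq w0 M (l + 1) T \<phi> \<le> ennreal (4 * (H_norm w0 (l + 1) (\<phi>0 \<epsilon>))\<^sup>2 + (H_norm w0 l (a0 \<epsilon>)) ^ (4 * \<sigma>)) \<and>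
      triple_norm_sq w0 M l T a \<le> ennreal (2 * (H_norm w0 l (a0 \<epsilon>))\<^sup>2)"
    if M: "M0 \<le> M" and T: "0 < T \<and> T < w0 / M" and \<epsilon>: "\<epsilon> \<in> {0..1}" for M T \<epsilon>
  proof -
    have e: "\<bar>\<epsilon>\<bar> \<le> 1" using \<epsilon> by auto
    obtain \<phi> a where s: "(\<phi>, a) \<in> X_space (weight w0 M) T l" "classical_solution g f \<epsilon> T (\<phi>0 \<epsilon>) (a0 \<epsilon>) \<phi> a"
      "\<forall>t\<in>{0..T}. \<forall>x. \<phi> t x \<in> \<real>"
      and n: "triple_norm_sq w0 M (l + 1) T \<phi> \<le> ennreal (3 / 2 * (8/7 * (H_norm w0 (l + 1) (\<phi>0 \<epsilon>) + H_norm w0 l (a0 \<epsilon>) ^ (2 * \<sigma>) / 2))\<^sup>2)"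
      "triple_norm_sq w0 M l T a \<le> ennreal (3 / 2 * (8/7 * H_norm w0 l (a0 \<epsilon>))\<^sup>2)"
      using ex[rule_format, OF M conjunct1[OF T] conjunct2[OF T] e data(1,2)[OF \<epsilon>] C'[OF \<epsilon>] data(3)[OF \<epsilon>]] by blast
    show ?thesis
      using s order_trans[OF n(1) ennreal_leI[OF bound_constants(1)]] order_trans[OF n(2) ennreal_leI[OF bound_constants(2)]]
      by blast
  qed
  \<comment> \<open>The estimates are known for the constructed solution; uniqueness transfers them
    to every solution in the class.\<close>
  have bounds: "triple_norm_sq w0 M (l + 1) T \<phi> \<le> ennreal (4 * (H_norm w0 (l + 1) (\<phi>0 \<epsilon>))\<^sup>2 + (H_norm w0 l (a0 \<epsilon>)) ^ (4 * \<sigma>)) \<and>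
       triple_norm_sq w0 M l T a \<le> ennreal (2 * (H_norm w0 l (a0 \<epsilon>))\<^sup>2)"
    if M: "M0 \<le> M" and T: "0 < T \<and> T < w0 / M" and \<epsilon>: "\<epsilon> \<in> {0..1}"
      and s: "(\<phi>, a) \<in> X_space (weight w0 M) T l" "classical_solution g f \<epsilon> T (\<phi>0 \<epsilon>) (a0 \<epsilon>) \<phi> a" for M T \<epsilon> \<phi> a
  proof -
    obtain \<phi>' a' where s': "(\<phi>', a') \<in> X_space (weight w0 M) T l" "classical_solution g f \<epsilon> T (\<phi>0 \<epsilon>) (a0 \<epsilon>) \<phi>' a'"
      and n: "triple_norm_sq w0 M (l + 1) T \<phi>' \<le> ennreal (4 * (H_norm w0 (l + 1) (\<phi>0 \<epsilon>))\<^sup>2 + (H_norm w0 l (a0 \<epsilon>)) ^ (4 * \<sigma>))"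
      "triple_norm_sq w0 M l T a' \<le> ennreal (2 * (H_norm w0 l (a0 \<epsilon>))\<^sup>2)"
      using exist[OF M T \<epsilon>] by blast
    have "\<phi> t = \<phi>' t" "a t = a' t" if "t \<in> {0..T}" for t
      using unique[OF M T \<epsilon> s s' that] by auto
    then show ?thesis using n triple_norm_sq_cong by metis
  qed
  show ?thesis
  \<comment> \<open>\<open>M0\<close> is also the witness for \<open>M1\<close>: its choice already
    includes the smallness required by the bounds.\<close>
  proof (intro exI[of _ M0] conjI M0 order_refl allI impI ballI)
    fix M T \<epsilon> :: real assume h: "M0 \<le> M" "0 < T \<and> T < w0 / M" "\<epsilon> \<in> {0..1}"
    show "\<exists>\<phi> a. (\<phi>, a) \<in> X_space (weight w0 M) T l \<and> classical_solution g f \<epsilon> T (\<phi>0 \<epsilon>) (a0 \<epsilon>) \<phi> a \<and> (\<forall>t\<in>{0..T}. \<forall>x. \<phi> t x \<in> \<real>)"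
      using exist[OF h] by blast
  next
    fix M T \<epsilon> :: real and \<phi>1 a1 \<phi>2 a2 :: "real \<Rightarrow> real \<Rightarrow> complex" and t x :: real
    assume h: "M0 \<le> M" "0 < T \<and> T < w0 / M" "\<epsilon> \<in> {0..1}" and t: "t \<in> {0..T}"
      and s: "(\<phi>1, a1) \<in> X_space (weight w0 M) T l \<and> classical_solution g f \<epsilon> T (\<phi>0 \<epsilon>) (a0 \<epsilon>) \<phi>1 a1 \<and>
        (\<phi>2, a2) \<in> X_space (weight w0 M) T l \<and> classical_solution g f \<epsilon> T (\<phi>0 \<epsilon>) (a0 \<epsilon>) \<phi>2 a2"
    then show "\<phi>1 t x = \<phi>2 t x" "a1 t x = a2 t x" using unique[OF h _ _ _ _ t] by blast+
  next
    fix M T \<epsilon> :: real and \<phi> a :: "real \<Rightarrow> real \<Rightarrow> complex"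
    assume h: "M0 \<le> M" "0 < T \<and> T < w0 / M" "\<epsilon> \<in> {0..1}"
      and s: "(\<phi>, a) \<in> X_space (weight w0 M) T l \<and> classical_solution g f \<epsilon> T (\<phi>0 \<epsilon>) (a0 \<epsilon>) \<phi> a"
    then show "triple_norm_sq w0 M (l + 1) T \<phi> \<le> ennreal (4 * (H_norm w0 (l + 1) (\<phi>0 \<epsilon>))\<^sup>2 + (H_norm w0 l (a0 \<epsilon>)) ^ (4 * \<sigma>))"
      "triple_norm_sq w0 M l T a \<le> ennreal (2 * (H_norm w0 l (a0 \<epsilon>))\<^sup>2)"
      using bounds[OF h] by blast+
  qed
qed

end
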